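(* Let $\Phi \in C_{0}^{\infty}(\mathbb{R}^n \times \mathbb{R}^n)$ satisfy the condition (B), i.e. there exists a point $\boldsymbol{\xi}^{0}\in\mathbb{R}^{2n}$ such that $\Phi(\boldsymbol{\xi}^{0})\neq 0$ and $\boldsymbol{\xi}^{0}\notin \bigcup_{\boldsymbol{\mu}\in\mathbb{Z}^{2n}\setminus\{0\}} \mathrm{supp}\,\Phi(\cdot-\boldsymbol{\mu})$. Let $p_1, p_2, p, q_1, q_2, q\in (0, \infty]$ satisfy $1/p_1 + 1/p_2 \ge 1/p$. Then there exists a constant $c\in (0, \infty)$ depending only on $n, p_1, p_2, p, q_1, q_2, q$, and $\Phi$, such that $$c^{-1}\|S_a\|_{\ell^{q_1}\times \ell^{q_2}\to \ell^q}\le \|T_{a, \Phi }\|_{W^{p_1, q_1} \times W^{p_2, q_2} \to W^{p,q} }\le c\, \|S_a\|_{\ell^{q_1}\times \ell^{q_2}\to \ell^q}$$ for all $a \in \ell^{\infty}(\mathbb{Z}^n \times \mathbb{Z}^n)$ (the norms take values in $[0,\infty]$).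
   Context: Convention $1/\infty=0$. Fourier transform on $\mathbb{R}^n$: $\widehat{f}(\xi)=\int_{\mathbb{R}^n} e^{-2\pi i x\cdot\xi}f(x)\,dx$, extended to tempered distributions $\mathcal{S}'(\mathbb{R}^n)$; $\mathcal{S}=\mathcal{S}(\mathbb{R}^n)$ is the Schwartz space; $C_0^\infty$ denotes compactly supported smooth functions. For $m\in C_0^\infty(\mathbb{R}^n)$, $m(D)f=\mathcal{F}^{-1}(m\widehat{f})$, and $m(D-k)$ is the operator with multiplier $m(\cdot-k)$. Bilinear Fourier multiplier operator: for $\sigma\in L^\infty(\mathbb{R}^n\times\mathbb{R}^n)$ and $f_1,f_2\in\mathcal{S}(\mathbb{R}^n)$, $$T_\sigma(f_1,f_2)(x)=\iint_{\mathbb{R}^n\times\mathbb{R}^n} e^{2\pi i x\cdot(\xi_1+\xi_2)}\sigma(\xi_1,\xi_2)\widehat{f_1}(\xi_1)\widehat{f_2}(\xi_2)\,d\xi_1d\xi_2,\quad x\in\mathbb{R}^n.$$ For function spaces $X_1,X_2,Y$ on $\mathbb{R}^n$ with quasi-norms, $\|T_\sigma\|_{X_1\times X_2\to Y}$ is the smallest $C\in[0,\infty)$ such that $\|T_\sigma(f_1,f_2)\|_Y\le C\|f_1\|_{X_1}\|f_2\|_{X_2}$ for all $f_1\in\mathcal{S}\cap X_1$, $f_2\in\mathcal{S}\cap X_2$, and is $\infty$ if no such finite $C$ exists. For $a\in\ell^\infty(\mathbb{Z}^n\times\mathbb{Z}^n)$ and $\Phi\in C_0^\infty(\mathbb{R}^n\times\mathbb{R}^n)$,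 set $\sigma_{a,\Phi}(\xi_1,\xi_2)=\sum_{\mu_1,\mu_2\in\mathbb{Z}^n}a(\mu_1,\mu_2)\Phi(\xi_1-\mu_1,\xi_2-\mu_2)$ and $T_{a,\Phi}=T_{\sigma_{a,\Phi}}$. Wiener amalgam spaces: fix once and for all $\kappa\in C_0^\infty(\mathbb{R}^n)$ with $\big|\sum_{k\in\mathbb{Z}^n}\kappa(\xi-k)\big|\ge 1$ for all $\xi\in\mathbb{R}^n$. For $p,q\in(0,\infty]$, $W^{p,q}=W^{p,q}(\mathbb{R}^n)$ is the set of all $f\in\mathcal{S}'(\mathbb{R}^n)$ with $$\|f\|_{W^{p,q}}=\Big\|\big\|\kappa(D-k)f(x)\big\|_{\ell^q_k(\mathbb{Z}^n)}\Big\|_{L^p_x(\mathbb{R}^n)}<\infty.$$ (It is known that different choices of $\kappa$ give the same space with equivalent quasi-norms.) Sequence operator: $X(\mathbb{Z}^n)$ is the set of all functions $b:\mathbb{Z}^n\to\mathbb{C}$ with $b(\mu)=0$ except for finitely many $\mu$. For $b_1,b_2\in X(\mathbb{Z}^n)$, $$S_a(b_1,b_2)(\mu)=\sum_{\mu_1+\mu_2=\mu}a(\mu_1,\mu_2)b_1(\mu_1)b_2(\mu_2),\quad \mu\in\mathbb{Z}^n,$$ where the sum is over $\mu_1,\mu_2\in\mathbb{Z}^n$ with $\mu_1+\mu_2=\mu$, and $$\|S_a\|_{\ell^{q_1}\times\ell^{q_2}\to\ell^q}=\sup\left\{\frac{\|S_a(b_1,b_2)\|_{\ell^q(\mathbb{Z}^n)}}{\|b_1\|_{\ell^{q_1}(\mathbb{Z}^n)}\|b_2\|_{\ell^{q_2}(\mathbb{Z}^n)}}\;\Big|\;b_1,b_2\in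 X(\mathbb{Z}^n)\setminus\{0\}\right\}.$$ *)

theory Defs
  imports "HOL-Probability.Probability"
begin

section \<open>Smooth functions, test functions and Schwartz functions\<close>

fun iter_deriv :: "'a list \<Rightarrow> ('a::euclidean_space \<Rightarrow> complex) \<Rightarrow> 'a \<Rightarrow> complex" where
  "iter_deriv [] f = f"
| "iter_deriv (b # bs) f = (\<lambda>x. frechet_derivative (iter_deriv bs f) (at x) b)"

text \<open>Every iterated partial derivative is required to be totally differentiable, hence
  continuous; so this is the usual notion of a \<open>C\<close>-infinity function. Multi-indices appear
  as lists of basis vectors.\<close>

definition smooth :: "('a::euclidean_space \<Rightarrow> complex) \<Rightarrow> bool" where
  "smooth f \<longleftrightarrow> (\<forall>bs x. set bs \<subseteq> Basis \<longrightarrow> iter_deriv bs f differentiable (at x))"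

definition supp :: "('a::topological_space \<Rightarrow> complex) \<Rightarrow> 'a set" where
  "supp f = closure {x. f x \<noteq> 0}"

definition test_fun :: "('a::euclidean_space \<Rightarrow> complex) \<Rightarrow> bool" where
  "test_fun f \<longleftrightarrow> smooth f \<and> compact (supp f)"

definition schwartz :: "('a::euclidean_space \<Rightarrow> complex) set" where
  "schwartz = {f. smooth f \<and> (\<forall>N bs. set bs \<subseteq> Basis \<longrightarrow>
     bdd_above (range (\<lambda>x. (1 + norm x) ^ N * cmod (iter_deriv bs f x))))}"

definition schwartz_seminorm :: "nat \<Rightarrow> 'a list \<Rightarrow> ('a::euclidean_space \<Rightarrow> complex) \<Rightarrow> real" where
  "schwartz_seminorm N bs f = (SUP x. (1 + norm x) ^ N * cmod (iter_deriv bs f x))"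

definition schwartz_tendsto ::
  "(nat \<Rightarrow> 'a::euclidean_space \<Rightarrow> complex) \<Rightarrow> ('a \<Rightarrow> complex) \<Rightarrow> bool" where
  "schwartz_tendsto \<phi> \<psi> \<longleftrightarrow> (\<forall>N bs. set bs \<subseteq> Basis \<longrightarrow>
     (\<lambda>j. schwartz_seminorm N bs (\<lambda>x. \<phi> j x - \<psi> x)) \<longlonglongrightarrow> 0)"


section \<open>Fourier transform and tempered distributions\<close>

definition fourier :: "('a::euclidean_space \<Rightarrow> complex) \<Rightarrow> 'a \<Rightarrow> complex" where
  "fourier f \<xi> = (\<integral>x. cis (- 2 * pi * (x \<bullet> \<xi>)) * f x \<partial>lborel)"

definition inv_fourier :: "('a::euclidean_space \<Rightarrow> complex) \<Rightarrow> 'a \<Rightarrow> complex" where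
  "inv_fourier f x = (\<integral>\<xi>. cis (2 * pi * (x \<bullet> \<xi>)) * f \<xi> \<partial>lborel)"

text \<open>A tempered distribution is a functional on all functions of which only the values on
  \<^const>\<open>schwartz\<close> matter. The Schwartz space is metrizable, so sequential continuity is
  continuity.\<close>

type_synonym 'a distr = "('a \<Rightarrow> complex) \<Rightarrow> complex"

definition tempered :: "('a::euclidean_space) distr \<Rightarrow> bool" where
  "tempered u \<longleftrightarrow>
     (\<forall>\<phi>\<in>schwartz. \<forall>\<psi>\<in>schwartz. u (\<lambda>x. \<phi> x + \<psi> x) = u \<phi> + u \<psi>) \<and>
     (\<forall>\<phi>\<in>schwartz. \<forall>c. u (\<lambda>x. c * \<phi> x) = c * u \<phi>) \<and>
     (\<forall>\<phi> \<psi>. range \<phi> \<subseteq> schwartz \<longrightarrow> \<psi> \<in> schwartz \<longrightarrow> schwartz_tendsto \<phi> \<psi> \<longrightarrow>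
        (\<lambda>j. u (\<phi> j)) \<longlonglongrightarrow> u \<psi>)"

definition distr_of_fun :: "('a::euclidean_space \<Rightarrow> complex) \<Rightarrow> 'a distr" where
  "distr_of_fun g = (\<lambda>\<phi>. \<integral>x. g x * \<phi> x \<partial>lborel)"

definition distr_fourier :: "('a::euclidean_space) distr \<Rightarrow> 'a distr" where
  "distr_fourier u = (\<lambda>\<phi>. u (fourier \<phi>))"

definition distr_inv_fourier :: "('a::euclidean_space) distr \<Rightarrow> 'a distr" where
  "distr_inv_fourier u = (\<lambda>\<phi>. u (inv_fourier \<phi>))"

definition distr_mult :: "('a::euclidean_space \<Rightarrow> complex) \<Rightarrow> 'a distr \<Rightarrow> 'a distr" where
  "distr_mult m u = (\<lambda>\<phi>. u (\<lambda>x. m x * \<phi> x))"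

definition multiplier :: "('a::euclidean_space \<Rightarrow> complex) \<Rightarrow> 'a distr \<Rightarrow> 'a distr" where
  "multiplier m u = distr_inv_fourier (distr_mult m (distr_fourier u))"

text \<open>The continuous function representing a distribution. It is meant for
  \<open>multiplier m u\<close> with \<open>m\<close> a test function and \<open>u\<close> tempered, which has compactly supported
  Fourier transform and therefore is a smooth function of polynomial growth.\<close>

definition fun_of_distr :: "('a::euclidean_space) distr \<Rightarrow> 'a \<Rightarrow> complex" where
  "fun_of_distr u = (THE g. continuous_on UNIV g \<and>
     (\<forall>\<phi>\<in>schwartz. integrable lborel (\<lambda>x. g x * \<phi> x) \<and> u \<phi> = distr_of_fun g \<phi>))"


section \<open>Lebesgue and sequence quasi-norms\<close>

text \<open>Only used for exponents \<open>r > 0\<close>.\<close>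

definition ennreal_powr :: "ennreal \<Rightarrow> real \<Rightarrow> ennreal" where
  "ennreal_powr x r = (if x = \<infinity> then \<infinity> else ennreal (enn2real x powr r))"

definition Lp_norm :: "'a measure \<Rightarrow> ennreal \<Rightarrow> ('a \<Rightarrow> ennreal) \<Rightarrow> ennreal" where
  "Lp_norm M p f =
     (if p = \<infinity> then esssup M f
      else ennreal_powr (\<integral>\<^sup>+x. ennreal_powr (f x) (enn2real p) \<partial>M) (1 / enn2real p))"

text \<open>For \<open>q = \<infinity>\<close> this is the supremum, counting measure having no nonempty null sets.\<close>

definition lq_norm :: "ennreal \<Rightarrow> ('k \<Rightarrow> ennreal) \<Rightarrow> ennreal" where
  "lq_norm q b = Lp_norm (count_space UNIV) q b"


section \<open>Wiener amalgam spaces\<close>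

definition of_lattice :: "int ^ 'n \<Rightarrow> real ^ 'n" where
  "of_lattice k = (\<chi> i. of_int (k $ i))"

definition wiener_window :: "(real ^ 'n \<Rightarrow> complex) \<Rightarrow> bool" where
  "wiener_window \<kappa> \<longleftrightarrow> test_fun \<kappa> \<and>
     (\<forall>\<xi>. 1 \<le> cmod (\<Sum>\<^sub>\<infinity>k::int ^ 'n. \<kappa> (\<xi> - of_lattice k)))"

text \<open>The value is \<open>\<infinity>\<close> exactly off the space, which is thus recovered as the set of all
  functionals of finite quasi-norm.\<close>

definition wiener_norm ::
  "(real ^ 'n \<Rightarrow> complex) \<Rightarrow> ennreal \<Rightarrow> ennreal \<Rightarrow> (real ^ 'n) distr \<Rightarrow> ennreal" where
  "wiener_norm \<kappa> p q u =
     (if tempered u then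
        Lp_norm lborel p (\<lambda>x. lq_norm q (\<lambda>k::int ^ 'n.
          ennreal (cmod (fun_of_distr (multiplier (\<lambda>\<xi>. \<kappa> (\<xi> - of_lattice k)) u) x))))
      else \<infinity>)"

definition wiener_space ::
  "(real ^ 'n \<Rightarrow> complex) \<Rightarrow> ennreal \<Rightarrow> ennreal \<Rightarrow> (real ^ 'n) distr set" where
  "wiener_space \<kappa> p q = {u. tempered u \<and> wiener_norm \<kappa> p q u < \<infinity>}"


section \<open>Bilinear Fourier multiplier operators\<close>

definition bilin_op ::
  "('a::euclidean_space \<times> 'a \<Rightarrow> complex) \<Rightarrow> ('a \<Rightarrow> complex) \<Rightarrow> ('a \<Rightarrow> complex) \<Rightarrow> 'a \<Rightarrow> complex" where
  "bilin_op \<sigma> f\<^sub>1 f\<^sub>2 x =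
     (\<integral>(\<xi>\<^sub>1, \<xi>\<^sub>2). cis (2 * pi * (x \<bullet> (\<xi>\<^sub>1 + \<xi>\<^sub>2))) * \<sigma> (\<xi>\<^sub>1, \<xi>\<^sub>2) * fourier f\<^sub>1 \<xi>\<^sub>1 * fourier f\<^sub>2 \<xi>\<^sub>2
        \<partial>(lborel \<Otimes>\<^sub>M lborel))"

text \<open>The infimum is \<open>\<infinity>\<close> if there is no admissible constant, and is attained otherwise.\<close>

definition bilin_wiener_norm ::
  "(real ^ 'n \<Rightarrow> complex) \<Rightarrow> ennreal \<Rightarrow> ennreal \<Rightarrow> ennreal \<Rightarrow> ennreal \<Rightarrow> ennreal \<Rightarrow> ennreal \<Rightarrow>
   ((real ^ 'n) \<times> (real ^ 'n) \<Rightarrow> complex) \<Rightarrow> ennreal" where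
  "bilin_wiener_norm \<kappa> p\<^sub>1 q\<^sub>1 p\<^sub>2 q\<^sub>2 p q \<sigma> =
     Inf {ennreal C | C::real. 0 \<le> C \<and>
       (\<forall>f\<^sub>1\<in>schwartz. \<forall>f\<^sub>2\<in>schwartz.
          distr_of_fun f\<^sub>1 \<in> wiener_space \<kappa> p\<^sub>1 q\<^sub>1 \<longrightarrow> distr_of_fun f\<^sub>2 \<in> wiener_space \<kappa> p\<^sub>2 q\<^sub>2 \<longrightarrow>
          wiener_norm \<kappa> p q (distr_of_fun (bilin_op \<sigma> f\<^sub>1 f\<^sub>2)) \<le>
            ennreal C * wiener_norm \<kappa> p\<^sub>1 q\<^sub>1 (distr_of_fun f\<^sub>1) *
              wiener_norm \<kappa> p\<^sub>2 q\<^sub>2 (distr_of_fun f\<^sub>2))}"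

definition lattice_symbol ::
  "((int ^ 'n) \<times> (int ^ 'n) \<Rightarrow> complex) \<Rightarrow> ((real ^ 'n) \<times> (real ^ 'n) \<Rightarrow> complex) \<Rightarrow>
   (real ^ 'n) \<times> (real ^ 'n) \<Rightarrow> complex" where
  "lattice_symbol a \<Phi> = (\<lambda>(\<xi>\<^sub>1, \<xi>\<^sub>2). \<Sum>\<^sub>\<infinity>(\<mu>\<^sub>1, \<mu>\<^sub>2)\<in>UNIV.
     a (\<mu>\<^sub>1, \<mu>\<^sub>2) * \<Phi> (\<xi>\<^sub>1 - of_lattice \<mu>\<^sub>1, \<xi>\<^sub>2 - of_lattice \<mu>\<^sub>2))"

definition condition_B :: "((real ^ 'n) \<times> (real ^ 'n) \<Rightarrow> complex) \<Rightarrow> bool" where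
  "condition_B \<Phi> \<longleftrightarrow> (\<exists>\<xi>\<^sub>0. \<Phi> \<xi>\<^sub>0 \<noteq> 0 \<and>
     \<xi>\<^sub>0 \<notin> (\<Union>\<mu> \<in> UNIV - {0 :: (int ^ 'n) \<times> (int ^ 'n)}.
       supp (\<lambda>\<xi>. \<Phi> (\<xi> - map_prod of_lattice of_lattice \<mu>))))"


section \<open>Bilinear sequence operators\<close>

definition finsupp :: "('k \<Rightarrow> complex) set" where
  "finsupp = {b. finite {\<mu>. b \<mu> \<noteq> 0}}"

definition seq_op ::
  "('k::ab_group_add \<times> 'k \<Rightarrow> complex) \<Rightarrow> ('k \<Rightarrow> complex) \<Rightarrow> ('k \<Rightarrow> complex) \<Rightarrow> 'k \<Rightarrow> complex" where
  "seq_op a b\<^sub>1 b\<^sub>2 \<mu> =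
     (\<Sum>\<^sub>\<infinity>(\<mu>\<^sub>1, \<mu>\<^sub>2)\<in>{(\<mu>\<^sub>1, \<mu>\<^sub>2). \<mu>\<^sub>1 + \<mu>\<^sub>2 = \<mu>}. a (\<mu>\<^sub>1, \<mu>\<^sub>2) * b\<^sub>1 \<mu>\<^sub>1 * b\<^sub>2 \<mu>\<^sub>2)"

definition seq_op_norm ::
  "ennreal \<Rightarrow> ennreal \<Rightarrow> ennreal \<Rightarrow> ('k::ab_group_add \<times> 'k \<Rightarrow> complex) \<Rightarrow> ennreal" where
  "seq_op_norm q\<^sub>1 q\<^sub>2 q a =
     Sup {lq_norm q (\<lambda>\<mu>. ennreal (cmod (seq_op a b\<^sub>1 b\<^sub>2 \<mu>))) /
          (lq_norm q\<^sub>1 (\<lambda>\<mu>. ennreal (cmod (b\<^sub>1 \<mu>))) * lq_norm q\<^sub>2 (\<lambda>\<mu>. ennreal (cmod (b\<^sub>2 \<mu>)))) |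
          b\<^sub>1 b\<^sub>2. b\<^sub>1 \<in> finsupp - {\<lambda>_. 0} \<and> b\<^sub>2 \<in> finsupp - {\<lambda>_. 0}}"

end

theory Submission imports Defs begin

text \<open>
  Everything reduces to one estimate for windows of band-limited functions. If \<open>f\<close> has its spectrum
  in a translate of a fixed compact set, then \<open>\<bar>f\<bar>\<close> is dominated by its own average against a
  polynomially decaying weight. Peetre's trick turns this into the same bound for \<open>\<bar>f\<bar> powr s\<close> with
  \<open>s < 1\<close>, which is what makes exponents below \<open>1\<close> accessible. Hence the \<open>lq\<close> norm of the windows of
  \<open>f\<close> has a slowly varying majorant \<open>J\<close> whose \<open>Lp\<close> norm and whose supremum are both controlled by
  the Wiener amalgam norm.

  Upper bound: by Fourier inversion, a window of \<open>T(f\<^sub>1, f\<^sub>2)\<close> at the point \<open>x\<close> is the value at the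
  origin of a multiplier applied to a band-limited function of \<open>y \<in> \<real>\<^sup>n \<times> \<real>\<^sup>n\<close>, namely to
  \<open>S\<^sub>a(b\<^sub>1, b\<^sub>2)\<close> for the sequences \<open>b\<^sub>i\<close> of windows of \<open>f\<^sub>i\<close> at \<open>x + y\<^sub>i\<close>. So it is again controlled by
  an average over \<open>y\<close>, and applying the norm of \<open>S\<^sub>a\<close> for each \<open>y\<close> bounds the windows by
  \<open>J\<^sub>1 x * J\<^sub>2 x\<close>. Since each \<open>J\<^sub>i\<close> is bounded by the norm of \<open>f\<^sub>i\<close>, Hoelder's inequality extends to
  all exponents with \<open>1 / p \<le> 1 / p\<^sub>1 + 1 / p\<^sub>2\<close>.

  Lower bound: by condition (B), functions whose Fourier transforms are sums of small bumps
  \<open>b\<^sub>i(\<mu>) \<psi>\<^sub>i(\<xi> - \<mu>)\<close> see only one term of the symbol at a time, and the windows of \<open>T(f\<^sub>1, f\<^sub>2)\<close> at \<open>0\<close>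
  are a fixed nonzero multiple of \<open>S\<^sub>a(b\<^sub>1, b\<^sub>2)\<close>.
\<close>

section \<open>Smooth functions and rapid decay\<close>

text \<open>For exponents below 1 there is no Minkowski inequality, so sums over windows are formed
  only after raising to the power \<open>ex q\<close>, where they commute with averaging. Peetre's
  division needs a supremum known in advance to be finite; it is, because every window is the
  inverse transform of an integrable function.

  A term of the bilinear form carries the factor \<open>\<kappa> (\<xi>\<^sub>1 + \<xi>\<^sub>2 - k)
  * \<Phi> (\<xi> - \<mu>)\<close>. Moved to the origin it depends on \<open>\<mu>\<close> only
  through \<open>l = \<mu>\<^sub>1 + \<mu>\<^sub>2 - k\<close>, and \<open>l\<close> stays in a
  finite set fixed by the supports. Finitely many kernels on the doubled space therefore serve all
  \<open>k\<close>, and the rest of the sum over \<open>\<mu>\<close> is the sequence operator.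

  Its norm speaks of finitely supported sequences, so the symbol is first truncated, with constants
  that do not see the truncation.

  In the lower bound \<open>\<kappa>\<close> may vanish where the output lives, so a second window
  near the point of condition (B) is used; a change of window costs a constant. All cut-offs and
  bumps are made from \<open>\<kappa>\<close> itself.\<close>

primrec Ck :: "nat \<Rightarrow> ('a::euclidean_space \<Rightarrow> complex) \<Rightarrow> bool" where
  "Ck 0 f \<longleftrightarrow> True"
| "Ck (Suc m) f \<longleftrightarrow> (\<forall>x. f differentiable (at x)) \<and>
     (\<forall>b\<in>Basis. Ck m (\<lambda>x. frechet_derivative f (at x) b))"

lemma iter_deriv_append: "iter_deriv (bs @ cs) f = iter_deriv bs (iter_deriv cs f)"
  by (induction bs) auto

lemma smooth_diff: "smooth f \<Longrightarrow> f differentiable (at x)"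
  unfolding smooth_def by (metis empty_iff empty_set iter_deriv.simps(1) subsetI)

lemma smooth_deriv:
  assumes "smooth f" "b \<in> Basis"
  shows "smooth (\<lambda>x. frechet_derivative f (at x) b)"
  unfolding smooth_def
proof (intro allI impI)
  fix bs x assume bs: "set bs \<subseteq> (Basis::'a set)"
  have "iter_deriv (bs @ [b]) f differentiable (at x)"
    using assms bs unfolding smooth_def by auto
  then show "iter_deriv bs (\<lambda>x. frechet_derivative f (at x) b) differentiable (at x)"
    by (simp add: iter_deriv_append)
qed

lemma smooth_imp_Ck: "smooth f \<Longrightarrow> Ck m f"
  by (induction m arbitrary: f) (auto simp: smooth_diff smooth_deriv)

text \<open>\<open>iter_deriv\<close> adds directions on the outside, so a product or chain rule
  would have to be carried through whole lists of directions. \<open>Ck\<close> peels off the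
  innermost derivative instead; closure properties then follow by induction on the order with the
  functions left arbitrary.\<close>

lemma smooth_iff_Ck: "smooth f \<longleftrightarrow> (\<forall>m. Ck m f)"
proof
  assume *: "\<forall>m. Ck m f"
  have "\<forall>m. Ck m (iter_deriv bs f)" if "set bs \<subseteq> Basis" for bs
    using that
  proof (induction bs)
    case (Cons b bs)
    then have "Ck (Suc m) (iter_deriv bs f)" for m by auto
    with Cons.prems show ?case by auto
  qed (use * in auto)
  then have "Ck 1 (iter_deriv bs f)" if "set bs \<subseteq> Basis" for bs
    using that by blast
  then show "smooth f" unfolding smooth_def by auto
qed (auto simp: smooth_imp_Ck)

lemma Ck_Suc_D: "Ck (Suc m) f \<Longrightarrow> Ck m f"
  by (induction m arbitrary: f) auto

lemma Ck_Suc_diff: "Ck (Suc m) f \<Longrightarrow> (f has_derivative frechet_derivative f (at x)) (at x)"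
  by (auto simp: frechet_derivative_works)

lemma Ck_SucI:
  assumes "\<And>x. (f has_derivative f' x) (at x)"
    and "\<And>b. b \<in> Basis \<Longrightarrow> Ck m (\<lambda>x. f' x b)"
  shows "Ck (Suc m) f"
proof -
  have "frechet_derivative f (at x) = f' x" for x
    using frechet_derivative_at[OF assms(1)] by simp
  then show ?thesis using assms by (auto simp: differentiable_def)
qed

lemma Ck_const: "Ck m (\<lambda>x. c)"
  by (induction m arbitrary: c) (auto)

lemma Ck_add: "Ck m f \<Longrightarrow> Ck m g \<Longrightarrow> Ck m (\<lambda>x. f x + g x)"
proof (induction m arbitrary: f g)
  case (Suc m)
  show ?case
    by (rule Ck_SucI[OF has_derivative_add[OF Ck_Suc_diff[OF Suc.prems(1)] Ck_Suc_diff[OF Suc.prems(2)]]])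
       (use Suc in auto)
qed auto

lemma Ck_sum: "(\<And>i. i \<in> I \<Longrightarrow> Ck m (f i)) \<Longrightarrow> Ck m (\<lambda>x. \<Sum>i\<in>I. f i x)"
  by (induction I rule: infinite_finite_induct) (auto intro: Ck_const Ck_add)

lemma Ck_mult: "Ck m f \<Longrightarrow> Ck m g \<Longrightarrow> Ck m (\<lambda>x. f x * g x)"
proof (induction m arbitrary: f g)
  case (Suc m)
  show ?case
    by (rule Ck_SucI[OF has_derivative_mult[OF Ck_Suc_diff[OF Suc.prems(1)] Ck_Suc_diff[OF Suc.prems(2)]]])
       (use Suc Ck_Suc_D in \<open>auto intro!: Ck_add Suc.IH\<close>)
qed auto

lemma Ck_uminus: "Ck m f \<Longrightarrow> Ck m (\<lambda>x. - f x)"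
  using Ck_mult[OF Ck_const[of m "-1"], of f] by simp

lemma Ck_inverse: "Ck m f \<Longrightarrow> (\<And>x. f x \<noteq> 0) \<Longrightarrow> Ck m (\<lambda>x. inverse (f x))"
proof (induction m arbitrary: f)
  case (Suc m)
  \<comment> \<open>The derivative again contains the inverse of the same \<open>f\<close>; the
    induction hypothesis supplies it one order down.\<close>
  have i: "Ck m (\<lambda>x. inverse (f x))" using Suc Ck_Suc_D by blast
  have "Ck m (\<lambda>x. - (inverse (f x) * frechet_derivative f (at x) b * inverse (f x)))"
    if "b \<in> Basis" for b
    using that Suc.prems(1) by (intro Ck_uminus Ck_mult i) simp
  then show ?case
    by (intro Ck_SucI[OF Deriv.has_derivative_inverse[OF Suc.prems(2) Ck_Suc_diff[OF Suc.prems(1)]]])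
qed auto

lemma Ck_cnj: "Ck m f \<Longrightarrow> Ck m (\<lambda>x. cnj (f x))"
proof (induction m arbitrary: f)
  case (Suc m)
  show ?case
    by (rule Ck_SucI[OF has_derivative_cnj[OF Ck_Suc_diff[OF Suc.prems(1)]]])
       (use Suc in auto)
qed auto

lemma Ck_affine:
  fixes A :: "'b::euclidean_space \<Rightarrow> 'a::euclidean_space"
  assumes "bounded_linear A"
  shows "Ck m f \<Longrightarrow> Ck m (\<lambda>x. f (A x + c))"
proof (induction m arbitrary: f)
  case (Suc m)
  have d: "((\<lambda>x. f (A x + c)) has_derivative (\<lambda>v. frechet_derivative f (at (A x + c)) (A v))) (at x)" for x
  proof -
    have "((\<lambda>x. A x + c) has_derivative A) (at x)"
      using assms by (auto intro!: derivative_eq_intros bounded_linear_imp_has_derivative)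
    from has_derivative_compose[OF this Ck_Suc_diff[OF Suc.prems]] show ?thesis .
  qed
  \<comment> \<open>\<open>Ck\<close> knows partial derivatives along \<open>Basis\<close> only,
    while the chain rule produces the direction \<open>A v\<close>. It is expanded in coordinates,
    which do not depend on \<open>x\<close>.\<close>
  have e: "frechet_derivative f (at (A x + c)) (A v) =
     (\<Sum>b\<in>Basis. of_real (A v \<bullet> b) * frechet_derivative f (at (A x + c)) b)" for x v
  proof -
    have l: "linear (frechet_derivative f (at (A x + c)))"
      using Ck_Suc_diff[OF Suc.prems] by (rule has_derivative_linear)
    have "frechet_derivative f (at (A x + c)) (\<Sum>b\<in>Basis. (A v \<bullet> b) *\<^sub>R b) =
       (\<Sum>b\<in>Basis. (A v \<bullet> b) *\<^sub>R frechet_derivative f (at (A x + c)) b)"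
      using l by (simp add: linear_sum linear_cmul)
    then show ?thesis by (simp add: euclidean_representation scaleR_conv_of_real)
  qed
  show ?case
    by (rule Ck_SucI[OF d]) (subst e, use Suc in \<open>auto intro!: Ck_sum Ck_mult Ck_const\<close>)
qed auto

text \<open>Meant for lattice sums: near each point they agree with a finite sum, but with a
  different one at different points.\<close>

lemma Ck_local:
  assumes "\<And>x. \<exists>U g. open U \<and> x \<in> U \<and> Ck m g \<and> (\<forall>y\<in>U. f y = g y)"
  shows "Ck m f"
  using assms
proof (induction m arbitrary: f)
  case (Suc m)
  \<comment> \<open>Derivatives are compared on all of \<open>U\<close>, not only at
    \<open>x\<close>, so that the same neighbourhood serves again one order lower.\<close>
  have *: "\<exists>U g. open U \<and> x \<in> U \<and> Ck (Suc m) g \<and> (\<forall>y\<in>U. f y = g y \<and>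
      (f has_derivative frechet_derivative g (at y)) (at y))" for x
  proof -
    obtain U g where U: "open U" "x \<in> U" "Ck (Suc m) g" "\<forall>y\<in>U. f y = g y"
      using Suc.prems by blast
    have "(f has_derivative frechet_derivative g (at y)) (at y)" if "y \<in> U" for y
      by (rule has_derivative_transform_within_open[OF Ck_Suc_diff[OF U(3)] U(1) that])
         (use U in auto)
    then show ?thesis using U by blast
  qed
  have d: "f differentiable (at x)" for x using *[of x] by (auto simp: differentiable_def)
  moreover have "Ck m (\<lambda>x. frechet_derivative f (at x) b)" if b: "b \<in> Basis" for b
  proof (rule Suc.IH)
    fix x
    obtain U g where U: "open U" "x \<in> U" "Ck (Suc m) g"
      "\<forall>y\<in>U. (f has_derivative frechet_derivative g (at y)) (at y)" using *[of x] by blast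
    have "frechet_derivative f (at y) b = frechet_derivative g (at y) b" if "y \<in> U" for y
      using frechet_derivative_at[of f "frechet_derivative g (at y)" y] U(4) that by simp
    then show "\<exists>U g. open U \<and> x \<in> U \<and> Ck m g \<and> (\<forall>y\<in>U. frechet_derivative f (at y) b = g y)"
      using U b by (intro exI[of _ U] exI[of _ "\<lambda>x. frechet_derivative g (at x) b"]) auto
  qed
  ultimately show ?case by auto
qed auto

lemma smooth_const [simp]: "smooth (\<lambda>x. c)"
  and smooth_add: "smooth f \<Longrightarrow> smooth g \<Longrightarrow> smooth (\<lambda>x. f x + g x)"
  and smooth_mult: "smooth f \<Longrightarrow> smooth g \<Longrightarrow> smooth (\<lambda>x. f x * g x)"
  and smooth_cnj: "smooth f \<Longrightarrow> smooth (\<lambda>x. cnj (f x))"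
  and smooth_inverse: "smooth f \<Longrightarrow> (\<And>x. f x \<noteq> 0) \<Longrightarrow> smooth (\<lambda>x. inverse (f x))"
  by (auto simp: smooth_iff_Ck intro: Ck_const Ck_add Ck_mult Ck_cnj Ck_inverse)

lemma smooth_sum: "(\<And>i. i \<in> I \<Longrightarrow> smooth (f i)) \<Longrightarrow> smooth (\<lambda>x. \<Sum>i\<in>I. f i x)"
  by (auto simp: smooth_iff_Ck intro: Ck_sum)

lemma smooth_affine: "bounded_linear A \<Longrightarrow> smooth f \<Longrightarrow> smooth (\<lambda>x. f (A x + c))"
  by (auto simp: smooth_iff_Ck intro: Ck_affine)

lemma smooth_local:
  assumes "\<And>x. \<exists>U g. open U \<and> x \<in> U \<and> smooth g \<and> (\<forall>y\<in>U. f y = g y)"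
  shows "smooth f"
  using assms unfolding smooth_iff_Ck by (intro allI Ck_local) metis

lemma smooth_shift: "smooth f \<Longrightarrow> smooth (\<lambda>x. f (x - c))"
  using smooth_affine[of "\<lambda>x. x" f "-c"] by (simp add: bounded_linear_ident)

lemma smooth_continuous: "smooth f \<Longrightarrow> continuous_on UNIV f"
  by (meson continuous_at_imp_continuous_on differentiable_imp_continuous_within smooth_diff)

lemma smooth_inner: "smooth (\<lambda>x. complex_of_real (x \<bullet> b))"
proof -
  have "Ck m (\<lambda>x. complex_of_real (x \<bullet> b))" for m
  proof (cases m)
    case (Suc k)
    have "((\<lambda>x. complex_of_real (x \<bullet> b)) has_derivative (\<lambda>v. complex_of_real (v \<bullet> b))) (at x)" for x
      by (auto intro!: derivative_eq_intros)
    then show ?thesis unfolding Suc by (rule Ck_SucI) (auto intro: Ck_const)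
  qed auto
  then show ?thesis by (simp add: smooth_iff_Ck)
qed

lemma test_fun_smooth: "test_fun f \<Longrightarrow> smooth f"
  by (simp add: test_fun_def)

lemma test_fun_bounded_supp:
  assumes "test_fun f" obtains R where "R > 0" "\<And>x. f x \<noteq> 0 \<Longrightarrow> norm x < R"
proof -
  have "bounded {x. f x \<noteq> 0}"
    using assms unfolding test_fun_def supp_def
    by (meson bounded_subset closure_subset compact_imp_bounded)
  then obtain R where "\<And>x. f x \<noteq> 0 \<Longrightarrow> norm x \<le> R" by (auto simp: bounded_iff)
  then show thesis by (intro that[of "\<bar>R\<bar> + 1"]) fastforce+
qed

lemma test_funI:
  assumes "smooth f" "\<And>x. f x \<noteq> 0 \<Longrightarrow> norm x \<le> R"
  shows "test_fun f"
proof -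
  have "{x. f x \<noteq> 0} \<subseteq> cball 0 R" using assms(2) by auto
  then have "bounded (closure {x. f x \<noteq> 0})"
    by (meson bounded_cball bounded_closure bounded_subset)
  then show ?thesis
    using assms(1) by (auto simp: test_fun_def supp_def compact_eq_bounded_closed)
qed

lemma test_fun_mult:
  assumes "test_fun f" "smooth g" shows "test_fun (\<lambda>x. f x * g x)"
proof -
  obtain R where "\<And>x. f x \<noteq> 0 \<Longrightarrow> norm x < R" using test_fun_bounded_supp[OF assms(1)] by blast
  then show ?thesis
    using assms by (intro test_funI[where R=R] smooth_mult) (auto simp: test_fun_smooth intro: less_imp_le)
qed

lemma test_fun_mult2: "smooth g \<Longrightarrow> test_fun f \<Longrightarrow> test_fun (\<lambda>x. g x * f x)"
  using test_fun_mult[of f g] by (simp add: mult.commute)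

lemma test_fun_shift:
  assumes "test_fun f" shows "test_fun (\<lambda>x. f (x - c))"
proof -
  obtain R where R: "\<And>x. f x \<noteq> 0 \<Longrightarrow> norm x < R" using test_fun_bounded_supp[OF assms(1)] by blast
  have "norm x \<le> R + norm c" if "f (x - c) \<noteq> 0" for x
    using R[OF that] norm_triangle_ineq2[of x c] by linarith
  then show ?thesis
    using assms by (intro test_funI[where R="R + norm c"] smooth_shift) (auto simp: test_fun_smooth)
qed

lemma test_fun_sum:
  assumes "finite I" "\<And>i. i \<in> I \<Longrightarrow> test_fun (f i)"
  shows "test_fun (\<lambda>x. \<Sum>i\<in>I. f i x)"
proof -
  have "\<forall>i\<in>I. \<exists>R. \<forall>x. f i x \<noteq> 0 \<longrightarrow> norm x < R"
    using test_fun_bounded_supp[OF assms(2)] by metis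
  then obtain R where R: "\<And>i x. i \<in> I \<Longrightarrow> f i x \<noteq> 0 \<Longrightarrow> norm x < R i" by metis
  have "norm x \<le> (\<Sum>i\<in>I. \<bar>R i\<bar>)" if nz: "(\<Sum>i\<in>I. f i x) \<noteq> 0" for x
  proof -
    obtain i where "i \<in> I" "f i x \<noteq> 0" using nz by (meson sum.neutral)
    then have "norm x \<le> \<bar>R i\<bar>" "\<bar>R i\<bar> \<le> (\<Sum>i\<in>I. \<bar>R i\<bar>)"
      using R[of i x] assms(1) by (auto intro: member_le_sum)
    then show ?thesis by linarith
  qed
  then show ?thesis
    using assms by (intro test_funI smooth_sum) (auto simp: test_fun_smooth)
qed

text \<open>Any test function that is nonzero somewhere yields bumps everywhere: translate its point
  \<open>z\<close> to \<open>c\<close>, compress by \<open>d\<close> until the support fits into the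
  ball of radius \<open>e\<close>, and take the squared modulus, which is smooth and
  nonnegative.\<close>

lemma test_fun_bump:
  fixes \<kappa> :: "'a::euclidean_space \<Rightarrow> complex"
  assumes "test_fun \<kappa>" "\<kappa> z \<noteq> 0" "e > 0"
  obtains \<beta> :: "'a \<Rightarrow> real" where "test_fun (\<lambda>x. complex_of_real (\<beta> x))" "\<And>x. 0 \<le> \<beta> x"
    "0 < \<beta> c" "\<And>x. \<beta> x \<noteq> 0 \<Longrightarrow> dist x c < e"
proof -
  obtain R where R: "R > 0" "\<And>x. \<kappa> x \<noteq> 0 \<Longrightarrow> norm x < R" using test_fun_bounded_supp[OF assms(1)] by blast
  define d where "d = (R + norm z) / e"
  have d: "d > 0" using R assms(3) by (simp add: d_def add_pos_nonneg)
  define \<beta> where "\<beta> x = (cmod (\<kappa> (d *\<^sub>R x + (z - d *\<^sub>R c))))\<^sup>2" for x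
  have s: "dist x c < e" if "\<beta> x \<noteq> 0" for x
  proof -
    have "norm (d *\<^sub>R (x - c) + z) < R" using that R(2) by (auto simp: \<beta>_def algebra_simps)
    then have "norm (d *\<^sub>R (x - c)) < R + norm z" using norm_triangle_ineq4[of "d *\<^sub>R (x - c) + z" z] by simp
    moreover have "d * e = R + norm z" using assms(3) by (simp add: d_def)
    ultimately have "d * dist x c < d * e" using d by (simp add: dist_norm)
    then show ?thesis using d by simp
  qed
  have "smooth (\<lambda>x. complex_of_real (\<beta> x))"
    unfolding \<beta>_def complex_norm_square using assms(1)
    by (intro smooth_mult smooth_cnj smooth_affine) (auto simp: test_fun_smooth bounded_linear_scaleR_right)
  moreover have "norm x \<le> norm c + e" if "complex_of_real (\<beta> x) \<noteq> 0" for x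
    using s[of x] that norm_triangle_ineq2[of x c] by (auto simp: dist_norm)
  ultimately have "test_fun (\<lambda>x. complex_of_real (\<beta> x))" by (rule test_funI)
  moreover have "0 < \<beta> c" using assms(2) by (auto simp: \<beta>_def)
  ultimately show thesis by (intro that[of \<beta>] s) (auto simp: \<beta>_def)
qed

section \<open>Polynomial weights\<close>

definition wgt :: "nat \<Rightarrow> 'a::real_normed_vector \<Rightarrow> real" where
  "wgt N y = 1 / (1 + norm y) ^ N"

lemma one_norm_pos: "0 < 1 + norm x"
  by (simp add: add_pos_nonneg)

lemma wgt_pos [simp]: "0 < wgt N y" and wgt_nonneg [simp]: "0 \<le> wgt N y"
  and wgt_le_1: "wgt N y \<le> 1"
  by (simp_all add: wgt_def one_norm_pos add_nonneg_nonneg)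

lemma wgt_mono: "N \<le> M \<Longrightarrow> wgt M y \<le> wgt N y"
  unfolding wgt_def by (intro divide_left_mono power_increasing) (simp_all add: one_norm_pos add_nonneg_nonneg)

lemma wgt_add: "wgt (N + M) y = wgt N y * wgt M y"
  by (simp add: wgt_def power_add)

lemma wgt_mult_power: "(1 + norm y) ^ N * wgt N y = 1"
  using one_norm_pos[of y] by (simp add: wgt_def)

lemma le_wgt_iff: "u \<le> C * wgt N y \<longleftrightarrow> (1 + norm y) ^ N * u \<le> C"
  using one_norm_pos[of y] by (simp add: wgt_def field_simps)

text \<open>Peetre's inequality, from
  \<open>1 + norm (x + y) \<le> (1 + norm x) * (1 + norm y)\<close>. It recentres a weight at a
  price that is polynomial in the displacement.\<close>

lemma wgt_shift: "wgt N x \<le> (1 + norm y) ^ N * wgt N (x + y)"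
proof -
  have "0 \<le> norm x * norm y" by simp
  then have "1 + norm (x + y) \<le> (1 + norm x) * (1 + norm y)"
    using norm_triangle_ineq[of x y] unfolding distrib_left distrib_right by linarith
  then have "(1 + norm (x + y)) ^ N \<le> (1 + norm x) ^ N * (1 + norm y) ^ N"
    by (metis one_norm_pos less_imp_le power_mono power_mult_distrib)
  then show ?thesis
    using one_norm_pos[of x] one_norm_pos[of "x+y"] by (simp add: wgt_def field_simps)
qed

lemma wgt_minus [simp]: "wgt N (- x) = wgt N x"
  by (simp add: wgt_def)

lemma wgt_continuous: "continuous_on S (wgt N)"
  unfolding wgt_def by (intro continuous_intros ballI power_not_zero) (metis one_norm_pos less_irrefl)

lemma wgt_measurable [measurable]: "wgt N \<in> borel_measurable borel"
  by (intro borel_measurable_continuous_onI wgt_continuous)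

text \<open>Each factor \<open>1 + (x \<bullet> b)\<^sup>2\<close> is at most
  \<open>(1 + norm x)\<^sup>2\<close>, so the weight is dominated by a product of one-dimensional
  Cauchy densities. This is the origin of the threshold of two powers per dimension used
  throughout.\<close>

lemma wgt_integrable:
  assumes "2 * DIM('a) \<le> N"
  shows "integrable lborel (wgt N :: 'a::euclidean_space \<Rightarrow> real)"
proof -
  have i: "integrable lborel (\<lambda>t::real. inverse (1 + t\<^sup>2))"
    using integrable_inverse_1_plus_square by (simp add: set_integrable_def)
  have le: "wgt N x \<le> (\<Prod>b\<in>Basis. inverse (1 + (x \<bullet> b)\<^sup>2))" for x :: 'a
  proof -
    have "(\<Prod>b\<in>Basis. 1 + (x \<bullet> b)\<^sup>2) \<le> (\<Prod>b\<in>(Basis::'a set). (1 + norm x)\<^sup>2)"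
    proof (intro prod_mono conjI)
      fix b :: 'a assume "b \<in> Basis"
      then have "\<bar>x \<bullet> b\<bar>\<^sup>2 \<le> (norm x)\<^sup>2" by (intro power_mono Basis_le_norm) auto
      then show "1 + (x \<bullet> b)\<^sup>2 \<le> (1 + norm x)\<^sup>2"
        by (simp add: power2_eq_square algebra_simps) (smt (verit) norm_ge_zero)
    qed (simp add: add_nonneg_nonneg)
    also have "\<dots> = (1 + norm x) ^ (2 * DIM('a))" by (simp add: power_mult)
    also have "\<dots> \<le> (1 + norm x) ^ N" using assms by (intro power_increasing) auto
    finally have "(\<Prod>b\<in>Basis. 1 + (x \<bullet> b)\<^sup>2) \<le> (1 + norm x) ^ N" .
    moreover have "0 < (\<Prod>b\<in>Basis. 1 + (x \<bullet> b)\<^sup>2)" by (intro prod_pos) (simp add: add_pos_nonneg)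
    ultimately have "inverse ((1 + norm x) ^ N) \<le> inverse (\<Prod>b\<in>Basis. 1 + (x \<bullet> b)\<^sup>2)"
      by (rule le_imp_inverse_le)
    then show ?thesis by (simp add: wgt_def inverse_eq_divide prod_dividef)
  qed
  have "(\<integral>\<^sup>+x. ennreal (wgt N x) \<partial>(lborel::'a measure)) \<le> 
     (\<integral>\<^sup>+x. (\<Prod>b\<in>Basis. ennreal (inverse (1 + (x \<bullet> b)\<^sup>2))) \<partial>(lborel::'a measure))"
    by (intro nn_integral_mono) (subst prod_ennreal, auto intro: ennreal_leI le)
  also have "\<dots> = (\<Prod>b\<in>(Basis::'a set). \<integral>\<^sup>+t. ennreal (inverse (1 + t\<^sup>2)) \<partial>lborel)"
    by (rule nn_integral_lborel_prod) auto
  also have "\<dots> < \<infinity>"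
    using i by (simp add: integrable_iff_bounded less_top[symmetric] ennreal_prod_eq_top power_eq_top_ennreal_iff)
  finally show ?thesis by (intro integrableI_bounded) auto
qed

section \<open>Affine substitutions in Lebesgue integrals\<close>

lemma nn_integral_lborel_affine:
  fixes f :: "'a::euclidean_space \<Rightarrow> ennreal"
  assumes [measurable]: "f \<in> borel_measurable borel" and "c \<noteq> 0"
  shows "(\<integral>\<^sup>+x. f x \<partial>lborel) = ennreal (\<bar>c\<bar> ^ DIM('a)) * (\<integral>\<^sup>+x. f (t + c *\<^sub>R x) \<partial>lborel)"
  by (subst lborel_affine[OF assms(2), of t])
     (simp add: nn_integral_density nn_integral_distr nn_integral_cmult)

lemma nn_integral_lborel_shift:
  fixes f :: "'a::euclidean_space \<Rightarrow> ennreal"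
  assumes "f \<in> borel_measurable borel"
  shows "(\<integral>\<^sup>+x. f (t + x) \<partial>lborel) = (\<integral>\<^sup>+x. f x \<partial>lborel)"
    and "(\<integral>\<^sup>+x. f (t - x) \<partial>lborel) = (\<integral>\<^sup>+x. f x \<partial>lborel)"
  using nn_integral_lborel_affine[OF assms, of 1 t] nn_integral_lborel_affine[OF assms, of "-1" t] by auto

lemma integral_lborel_affine:
  fixes f :: "'a::euclidean_space \<Rightarrow> 'b::{banach, second_countable_topology}"
  assumes [measurable]: "f \<in> borel_measurable borel" and c: "c \<noteq> 0"
  shows "(\<integral>x. f x \<partial>lborel) = \<bar>c\<bar> ^ DIM('a) *\<^sub>R (\<integral>x. f (t + c *\<^sub>R x) \<partial>lborel)"
  by (subst lborel_affine[OF c, of t])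
     (simp add: integral_density integral_distr)

lemma integrable_lborel_affine:
  fixes f :: "'a::euclidean_space \<Rightarrow> 'b::{banach, second_countable_topology}"
  assumes f: "integrable lborel f" and c: "c \<noteq> 0"
  shows "integrable lborel (\<lambda>x. f (t + c *\<^sub>R x))"
proof -
  have [measurable]: "f \<in> borel_measurable borel" using borel_measurable_integrable[OF f] by simp
  have "(\<integral>\<^sup>+x. norm (f x) \<partial>lborel) < \<infinity>" using f by (simp add: integrable_iff_bounded)
  then have "(\<integral>\<^sup>+x. norm (f (t + c *\<^sub>R x)) \<partial>lborel) < \<infinity>"
    by (subst (asm) nn_integral_lborel_affine[OF _ c, of _ t])
       (use c in \<open>auto simp: ennreal_mult_less_top\<close>)
  then show ?thesis by (intro integrableI_bounded) auto
qed

lemma integral_lborel_shift: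
  fixes f :: "'a::euclidean_space \<Rightarrow> 'b::{banach, second_countable_topology}"
  assumes "f \<in> borel_measurable borel"
  shows "(\<integral>x. f (t + x) \<partial>lborel) = (\<integral>x. f x \<partial>lborel)"
    and "(\<integral>x. f (t - x) \<partial>lborel) = (\<integral>x. f x \<partial>lborel)"
  using integral_lborel_affine[OF assms, of 1 t] integral_lborel_affine[OF assms, of "-1" t] by auto

lemma integrable_lborel_shift:
  fixes f :: "'a::euclidean_space \<Rightarrow> 'b::{banach, second_countable_topology}"
  assumes f: "integrable lborel f"
  shows "integrable lborel (\<lambda>x. f (t + x))" "integrable lborel (\<lambda>x. f (t - x))"
  using integrable_lborel_affine[OF f, of 1 t] integrable_lborel_affine[OF f, of "-1" t] by auto

section \<open>Rapidly decreasing functions and Schwartz functions\<close>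

text \<open>The part of the Schwartz condition that involves no derivatives. It is stable under
  multiplication by coordinates, and this alone makes the inverse Fourier transform smooth.\<close>

definition rd :: "('a::euclidean_space \<Rightarrow> complex) \<Rightarrow> bool" where
  "rd f \<longleftrightarrow> continuous_on UNIV f \<and> (\<forall>N. \<exists>C. \<forall>x. cmod (f x) \<le> C * wgt N x)"

lemma rdE:
  assumes "rd f" obtains C where "C > 0" "\<And>x. cmod (f x) \<le> C * wgt N x"
proof -
  obtain C where C: "\<And>x. cmod (f x) \<le> C * wgt N x" using assms unfolding rd_def by blast
  have "cmod (f x) \<le> (\<bar>C\<bar> + 1) * wgt N x" for x
    using C[of x] by (smt (verit) mult_right_mono wgt_nonneg)
  then show thesis by (intro that[of "\<bar>C\<bar> + 1"]) auto
qed

lemma rd_measurable: "rd f \<Longrightarrow> f \<in> borel_measurable borel"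
  unfolding rd_def by (auto intro: borel_measurable_continuous_onI)

lemma rd_integrable: fixes f :: "'a::euclidean_space \<Rightarrow> complex" assumes "rd f" shows "integrable lborel f"
proof -
  obtain C where C: "C > 0" "\<And>x. cmod (f x) \<le> C * wgt (2 * DIM('a)) x" using rdE[OF assms] by blast
  show ?thesis
    by (rule Bochner_Integration.integrable_bound[of _ "\<lambda>x. C * wgt (2 * DIM('a)) x"])
       (use C rd_measurable[OF assms] wgt_integrable[of "2 * DIM('a)", where 'a='a] in auto)
qed

lemma rd_bounded: assumes "rd f" obtains C where "C > 0" "\<And>x. cmod (f x) \<le> C"
  using rdE[OF assms, of 0] by (auto simp: wgt_def)

lemma rd_mult_inner:
  assumes "rd f" shows "rd (\<lambda>x. complex_of_real (x \<bullet> v) * f x)"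
  unfolding rd_def
proof (intro conjI allI)
  show "continuous_on UNIV (\<lambda>x. complex_of_real (x \<bullet> v) * f x)"
    using assms by (auto simp: rd_def intro!: continuous_intros)
  fix N
  obtain C where C: "C > 0" "\<And>x. cmod (f x) \<le> C * wgt (N + 1) x" using rdE[OF assms] by blast
  have "cmod (complex_of_real (x \<bullet> v) * f x) \<le> (norm v * C) * wgt N x" for x
  proof -
    have a: "\<bar>x \<bullet> v\<bar> \<le> norm v * (1 + norm x)"
      using Cauchy_Schwarz_ineq2[of x v] by (simp add: algebra_simps) (smt (verit) norm_ge_zero)
    have "cmod (complex_of_real (x \<bullet> v) * f x) \<le> (norm v * (1 + norm x)) * (C * wgt (N + 1) x)"
      unfolding norm_mult using a C by (intro mult_mono) auto
    also have "\<dots> = (norm v * C) * wgt N x * ((1 + norm x) ^ 1 * wgt 1 x)" unfolding wgt_add by (simp only: mult_ac power_one_right)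
    finally show ?thesis unfolding wgt_mult_power by simp
  qed
  then show "\<exists>C. \<forall>x. cmod (complex_of_real (x \<bullet> v) * f x) \<le> C * wgt N x" by blast
qed

lemma rd_const_mult: assumes "rd f" shows "rd (\<lambda>x. c * f x)"
  unfolding rd_def
proof (intro conjI allI)
  show "continuous_on UNIV (\<lambda>x. c * f x)"
    using assms by (auto simp: rd_def intro!: continuous_intros)
  fix N
  obtain C where C: "C > 0" "\<And>x. cmod (f x) \<le> C * wgt N x" using rdE[OF assms] by blast
  then have "cmod (c * f x) \<le> (cmod c * C) * wgt N x" for x
    unfolding norm_mult by (metis mult.assoc mult_left_mono norm_ge_zero)
  then show "\<exists>C. \<forall>x. cmod (c * f x) \<le> C * wgt N x" by blast
qed

lemma rd_test_fun: assumes "test_fun f" shows "rd f"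
  unfolding rd_def
proof (intro conjI allI)
  show c: "continuous_on UNIV f" using assms by (simp add: test_fun_smooth smooth_continuous)
  fix N
  obtain R where R: "R > 0" "\<And>x. f x \<noteq> 0 \<Longrightarrow> norm x < R" using test_fun_bounded_supp[OF assms] by blast
  have "compact ((\<lambda>x. (1 + norm x) ^ N * cmod (f x)) ` cball 0 R)"
    by (intro compact_continuous_image continuous_intros continuous_on_subset[OF c]) auto
  then obtain C where C: "\<And>x. norm x \<le> R \<Longrightarrow> (1 + norm x) ^ N * cmod (f x) \<le> C"
    using compact_imp_bounded bounded_iff by (smt (verit, best) imageI mem_cball_0 real_norm_def)
  have "cmod (f x) \<le> \<bar>C\<bar> * wgt N x" for x
    unfolding le_wgt_iff using C[of x] R(2)[of x] by (cases "f x = 0") auto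
  then show "\<exists>C. \<forall>x. cmod (f x) \<le> C * wgt N x" by blast
qed

lemma schwartz_bdd:
  assumes "f \<in> schwartz" "set bs \<subseteq> Basis"
  obtains C where "\<And>x. (1 + norm x) ^ N * cmod (iter_deriv bs f x) \<le> C"
proof -
  have "\<forall>N bs. set bs \<subseteq> Basis \<longrightarrow> bdd_above (range (\<lambda>x. (1 + norm x) ^ N * cmod (iter_deriv bs f x)))"
    using assms(1) by (simp add: schwartz_def)
  from this[rule_format, OF assms(2), of N] show thesis
    by (auto simp: bdd_above_def intro: that)
qed

lemma rd_schwartz: assumes "f \<in> schwartz" shows "rd f"
  unfolding rd_def
proof (intro conjI allI)
  show "continuous_on UNIV f" using assms by (simp add: schwartz_def smooth_continuous)
  fix N
  obtain C where "\<And>x. (1 + norm x) ^ N * cmod (iter_deriv [] f x) \<le> C"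
    using schwartz_bdd[OF assms, of "[]"] by auto
  then show "\<exists>C. \<forall>x. cmod (f x) \<le> C * wgt N x" unfolding le_wgt_iff by auto
qed

lemma schwartz_deriv:
  assumes "f \<in> schwartz" "b \<in> Basis" shows "(\<lambda>x. frechet_derivative f (at x) b) \<in> schwartz"
proof -
  have "bdd_above (range (\<lambda>x. (1 + norm x) ^ N * cmod (iter_deriv bs (\<lambda>x. frechet_derivative f (at x) b) x)))"
    if bs: "set bs \<subseteq> Basis" for N bs
  proof -
    have s: "set (bs @ [b]) \<subseteq> Basis" using bs assms(2) by simp
    obtain C where "\<And>x. (1 + norm x) ^ N * cmod (iter_deriv (bs @ [b]) f x) \<le> C"
      using schwartz_bdd[OF assms(1) s] by auto
    then show ?thesis by (intro bdd_aboveI2) (simp add: iter_deriv_append)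
  qed
  then show ?thesis using assms smooth_deriv unfolding schwartz_def by auto
qed

lemma schwartzI:
  assumes "smooth f" "\<And>bs. set bs \<subseteq> Basis \<Longrightarrow> rd (iter_deriv bs f)"
  shows "f \<in> schwartz"
proof -
  have "bdd_above (range (\<lambda>x. (1 + norm x) ^ N * cmod (iter_deriv bs f x)))"
    if bs: "set bs \<subseteq> Basis" for N bs
  proof -
    obtain C where "\<And>x. cmod (iter_deriv bs f x) \<le> C * wgt N x" using rdE[OF assms(2)[OF bs]] by blast
    then show ?thesis unfolding le_wgt_iff by (intro bdd_aboveI2)
  qed
  then show ?thesis using assms(1) by (simp add: schwartz_def)
qed

lemma test_fun_schwartz: assumes "test_fun f" shows "f \<in> schwartz"
proof (rule schwartzI)
  show "smooth f" using assms by (rule test_fun_smooth)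
  fix bs assume "set bs \<subseteq> (Basis::'a set)"
  then have "test_fun (iter_deriv bs f)"
  proof (induction bs)
    case (Cons b bs)
    then have t: "test_fun (iter_deriv bs f)" and b: "b \<in> Basis" by auto
    obtain R where R: "R > 0" "\<And>x. iter_deriv bs f x \<noteq> 0 \<Longrightarrow> norm x < R" using test_fun_bounded_supp[OF t] by blast
    have "frechet_derivative (iter_deriv bs f) (at x) b = 0" if x: "R < norm x" for x
    proof -
      have "((\<lambda>x. 0) has_derivative (\<lambda>v. 0)) (at x)" by simp
      moreover have "open {x::'a. R < norm x}" by (intro open_Collect_less continuous_intros)
      ultimately have "(iter_deriv bs f has_derivative (\<lambda>v. 0)) (at x)"
        by (rule has_derivative_transform_within_open) (use x R in force)+
      then show ?thesis using frechet_derivative_at by metis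
    qed
    then have "frechet_derivative (iter_deriv bs f) (at x) b \<noteq> 0 \<Longrightarrow> norm x \<le> R" for x
      by (meson not_le)
    then show ?case unfolding iter_deriv.simps by (intro test_funI[OF smooth_deriv[OF test_fun_smooth[OF t] b]])
  qed (use assms in simp)
  then show "rd (iter_deriv bs f)" by (rule rd_test_fun)
qed

section \<open>Fourier inversion\<close>

text \<open>The inverse Fourier transform of the image under \<open>\<rho>\<close> of the complex measure with density \<open>F\<close>.
  With \<open>\<rho> (\<xi>\<^sub>1, \<xi>\<^sub>2) = \<xi>\<^sub>1 + \<xi>\<^sub>2\<close> this is the bilinear operator.\<close>

definition synth :: "('b::euclidean_space \<Rightarrow> 'a::euclidean_space) \<Rightarrow> ('b \<Rightarrow> complex) \<Rightarrow> 'a \<Rightarrow> complex" where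
  "synth \<rho> F x = (\<integral>\<omega>. cis (2 * pi * (x \<bullet> \<rho> \<omega>)) * F \<omega> \<partial>lborel)"

lemma inv_fourier_synth: "inv_fourier f = synth (\<lambda>\<xi>. \<xi>) f"
  by (simp add: fun_eq_iff inv_fourier_def synth_def)

lemma fourier_inv_fourier: "fourier f \<xi> = inv_fourier f (- \<xi>)"
  by (simp add: fourier_def inv_fourier_def inner_commute)

lemma cis_measurable [measurable]: "cis \<in> borel_measurable borel"
  by (intro borel_measurable_continuous_onI continuous_intros)

lemma integrable_cis_mult:
  assumes "integrable M F" "\<theta> \<in> borel_measurable M"
  shows "integrable M (\<lambda>\<omega>. cis (\<theta> \<omega>) * F \<omega>)"
proof (rule Bochner_Integration.integrable_bound[OF assms(1)])
  have [measurable]: "\<theta> \<in> borel_measurable M" "F \<in> borel_measurable M"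
    using assms by auto
  show "(\<lambda>\<omega>. cis (\<theta> \<omega>) * F \<omega>) \<in> borel_measurable M" by measurable
qed (simp add: norm_mult)

context
  fixes \<rho> :: "'b::euclidean_space \<Rightarrow> 'a::euclidean_space" and F :: "'b \<Rightarrow> complex"
  assumes F: "integrable lborel F" and \<rho>[measurable]: "\<rho> \<in> borel_measurable borel"
begin

lemma synth_integrable: "integrable lborel (\<lambda>\<omega>. cis (2 * pi * (x \<bullet> \<rho> \<omega>)) * F \<omega>)"
  by (intro integrable_cis_mult F) measurable

lemma synth_bound: "cmod (synth \<rho> F x) \<le> (\<integral>\<omega>. cmod (F \<omega>) \<partial>lborel)"
  unfolding synth_def by (rule order_trans[OF integral_norm_bound]) (simp add: norm_mult)

lemma synth_continuous: "continuous_on UNIV (synth \<rho> F)"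
proof (rule continuous_on_sequentiallyI)
  have [measurable]: "F \<in> borel_measurable borel" using borel_measurable_integrable[OF F] by simp
  fix u :: "nat \<Rightarrow> 'a" and a assume "u \<longlonglongrightarrow> a"
  then have "(\<lambda>n. cis (2 * pi * (u n \<bullet> \<rho> \<omega>)) * F \<omega>) \<longlonglongrightarrow> cis (2 * pi * (a \<bullet> \<rho> \<omega>)) * F \<omega>" for \<omega>
    by (intro tendsto_intros)
  then show "(\<lambda>n. synth \<rho> F (u n)) \<longlonglongrightarrow> synth \<rho> F a"
    unfolding synth_def
    by (intro integral_dominated_convergence[where w="\<lambda>\<omega>. cmod (F \<omega>)"])
       (use F in \<open>auto simp: norm_mult\<close>)
qed

lemma synth_measurable [measurable]: "synth \<rho> F \<in> borel_measurable borel"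
  by (intro borel_measurable_continuous_onI synth_continuous)

end

lemma cmod_integral_le:
  assumes "integrable M g" "\<And>x. cmod (f x) \<le> g x"
  shows "cmod (\<integral>x. f x \<partial>M) \<le> (\<integral>x. g x \<partial>M)"
proof -
  have "cmod (\<integral>x. f x \<partial>M) \<le> (\<integral>x. cmod (f x) \<partial>M)" by (rule integral_norm_bound)
  also have "\<dots> \<le> (\<integral>x. g x \<partial>M)"
    using order_trans[OF norm_ge_zero assms(2)] by (intro integral_mono'[OF assms(1)] assms(2))
  finally show ?thesis .
qed

lemma cis_approx: "cmod (cis t - 1 - \<i> * complex_of_real t) \<le> t\<^sup>2"
proof -
  have "cmod (cis t - 1 - \<i> * complex_of_real t) \<le> t\<^sup>2 / 2"
    using iexp_approx1[of t 1] by (simp add: cis_conv_exp algebra_simps power2_eq_square)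
  then show ?thesis by (smt (verit) zero_le_power2 field_sum_of_halves)
qed

lemma has_derivative_quadratic:
  assumes "bounded_linear L" "\<And>v. norm (f (x + v) - f x - L v) \<le> K * (norm v)\<^sup>2"
  shows "(f has_derivative L) (at x)"
proof -
  have "((\<lambda>v. norm (f (x + v) - f x - L v) / norm v) \<longlongrightarrow> 0) (at 0)"
  proof (rule Lim_null_comparison)
    show "\<forall>\<^sub>F v in at 0. norm (norm (f (x + v) - f x - L v) / norm v) \<le> K * norm v"
    proof (rule always_eventually, rule allI)
      fix v
      show "norm (norm (f (x + v) - f x - L v) / norm v) \<le> K * norm v"
        using assms(2)[of v] by (cases "v = 0") (simp_all add: pos_divide_le_eq power2_eq_square mult.assoc)
    qed
    show "((\<lambda>v. K * norm v) \<longlongrightarrow> 0) (at 0)" by (auto intro!: tendsto_eq_intros)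
  qed
  then show ?thesis using assms(1) by (simp add: has_derivative_at)
qed

text \<open>The total derivative is read off directly: the first-order Taylor remainder of
  \<open>cis\<close> is quadratic in \<open>v \<bullet> \<xi>\<close>, and two spare powers of decay
  of \<open>f\<close> pay for the resulting square of \<open>1 + norm \<xi>\<close>. The remainder
  is thus at most a constant times the square of \<open>norm v\<close>.\<close>

lemma inv_fourier_has_derivative:
  assumes f: "rd f"
  shows "(inv_fourier f has_derivative
     (\<lambda>v. inv_fourier (\<lambda>\<xi>. complex_of_real (\<xi> \<bullet> v) * (2 * pi * \<i> * f \<xi>)) x)) (at x)"
    (is "(_ has_derivative ?L) _")
proof -
  have f2: "rd (\<lambda>\<xi>. 2 * pi * \<i> * f \<xi>)" using f by (rule rd_const_mult)
  have fv: "rd (\<lambda>\<xi>. complex_of_real (\<xi> \<bullet> v) * (2 * pi * \<i> * f \<xi>))" for v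
    by (rule rd_mult_inner[OF f2])
  have int: "integrable lborel (\<lambda>\<xi>. cis (2 * pi * (x \<bullet> \<xi>)) * g \<xi>)" if "rd g" for g x
    using rd_integrable[OF that] by (rule integrable_cis_mult) measurable
  obtain C where C: "C > 0" "\<And>\<xi>. cmod (f \<xi>) \<le> C * wgt (2 * DIM('a) + 2) \<xi>"
    using rdE[OF f] by blast
  define K where "K = (2 * pi)\<^sup>2 * C * (\<integral>\<xi>. wgt (2 * DIM('a)) (\<xi>::'a) \<partial>lborel)"
  have est: "cmod (inv_fourier f (x + v) - inv_fourier f x - ?L v) \<le> K * (norm v)\<^sup>2" for v
  proof -
    have "inv_fourier f (x + v) - inv_fourier f x - ?L v =
      (\<integral>\<xi>. cis (2 * pi * ((x + v) \<bullet> \<xi>)) * f \<xi> - cis (2 * pi * (x \<bullet> \<xi>)) * f \<xi>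
         - cis (2 * pi * (x \<bullet> \<xi>)) * (complex_of_real (\<xi> \<bullet> v) * (2 * pi * \<i> * f \<xi>)) \<partial>lborel)"
      unfolding inv_fourier_def
      by (subst Bochner_Integration.integral_diff, (intro Bochner_Integration.integrable_diff int f fv)+)+ simp
    also have "\<dots> = (\<integral>\<xi>. cis (2 * pi * (x \<bullet> \<xi>)) * f \<xi> * 
       (cis (2 * pi * (v \<bullet> \<xi>)) - 1 - \<i> * complex_of_real (2 * pi * (v \<bullet> \<xi>))) \<partial>lborel)"
      by (intro Bochner_Integration.integral_cong refl)
         (simp add: inner_add_left distrib_left cis_mult[symmetric] algebra_simps inner_commute)
    also have "cmod \<dots> \<le> (\<integral>\<xi>. (norm v)\<^sup>2 * ((2 * pi)\<^sup>2 * C * wgt (2 * DIM('a)) (\<xi>::'a)) \<partial>lborel)"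
    proof (rule cmod_integral_le)
      show "integrable lborel (\<lambda>\<xi>::'a. (norm v)\<^sup>2 * ((2 * pi)\<^sup>2 * C * wgt (2 * DIM('a)) \<xi>))"
        using wgt_integrable[of "2 * DIM('a)", where 'a='a] by (intro integrable_mult_right) auto
      fix \<xi> :: 'a
      have "(v \<bullet> \<xi>)\<^sup>2 \<le> (norm v * (1 + norm \<xi>))\<^sup>2"
        using Cauchy_Schwarz_ineq2[of v \<xi>] 
        by (intro iffD1[OF abs_le_square_iff]) (smt (verit) mult_left_mono norm_ge_zero abs_of_nonneg mult_nonneg_nonneg)
      then have q: "(2 * pi * (v \<bullet> \<xi>))\<^sup>2 \<le> (2 * pi)\<^sup>2 * ((norm v)\<^sup>2 * (1 + norm \<xi>)\<^sup>2)"
        unfolding power_mult_distrib by (intro mult_left_mono) (auto simp: power_mult_distrib)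
      have "cmod (cis (2 * pi * (x \<bullet> \<xi>)) * f \<xi> * 
         (cis (2 * pi * (v \<bullet> \<xi>)) - 1 - \<i> * complex_of_real (2 * pi * (v \<bullet> \<xi>))))
        \<le> (C * wgt (2 * DIM('a) + 2) \<xi>) * ((2 * pi)\<^sup>2 * ((norm v)\<^sup>2 * (1 + norm \<xi>)\<^sup>2))"
        unfolding norm_mult norm_cis mult_1_left
        using C order_trans[OF cis_approx q] by (intro mult_mono) auto
      also have "\<dots> = (norm v)\<^sup>2 * ((2 * pi)\<^sup>2 * C * wgt (2 * DIM('a)) \<xi>) * ((1 + norm \<xi>)\<^sup>2 * wgt 2 \<xi>)"
        unfolding wgt_add by (simp only: mult_ac)
      finally show "cmod (cis (2 * pi * (x \<bullet> \<xi>)) * f \<xi> * 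
         (cis (2 * pi * (v \<bullet> \<xi>)) - 1 - \<i> * complex_of_real (2 * pi * (v \<bullet> \<xi>))))
        \<le> (norm v)\<^sup>2 * ((2 * pi)\<^sup>2 * C * wgt (2 * DIM('a)) \<xi>)"
        unfolding wgt_mult_power by simp
    qed
    also have "\<dots> = K * (norm v)\<^sup>2" by (simp add: K_def)
    finally show ?thesis .
  qed
  have lin: "bounded_linear ?L"
  proof (rule bounded_linear_intro[where K="2 * pi * C * (\<integral>\<xi>. wgt (2 * DIM('a)) (\<xi>::'a) \<partial>lborel)"])
    show "?L (v + w) = ?L v + ?L w" for v w
      unfolding inv_fourier_def
      by (subst Bochner_Integration.integral_add[symmetric], (intro int fv)+)
         (simp add: inner_add_right algebra_simps)
    show "?L (r *\<^sub>R v) = r *\<^sub>R ?L v" for r v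
      unfolding inv_fourier_def integral_scaleR_right[symmetric]
      by (intro Bochner_Integration.integral_cong refl) (simp add: scaleR_conv_of_real mult_ac)
    fix v
    have "cmod (?L v) \<le> (\<integral>\<xi>. norm v * (2 * pi * C * wgt (2 * DIM('a)) (\<xi>::'a)) \<partial>lborel)"
      unfolding inv_fourier_def
    proof (rule cmod_integral_le)
      show "integrable lborel (\<lambda>\<xi>::'a. norm v * (2 * pi * C * wgt (2 * DIM('a)) \<xi>))"
        using wgt_integrable[of "2 * DIM('a)", where 'a='a] by (intro integrable_mult_right) auto
      fix \<xi> :: 'a
      have 1: "\<bar>\<xi> \<bullet> v\<bar> \<le> norm v * (1 + norm \<xi>)"
        using Cauchy_Schwarz_ineq2[of \<xi> v] by (simp add: algebra_simps) (smt (verit) norm_ge_zero)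
      have "cmod (cis (2 * pi * (x \<bullet> \<xi>)) * (complex_of_real (\<xi> \<bullet> v) * (2 * pi * \<i> * f \<xi>)))
         = \<bar>\<xi> \<bullet> v\<bar> * (2 * pi * cmod (f \<xi>))" by (simp add: norm_mult)
      also have "\<dots> \<le> (norm v * (1 + norm \<xi>)) * (2 * pi * (C * wgt (2 * DIM('a) + 1) \<xi>))"
        using 1 C order_trans[OF C(2) mult_left_mono[OF wgt_mono]] by (intro mult_mono) auto
      also have "\<dots> = norm v * (2 * pi * C * wgt (2 * DIM('a)) \<xi>) * ((1 + norm \<xi>) ^ 1 * wgt 1 \<xi>)"
        unfolding wgt_add by (simp only: mult_ac power_one_right)
      finally show "cmod (cis (2 * pi * (x \<bullet> \<xi>)) * (complex_of_real (\<xi> \<bullet> v) * (2 * pi * \<i> * f \<xi>)))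
        \<le> norm v * (2 * pi * C * wgt (2 * DIM('a)) \<xi>)" unfolding wgt_mult_power by simp
    qed
    then show "cmod (?L v) \<le> norm v * (2 * pi * C * (\<integral>\<xi>. wgt (2 * DIM('a)) (\<xi>::'a) \<partial>lborel))"
      by simp
  qed
  show ?thesis by (rule has_derivative_quadratic[OF lin est])
qed

lemma inv_fourier_smooth: assumes "rd f" shows "smooth (inv_fourier f)"
proof -
  have "Ck m (inv_fourier f)" for m
    using assms
  proof (induction m arbitrary: f)
    case (Suc m)
    show ?case
    proof (rule Ck_SucI[OF inv_fourier_has_derivative[OF Suc.prems]])
      fix b :: 'a
      have "rd (\<lambda>\<xi>. complex_of_real (\<xi> \<bullet> b) * (2 * pi * \<i> * f \<xi>))"
        by (rule rd_mult_inner[OF rd_const_mult[OF Suc.prems]])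
      from Suc.IH[OF this] show "Ck m (\<lambda>x. inv_fourier (\<lambda>\<xi>. complex_of_real (\<xi> \<bullet> b) * (2 * pi * \<i> * f \<xi>)) x)" .
    qed
  qed auto
  then show ?thesis by (simp add: smooth_iff_Ck)
qed

lemma norm_scaleR_le:
  assumes "norm z \<le> W" shows "norm (u *\<^sub>R z) \<le> W * norm (u::real)"
  using mult_left_mono[OF assms abs_ge_zero[of u]] unfolding mult.commute[of W] by simp

text \<open>Difference quotients have integral zero because Lebesgue measure is translation
  invariant, and they converge to the derivative under an integrable majorant.\<close>

lemma integral_deriv_zero:
  fixes h :: "'a::euclidean_space \<Rightarrow> complex"
  assumes d: "\<And>x. (h has_derivative h' x) (at x)" and i: "integrable lborel h"
    and le: "\<And>x. cmod (h' x b) \<le> C * wgt (2 * DIM('a)) x"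
  shows "(\<integral>x. h' x b \<partial>lborel) = 0"
proof -
  define t where "t n = inverse (real (Suc n))" for n
  have t: "0 < t n" "t n \<le> 1" for n by (auto simp: t_def field_simps)
  have t0: "t \<longlonglongrightarrow> 0" unfolding t_def by (rule LIMSEQ_inverse_real_of_nat)
  define s where "s n x = (h (t n *\<^sub>R b + x) - h x) /\<^sub>R t n" for n x
  have hm [measurable]: "h \<in> borel_measurable borel" using borel_measurable_integrable[OF i] by simp
  have C: "0 \<le> C" using le[of 0] by (smt (verit) norm_ge_zero wgt_pos zero_le_mult_iff)
  have lim: "(\<lambda>n. s n x) \<longlonglongrightarrow> h' x b" for x
  proof -
    have "((\<lambda>r. h (r *\<^sub>R b + x)) has_vector_derivative h' x b) (at 0)"
    proof -
      have "((\<lambda>r::real. r *\<^sub>R b + x) has_derivative (\<lambda>r. r *\<^sub>R b)) (at 0)"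
        by (auto intro!: derivative_eq_intros)
      from has_derivative_compose[OF this, of h "h' x"] d[of x]
      have "((\<lambda>r. h (r *\<^sub>R b + x)) has_derivative (\<lambda>r. h' x (r *\<^sub>R b))) (at 0)" by simp
      moreover have "h' x (r *\<^sub>R b) = r *\<^sub>R h' x b" for r
        using has_derivative_linear[OF d] by (simp add: linear_cmul)
      ultimately show ?thesis by (simp add: has_vector_derivative_def)
    qed
    then have "((\<lambda>r. norm (h (r *\<^sub>R b + x) - h x - r *\<^sub>R h' x b) / norm r) \<longlongrightarrow> 0) (at 0)"
      by (simp add: has_vector_derivative_def has_derivative_iff_norm)
    moreover have "\<forall>\<^sub>F r in at 0. norm (h (r *\<^sub>R b + x) - h x - r *\<^sub>R h' x b) / norm r
        = norm ((h (r *\<^sub>R b + x) - h x) /\<^sub>R r - h' x b)"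
    proof (rule eventually_at_filter[THEN iffD2], rule always_eventually, intro allI impI)
      fix r :: real assume "r \<noteq> 0"
      then have "(h (r *\<^sub>R b + x) - h x) /\<^sub>R r - h' x b = (h (r *\<^sub>R b + x) - h x - r *\<^sub>R h' x b) /\<^sub>R r"
        by (simp add: algebra_simps)
      then show "norm (h (r *\<^sub>R b + x) - h x - r *\<^sub>R h' x b) / norm r
        = norm ((h (r *\<^sub>R b + x) - h x) /\<^sub>R r - h' x b)" by (simp add: divide_inverse mult.commute)
    qed
    ultimately have "((\<lambda>r. norm ((h (r *\<^sub>R b + x) - h x) /\<^sub>R r - h' x b)) \<longlongrightarrow> 0) (at 0)"
      by (rule Lim_transform_eventually)
    then have "((\<lambda>r. (h (r *\<^sub>R b + x) - h x) /\<^sub>R r) \<longlongrightarrow> h' x b) (at 0)"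
      by (simp add: tendsto_norm_zero_iff LIM_zero_iff)
    then show ?thesis unfolding s_def
      by (rule filterlim_compose) (use t t0 in \<open>auto simp: filterlim_at less_le\<close>)
  qed
  \<comment> \<open>Mean value inequality on the segment from \<open>x\<close> to
    \<open>x + b\<close>; Peetre's inequality brings the weight at a point of the segment back to
    \<open>x\<close>.\<close>
  have bd: "cmod (s n x) \<le> C * (1 + norm b) ^ (2 * DIM('a)) * wgt (2 * DIM('a)) x" (is "_ \<le> ?w x") for n x
  proof -
    have "norm (h (t n *\<^sub>R b + x) - h (0 *\<^sub>R b + x)) \<le> ?w x * norm (t n - 0)"
    proof (rule differentiable_bound[where S="{0..1}" and f'="\<lambda>r u. u *\<^sub>R h' (r *\<^sub>R b + x) b"])
      fix r :: real assume r: "r \<in> {0..1}"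
      have "((\<lambda>r::real. r *\<^sub>R b + x) has_derivative (\<lambda>r. r *\<^sub>R b)) (at r within {0..1})"
        by (auto intro!: derivative_eq_intros)
      from has_derivative_compose[OF this d]
      have "((\<lambda>r. h (r *\<^sub>R b + x)) has_derivative (\<lambda>u. h' (r *\<^sub>R b + x) (u *\<^sub>R b))) (at r within {0..1})" .
      moreover have "h' y (u *\<^sub>R b) = u *\<^sub>R h' y b" for u y
        using has_derivative_linear[OF d] by (simp add: linear_cmul)
      ultimately show "((\<lambda>r. h (r *\<^sub>R b + x)) has_derivative (\<lambda>u. u *\<^sub>R h' (r *\<^sub>R b + x) b)) (at r within {0..1})"
        by simp
      have "wgt (2 * DIM('a)) (r *\<^sub>R b + x) \<le> (1 + norm (- r *\<^sub>R b)) ^ (2 * DIM('a)) * wgt (2 * DIM('a)) ((r *\<^sub>R b + x) + (- r *\<^sub>R b))"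
        by (rule wgt_shift)
      also have "\<dots> \<le> (1 + norm b) ^ (2 * DIM('a)) * wgt (2 * DIM('a)) x"
        using r by (intro mult_mono power_mono) (auto simp: mult_left_le_one_le)
      finally have "cmod (h' (r *\<^sub>R b + x) b) \<le> ?w x"
        using le[of "r *\<^sub>R b + x"] C by (smt (verit) mult.assoc mult_left_mono)
      then show "onorm (\<lambda>u. u *\<^sub>R h' (r *\<^sub>R b + x) b) \<le> ?w x"
        by (intro onorm_le norm_scaleR_le)
    qed (use t[of n] in auto)
    then have "cmod (h (t n *\<^sub>R b + x) - h x) \<le> ?w x * t n" using t[of n] by simp
    moreover have "cmod (s n x) = cmod (h (t n *\<^sub>R b + x) - h x) / t n"
      using t[of n] by (simp add: s_def divide_inverse mult.commute)
    ultimately show ?thesis using t[of n] by (simp only: pos_divide_le_eq)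
  qed
  have wi: "integrable lborel ?w"
    using wgt_integrable[of "2 * DIM('a)", where 'a='a] by auto
  have sm [measurable]: "s n \<in> borel_measurable borel" for n unfolding s_def by measurable
  have h'm: "(\<lambda>x. h' x b) \<in> borel_measurable borel"
    by (rule borel_measurable_LIMSEQ_metric[OF sm lim])
  have "(\<lambda>n. \<integral>x. s n x \<partial>lborel) \<longlonglongrightarrow> (\<integral>x. h' x b \<partial>lborel)"
  proof (rule integral_dominated_convergence[where w="?w"])
    show "AE x in lborel. (\<lambda>n. s n x) \<longlonglongrightarrow> h' x b" using lim by blast
    show "AE x in lborel. cmod (s n x) \<le> ?w x" for n using bd by blast
  qed (use wi h'm in simp_all)
  moreover have "(\<integral>x. s n x \<partial>lborel) = 0" for n
    unfolding s_def
    using integrable_lborel_shift(1)[OF i, of "t n *\<^sub>R b"] i integral_lborel_shift(1)[OF hm, of "t n *\<^sub>R b"]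
    by simp
  ultimately show ?thesis by (simp add: LIMSEQ_const_iff)
qed

text \<open>Integration by parts: the derivative of character times \<open>f\<close> integrates to
  zero, and the product rule splits it into the two sides.\<close>

lemma inv_fourier_deriv:
  assumes f: "f \<in> schwartz" and b: "b \<in> Basis"
  shows "inv_fourier (\<lambda>\<xi>. frechet_derivative f (at \<xi>) b) x
    = - (2 * pi * \<i> * complex_of_real (x \<bullet> b)) * inv_fourier f x"
proof -
  define f' where "f' \<xi> = frechet_derivative f (at \<xi>)" for \<xi>
  define E where "E \<xi> = cis (2 * pi * (x \<bullet> \<xi>))" for \<xi>
  define h' where "h' \<xi> v = E \<xi> * f' \<xi> v + (2 * pi * \<i> * complex_of_real (x \<bullet> v)) * E \<xi> * f \<xi>" for \<xi> v
  have rf: "rd f" and rf': "rd (\<lambda>\<xi>. f' \<xi> b)"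
    using f schwartz_deriv[OF f b] by (auto simp: f'_def intro: rd_schwartz)
  have int: "integrable lborel (\<lambda>\<xi>. E \<xi> * g \<xi>)" if "rd g" for g
    unfolding E_def using rd_integrable[OF that] by (rule integrable_cis_mult) measurable
  have df: "(f has_derivative f' \<xi>) (at \<xi>)" for \<xi>
    using f by (auto simp: f'_def schwartz_def frechet_derivative_works[symmetric] smooth_diff)
  have dE: "(E has_derivative (\<lambda>v. (2 * pi * \<i> * complex_of_real (x \<bullet> v)) * E \<xi>)) (at \<xi>)" for \<xi>
    unfolding E_def
    by (auto intro!: derivative_eq_intros simp: scaleR_conv_of_real mult_ac)
  have d: "((\<lambda>\<xi>. E \<xi> * f \<xi>) has_derivative h' \<xi>) (at \<xi>)" for \<xi>
    using has_derivative_mult[OF dE df, of \<xi>] by (simp add: h'_def[abs_def])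
  obtain C1 where C1: "C1 > 0" "\<And>\<xi>. cmod (f \<xi>) \<le> C1 * wgt (2 * DIM('a)) \<xi>" using rdE[OF rf] by blast
  obtain C2 where C2: "C2 > 0" "\<And>\<xi>. cmod (f' \<xi> b) \<le> C2 * wgt (2 * DIM('a)) \<xi>" using rdE[OF rf'] by blast
  have [simp]: "cmod (E \<xi>) = 1" for \<xi> by (simp add: E_def)
  have "(\<integral>\<xi>. h' \<xi> b \<partial>lborel) = 0"
  proof (rule integral_deriv_zero[OF d int[OF rf]])
    fix \<xi>
    have "cmod (h' \<xi> b) \<le> cmod (E \<xi> * f' \<xi> b) + cmod ((2 * pi * \<i> * complex_of_real (x \<bullet> b)) * E \<xi> * f \<xi>)"
      unfolding h'_def by (rule norm_triangle_ineq)
    also have "\<dots> = cmod (f' \<xi> b) + 2 * pi * \<bar>x \<bullet> b\<bar> * cmod (f \<xi>)" by (simp add: norm_mult)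
    also have "\<dots> \<le> C2 * wgt (2 * DIM('a)) \<xi> + 2 * pi * \<bar>x \<bullet> b\<bar> * (C1 * wgt (2 * DIM('a)) \<xi>)"
      using C1 C2 by (intro add_mono mult_left_mono) auto
    finally show "cmod (h' \<xi> b) \<le> (C2 + 2 * pi * \<bar>x \<bullet> b\<bar> * C1) * wgt (2 * DIM('a)) \<xi>"
      by (simp add: algebra_simps)
  qed
  moreover have "(\<integral>\<xi>. h' \<xi> b \<partial>lborel) = (\<integral>\<xi>. E \<xi> * f' \<xi> b \<partial>lborel)
      + (2 * pi * \<i> * complex_of_real (x \<bullet> b)) * (\<integral>\<xi>. E \<xi> * f \<xi> \<partial>lborel)"
    unfolding h'_def using int[OF rf] int[OF rf'] by (simp add: mult.assoc)
  ultimately show ?thesis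
    unfolding inv_fourier_def E_def f'_def by (simp add: eq_neg_iff_add_eq_0)
qed

lemma inv_fourier_schwartz_coord:
  assumes "f \<in> schwartz" "b \<in> Basis"
  shows "\<exists>C. \<forall>x. \<bar>x \<bullet> b\<bar> ^ N * cmod (inv_fourier f x) \<le> C"
  using assms(1)
proof (induction N arbitrary: f)
  case 0
  have "cmod (inv_fourier f x) \<le> (\<integral>\<omega>. cmod (f \<omega>) \<partial>lborel)" for x
    unfolding inv_fourier_synth by (rule synth_bound) (auto intro: rd_integrable rd_schwartz 0)
  then show ?case by auto
next
  case (Suc N)
  obtain C where C: "\<And>x. \<bar>x \<bullet> b\<bar> ^ N * cmod (inv_fourier (\<lambda>\<xi>. frechet_derivative f (at \<xi>) b) x) \<le> C"
    using Suc.IH[OF schwartz_deriv[OF Suc.prems assms(2)]] by blast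
  have "\<bar>x \<bullet> b\<bar> ^ Suc N * cmod (inv_fourier f x) \<le> C" for x
  proof -
    have "\<bar>x \<bullet> b\<bar> ^ Suc N * cmod (inv_fourier f x) \<le> 2 * pi * (\<bar>x \<bullet> b\<bar> ^ Suc N * cmod (inv_fourier f x))"
      using mult_right_mono[of 1 "2 * pi" "\<bar>x \<bullet> b\<bar> ^ Suc N * cmod (inv_fourier f x)"] pi_ge_two
      by (simp only: mult_1_left) simp
    also have "\<dots> = \<bar>x \<bullet> b\<bar> ^ N * cmod (inv_fourier (\<lambda>\<xi>. frechet_derivative f (at \<xi>) b) x)"
      unfolding inv_fourier_deriv[OF Suc.prems assms(2)] by (simp add: norm_mult)
    finally show ?thesis using C[of x] by linarith
  qed
  then show ?case by blast
qed

lemma one_plus_power_le: "0 \<le> u \<Longrightarrow> (1 + u) ^ N \<le> 2 ^ N * (1 + (u::real) ^ N)"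
proof -
  assume u: "0 \<le> u"
  have "(1 + u) ^ N \<le> (2 * max 1 u) ^ N" using u by (intro power_mono) auto
  also have "\<dots> = 2 ^ N * max 1 u ^ N" by (simp add: power_mult_distrib)
  also have "max 1 u ^ N \<le> 1 + u ^ N" using u by (cases "u \<le> 1") (auto simp: max_def)
  finally show ?thesis by simp
qed

lemma norm_power_le_coord:
  "norm (x::'a::euclidean_space) ^ N \<le> real DIM('a) ^ N * (\<Sum>b\<in>Basis. \<bar>x \<bullet> b\<bar> ^ N)"
proof -
  define m where "m = Max ((\<lambda>b. \<bar>x \<bullet> b\<bar>) ` Basis)"
  have "m \<in> (\<lambda>b. \<bar>x \<bullet> b\<bar>) ` Basis" unfolding m_def by (rule Max_in) auto
  then obtain b where b: "b \<in> Basis" "m = \<bar>x \<bullet> b\<bar>" by blast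
  have "norm x \<le> (\<Sum>b\<in>Basis. \<bar>x \<bullet> b\<bar>)" by (rule norm_le_l1)
  also have "\<dots> \<le> (\<Sum>b\<in>(Basis::'a set). m)" unfolding m_def by (intro sum_mono Max_ge) auto
  finally have "norm x ^ N \<le> (real DIM('a) * m) ^ N" by (intro power_mono) auto
  also have "\<dots> = real DIM('a) ^ N * \<bar>x \<bullet> b\<bar> ^ N" by (simp add: power_mult_distrib b)
  also have "\<bar>x \<bullet> b\<bar> ^ N \<le> (\<Sum>b\<in>Basis. \<bar>x \<bullet> b\<bar> ^ N)" using b by (intro member_le_sum) auto
  finally show ?thesis by (simp add: mult_left_mono)
qed

lemma rd_inv_fourier: assumes f: "(f::'a::euclidean_space \<Rightarrow> complex) \<in> schwartz" shows "rd (inv_fourier f)"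
  unfolding rd_def
proof (intro conjI allI)
  show "continuous_on UNIV (inv_fourier f)"
    by (rule smooth_continuous[OF inv_fourier_smooth[OF rd_schwartz[OF f]]])
  fix N
  have "\<forall>b\<in>Basis. \<exists>C. \<forall>x. \<bar>x \<bullet> b\<bar> ^ N * cmod (inv_fourier f x) \<le> C"
    using inv_fourier_schwartz_coord[OF f] by blast
  then obtain C where C: "\<And>b x. b \<in> Basis \<Longrightarrow> \<bar>x \<bullet> b\<bar> ^ N * cmod (inv_fourier f x) \<le> C b" by metis
  \<comment> \<open>The coordinate bound with exponent 0 is a plain supremum bound, whichever basis
    vector is used.\<close>
  obtain C0 where C0: "\<And>x. cmod (inv_fourier f x) \<le> C0"
    using inv_fourier_schwartz_coord[OF f, of "SOME b. b \<in> Basis" 0] by (auto simp: some_in_eq)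
  have "(1 + norm x) ^ N * cmod (inv_fourier f x) \<le> 2 ^ N * (C0 + real DIM('a) ^ N * (\<Sum>b\<in>Basis. C b))" for x
  proof -
    have "(1 + norm x) ^ N \<le> 2 ^ N * (1 + norm x ^ N)" by (rule one_plus_power_le) simp
    also have "\<dots> \<le> 2 ^ N * (1 + real DIM('a) ^ N * (\<Sum>b\<in>Basis. \<bar>x \<bullet> b\<bar> ^ N))"
      using norm_power_le_coord[of x N] by simp
    finally have "(1 + norm x) ^ N * cmod (inv_fourier f x)
      \<le> 2 ^ N * (1 + real DIM('a) ^ N * (\<Sum>b\<in>Basis. \<bar>x \<bullet> b\<bar> ^ N)) * cmod (inv_fourier f x)"
      by (rule mult_right_mono) simp
    also have "\<dots> = 2 ^ N * (cmod (inv_fourier f x) + real DIM('a) ^ N * (\<Sum>b\<in>Basis. \<bar>x \<bullet> b\<bar> ^ N * cmod (inv_fourier f x)))"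
      by (simp add: algebra_simps sum_distrib_left sum_distrib_right)
    also have "\<dots> \<le> 2 ^ N * (C0 + real DIM('a) ^ N * (\<Sum>b\<in>Basis. C b))"
      by (intro mult_left_mono add_mono sum_mono C C0) auto
    finally show ?thesis .
  qed
  then show "\<exists>C. \<forall>x. cmod (inv_fourier f x) \<le> C * wgt N x" unfolding le_wgt_iff by blast
qed

lemma rd_reflect: assumes "rd f" shows "rd (\<lambda>x. f (- x))"
  unfolding rd_def
proof (intro conjI allI)
  show "continuous_on UNIV (\<lambda>x. f (- x))"
    using assms by (auto simp: rd_def intro!: continuous_on_compose2[of UNIV f UNIV uminus] continuous_on_minus)
  fix N
  show "\<exists>C. \<forall>x. cmod (f (- x)) \<le> C * wgt N x" using assms unfolding rd_def by (metis wgt_minus)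
qed

lemma rd_fourier: "f \<in> schwartz \<Longrightarrow> rd (fourier f)"
  using rd_reflect[OF rd_inv_fourier, of f] by (simp add: fourier_inv_fourier[abs_def])

text \<open>A derivative of the inverse transform is the inverse transform of a coordinate multiple
  of \<open>f\<close>. Multiples of test functions are test functions, so the induction over the
  list of directions stays within one class.\<close>

lemma inv_fourier_test_schwartz:
  assumes "test_fun f" shows "inv_fourier f \<in> schwartz"
proof (rule schwartzI)
  show "smooth (inv_fourier f)" by (rule inv_fourier_smooth[OF rd_test_fun[OF assms]])
  fix bs assume "set bs \<subseteq> (Basis::'a set)"
  then have "\<exists>g. test_fun g \<and> iter_deriv bs (inv_fourier f) = inv_fourier g"
  proof (induction bs)
    case (Cons b bs)
    then obtain g where g: "test_fun g" "iter_deriv bs (inv_fourier f) = inv_fourier g" by auto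
    define h where "h = (\<lambda>\<xi>. complex_of_real (\<xi> \<bullet> b) * (2 * pi * \<i> * g \<xi>))"
    have "test_fun h"
      unfolding h_def by (intro test_fun_mult2 smooth_inner smooth_const g)
    moreover have "iter_deriv (b # bs) (inv_fourier f) = inv_fourier h"
      unfolding iter_deriv.simps g h_def
      by (subst frechet_derivative_at[OF inv_fourier_has_derivative[OF rd_test_fun[OF g(1)]], symmetric]) simp
    ultimately show ?case by blast
  qed (use assms in auto)
  then show "rd (iter_deriv bs (inv_fourier f))"
    using rd_inv_fourier[OF test_fun_schwartz] by metis
qed

section \<open>Gaussians and the inversion formula\<close>

definition gauss :: "'a::euclidean_space \<Rightarrow> real" where "gauss x = exp (- pi * (norm x)\<^sup>2)"

lemma gauss_real_integrable: "integrable lborel (\<lambda>x::real. exp (- pi * x\<^sup>2))"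
  and gauss_real_integral: "(\<integral>x. cis (2 * pi * (s * x)) * complex_of_real (exp (- pi * x\<^sup>2)) \<partial>lborel)
     = complex_of_real (exp (- pi * s\<^sup>2))"
proof -
  \<comment> \<open>Dilating by \<open>c\<close> turns the exponent of the standard normal density
    into \<open>- pi * x\<^sup>2\<close>, and the Jacobian \<open>c\<close> cancels its normalising
    factor. The integral is then the characteristic function of the normal law at
    \<open>c * s\<close>.\<close>
  define c where "c = sqrt (2 * pi)"
  have c: "c > 0" "c * c = 2 * pi" by (auto simp: c_def)
  have e: "std_normal_density (0 + c * x) = (1 / c) * exp (- pi * x\<^sup>2)" for x
    using c by (simp add: std_normal_density_def c_def[symmetric] power_mult_distrib power2_eq_square)
  have i: "integrable lborel std_normal_density" by (rule integrable_normal_density) simp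
  have "integrable lborel (\<lambda>x. std_normal_density (0 + c * x))"
    using c by (intro lborel_integrable_real_affine[OF i]) auto
  then have "integrable lborel (\<lambda>x. c * ((1 / c) * exp (- pi * x\<^sup>2)))" unfolding e by (rule integrable_mult_right)
  then show "integrable lborel (\<lambda>x::real. exp (- pi * x\<^sup>2))" using c by simp
  have "complex_of_real (exp (- (c * s)\<^sup>2 / 2)) = (\<integral>x. iexp (c * s * x) \<partial>std_normal_distribution)"
    using fun_cong[OF char_std_normal_distribution, of "c * s"] by (simp add: char_def)
  also have "\<dots> = (\<integral>x. std_normal_density x *\<^sub>R iexp (c * s * x) \<partial>lborel)"
    by (subst integral_density) (auto simp: normal_density_nonneg)
  also have "\<dots> = c *\<^sub>R (\<integral>x. std_normal_density (0 + c * x) *\<^sub>R iexp (c * s * (0 + c * x)) \<partial>lborel)"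
    using c by (subst lborel_integral_real_affine[of c _ 0]) auto
  also have "\<dots> = (\<integral>x. c *\<^sub>R (std_normal_density (0 + c * x) *\<^sub>R iexp (c * s * (0 + c * x))) \<partial>lborel)"
    by (rule integral_scaleR_right[symmetric])
  also have "\<dots> = (\<integral>x. cis (2 * pi * (s * x)) * complex_of_real (exp (- pi * x\<^sup>2)) \<partial>lborel)"
  proof (intro Bochner_Integration.integral_cong refl)
    fix x
    have "c * s * (0 + c * x) = 2 * pi * (s * x)" using c(2) by (metis add_0 mult.assoc mult.left_commute)
    then show "c *\<^sub>R (std_normal_density (0 + c * x) *\<^sub>R iexp (c * s * (0 + c * x))) = 
      cis (2 * pi * (s * x)) * complex_of_real (exp (- pi * x\<^sup>2))"
      unfolding e using c(1) by (simp only:) (simp add: cis_conv_exp scaleR_conv_of_real mult.commute)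
  qed
  finally have "complex_of_real (exp (- (c * s)\<^sup>2 / 2))
    = (\<integral>x. cis (2 * pi * (s * x)) * complex_of_real (exp (- pi * x\<^sup>2)) \<partial>lborel)" .
  moreover have "(c * s)\<^sup>2 = c * c * s\<^sup>2" by (simp add: power2_eq_square)
  ultimately show "(\<integral>x. cis (2 * pi * (s * x)) * complex_of_real (exp (- pi * x\<^sup>2)) \<partial>lborel)
     = complex_of_real (exp (- pi * s\<^sup>2))"
    unfolding c(2) by simp
qed

lemma lborel_integral_prod:
  fixes f :: "'a::euclidean_space \<Rightarrow> real \<Rightarrow> complex"
  assumes f: "\<And>b. b \<in> Basis \<Longrightarrow> integrable lborel (f b)"
  shows "integrable lborel (\<lambda>x::'a. \<Prod>b\<in>Basis. f b (x \<bullet> b))"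
    and "(\<integral>x. (\<Prod>b\<in>Basis. f b (x \<bullet> b)) \<partial>(lborel :: 'a measure)) = (\<Prod>b\<in>Basis. (\<integral>t. f b t \<partial>lborel))"
proof -
  interpret product_sigma_finite "\<lambda>_::'a. lborel :: real measure" by standard
  let ?T = "\<lambda>g. \<Sum>b\<in>Basis. g b *\<^sub>R (b::'a)"
  have m: "(\<lambda>x::'a. \<Prod>b\<in>Basis. f b (x \<bullet> b)) \<in> borel_measurable borel"
    using f[THEN borel_measurable_integrable] by measurable
  have T [measurable]: "?T \<in> measurable (\<Pi>\<^sub>M b\<in>Basis. lborel) borel" by measurable
  have eq: "(\<Prod>b\<in>Basis. f b (?T g \<bullet> b)) = (\<Prod>b\<in>Basis. f b (g b))" for g
    by (intro prod.cong refl) simp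
  have "integrable (distr (\<Pi>\<^sub>M b\<in>Basis. lborel) borel ?T) (\<lambda>x::'a. \<Prod>b\<in>Basis. f b (x \<bullet> b))"
    by (subst integrable_distr_eq[OF T m], subst eq) (rule product_integrable_prod[OF _ f], auto)
  then show "integrable lborel (\<lambda>x::'a. \<Prod>b\<in>Basis. f b (x \<bullet> b))" by (simp add: lborel_eq[symmetric])
  have "(\<integral>x. (\<Prod>b\<in>Basis. f b (x \<bullet> b)) \<partial>distr (\<Pi>\<^sub>M b\<in>Basis. lborel) borel ?T) = (\<Prod>b\<in>Basis. (\<integral>t. f b t \<partial>lborel))"
    by (subst integral_distr[OF T m], subst eq) (rule product_integral_prod[OF _ f], auto)
  then show "(\<integral>x. (\<Prod>b\<in>Basis. f b (x \<bullet> b)) \<partial>(lborel :: 'a measure)) = (\<Prod>b\<in>Basis. (\<integral>t. f b t \<partial>lborel))"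
    by (simp add: lborel_eq[symmetric])
qed

lemma gauss_prod: "complex_of_real (gauss x) = (\<Prod>b\<in>Basis. complex_of_real (exp (- pi * (x \<bullet> b)\<^sup>2)))"
proof -
  have "(norm x)\<^sup>2 = (\<Sum>b\<in>Basis. (x \<bullet> b)\<^sup>2)"
    unfolding power2_norm_eq_inner by (subst euclidean_inner) (simp add: power2_eq_square)
  then show ?thesis by (simp add: gauss_def sum_distrib_left exp_sum flip: of_real_prod sum_negf)
qed

lemma cis_sum: "finite A \<Longrightarrow> cis (sum g A) = (\<Prod>a\<in>A. cis (g a))"
  by (induction A rule: finite_induct) (auto simp: cis_mult[symmetric])

lemma gauss_integrable: "integrable lborel (gauss :: 'a::euclidean_space \<Rightarrow> real)"
proof -
  have "integrable lborel (\<lambda>x::'a. complex_of_real (gauss x))"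
    unfolding gauss_prod using gauss_real_integrable by (intro lborel_integral_prod) auto
  then show ?thesis by (simp add: complex_of_real_integrable_eq)
qed

lemma gauss_fourier: "inv_fourier (\<lambda>x::'a::euclidean_space. complex_of_real (gauss x)) s = complex_of_real (gauss s)"
proof -
  have "inv_fourier (\<lambda>x::'a. complex_of_real (gauss x)) s =
     (\<integral>x. (\<Prod>b\<in>Basis. cis (2 * pi * ((s \<bullet> b) * (x \<bullet> b))) * complex_of_real (exp (- pi * (x \<bullet> b)\<^sup>2))) \<partial>(lborel :: 'a measure))"
    unfolding inv_fourier_def gauss_prod prod.distrib
    by (subst euclidean_inner) (simp add: sum_distrib_left cis_sum)
  also have "\<dots> = (\<Prod>b\<in>Basis. (\<integral>t. cis (2 * pi * ((s \<bullet> b) * t)) * complex_of_real (exp (- pi * t\<^sup>2)) \<partial>lborel))"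
    by (rule lborel_integral_prod) (intro integrable_cis_mult, use gauss_real_integrable in auto)
  also have "\<dots> = complex_of_real (gauss s)"
    unfolding gauss_real_integral by (rule gauss_prod[symmetric])
  finally show ?thesis .
qed

lemma gauss_integral: "(\<integral>x. gauss x \<partial>(lborel :: 'a::euclidean_space measure)) = 1"
proof -
  have "complex_of_real (\<integral>x. gauss x \<partial>(lborel :: 'a measure)) = inv_fourier (\<lambda>x::'a. complex_of_real (gauss x)) 0"
    unfolding inv_fourier_def by simp
  also have "\<dots> = complex_of_real 1" unfolding gauss_fourier by (simp add: gauss_def)
  finally show ?thesis by (simp only: of_real_eq_iff)
qed

text \<open>Gaussian summation: damping the outer integral by a dilated Gaussian and exchanging the
  integrals turns it into an average of \<open>f\<close> around \<open>y\<close> at scale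
  \<open>t n\<close> against a Gaussian of mass one. Letting \<open>t n\<close> tend to 0 gives the
  inversion integral on one side and, by continuity, \<open>f y\<close> on the other.\<close>

theorem fourier_inversion:
  fixes f :: "'a::euclidean_space \<Rightarrow> complex"
  assumes cont: "continuous_on UNIV f" and f: "integrable lborel f"
    and bd: "\<And>x. cmod (f x) \<le> B" and G: "integrable lborel (inv_fourier f)"
  shows "fourier (inv_fourier f) y = f y"
proof -
  define t where "t n = inverse (real (Suc n))" for n
  have t: "0 < t n" for n by (auto simp: t_def)
  have t0: "t \<longlonglongrightarrow> 0" unfolding t_def by (rule LIMSEQ_inverse_real_of_nat)
  \<comment> \<open>Without the Gaussian factor the double integral in \<open>\<xi>\<close> and
    \<open>x\<close> would not converge absolutely, and the order of integration could not be
    exchanged.\<close>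
  define L where "L n = (\<integral>x. cis (- 2 * pi * (x \<bullet> y)) * inv_fourier f x * complex_of_real (gauss (t n *\<^sub>R x)) \<partial>lborel)" for n
  have [measurable]: "f \<in> borel_measurable borel" "inv_fourier f \<in> borel_measurable borel"
    using borel_measurable_integrable[OF f] borel_measurable_integrable[OF G] by auto
  have gm [measurable]: "(gauss :: 'a \<Rightarrow> real) \<in> borel_measurable borel"
    using borel_measurable_integrable[OF gauss_integrable[where 'a='a]] by simp
  have g1: "0 \<le> gauss z" "gauss z \<le> 1" for z :: 'a by (auto simp: gauss_def)
  have gc: "(\<lambda>n. gauss (t n *\<^sub>R x)) \<longlonglongrightarrow> gauss (0 *\<^sub>R x)" for x :: 'a
    unfolding gauss_def by (intro tendsto_intros t0)
  have lim1: "L \<longlonglongrightarrow> (\<integral>x. cis (- 2 * pi * (x \<bullet> y)) * inv_fourier f x \<partial>lborel)"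
    unfolding L_def
  proof (rule integral_dominated_convergence[where w="\<lambda>x. cmod (inv_fourier f x)"])
    show "AE x in lborel. (\<lambda>n. cis (- 2 * pi * (x \<bullet> y)) * inv_fourier f x * complex_of_real (gauss (t n *\<^sub>R x)))
       \<longlonglongrightarrow> cis (- 2 * pi * (x \<bullet> y)) * inv_fourier f x"
    proof (rule AE_I2)
      fix x
      show "(\<lambda>n. cis (- 2 * pi * (x \<bullet> y)) * inv_fourier f x * complex_of_real (gauss (t n *\<^sub>R x)))
       \<longlonglongrightarrow> cis (- 2 * pi * (x \<bullet> y)) * inv_fourier f x"
        using tendsto_mult[OF tendsto_const tendsto_of_real[OF gc[of x]], of "cis (- 2 * pi * (x \<bullet> y)) * inv_fourier f x"]
        by (simp add: gauss_def)
    qed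
    show "AE x in lborel. cmod (cis (- 2 * pi * (x \<bullet> y)) * inv_fourier f x * complex_of_real (gauss (t n *\<^sub>R x)))
      \<le> cmod (inv_fourier f x)" for n
      using g1 by (auto simp: norm_mult mult_left_le)
    show "integrable lborel (\<lambda>x. cmod (inv_fourier f x))" using G by auto
  qed measurable
  have Leq: "L n = (\<integral>\<eta>. f (y + t n *\<^sub>R \<eta>) * complex_of_real (gauss \<eta>) \<partial>lborel)" for n
  proof -
    define \<gamma> where "\<gamma> x = complex_of_real (gauss (t n *\<^sub>R x))" for x :: 'a
    have \<gamma>i: "integrable lborel \<gamma>"
      unfolding \<gamma>_def using integrable_lborel_affine[OF gauss_integrable, of "t n" 0] t[of n]
      by (simp add: complex_of_real_integrable_eq)
    have [measurable]: "\<gamma> \<in> borel_measurable borel" unfolding \<gamma>_def by measurable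
    have F: "integrable (lborel \<Otimes>\<^sub>M lborel) (\<lambda>(\<xi>, x). cis (2 * pi * (x \<bullet> (\<xi> - y))) * f \<xi> * \<gamma> x)"
    proof (rule lborel_pair.Fubini_integrable)
      show "(\<lambda>(\<xi>, x). cis (2 * pi * (x \<bullet> (\<xi> - y))) * f \<xi> * \<gamma> x) \<in> borel_measurable (lborel \<Otimes>\<^sub>M lborel)"
        by measurable
      show "integrable lborel (\<lambda>\<xi>. \<integral>x. norm (case (\<xi>, x) of (\<xi>, x) \<Rightarrow> cis (2 * pi * (x \<bullet> (\<xi> - y))) * f \<xi> * \<gamma> x) \<partial>lborel)"
        using f \<gamma>i by (simp add: norm_mult)
      show "AE \<xi> in lborel. integrable lborel (\<lambda>x. case (\<xi>, x) of (\<xi>, x) \<Rightarrow> cis (2 * pi * (x \<bullet> (\<xi> - y))) * f \<xi> * \<gamma> x)"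
      proof (rule AE_I2)
        fix \<xi>
        have "integrable lborel (\<lambda>x. cis (2 * pi * (x \<bullet> (\<xi> - y))) * (f \<xi> * \<gamma> x))"
          by (intro integrable_cis_mult integrable_mult_right \<gamma>i) measurable
        then show "integrable lborel (\<lambda>x. case (\<xi>, x) of (\<xi>, x) \<Rightarrow> cis (2 * pi * (x \<bullet> (\<xi> - y))) * f \<xi> * \<gamma> x)"
          by (simp add: mult.assoc)
      qed
    qed
    have "L n = (\<integral>x. (\<integral>\<xi>. cis (2 * pi * (x \<bullet> (\<xi> - y))) * f \<xi> * \<gamma> x \<partial>lborel) \<partial>lborel)"
      unfolding L_def
    proof (intro Bochner_Integration.integral_cong refl)
      fix x
      have "cis (- 2 * pi * (x \<bullet> y)) * inv_fourier f x = (\<integral>\<xi>. cis (- 2 * pi * (x \<bullet> y)) * (cis (2 * pi * (x \<bullet> \<xi>)) * f \<xi>) \<partial>lborel)"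
        unfolding inv_fourier_def by simp
      also have "\<dots> = (\<integral>\<xi>. cis (2 * pi * (x \<bullet> (\<xi> - y))) * f \<xi> \<partial>lborel)"
      proof (intro Bochner_Integration.integral_cong refl)
        fix \<xi>
        have "2 * pi * (x \<bullet> (\<xi> - y)) = - 2 * pi * (x \<bullet> y) + 2 * pi * (x \<bullet> \<xi>)"
          by (simp add: inner_diff_right algebra_simps)
        then show "cis (- 2 * pi * (x \<bullet> y)) * (cis (2 * pi * (x \<bullet> \<xi>)) * f \<xi>) = cis (2 * pi * (x \<bullet> (\<xi> - y))) * f \<xi>"
          by (simp only: cis_mult[symmetric] mult.assoc)
      qed
      finally show "cis (- 2 * pi * (x \<bullet> y)) * inv_fourier f x * complex_of_real (gauss (t n *\<^sub>R x)) =
        (\<integral>\<xi>. cis (2 * pi * (x \<bullet> (\<xi> - y))) * f \<xi> * \<gamma> x \<partial>lborel)"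
        by (simp add: \<gamma>_def)
    qed
    also have "\<dots> = (\<integral>\<xi>. (\<integral>x. cis (2 * pi * (x \<bullet> (\<xi> - y))) * f \<xi> * \<gamma> x \<partial>lborel) \<partial>lborel)"
      using lborel_pair.Fubini_integral[OF F] by simp
    also have "\<dots> = (\<integral>\<xi>. f \<xi> * inv_fourier \<gamma> (\<xi> - y) \<partial>lborel)"
      unfolding inv_fourier_def
      by (intro Bochner_Integration.integral_cong refl)
         (simp only: inner_commute[of "_ - y"] mult.left_commute[of _ "f _"] mult.assoc integral_mult_right_zero)
    also have "\<dots> = \<bar>t n\<bar> ^ DIM('a) *\<^sub>R (\<integral>\<eta>. f (y + t n *\<^sub>R \<eta>) * inv_fourier \<gamma> ((y + t n *\<^sub>R \<eta>) - y) \<partial>lborel)"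
    proof (rule integral_lborel_affine)
      have "inv_fourier \<gamma> \<in> borel_measurable borel"
        unfolding inv_fourier_synth by (rule synth_measurable[OF \<gamma>i]) measurable
      then show "(\<lambda>\<xi>. f \<xi> * inv_fourier \<gamma> (\<xi> - y)) \<in> borel_measurable borel" by measurable
    qed (use t[of n] in auto)
    also have "\<dots> = (\<integral>\<eta>. f (y + t n *\<^sub>R \<eta>) * (\<bar>t n\<bar> ^ DIM('a) *\<^sub>R inv_fourier \<gamma> (t n *\<^sub>R \<eta>)) \<partial>lborel)"
      by (simp only: mult_scaleR_right integral_scaleR_right add_diff_cancel_left')
    also have "\<dots> = (\<integral>\<eta>. f (y + t n *\<^sub>R \<eta>) * complex_of_real (gauss \<eta>) \<partial>lborel)"
    proof -
      \<comment> \<open>The Gaussian is its own transform, so the transform of its dilation is the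
        reciprocal dilation; the Jacobian is exactly the factor left over from the substitution in
        \<open>\<xi>\<close>.\<close>
      have "\<bar>t n\<bar> ^ DIM('a) *\<^sub>R inv_fourier \<gamma> (t n *\<^sub>R \<eta>) = complex_of_real (gauss \<eta>)" for \<eta>
      proof -
        have "complex_of_real (gauss \<eta>) = (\<integral>x. cis (2 * pi * (\<eta> \<bullet> x)) * complex_of_real (gauss x) \<partial>lborel)"
          by (rule gauss_fourier[of \<eta>, unfolded inv_fourier_def, symmetric])
        also have "\<dots> = \<bar>t n\<bar> ^ DIM('a) *\<^sub>R (\<integral>x. cis (2 * pi * (\<eta> \<bullet> (0 + t n *\<^sub>R x))) * complex_of_real (gauss (0 + t n *\<^sub>R x)) \<partial>lborel)"
          using t[of n] by (intro integral_lborel_affine) auto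
        finally show ?thesis by (simp add: inv_fourier_def \<gamma>_def)
      qed
      then show ?thesis by simp
    qed
    finally show ?thesis .
  qed
  have lim2: "(\<lambda>n. \<integral>\<eta>. f (y + t n *\<^sub>R \<eta>) * complex_of_real (gauss \<eta>) \<partial>lborel) \<longlonglongrightarrow> (\<integral>\<eta>. f y * complex_of_real (gauss \<eta>) \<partial>(lborel::'a measure))"
  proof (rule integral_dominated_convergence[where w="\<lambda>\<eta>. B * gauss \<eta>"])
    have fc: "isCont f y" using cont by (simp add: continuous_on_eq_continuous_at)
    show "AE \<eta> in lborel. (\<lambda>n. f (y + t n *\<^sub>R \<eta>) * complex_of_real (gauss \<eta>)) \<longlonglongrightarrow> f y * complex_of_real (gauss \<eta>)"
    proof (rule AE_I2)
      fix \<eta>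
      have "(\<lambda>n. y + t n *\<^sub>R \<eta>) \<longlonglongrightarrow> y + 0 *\<^sub>R \<eta>" by (intro tendsto_intros t0)
      then have "(\<lambda>n. f (y + t n *\<^sub>R \<eta>)) \<longlonglongrightarrow> f y" using isCont_tendsto_compose[OF fc] by simp
      then show "(\<lambda>n. f (y + t n *\<^sub>R \<eta>) * complex_of_real (gauss \<eta>)) \<longlonglongrightarrow> f y * complex_of_real (gauss \<eta>)"
        by (intro tendsto_mult tendsto_const)
    qed
    show "AE \<eta> in lborel. cmod (f (y + t n *\<^sub>R \<eta>) * complex_of_real (gauss \<eta>)) \<le> B * gauss \<eta>" for n
      using g1 by (auto simp: norm_mult intro!: mult_right_mono bd)
    show "integrable lborel (\<lambda>\<eta>::'a. B * gauss \<eta>)" using gauss_integrable by auto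
  qed measurable
  have "L \<longlonglongrightarrow> (\<integral>\<eta>. f y * complex_of_real (gauss \<eta>) \<partial>(lborel::'a measure))"
    using lim2 unfolding Leq[symmetric] .
  from LIMSEQ_unique[OF lim1 this]
  have "fourier (inv_fourier f) y = (\<integral>\<eta>. f y * complex_of_real (gauss \<eta>) \<partial>(lborel::'a measure))"
    unfolding fourier_def .
  also have "\<dots> = f y" using gauss_integral[where 'a='a] by simp
  finally show ?thesis .
qed

lemma fourier_inv_fourier_schwartz:
  assumes "f \<in> schwartz" shows "fourier (inv_fourier f) = f"
proof
  fix y
  obtain B where "\<And>x. cmod (f x) \<le> B" using rd_bounded[OF rd_schwartz[OF assms]] by blast
  then show "fourier (inv_fourier f) y = f y"
    using assms rd_integrable rd_inv_fourier rd_schwartz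
    by (intro fourier_inversion) (auto simp: schwartz_def smooth_continuous)
qed

lemma inv_fourier_fourier_schwartz:
  assumes "f \<in> schwartz" shows "inv_fourier (fourier f) = f"
proof
  fix y
  let ?g = "inv_fourier f"
  have gi: "integrable lborel ?g" using assms by (intro rd_integrable rd_inv_fourier)
  have "inv_fourier (fourier f) y = (\<integral>\<xi>. cis (- 2 * pi * (- \<xi> \<bullet> y)) * ?g (- \<xi>) \<partial>lborel)"
    unfolding inv_fourier_def[of "fourier f"] fourier_inv_fourier by (simp add: inner_commute)
  also have "\<dots> = fourier ?g y"
    unfolding fourier_def
    using integral_lborel_shift(2)[of "\<lambda>\<xi>. cis (- 2 * pi * (\<xi> \<bullet> y)) * ?g \<xi>" 0] borel_measurable_integrable[OF gi]
    by simp
  also have "\<dots> = f y" by (simp add: fourier_inv_fourier_schwartz[OF assms])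
  finally show "inv_fourier (fourier f) y = f y" .
qed

section \<open>Tempered distributions represented by functions\<close>

lemma integrable_bounded_mult:
  fixes g h :: "'a::euclidean_space \<Rightarrow> complex"
  assumes "g \<in> borel_measurable borel" "\<And>x. cmod (g x) \<le> B" "integrable lborel h"
  shows "integrable lborel (\<lambda>x. g x * h x)"
proof (rule Bochner_Integration.integrable_bound[where f="\<lambda>x. B * cmod (h x)"])
  show "integrable lborel (\<lambda>x. B * cmod (h x))" using assms(3) by auto
  show "(\<lambda>x. g x * h x) \<in> borel_measurable lborel"
    using assms(1) borel_measurable_integrable[OF assms(3)] by simp
  have "0 \<le> B" using assms(2) by (meson norm_ge_zero order_trans)
  then show "AE x in lborel. cmod (g x * h x) \<le> norm (B * cmod (h x))"
    using assms(2) by (auto simp: norm_mult abs_mult intro!: mult_right_mono)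
qed

lemma tempered_bounded:
  fixes u :: "'a::euclidean_space \<Rightarrow> complex"
  assumes u: "u \<in> borel_measurable borel" "\<And>x. cmod (u x) \<le> B"
  shows "tempered (distr_of_fun u)"
proof -
  have i: "integrable lborel (\<lambda>x. u x * \<phi> x)" if "\<phi> \<in> schwartz" for \<phi>
    using u rd_integrable[OF rd_schwartz[OF that]] by (rule integrable_bounded_mult)
  have B: "0 \<le> B" using u(2) by (meson norm_ge_zero order_trans)
  have "(\<lambda>j. distr_of_fun u (\<phi> j)) \<longlonglongrightarrow> distr_of_fun u \<psi>"
    if \<phi>: "range \<phi> \<subseteq> schwartz" and \<psi>: "\<psi> \<in> schwartz" and t: "schwartz_tendsto \<phi> \<psi>" for \<phi> \<psi>
  proof -
    \<comment> \<open>One seminorm of derivative order zero controls the pairing: the weight of this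
      order is integrable and \<open>u\<close> is bounded.\<close>
    define N where "N = 2 * DIM('a)"
    define s where "s j = schwartz_seminorm N [] (\<lambda>x. \<phi> j x - \<psi> x)" for j
    have s0: "s \<longlonglongrightarrow> 0"
      using t unfolding schwartz_tendsto_def s_def by (metis empty_iff list.set(1) subsetI)
    have \<phi>j: "\<phi> j \<in> schwartz" for j using \<phi> by auto
    have le: "cmod (\<phi> j x - \<psi> x) \<le> s j * wgt N x" for j x
    proof -
      obtain C1 where C1: "\<And>x. cmod (\<phi> j x) \<le> C1 * wgt N x" using rdE[OF rd_schwartz[OF \<phi>j]] by metis
      obtain C2 where C2: "\<And>x. cmod (\<psi> x) \<le> C2 * wgt N x" using rdE[OF rd_schwartz[OF \<psi>]] by metis
      have "(1 + norm x) ^ N * cmod (\<phi> j x - \<psi> x) \<le> C1 + C2" for x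
      proof -
        have "cmod (\<phi> j x - \<psi> x) \<le> (C1 + C2) * wgt N x"
          using norm_triangle_ineq4[of "\<phi> j x" "\<psi> x"] C1[of x] C2[of x] by (simp add: algebra_simps)
        then show ?thesis by (simp add: le_wgt_iff)
      qed
      then have "bdd_above (range (\<lambda>x. (1 + norm x) ^ N * cmod (\<phi> j x - \<psi> x)))"
        by (intro bdd_aboveI2)
      then have "(1 + norm x) ^ N * cmod (\<phi> j x - \<psi> x) \<le> s j"
        unfolding s_def schwartz_seminorm_def iter_deriv.simps by (intro cSUP_upper) auto
      then show ?thesis by (simp add: le_wgt_iff)
    qed
    have d: "cmod (distr_of_fun u (\<phi> j) - distr_of_fun u \<psi>) \<le> s j * (B * (\<integral>x. wgt N (x::'a) \<partial>lborel))" for j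
    proof -
      have "distr_of_fun u (\<phi> j) - distr_of_fun u \<psi> = (\<integral>x. u x * (\<phi> j x - \<psi> x) \<partial>lborel)"
        unfolding distr_of_fun_def using i[OF \<phi>j, of j] i[OF \<psi>] by (simp add: right_diff_distrib)
      also have "cmod \<dots> \<le> (\<integral>x. B * (s j * wgt N (x::'a)) \<partial>lborel)"
      proof (rule cmod_integral_le)
        show "integrable lborel (\<lambda>x::'a. B * (s j * wgt N x))"
          using wgt_integrable[where 'a='a] by (auto simp: N_def)
        show "cmod (u x * (\<phi> j x - \<psi> x)) \<le> B * (s j * wgt N x)" for x
          unfolding norm_mult using u B le by (intro mult_mono) auto
      qed
      finally show ?thesis by (simp add: mult_ac)
    qed
    have "(\<lambda>j. s j * (B * (\<integral>x. wgt N (x::'a) \<partial>lborel))) \<longlonglongrightarrow> 0"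
      using tendsto_mult_right[OF s0] by simp
    from Lim_null_comparison[OF always_eventually[OF allI[OF d]] this]
    have "(\<lambda>j. distr_of_fun u (\<phi> j) - distr_of_fun u \<psi>) \<longlonglongrightarrow> 0" .
    then show ?thesis by (simp add: LIM_zero_iff)
  qed
  moreover have "distr_of_fun u (\<lambda>x. \<phi> x + \<psi> x) = distr_of_fun u \<phi> + distr_of_fun u \<psi>"
    if "\<phi> \<in> schwartz" "\<psi> \<in> schwartz" for \<phi> \<psi>
    unfolding distr_of_fun_def using i[OF that(1)] i[OF that(2)] by (simp add: distrib_left)
  moreover have "distr_of_fun u (\<lambda>x. c * \<phi> x) = c * distr_of_fun u \<phi>" for c \<phi>
    unfolding distr_of_fun_def by (subst mult.left_commute) simp
  ultimately show ?thesis unfolding tempered_def by blast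
qed

lemma continuous_integral_zero:
  fixes h :: "'a::euclidean_space \<Rightarrow> real"
  assumes c: "continuous_on UNIV h" and i: "integrable lborel h" and nn: "\<And>x. 0 \<le> h x"
    and z: "(\<integral>x. h x \<partial>lborel) = 0"
  shows "h x = 0"
proof (rule ccontr)
  assume "h x \<noteq> 0"
  then have "x \<in> {x. 0 < h x}" using nn[of x] by (simp add: less_le)
  then have ne: "{x. 0 < h x} \<noteq> {}" by blast
  have op: "open {x. 0 < h x}" by (intro open_Collect_less continuous_intros c)
  have "AE x in lborel. h x = 0"
    using integral_nonneg_eq_0_iff_AE[OF i] nn z by auto
  then have "AE x in lborel. x \<notin> {x. 0 < h x}" by (rule AE_mp) simp
  then have "{x. 0 < h x} \<in> null_sets lborel" using op by (subst AE_iff_null_sets) auto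
  then have "negligible {x. 0 < h x}" by (simp add: negligible_iff_null_sets null_sets_completionI)
  then show False using open_not_negligible[OF op ne] by simp
qed

text \<open>Uniqueness behind the definite description in \<open>fun_of_distr\<close>. The function
  \<open>\<kappa>\<close> supplies the bump that isolates a point where the two candidates
  differ.\<close>

lemma continuous_eq_weak:
  fixes g g' :: "'a::euclidean_space \<Rightarrow> complex"
  assumes \<kappa>: "test_fun (\<kappa> :: 'a \<Rightarrow> complex)" "\<kappa> z \<noteq> 0"
    and c: "continuous_on UNIV g" "continuous_on UNIV g'"
    and i: "\<And>\<phi>. \<phi> \<in> schwartz \<Longrightarrow> integrable lborel (\<lambda>x. g x * \<phi> x)"
           "\<And>\<phi>. \<phi> \<in> schwartz \<Longrightarrow> integrable lborel (\<lambda>x. g' x * \<phi> x)"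
    and eq: "\<And>\<phi>. \<phi> \<in> schwartz \<Longrightarrow> distr_of_fun g \<phi> = distr_of_fun g' \<phi>"
  shows "g = g'"
proof
  fix x0
  show "g x0 = g' x0"
  proof (rule ccontr)
    assume ne: "g x0 \<noteq> g' x0"
    define d where "d x = g x - g' x" for x
    \<comment> \<open>With this factor \<open>w * d x\<close> is real and positive at
      \<open>x0\<close>, so its real part stays positive near \<open>x0\<close> and cannot cancel
      against a nonnegative bump.\<close>
    define w where "w = cnj (d x0)"
    define S where "S = {x. 0 < Re (w * d x)}"
    have dc: "continuous_on UNIV d" unfolding d_def by (intro continuous_intros c)
    have "open S" unfolding S_def by (intro open_Collect_less continuous_intros dc)
    moreover have pos0: "0 < Re (w * d x0)"
    proof -
      have "w * d x0 = complex_of_real ((cmod (d x0))\<^sup>2)"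
        unfolding w_def by (simp add: complex_norm_square mult.commute flip: of_real_power)
      then show ?thesis using ne by (simp add: d_def)
    qed
    ultimately obtain e where e: "e > 0" "ball x0 e \<subseteq> S"
      unfolding S_def open_contains_ball by blast
    obtain \<beta> :: "'a \<Rightarrow> real" where \<beta>: "test_fun (\<lambda>x. complex_of_real (\<beta> x))" "\<And>x. 0 \<le> \<beta> x"
      "0 < \<beta> x0" "\<And>x. \<beta> x \<noteq> 0 \<Longrightarrow> dist x x0 < e"
      using test_fun_bump[OF \<kappa> e(1)] by metis
    have \<beta>s: "(\<lambda>x. complex_of_real (\<beta> x)) \<in> schwartz" by (rule test_fun_schwartz[OF \<beta>(1)])
    have di: "integrable lborel (\<lambda>x. d x * complex_of_real (\<beta> x))"
      unfolding d_def left_diff_distrib by (intro Bochner_Integration.integrable_diff i \<beta>s)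
    have wi: "integrable lborel (\<lambda>x. w * (d x * complex_of_real (\<beta> x)))"
      using di by (rule integrable_mult_right)
    have "(\<integral>x. d x * complex_of_real (\<beta> x) \<partial>lborel) = 0"
      using eq[OF \<beta>s] i[OF \<beta>s] unfolding d_def left_diff_distrib distr_of_fun_def by simp
    then have "Re (\<integral>x. w * (d x * complex_of_real (\<beta> x)) \<partial>lborel) = 0" by simp
    then have z: "(\<integral>x. Re (w * d x) * \<beta> x \<partial>lborel) = 0"
      using integral_Re[OF wi] by (simp add: mult.assoc[symmetric])
    have bc: "continuous_on UNIV \<beta>"
      using continuous_on_Re[OF smooth_continuous[OF test_fun_smooth[OF \<beta>(1)]]] by simp
    have "Re (w * d x0) * \<beta> x0 = 0"
    proof (rule continuous_integral_zero[of "\<lambda>x. Re (w * d x) * \<beta> x"])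
      show "continuous_on UNIV (\<lambda>x. Re (w * d x) * \<beta> x)" by (intro continuous_intros dc bc)
      show "integrable lborel (\<lambda>x. Re (w * d x) * \<beta> x)"
        using integrable_Re[OF wi] by (simp add: mult.assoc[symmetric])
      show "0 \<le> Re (w * d x) * \<beta> x" for x
      proof (cases "\<beta> x = 0")
        case False
        then have "x \<in> ball x0 e" using \<beta>(4)[of x] by (simp add: dist_commute)
        then have "x \<in> S" using e(2) by blast
        then show ?thesis using \<beta>(2)[of x] by (auto simp: S_def)
      qed simp
    qed (rule z)
    then show False using pos0 \<beta>(3) by simp
  qed
qed

lemma fun_of_distr_eqI:
  fixes g :: "'a::euclidean_space \<Rightarrow> complex"
  assumes \<kappa>: "test_fun (\<kappa> :: 'a \<Rightarrow> complex)" "\<kappa> z \<noteq> 0"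
    and c: "continuous_on UNIV g"
    and g: "\<And>\<phi>. \<phi> \<in> schwartz \<Longrightarrow> integrable lborel (\<lambda>x. g x * \<phi> x)"
       "\<And>\<phi>. \<phi> \<in> schwartz \<Longrightarrow> u \<phi> = distr_of_fun g \<phi>"
  shows "fun_of_distr u = g"
  unfolding fun_of_distr_def
proof (rule the_equality)
  show "continuous_on UNIV g \<and> (\<forall>\<phi>\<in>schwartz. integrable lborel (\<lambda>x. g x * \<phi> x) \<and> u \<phi> = distr_of_fun g \<phi>)"
    using c g by blast
  fix g' assume *: "continuous_on UNIV g' \<and> (\<forall>\<phi>\<in>schwartz. integrable lborel (\<lambda>x. g' x * \<phi> x) \<and> u \<phi> = distr_of_fun g' \<phi>)"
  show "g' = g"
    by (rule continuous_eq_weak[OF \<kappa>]) (use * c g in auto)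
qed

text \<open>Fubini's theorem: the multiplication formula of the Fourier transform, with the density
  on one side replaced by an image measure under \<open>\<rho>\<close>.\<close>

lemma synth_duality:
  fixes \<rho> :: "'b::euclidean_space \<Rightarrow> 'a::euclidean_space"
  assumes A: "integrable lborel A" and G: "integrable lborel G" and \<rho>[measurable]: "\<rho> \<in> borel_measurable borel"
  shows "(\<integral>x. synth \<rho> A x * G x \<partial>lborel) = (\<integral>\<omega>. A \<omega> * inv_fourier G (\<rho> \<omega>) \<partial>lborel)"
proof -
  have [measurable]: "A \<in> borel_measurable borel" "G \<in> borel_measurable borel"
    using borel_measurable_integrable[OF A] borel_measurable_integrable[OF G] by auto
  have F: "integrable (lborel \<Otimes>\<^sub>M lborel) (\<lambda>(\<omega>, x). cis (2 * pi * (x \<bullet> \<rho> \<omega>)) * A \<omega> * G x)"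
  proof (rule lborel_pair.Fubini_integrable)
    show "(\<lambda>(\<omega>, x). cis (2 * pi * (x \<bullet> \<rho> \<omega>)) * A \<omega> * G x) \<in> borel_measurable (lborel \<Otimes>\<^sub>M lborel)"
      by measurable
    show "integrable lborel (\<lambda>\<omega>. \<integral>x. norm (case (\<omega>, x) of (\<omega>, x) \<Rightarrow> cis (2 * pi * (x \<bullet> \<rho> \<omega>)) * A \<omega> * G x) \<partial>lborel)"
      using A G by (simp add: norm_mult)
    show "AE \<omega> in lborel. integrable lborel (\<lambda>x. case (\<omega>, x) of (\<omega>, x) \<Rightarrow> cis (2 * pi * (x \<bullet> \<rho> \<omega>)) * A \<omega> * G x)"
    proof (rule AE_I2)
      fix \<omega>
      have "integrable lborel (\<lambda>x. cis (2 * pi * (x \<bullet> \<rho> \<omega>)) * (A \<omega> * G x))"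
        by (intro integrable_cis_mult integrable_mult_right G) measurable
      then show "integrable lborel (\<lambda>x. case (\<omega>, x) of (\<omega>, x) \<Rightarrow> cis (2 * pi * (x \<bullet> \<rho> \<omega>)) * A \<omega> * G x)"
        by (simp add: mult.assoc)
    qed
  qed
  have "(\<integral>x. synth \<rho> A x * G x \<partial>lborel) = (\<integral>x. (\<integral>\<omega>. cis (2 * pi * (x \<bullet> \<rho> \<omega>)) * A \<omega> * G x \<partial>lborel) \<partial>lborel)"
    unfolding synth_def by (simp only: integral_mult_left_zero)
  also have "\<dots> = (\<integral>\<omega>. (\<integral>x. cis (2 * pi * (x \<bullet> \<rho> \<omega>)) * A \<omega> * G x \<partial>lborel) \<partial>lborel)"
    using lborel_pair.Fubini_integral[OF F] by simp
  also have "\<dots> = (\<integral>\<omega>. A \<omega> * inv_fourier G (\<rho> \<omega>) \<partial>lborel)"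
    unfolding inv_fourier_def
    by (simp only: inner_commute[of "\<rho> _"] mult.left_commute[of _ "A _"] mult.assoc integral_mult_right_zero)
  finally show ?thesis .
qed

lemma test_mult_integrable:
  fixes \<rho> :: "'b::euclidean_space \<Rightarrow> 'a::euclidean_space"
  assumes "rd m" "integrable lborel F" and [measurable]: "\<rho> \<in> borel_measurable borel"
  shows "integrable lborel (\<lambda>\<omega>. m (\<rho> \<omega>) * F \<omega>)"
proof -
  obtain B where B: "\<And>x. cmod (m x) \<le> B" using rd_bounded[OF assms(1)] by blast
  have [measurable]: "m \<in> borel_measurable borel" using assms(1) by (rule rd_measurable)
  show ?thesis
    by (rule integrable_bounded_mult[OF _ B assms(2)]) measurable
qed

text \<open>Turns the window, which is defined by duality, into an explicit integral. The product
  \<open>h\<close> of \<open>m\<close> with an inverse transform has compact support, so it is a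
  test function and inversion applies to it.\<close>

lemma multiplier_synth:
  fixes \<rho> :: "'b::euclidean_space \<Rightarrow> 'a::euclidean_space"
  assumes \<kappa>: "test_fun (\<kappa> :: 'a \<Rightarrow> complex)" "\<kappa> z \<noteq> 0" and m: "test_fun m"
    and F: "integrable lborel F" and \<rho>: "\<rho> \<in> borel_measurable borel"
  shows "fun_of_distr (multiplier m (distr_of_fun (synth \<rho> F))) = synth \<rho> (\<lambda>\<omega>. m (\<rho> \<omega>) * F \<omega>)"
proof (rule fun_of_distr_eqI[OF \<kappa>])
  have mF: "integrable lborel (\<lambda>\<omega>. m (\<rho> \<omega>) * F \<omega>)"
    by (rule test_mult_integrable[OF rd_test_fun[OF m] F \<rho>])
  show "continuous_on UNIV (synth \<rho> (\<lambda>\<omega>. m (\<rho> \<omega>) * F \<omega>))" by (rule synth_continuous[OF mF \<rho>])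
  fix \<phi> :: "'a \<Rightarrow> complex" assume \<phi>: "\<phi> \<in> schwartz"
  show "integrable lborel (\<lambda>x. synth \<rho> (\<lambda>\<omega>. m (\<rho> \<omega>) * F \<omega>) x * \<phi> x)"
    using synth_measurable[OF mF \<rho>] synth_bound[OF mF \<rho>] rd_integrable[OF rd_schwartz[OF \<phi>]]
    by (rule integrable_bounded_mult)
  define h where "h \<xi> = m \<xi> * inv_fourier \<phi> \<xi>" for \<xi>
  have h: "test_fun h" unfolding h_def by (intro test_fun_mult m inv_fourier_smooth rd_schwartz \<phi>)
  have hh: "(\<lambda>\<xi>. m \<xi> * inv_fourier \<phi> \<xi>) = h" by (simp add: h_def fun_eq_iff)
  have "multiplier m (distr_of_fun (synth \<rho> F)) \<phi> = (\<integral>x. synth \<rho> F x * fourier h x \<partial>lborel)"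
    by (simp add: multiplier_def distr_inv_fourier_def distr_mult_def distr_fourier_def distr_of_fun_def hh)
  also have "\<dots> = (\<integral>\<omega>. F \<omega> * inv_fourier (fourier h) (\<rho> \<omega>) \<partial>lborel)"
    by (rule synth_duality[OF F rd_integrable[OF rd_fourier[OF test_fun_schwartz[OF h]]] \<rho>])
  also have "\<dots> = (\<integral>\<omega>. (m (\<rho> \<omega>) * F \<omega>) * inv_fourier \<phi> (\<rho> \<omega>) \<partial>lborel)"
    unfolding inv_fourier_fourier_schwartz[OF test_fun_schwartz[OF h]] by (simp add: h_def mult_ac)
  also have "\<dots> = (\<integral>x. synth \<rho> (\<lambda>\<omega>. m (\<rho> \<omega>) * F \<omega>) x * \<phi> x \<partial>lborel)"
    by (rule synth_duality[OF mF rd_integrable[OF rd_schwartz[OF \<phi>]] \<rho>, symmetric])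
  finally show "multiplier m (distr_of_fun (synth \<rho> F)) \<phi> = distr_of_fun (synth \<rho> (\<lambda>\<omega>. m (\<rho> \<omega>) * F \<omega>)) \<phi>"
    by (simp add: distr_of_fun_def)
qed

text \<open>Convolution with \<open>\<eta>\<close> multiplies frequencies by its transform. To use
  duality, the value at \<open>x - y\<close> is read as a function of \<open>y\<close> whose
  frequencies are reflected and whose density is multiplied by the character at
  \<open>x\<close>.\<close>

lemma synth_conv:
  fixes \<rho> :: "'b::euclidean_space \<Rightarrow> 'a::euclidean_space"
  assumes F: "integrable lborel F" and \<rho>[measurable]: "\<rho> \<in> borel_measurable borel" and \<eta>: "integrable lborel \<eta>"
  shows "synth \<rho> (\<lambda>\<omega>. fourier \<eta> (\<rho> \<omega>) * F \<omega>) x = (\<integral>y. synth \<rho> F (x - y) * \<eta> y \<partial>lborel)"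
proof -
  have Fi: "integrable lborel (\<lambda>\<omega>. cis (2 * pi * (x \<bullet> \<rho> \<omega>)) * F \<omega>)" by (rule synth_integrable[OF F \<rho>])
  have s: "synth \<rho> F (x - y) = synth (\<lambda>\<omega>. - \<rho> \<omega>) (\<lambda>\<omega>. cis (2 * pi * (x \<bullet> \<rho> \<omega>)) * F \<omega>) y" for y
    unfolding synth_def
    by (intro Bochner_Integration.integral_cong refl)
       (simp add: mult.assoc[symmetric] cis_mult inner_diff_left right_diff_distrib)
  have "(\<integral>y. synth \<rho> F (x - y) * \<eta> y \<partial>lborel) = (\<integral>\<omega>. (cis (2 * pi * (x \<bullet> \<rho> \<omega>)) * F \<omega>) * inv_fourier \<eta> (- \<rho> \<omega>) \<partial>lborel)"
    unfolding s by (rule synth_duality[OF Fi \<eta>]) measurable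
  also have "\<dots> = synth \<rho> (\<lambda>\<omega>. fourier \<eta> (\<rho> \<omega>) * F \<omega>) x"
    unfolding synth_def fourier_inv_fourier by (simp add: mult_ac)
  finally show ?thesis by simp
qed

lemma fourier_modulate: "fourier (\<lambda>y. cis (2 * pi * (y \<bullet> k)) * g y) \<xi> = fourier g (\<xi> - k)"
  unfolding fourier_def
  by (intro Bochner_Integration.integral_cong refl)
     (simp add: mult.assoc[symmetric] cis_mult inner_diff_right right_diff_distrib)

lemma synth_measurable_norm:
  assumes "integrable lborel F" "\<rho> \<in> borel_measurable borel"
  shows "(\<lambda>x. cmod (synth \<rho> F x)) \<in> borel_measurable borel"
  using synth_measurable[OF assms] by measurable

lemma integrable_wgt_mult:
  fixes d :: "'a::euclidean_space \<Rightarrow> real"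
  assumes "d \<in> borel_measurable borel" "\<And>x. 0 \<le> d x" "\<And>x. d x \<le> B" "2 * DIM('a) \<le> N"
  shows "integrable lborel (\<lambda>y. d (x - y) * wgt N y)"
proof (rule Bochner_Integration.integrable_bound[where f="\<lambda>y. B * wgt N y"])
  show "integrable lborel (\<lambda>y::'a. B * wgt N y)" using wgt_integrable[OF assms(4)] by auto
  have [measurable]: "d \<in> borel_measurable borel" by fact
  show "(\<lambda>y. d (x - y) * wgt N y) \<in> borel_measurable lborel" by measurable
  show "AE y in lborel. norm (d (x - y) * wgt N y) \<le> norm (B * wgt N y)"
    using assms(2,3) order_trans[OF assms(2,3)] by (auto simp: abs_mult intro!: mult_right_mono)
qed

text \<open>The kernel of the translated multiplier \<open>m (\<xi> - k)\<close> is a modulation of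
  the kernel of \<open>m\<close>. Its modulus does not see \<open>k\<close>, so one constant serves
  all lattice windows, all \<open>F\<close> and all \<open>\<rho>\<close>.\<close>

lemma synth_window_le:
  assumes m: "test_fun (m :: 'a::euclidean_space \<Rightarrow> complex)" and N: "2 * DIM('a) \<le> N"
  obtains C where "C > 0"
    "\<And>(\<rho> :: 'b::euclidean_space \<Rightarrow> 'a) F k x. integrable lborel F \<Longrightarrow> \<rho> \<in> borel_measurable borel \<Longrightarrow>
      cmod (synth \<rho> (\<lambda>\<omega>. m (\<rho> \<omega> - k) * F \<omega>) x) \<le> C * (\<integral>y. cmod (synth \<rho> F (x - y)) * wgt N y \<partial>lborel)"
proof -
  have s: "inv_fourier m \<in> schwartz" by (rule inv_fourier_test_schwartz[OF m])
  obtain C where C: "C > 0" "\<And>y. cmod (inv_fourier m y) \<le> C * wgt N y" using rdE[OF rd_schwartz[OF s]] by blast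
  show thesis
  proof (rule that[OF C(1)])
    fix \<rho> :: "'b \<Rightarrow> 'a" and F :: "'b \<Rightarrow> complex" and k x :: 'a
    assume F: "integrable lborel F" and \<rho>: "\<rho> \<in> borel_measurable borel"
    define \<eta> where "\<eta> y = cis (2 * pi * (y \<bullet> k)) * inv_fourier m y" for y
    have \<eta>: "integrable lborel \<eta>" unfolding \<eta>_def
      by (intro integrable_cis_mult rd_integrable rd_schwartz s) measurable
    have "fourier \<eta> \<xi> = m (\<xi> - k)" for \<xi>
      unfolding \<eta>_def fourier_modulate fourier_inv_fourier_schwartz[OF test_fun_schwartz[OF m]] ..
    then have "synth \<rho> (\<lambda>\<omega>. m (\<rho> \<omega> - k) * F \<omega>) x = (\<integral>y. synth \<rho> F (x - y) * \<eta> y \<partial>lborel)"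
      using synth_conv[OF F \<rho> \<eta>] by simp
    also have "cmod \<dots> \<le> (\<integral>y. C * (cmod (synth \<rho> F (x - y)) * wgt N y) \<partial>lborel)"
    proof (rule cmod_integral_le)
      show "integrable lborel (\<lambda>y. C * (cmod (synth \<rho> F (x - y)) * wgt N y))"
        by (intro integrable_mult_right integrable_wgt_mult[OF synth_measurable_norm[OF F \<rho>] _ synth_bound[OF F \<rho>] N]) auto
      show "cmod (synth \<rho> F (x - y) * \<eta> y) \<le> C * (cmod (synth \<rho> F (x - y)) * wgt N y)" for y
        using mult_left_mono[OF C(2)[of y], of "cmod (synth \<rho> F (x - y))"] by (simp add: norm_mult \<eta>_def mult_ac)
    qed
    finally show "cmod (synth \<rho> (\<lambda>\<omega>. m (\<rho> \<omega> - k) * F \<omega>) x) \<le> C * (\<integral>y. cmod (synth \<rho> F (x - y)) * wgt N y \<partial>lborel)"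
      by simp
  qed
qed

section \<open>Windows on the lattice\<close>

lemma of_lattice_add: "of_lattice (k + l) = of_lattice k + of_lattice l"
  and of_lattice_diff: "of_lattice (k - l) = of_lattice k - of_lattice l"
  and of_lattice_0 [simp]: "of_lattice 0 = 0"
  by (simp_all add: of_lattice_def vec_eq_iff)

lemma finite_lattice: "finite {k::int ^ 'n. norm (of_lattice k) \<le> R}"
proof (rule finite_subset)
  define M where "M = \<lceil>R\<rceil>"
  show "{k::int ^ 'n. norm (of_lattice k) \<le> R} \<subseteq> (\<lambda>f. \<chi> i. f i) ` (PiE UNIV (\<lambda>_. {-M..M}))"
  proof
    fix k :: "int ^ 'n" assume "k \<in> {k. norm (of_lattice k) \<le> R}"
    then have k: "norm (of_lattice k) \<le> R" by simp
    have kM: "k $ i \<in> {-M..M}" for i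
    proof -
      have "\<bar>real_of_int (k $ i)\<bar> \<le> R"
        using component_le_norm_cart[of "of_lattice k" i] k by (simp add: of_lattice_def)
      then have "\<bar>k $ i\<bar> \<le> M" unfolding M_def by linarith
      then show ?thesis by auto
    qed
    show "k \<in> (\<lambda>f. \<chi> i. f i) ` (PiE UNIV (\<lambda>_. {-M..M}))"
    proof (rule image_eqI)
      show "k = (\<chi> i. k $ i)" by simp
      show "(\<lambda>i. k $ i) \<in> PiE UNIV (\<lambda>_. {-M..M})" using kM by (simp add: PiE_iff)
    qed
  qed
qed (intro finite_imageI finite_PiE finite finite_atLeastAtMost_int)

text \<open>For a Wiener window this has modulus at least 1, so its inverse is smooth and division
  by it makes the lattice translates of \<open>\<kappa>\<close> a partition of unity.\<close>

definition window_sum :: "(real ^ 'n \<Rightarrow> complex) \<Rightarrow> real ^ 'n \<Rightarrow> complex" where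
  "window_sum \<kappa> \<xi> = (\<Sum>\<^sub>\<infinity>k::int ^ 'n. \<kappa> (\<xi> - of_lattice k))"

lemma window_sum_finite:
  assumes "finite L" "\<And>k. k \<notin> L \<Longrightarrow> \<kappa> (\<xi> - of_lattice k) = 0"
  shows "window_sum \<kappa> \<xi> = (\<Sum>k\<in>L. \<kappa> (\<xi> - of_lattice k))"
proof -
  have "window_sum \<kappa> \<xi> = (\<Sum>\<^sub>\<infinity>k\<in>L. \<kappa> (\<xi> - of_lattice k))"
    unfolding window_sum_def by (rule infsum_cong_neutral) (use assms in auto)
  then show ?thesis using assms(1) by simp
qed

lemma window_sum_smooth:
  fixes \<kappa> :: "real ^ 'n \<Rightarrow> complex"
  assumes "test_fun \<kappa>" shows "smooth (window_sum \<kappa>)"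
proof (rule smooth_local)
  fix x :: "real ^ 'n"
  obtain R where R: "R > 0" "\<And>x. \<kappa> x \<noteq> 0 \<Longrightarrow> norm x < R" using test_fun_bounded_supp[OF assms] by blast
  define L where "L = {k::int ^ 'n. norm (of_lattice k) \<le> norm x + 1 + R}"
  have L: "finite L" unfolding L_def by (rule finite_lattice)
  have z: "\<kappa> (y - of_lattice k) = 0" if y: "y \<in> ball x 1" and k: "k \<notin> L" for y k
  proof (rule ccontr)
    assume "\<kappa> (y - of_lattice k) \<noteq> 0"
    then have "norm (y - of_lattice k) < R" by (rule R(2))
    moreover have "norm (of_lattice k) \<le> norm (y - of_lattice k) + norm y"
      by (metis norm_minus_commute norm_triangle_sub add.commute)
    moreover have "norm y \<le> norm x + norm (x - y)" by (metis norm_minus_commute norm_triangle_sub)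
    moreover have "norm (x - y) < 1" using y by (simp add: dist_norm)
    ultimately show False using k by (simp add: L_def)
  qed
  have "window_sum \<kappa> y = (\<Sum>k\<in>L. \<kappa> (y - of_lattice k))" if "y \<in> ball x 1" for y
    using z[OF that] by (rule window_sum_finite[OF L])
  then show "\<exists>U g. open U \<and> x \<in> U \<and> smooth g \<and> (\<forall>y\<in>U. window_sum \<kappa> y = g y)"
    by (intro exI[of _ "ball x 1"] exI[of _ "\<lambda>y. \<Sum>k\<in>L. \<kappa> (y - of_lattice k)"] conjI ballI smooth_sum
        smooth_shift test_fun_smooth assms) auto
qed

lemma wiener_window_nonzero: "wiener_window \<kappa> \<Longrightarrow> window_sum \<kappa> \<xi> \<noteq> 0"
  unfolding wiener_window_def window_sum_def by (metis norm_zero not_one_le_zero)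

lemma wiener_window_test: "wiener_window \<kappa> \<Longrightarrow> test_fun \<kappa>"
  unfolding wiener_window_def by blast

lemma wiener_window_point: assumes "wiener_window (\<kappa> :: real ^ 'n \<Rightarrow> complex)" obtains z where "\<kappa> z \<noteq> 0"
proof -
  have "\<exists>k::int ^ 'n. \<kappa> (0 - of_lattice k) \<noteq> 0"
    using wiener_window_nonzero[OF assms, of 0] window_sum_finite[of "{}" \<kappa> 0] by auto
  then show thesis using that by blast
qed

lemma smooth_inverse_window_sum:
  "wiener_window \<kappa> \<Longrightarrow> smooth (\<lambda>\<xi>. inverse (window_sum \<kappa> \<xi>))"
  by (intro smooth_inverse window_sum_smooth wiener_window_test wiener_window_nonzero)

text \<open>Change of window: multiply \<open>\<psi>\<close> by the partition of unity made from
  \<open>\<kappa>\<close> and translate by \<open>\<mu>\<close>. Only finitely many \<open>l\<close>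
  meet the support of \<open>\<psi>\<close>, and neither \<open>L\<close> nor \<open>m\<close>
  depends on \<open>\<mu>\<close>.\<close>

lemma window_decomp:
  fixes \<kappa> :: "real ^ 'n \<Rightarrow> complex"
  assumes w: "wiener_window \<kappa>" and \<psi>: "test_fun \<psi>"
  obtains L m where "finite L" "test_fun m"
    "\<And>\<mu> \<xi>. \<psi> (\<xi> - of_lattice \<mu>) = (\<Sum>l\<in>L. m (\<xi> - of_lattice \<mu>) * \<kappa> (\<xi> - of_lattice (\<mu> + l)))"
proof -
  obtain R where R: "R > 0" "\<And>x. \<kappa> x \<noteq> 0 \<Longrightarrow> norm x < R"
    using test_fun_bounded_supp[OF wiener_window_test[OF w]] by blast
  obtain R' where R': "R' > 0" "\<And>x. \<psi> x \<noteq> 0 \<Longrightarrow> norm x < R'"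
    using test_fun_bounded_supp[OF \<psi>] by blast
  define L where "L = {k::int ^ 'n. norm (of_lattice k) \<le> R + R'}"
  have L: "finite L" unfolding L_def by (rule finite_lattice)
  define m where "m \<xi> = \<psi> \<xi> * inverse (window_sum \<kappa> \<xi>)" for \<xi>
  have m: "test_fun m"
    unfolding m_def by (intro test_fun_mult \<psi> smooth_inverse_window_sum w)
  have d: "\<psi> \<eta> = (\<Sum>l\<in>L. m \<eta> * \<kappa> (\<eta> - of_lattice l))" for \<eta>
  proof (cases "\<psi> \<eta> = 0")
    case False
    have "\<kappa> (\<eta> - of_lattice k) = 0" if k: "k \<notin> L" for k
    proof (rule ccontr)
      assume "\<kappa> (\<eta> - of_lattice k) \<noteq> 0"
      then have "norm (\<eta> - of_lattice k) < R" by (rule R(2))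
      moreover have "norm \<eta> < R'" using False by (rule R'(2))
      moreover have "norm (of_lattice k) \<le> norm (\<eta> - of_lattice k) + norm \<eta>"
        by (metis norm_minus_commute norm_triangle_sub add.commute)
      ultimately show False using k by (simp add: L_def)
    qed
    then have "window_sum \<kappa> \<eta> = (\<Sum>l\<in>L. \<kappa> (\<eta> - of_lattice l))" by (rule window_sum_finite[OF L])
    then have "(\<Sum>l\<in>L. m \<eta> * \<kappa> (\<eta> - of_lattice l)) = m \<eta> * window_sum \<kappa> \<eta>"
      by (simp add: sum_distrib_left)
    also have "\<dots> = \<psi> \<eta>" using wiener_window_nonzero[OF w] by (simp add: m_def)
    finally show ?thesis by simp
  qed (simp add: m_def)
  show thesis
  proof (rule that[OF L m])
    fix \<mu> \<xi>
    show "\<psi> (\<xi> - of_lattice \<mu>) = (\<Sum>l\<in>L. m (\<xi> - of_lattice \<mu>) * \<kappa> (\<xi> - of_lattice (\<mu> + l)))"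
      using d[of "\<xi> - of_lattice \<mu>"] by (simp add: of_lattice_add diff_diff_eq)
  qed
qed

text \<open>A finite part of the partition of unity that contains every index whose translate meets
  the ball.\<close>

lemma cutoff_exists:
  fixes \<kappa> :: "real ^ 'n \<Rightarrow> complex"
  assumes w: "wiener_window \<kappa>"
  obtains \<psi> :: "real ^ 'n \<Rightarrow> complex" where "test_fun \<psi>" "\<And>\<xi>. norm \<xi> \<le> R \<Longrightarrow> \<psi> \<xi> = 1"
proof -
  obtain r where r: "r > 0" "\<And>x. \<kappa> x \<noteq> 0 \<Longrightarrow> norm x < r"
    using test_fun_bounded_supp[OF wiener_window_test[OF w]] by blast
  define L where "L = {k::int ^ 'n. norm (of_lattice k) \<le> R + r}"
  have L: "finite L" unfolding L_def by (rule finite_lattice)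
  define \<psi> where "\<psi> \<xi> = (\<Sum>k\<in>L. \<kappa> (\<xi> - of_lattice k)) * inverse (window_sum \<kappa> \<xi>)" for \<xi>
  show thesis
  proof (rule that[of \<psi>])
    show "test_fun \<psi>" unfolding \<psi>_def
      by (intro test_fun_mult test_fun_sum L test_fun_shift wiener_window_test smooth_inverse_window_sum w)
    fix \<xi> :: "real ^ 'n" assume \<xi>: "norm \<xi> \<le> R"
    have "\<kappa> (\<xi> - of_lattice k) = 0" if k: "k \<notin> L" for k
    proof (rule ccontr)
      assume "\<kappa> (\<xi> - of_lattice k) \<noteq> 0"
      then have "norm (\<xi> - of_lattice k) < r" by (rule r(2))
      moreover have "norm (of_lattice k) \<le> norm (\<xi> - of_lattice k) + norm \<xi>"
        by (metis norm_minus_commute norm_triangle_sub add.commute)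
      ultimately show False using k \<xi> by (simp add: L_def)
    qed
    then have "window_sum \<kappa> \<xi> = (\<Sum>l\<in>L. \<kappa> (\<xi> - of_lattice l))" by (rule window_sum_finite[OF L])
    then show "\<psi> \<xi> = 1" unfolding \<psi>_def using wiener_window_nonzero[OF w, of \<xi>] by simp
  qed
qed

lemma wiener_norm_synth:
  fixes \<kappa> :: "real ^ 'n \<Rightarrow> complex" and \<rho> :: "'b::euclidean_space \<Rightarrow> real ^ 'n"
  assumes w: "wiener_window \<kappa>" and F: "integrable lborel F" and \<rho>: "\<rho> \<in> borel_measurable borel"
  shows "wiener_norm \<kappa> p q (distr_of_fun (synth \<rho> F)) =
    Lp_norm lborel p (\<lambda>x. lq_norm q (\<lambda>k. ennreal (cmod (synth \<rho> (\<lambda>\<omega>. \<kappa> (\<rho> \<omega> - of_lattice k) * F \<omega>) x))))"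
proof -
  obtain z where z: "\<kappa> z \<noteq> 0" using wiener_window_point[OF w] by blast
  have t: "tempered (distr_of_fun (synth \<rho> F))"
    by (rule tempered_bounded[OF synth_measurable[OF F \<rho>] synth_bound[OF F \<rho>]])
  have "fun_of_distr (multiplier (\<lambda>\<xi>. \<kappa> (\<xi> - of_lattice k)) (distr_of_fun (synth \<rho> F)))
    = synth \<rho> (\<lambda>\<omega>. \<kappa> (\<rho> \<omega> - of_lattice k) * F \<omega>)" for k
    by (rule multiplier_synth[OF wiener_window_test[OF w] z test_fun_shift[OF wiener_window_test[OF w]] F \<rho>])
  then show ?thesis using t by (simp add: wiener_norm_def)
qed

lemma schwartz_synth: "f \<in> schwartz \<Longrightarrow> synth (\<lambda>\<xi>. \<xi>) (fourier f) = f"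
  using inv_fourier_fourier_schwartz[of f] by (simp add: inv_fourier_synth)

lemma bilin_op_synth:
  "bilin_op \<sigma> f\<^sub>1 f\<^sub>2 = synth (\<lambda>\<xi>. fst \<xi> + snd \<xi>) (\<lambda>\<xi>. \<sigma> \<xi> * fourier f\<^sub>1 (fst \<xi>) * fourier f\<^sub>2 (snd \<xi>))"
  unfolding fun_eq_iff bilin_op_def synth_def lborel_prod
  by (intro allI Bochner_Integration.integral_cong refl) (simp add: split_beta mult.assoc)

section \<open>Averages of band-limited functions\<close>

lemma powr_tangent:
  fixes t m s :: real
  assumes "0 \<le> t" "0 < m" "1 \<le> s"
  shows "m powr s + s * m powr (s - 1) * (t - m) \<le> t powr s"
proof (cases "t = 0")
  case True
  have "m powr s = m powr (s - 1) * m" using assms by (simp add: powr_diff)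
  then show ?thesis using True assms mult_right_mono[of 1 s "m powr s"] by (simp add: algebra_simps)
next
  case False
  have "s * m powr (s - 1) * (t - m) \<le> t powr s - m powr s"
  proof (rule convex_on_imp_above_tangent[OF powr_convex[OF assms(3)]])
    have "((\<lambda>x. x powr s) has_field_derivative s * m powr (s - 1)) (at m)"
      using assms by (auto intro!: derivative_eq_intros simp: powr_diff)
    then show "((\<lambda>x. x powr s) has_field_derivative s * m powr (s - 1)) (at m within {0<..})"
      by (rule has_field_derivative_at_within)
  qed (use assms False in \<open>auto simp: interior_open\<close>)
  then show ?thesis by simp
qed

text \<open>Jensen's inequality for a weight of arbitrary mass: integrate the tangent line of the
  power function at the weighted mean \<open>m\<close>, where the linear term integrates to
  zero.\<close>

lemma weighted_jensen:
  fixes d w :: "'a::euclidean_space \<Rightarrow> real"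
  assumes s: "1 \<le> s" and w: "integrable lborel w" "\<And>y. 0 \<le> w y" "0 < (\<integral>y. w y \<partial>lborel)"
    and d: "\<And>y. 0 \<le> d y" "integrable lborel (\<lambda>y. d y * w y)" "integrable lborel (\<lambda>y. d y powr s * w y)"
  shows "(\<integral>y. d y * w y \<partial>lborel) powr s \<le> (\<integral>y. w y \<partial>lborel) powr (s - 1) * (\<integral>y. d y powr s * w y \<partial>lborel)"
proof -
  define W where "W = (\<integral>y. w y \<partial>lborel)"
  define I where "I = (\<integral>y. d y * w y \<partial>lborel)"
  have W: "0 < W" using w by (simp add: W_def)
  have I: "0 \<le> I" unfolding I_def using d w by (intro integral_nonneg_AE) auto
  show ?thesis
  proof (cases "I = 0")
    case True
    have "0 \<le> (\<integral>y. d y powr s * w y \<partial>lborel)" using d w by (intro integral_nonneg_AE) auto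
    then show ?thesis using True by (simp add: I_def)
  next
    case False
    define m where "m = I / W"
    have m: "0 < m" using False I W by (simp add: m_def)
    have "m powr s * W = (\<integral>y. (m powr s + s * m powr (s - 1) * (d y - m)) * w y \<partial>lborel)"
    proof -
      have "(\<integral>y. (m powr s + s * m powr (s - 1) * (d y - m)) * w y \<partial>lborel) =
         (\<integral>y. m powr s * w y + s * m powr (s - 1) * (d y * w y) - s * m powr (s - 1) * m * w y \<partial>lborel)"
        by (intro Bochner_Integration.integral_cong refl) (simp add: algebra_simps)
      also have "\<dots> = m powr s * W + s * m powr (s - 1) * I - s * m powr (s - 1) * m * W"
        using w(1) d(2) by (simp add: W_def I_def)
      also have "I = m * W" using W by (simp add: m_def)
      finally show ?thesis by simp
    qed
    also have "\<dots> \<le> (\<integral>y. d y powr s * w y \<partial>lborel)"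
    proof (rule integral_mono[OF _ d(3)])
      have "integrable lborel (\<lambda>y. m powr s * w y + s * m powr (s - 1) * (d y * w y) - s * m powr (s - 1) * m * w y)"
        using w(1) d(2) by auto
      then show "integrable lborel (\<lambda>y. (m powr s + s * m powr (s - 1) * (d y - m)) * w y)"
        by (rule Bochner_Integration.integrable_cong[THEN iffD1, rotated 2]) (simp_all add: algebra_simps)
      show "(m powr s + s * m powr (s - 1) * (d y - m)) * w y \<le> d y powr s * w y" for y
        by (intro mult_right_mono powr_tangent d w m s)
    qed
    finally have le: "m powr s * W \<le> (\<integral>y. d y powr s * w y \<partial>lborel)" .
    have "I powr s = W powr (s - 1) * (m powr s * W)"
      using W I by (simp add: m_def powr_divide powr_diff)
    then show ?thesis using le W by (simp add: I_def W_def mult_left_mono)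
  qed
qed

lemma integral_wgt_pos:
  assumes "2 * DIM('a) \<le> N"
  shows "0 < (\<integral>y. wgt N y \<partial>(lborel :: 'a::euclidean_space measure))"
proof -
  have "(\<integral>y. wgt N y \<partial>(lborel :: 'a measure)) \<noteq> 0"
    using continuous_integral_zero[OF wgt_continuous wgt_integrable[OF assms]] wgt_pos[of N "0::'a"]
    by (metis less_irrefl wgt_nonneg)
  moreover have "0 \<le> (\<integral>y. wgt N y \<partial>(lborel :: 'a measure))" by (intro integral_nonneg_AE) auto
  ultimately show ?thesis by linarith
qed

lemma powr_bounded_meas:
  fixes d :: "'a::euclidean_space \<Rightarrow> real"
  assumes "d \<in> borel_measurable borel" "\<And>x. 0 \<le> d x" "\<And>x. d x \<le> B" "0 < s"
  shows "(\<lambda>x. d x powr s) \<in> borel_measurable borel" "\<And>x. d x powr s \<le> B powr s"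
  using assms by (auto intro: powr_mono2)

text \<open>Peetre's maximal function trick: for \<open>s < 1\<close> the bound on \<open>d\<close> by its own average lets one
  factor \<open>d = d powr (1 - s) * d powr s\<close>, estimate the first factor by the weighted supremum
  and divide by it.\<close>

lemma self_bounded_average:
  fixes d :: "'a::euclidean_space \<Rightarrow> real"
  assumes s: "0 < s" "s < 1" and M: "2 * DIM('a) \<le> M" and N: "real M \<le> real N * s"
    and A: "0 < A"
    and d[measurable]: "d \<in> borel_measurable borel" and d0: "\<And>x. 0 \<le> d x" and dB: "\<And>x. d x \<le> B"
    and self: "\<And>x. d x \<le> A * (\<integral>y. d (x - y) * wgt (N + 2 * DIM('a)) y \<partial>lborel)"
  shows "(\<integral>y. d (x - y) * wgt (N + 2 * DIM('a)) y \<partial>lborel) powr s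
    \<le> (\<integral>y. wgt (2 * DIM('a)) (y::'a) \<partial>lborel) powr s * A * (\<integral>y. d (x - y) powr s * wgt M y \<partial>lborel)"
proof -
  define N' where "N' = N + 2 * DIM('a)"
  have N': "2 * DIM('a) \<le> N'" by (simp add: N'_def)
  define Q where "Q = (\<integral>y. d (x - y) powr s * wgt M y \<partial>lborel)"
  \<comment> \<open>Peetre's maximal function at \<open>x\<close>. It is finite because
    \<open>d\<close> is bounded, which is what makes the later division by a power of
    \<open>S\<close> legitimate.\<close>
  define S where "S = (SUP z. d (x - z) * wgt N z)"
  have bdd: "bdd_above (range (\<lambda>z. d (x - z) * wgt N z))"
  proof (rule bdd_aboveI2)
    fix z show "d (x - z) * wgt N z \<le> B"
      using mult_mono[OF dB[of "x - z"] wgt_le_1[of N z] order_trans[OF d0 dB]] d0 by simp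
  qed
  have le_S: "d (x - z) * wgt N z \<le> S" for z unfolding S_def by (rule cSUP_upper[OF _ bdd]) simp
  have le_S': "d (x - z) \<le> S * (1 + norm z) ^ N" for z
    using le_S[of z] one_norm_pos[of z] by (simp add: wgt_def field_simps)
  have S0: "0 \<le> S" using le_S[of 0] d0[of x] by (simp add: wgt_def)
  note ds = powr_bounded_meas[OF d d0 dB s(1)]
  have ds0: "0 \<le> d x powr s" for x by simp
  have Q0: "0 \<le> Q" unfolding Q_def by (intro integral_nonneg_AE) auto
  have "d (x - z) * wgt N z \<le> A * S powr (1 - s) * Q" for z
  proof -
    have "d (x - z) \<le> A * (\<integral>y. d (x - z - y) * wgt N' y \<partial>lborel)" unfolding N'_def by (rule self)
    also have "(\<integral>y. d (x - z - y) * wgt N' y \<partial>lborel) = (\<integral>w. d (x - z - (- z + w)) * wgt N' (- z + w) \<partial>lborel)"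
      by (rule integral_lborel_shift(1)[symmetric]) measurable
    also have "\<dots> = (\<integral>w. d (x - w) * wgt N' (w - z) \<partial>lborel)" by simp
    finally have "d (x - z) * wgt N z \<le> (A * (\<integral>w. d (x - w) * wgt N' (w - z) \<partial>lborel)) * wgt N z"
      by (rule mult_right_mono) simp
    also have "\<dots> = A * (\<integral>w. d (x - w) * wgt N' (w - z) * wgt N z \<partial>lborel)" by simp
    also have "(\<integral>w. d (x - w) * wgt N' (w - z) * wgt N z \<partial>lborel)
      \<le> (\<integral>w. S powr (1 - s) * (d (x - w) powr s * wgt M w) \<partial>lborel)"
    proof (rule integral_mono')
      show "integrable lborel (\<lambda>w. S powr (1 - s) * (d (x - w) powr s * wgt M w))"
        by (intro integrable_mult_right integrable_wgt_mult[OF ds(1) ds0 ds(2) M])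
      fix w
      \<comment> \<open>The average around \<open>x - z\<close> is compared with one around
        \<open>x\<close>: the weight in \<open>w - z\<close> times the weight in \<open>z\<close> is
        at most the weight in \<open>w\<close>.\<close>
      have "wgt N' (w - z) \<le> wgt N (w - z)" by (rule wgt_mono) (simp add: N'_def)
      then have "wgt N' (w - z) * wgt N z \<le> wgt N (w - z) * ((1 + norm (w - z)) ^ N * wgt N (z + (w - z)))"
        by (intro mult_mono wgt_shift) auto
      also have "\<dots> = ((1 + norm (w - z)) ^ N * wgt N (w - z)) * wgt N w" by simp
      finally have 1: "wgt N' (w - z) * wgt N z \<le> wgt N w" unfolding wgt_mult_power by simp
      have 2: "d (x - w) * wgt N w \<le> S powr (1 - s) * (d (x - w) powr s * wgt M w)"
      proof (cases "d (x - w) = 0")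
        case False
        then have dp: "0 < d (x - w)" using d0[of "x - w"] by simp
        have "d (x - w) = d (x - w) powr (1 - s) * d (x - w) powr s" using dp by (simp flip: powr_add)
        moreover have "d (x - w) powr (1 - s) \<le> (S * (1 + norm w) ^ N) powr (1 - s)"
          using s le_S' dp by (intro powr_mono2) auto
        moreover have "(S * (1 + norm w) ^ N) powr (1 - s) = S powr (1 - s) * (1 + norm w) powr (real N * (1 - s))"
          using S0 one_norm_pos[of w] by (simp add: powr_mult powr_powr flip: powr_realpow)
        ultimately have "d (x - w) \<le> S powr (1 - s) * (1 + norm w) powr (real N * (1 - s)) * d (x - w) powr s"
          by (metis mult_right_mono powr_ge_zero)
        then have "d (x - w) * wgt N w \<le> S powr (1 - s) * (1 + norm w) powr (real N * (1 - s)) * d (x - w) powr s * wgt N w"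
          by (rule mult_right_mono) simp
        also have "\<dots> = S powr (1 - s) * (d (x - w) powr s * ((1 + norm w) powr (real N * (1 - s)) * wgt N w))" by simp
        \<comment> \<open>The exponents add up to \<open>- real N * s\<close>, and \<open>N\<close>
          was taken so large that this is at most \<open>- real M\<close>.\<close>
        also have "(1 + norm w) powr (real N * (1 - s)) * wgt N w \<le> wgt M w"
        proof -
          have "(1 + norm w) powr (real N * (1 - s)) * wgt N w = (1 + norm w) powr (real N * (1 - s) - real N)"
            using one_norm_pos[of w] by (simp add: wgt_def powr_diff powr_realpow)
          also have "\<dots> \<le> (1 + norm w) powr (- real M)" using N by (intro powr_mono) (auto simp: algebra_simps)
          also have "\<dots> = wgt M w" using one_norm_pos[of w] by (simp add: wgt_def powr_minus powr_realpow inverse_eq_divide)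
          finally show ?thesis .
        qed
        finally show ?thesis by (simp add: mult_left_mono)
      qed simp
      have "d (x - w) * wgt N' (w - z) * wgt N z \<le> d (x - w) * wgt N w"
        using 1 d0 by (simp add: mult.assoc mult_left_mono)
      also note 2
      finally show "d (x - w) * wgt N' (w - z) * wgt N z \<le> S powr (1 - s) * (d (x - w) powr s * wgt M w)" .
    qed simp
    finally show ?thesis using A by (simp add: Q_def mult.assoc)
  qed
  then have "S \<le> A * S powr (1 - s) * Q" unfolding S_def by (intro cSUP_least) auto
  then have Ss: "S powr s \<le> A * Q"
  proof (cases "S = 0")
    case False
    then have Sp: "0 < S" using S0 by simp
    have "S powr s * S powr (1 - s) = S" using Sp by (simp flip: powr_add)
    then have "S powr s * S powr (1 - s) \<le> (A * Q) * S powr (1 - s)"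
      using \<open>S \<le> A * S powr (1 - s) * Q\<close> by (simp add: mult_ac)
    then show ?thesis using Sp by simp
  qed (use A Q0 in simp)
  define W where "W = (\<integral>y. wgt (2 * DIM('a)) (y::'a) \<partial>lborel)"
  have W: "0 < W" unfolding W_def by (rule integral_wgt_pos) simp
  \<comment> \<open>The first \<open>N\<close> powers of the weight bound \<open>d\<close> by
    \<open>S\<close>; the remaining powers keep the integral finite.\<close>
  have "(\<integral>y. d (x - y) * wgt N' y \<partial>lborel) \<le> (\<integral>y. S * wgt (2 * DIM('a)) (y::'a) \<partial>lborel)"
  proof (rule integral_mono')
    show "integrable lborel (\<lambda>y::'a. S * wgt (2 * DIM('a)) y)"
      by (intro integrable_mult_right wgt_integrable) simp
    fix y
    show "d (x - y) * wgt N' y \<le> S * wgt (2 * DIM('a)) y"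
      unfolding N'_def wgt_add mult.assoc[symmetric] by (intro mult_right_mono le_S) simp
  qed (use S0 in simp)
  then have "(\<integral>y. d (x - y) * wgt N' y \<partial>lborel) \<le> W * S" by (simp add: W_def mult.commute)
  moreover have "0 \<le> (\<integral>y. d (x - y) * wgt N' y \<partial>lborel)" using d0 by (intro integral_nonneg_AE) auto
  ultimately have "(\<integral>y. d (x - y) * wgt N' y \<partial>lborel) powr s \<le> (W * S) powr s"
    using s by (intro powr_mono2) auto
  also have "\<dots> = W powr s * S powr s" using W S0 by (simp add: powr_mult)
  also have "\<dots> \<le> W powr s * (A * Q)" using Ss by (intro mult_left_mono) auto
  finally show ?thesis by (simp add: Q_def W_def N'_def mult.assoc)
qed

text \<open>Peetre's trick for \<open>s < 1\<close> and Jensen's inequality for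
  \<open>s \<ge> 1\<close> under one interface. \<open>N\<close> is fixed before \<open>A\<close>,
  since in the applications \<open>A\<close> comes from a kernel estimate that is itself made with
  the weight \<open>N\<close>.\<close>

lemma average_powr:
  assumes s: "0 < s" and M: "2 * DIM('a::euclidean_space) \<le> M"
  obtains N where "2 * DIM('a) \<le> N"
    "\<And>A. 0 < A \<Longrightarrow> \<exists>C>0. \<forall>(d::'a \<Rightarrow> real) B. d \<in> borel_measurable borel \<longrightarrow> (\<forall>x. 0 \<le> d x) \<longrightarrow> (\<forall>x. d x \<le> B) \<longrightarrow>
      (\<forall>x. d x \<le> A * (\<integral>y. d (x - y) * wgt N y \<partial>lborel)) \<longrightarrow>
      (\<forall>x. (\<integral>y. d (x - y) * wgt N y \<partial>lborel) powr s \<le> C * (\<integral>y. d (x - y) powr s * wgt M y \<partial>lborel))"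
proof (cases "s < 1")
  case True
  define N where "N = nat \<lceil>real M / s\<rceil>"
  have N: "real M \<le> real N * s"
  proof -
    have "real M / s \<le> real N" unfolding N_def by linarith
    then show ?thesis using s by (simp add: field_simps)
  qed
  show thesis
  proof (rule that[of "N + 2 * DIM('a)"])
    fix A :: real assume A: "0 < A"
    define C where "C = (\<integral>y. wgt (2 * DIM('a)) (y::'a) \<partial>lborel) powr s * A"
    have "C > 0" unfolding C_def using A integral_wgt_pos[of "2 * DIM('a)", where 'a='a] by simp
    then show "\<exists>C>0. \<forall>(d::'a \<Rightarrow> real) B. d \<in> borel_measurable borel \<longrightarrow> (\<forall>x. 0 \<le> d x) \<longrightarrow> (\<forall>x. d x \<le> B) \<longrightarrow>
      (\<forall>x. d x \<le> A * (\<integral>y. d (x - y) * wgt (N + 2 * DIM('a)) y \<partial>lborel)) \<longrightarrow>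
      (\<forall>x. (\<integral>y. d (x - y) * wgt (N + 2 * DIM('a)) y \<partial>lborel) powr s \<le> C * (\<integral>y. d (x - y) powr s * wgt M y \<partial>lborel))"
      unfolding C_def using self_bounded_average[OF s True M N A] by blast
  qed simp
next
  case False
  define W where "W = (\<integral>y. wgt M (y::'a) \<partial>lborel)"
  have W: "0 < W" unfolding W_def by (rule integral_wgt_pos[OF M])
  have "(\<integral>y. d (x - y) * wgt M y \<partial>lborel) powr s \<le> W powr (s - 1) * (\<integral>y. d (x - y) powr s * wgt M y \<partial>lborel)"
    if d: "d \<in> borel_measurable borel" "\<And>x. 0 \<le> d x" "\<And>x. d x \<le> B" for d :: "'a \<Rightarrow> real" and B x
    unfolding W_def
  proof (rule weighted_jensen)
    show "integrable lborel (\<lambda>y. d (x - y) powr s * wgt M y)"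
      using powr_bounded_meas[OF d s] by (intro integrable_wgt_mult[where B="B powr s"] M) auto
    show "integrable lborel (\<lambda>y. d (x - y) * wgt M y)" by (rule integrable_wgt_mult[OF d M])
  qed (use False d W in \<open>auto simp: W_def[symmetric] intro: wgt_integrable[OF M]\<close>)
  then show thesis using W by (intro that[OF M] exI[of _ "W powr (s - 1)"]) auto
qed

text \<open>For \<open>q < \<infinity>\<close> the \<open>lq\<close> norm is governed by the sums of \<open>q\<close>-th powers over finite index sets;
  with exponent \<open>1\<close> and at most one index the same description covers \<open>q = \<infinity>\<close>.\<close>

definition ex :: "ennreal \<Rightarrow> real" where "ex q = (if q = \<infinity> then 1 else enn2real q)"

definition adm :: "ennreal \<Rightarrow> 'k set \<Rightarrow> bool" where
  "adm q P \<longleftrightarrow> finite P \<and> (q = \<infinity> \<longrightarrow> card P \<le> 1)"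

section \<open>Sequence norms through finite sums\<close>

lemma ex_pos: "0 < q \<Longrightarrow> 0 < ex q"
  by (auto simp: ex_def enn2real_positive_iff less_top[symmetric] top_unique)

lemma ennreal_powr_ennreal: "0 \<le> t \<Longrightarrow> ennreal_powr (ennreal t) r = ennreal (t powr r)"
  by (simp add: ennreal_powr_def)

lemma ennreal_powr_mono: "x \<le> y \<Longrightarrow> 0 \<le> r \<Longrightarrow> ennreal_powr x r \<le> ennreal_powr y r"
  by (cases x; cases y) (auto simp: ennreal_powr_def top_unique intro!: ennreal_leI powr_mono2)

lemma ennreal_powr_inverse: "0 < r \<Longrightarrow> ennreal_powr (ennreal_powr x (1 / r)) r = x"
  by (cases x) (auto simp: ennreal_powr_def powr_powr)

lemma ennreal_powr_measurable [measurable]: "(\<lambda>x. ennreal_powr x r) \<in> borel_measurable borel"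
  unfolding ennreal_powr_def[abs_def] by measurable

lemma esssup_count_space: "esssup (count_space UNIV) (f :: 'k \<Rightarrow> ennreal) = (SUP k. f k)"
  by (subst esssup_eq_AE) (auto simp: AE_count_space Sup_eq_Inf intro!: arg_cong[where f=Inf])

text \<open>Written as a series over the natural numbers, the integral over indices is visibly
  measurable in a parameter and is a supremum of finite sums.\<close>

lemma nn_integral_count_suminf:
  fixes f :: "'k::countable \<Rightarrow> ennreal"
  shows "(\<integral>\<^sup>+k. f k \<partial>count_space UNIV) = (\<Sum>n. f (from_nat n) * indicator (range (to_nat :: 'k \<Rightarrow> nat)) n)"
proof -
  have "bij_betw (to_nat :: 'k \<Rightarrow> nat) UNIV (range (to_nat :: 'k \<Rightarrow> nat))" by (simp add: bij_betw_def)
  from nn_integral_bij_count_space[OF this, of "\<lambda>n. f (from_nat n)"]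
  have "(\<integral>\<^sup>+k. f k \<partial>count_space UNIV) = (\<integral>\<^sup>+n. f (from_nat n) \<partial>count_space (range (to_nat :: 'k \<Rightarrow> nat)))"
    by simp
  also have "\<dots> = (\<integral>\<^sup>+n. f (from_nat n) * indicator (range (to_nat :: 'k \<Rightarrow> nat)) n \<partial>count_space UNIV)"
    by (rule nn_integral_count_space_indicator) simp
  finally show ?thesis by (simp add: nn_integral_count_space_nat)
qed

lemma nn_integral_count_le_iff:
  fixes f :: "'k::countable \<Rightarrow> ennreal"
  shows "(\<integral>\<^sup>+k. f k \<partial>count_space UNIV) \<le> X \<longleftrightarrow> (\<forall>P. finite P \<longrightarrow> (\<Sum>k\<in>P. f k) \<le> X)"
proof (intro iffI allI impI)
  fix P :: "'k set" assume P: "finite P" and X: "(\<integral>\<^sup>+k. f k \<partial>count_space UNIV) \<le> X"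
  have "(\<Sum>k\<in>P. f k) = (\<integral>\<^sup>+k. f k \<partial>count_space P)" using P by (simp add: nn_integral_count_space_finite)
  also have "\<dots> = (\<integral>\<^sup>+k. f k * indicator P k \<partial>count_space UNIV)" by (rule nn_integral_count_space_indicator) simp
  also have "\<dots> \<le> (\<integral>\<^sup>+k. f k \<partial>count_space UNIV)" by (intro nn_integral_mono) (auto simp: indicator_def)
  finally show "(\<Sum>k\<in>P. f k) \<le> X" using X by simp
next
  assume *: "\<forall>P. finite P \<longrightarrow> (\<Sum>k\<in>P. f k) \<le> X"
  show "(\<integral>\<^sup>+k. f k \<partial>count_space UNIV) \<le> X"
    unfolding nn_integral_count_suminf
  proof (rule suminf_le_const)
    fix m
    let ?P = "(to_nat :: 'k \<Rightarrow> nat) -` {..<m}"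
    have fin: "finite ?P" by (intro finite_vimageI) auto
    have "(\<Sum>n<m. f (from_nat n) * indicator (range (to_nat :: 'k \<Rightarrow> nat)) n)
      = (\<Sum>n\<in>to_nat ` ?P. f (from_nat n) * indicator (range (to_nat :: 'k \<Rightarrow> nat)) n)"
      by (intro sum.mono_neutral_right) (auto simp: indicator_def)
    also have "\<dots> = (\<Sum>k\<in>?P. f k)" by (subst sum.reindex) (auto simp: inj_on_def)
    finally show "(\<Sum>n<m. f (from_nat n) * indicator (range (to_nat :: 'k \<Rightarrow> nat)) n) \<le> X"
      using * fin by simp
  qed auto
qed

lemma Lp_norm_alt: "0 < p \<Longrightarrow> p \<noteq> \<infinity> \<Longrightarrow>
   Lp_norm M p f = ennreal_powr (\<integral>\<^sup>+x. ennreal_powr (f x) (ex p) \<partial>M) (1 / ex p)"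
  by (simp add: Lp_norm_def ex_def)

lemma powr_le_iff: "0 < r \<Longrightarrow> 0 \<le> t \<Longrightarrow> 0 \<le> u \<Longrightarrow> t powr r \<le> u powr r \<longleftrightarrow> t \<le> (u::real)"
  by (meson not_le powr_less_mono2 powr_mono2 less_imp_le)

lemma ennreal_powr_le_iff:
  assumes "0 < r" "0 \<le> X"
  shows "ennreal_powr y (1 / r) \<le> ennreal X \<longleftrightarrow> y \<le> ennreal (X powr r)"
proof
  assume "ennreal_powr y (1 / r) \<le> ennreal X"
  from ennreal_powr_mono[OF this, of r] show "y \<le> ennreal (X powr r)"
    using assms by (simp add: ennreal_powr_inverse ennreal_powr_ennreal)
next
  assume "y \<le> ennreal (X powr r)"
  from ennreal_powr_mono[OF this, of "1 / r"] show "ennreal_powr y (1 / r) \<le> ennreal X"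
    using assms by (simp add: ennreal_powr_ennreal powr_powr)
qed

text \<open>The form in which sequence norms are estimated: sums of powers over finite index sets
  pass through integrals, so averages of whole families are handled as for a single function, with
  no triangle inequality for the norm.\<close>

lemma lq_norm_le_iff:
  fixes b :: "'k::countable \<Rightarrow> real"
  assumes q: "0 < q" and b: "\<And>k. 0 \<le> b k" and X: "0 \<le> X"
  shows "lq_norm q (\<lambda>k. ennreal (b k)) \<le> ennreal X \<longleftrightarrow>
    (\<forall>P. adm q P \<longrightarrow> (\<Sum>k\<in>P. b k powr ex q) \<le> X powr ex q)"
proof (cases "q = \<infinity>")
  case True
  have a: "adm q P \<longleftrightarrow> P = {} \<or> (\<exists>k. P = {k})" for P :: "'k set"
    using True by (auto simp: adm_def le_Suc_eq card_1_singleton_iff)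
  have "lq_norm q (\<lambda>k. ennreal (b k)) \<le> ennreal X \<longleftrightarrow> (\<forall>k. b k \<le> X)"
    using True X b by (simp add: lq_norm_def Lp_norm_def esssup_count_space SUP_le_iff ennreal_le_iff)
  also have "\<dots> \<longleftrightarrow> (\<forall>P. adm q P \<longrightarrow> (\<Sum>k\<in>P. b k powr ex q) \<le> X powr ex q)"
  proof -
    have all: "(\<forall>P. P = {} \<or> (\<exists>k. P = {k}) \<longrightarrow> S P \<le> Y) \<longleftrightarrow> S {} \<le> Y \<and> (\<forall>k. S {k} \<le> Y)"
      for S :: "'k set \<Rightarrow> real" and Y by blast
    show ?thesis unfolding a all using True X b by (simp add: ex_def)
  qed
  finally show ?thesis .
next
  case False
  have "lq_norm q (\<lambda>k. ennreal (b k)) \<le> ennreal X \<longleftrightarrow>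
    (\<integral>\<^sup>+k. ennreal (b k powr ex q) \<partial>count_space UNIV) \<le> ennreal (X powr ex q)"
    unfolding lq_norm_def Lp_norm_alt[OF q False] using ex_pos[OF q] X b
    by (simp add: ennreal_powr_le_iff ennreal_powr_ennreal)
  also have "\<dots> \<longleftrightarrow> (\<forall>P. adm q P \<longrightarrow> (\<Sum>k\<in>P. b k powr ex q) \<le> X powr ex q)"
    unfolding nn_integral_count_le_iff using False by (simp add: adm_def sum_nonneg)
  finally show ?thesis .
qed

lemma lq_norm_measurable:
  fixes g :: "'k::countable \<Rightarrow> 'a \<Rightarrow> real"
  assumes q: "0 < q" and [measurable]: "\<And>k. g k \<in> borel_measurable M"
  shows "(\<lambda>x. lq_norm q (\<lambda>k. ennreal (g k x))) \<in> borel_measurable M"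
proof (cases "q = \<infinity>")
  case True
  have "(\<lambda>x. SUP k. ennreal (g k x)) \<in> borel_measurable M" by (intro borel_measurable_SUP) auto
  then show ?thesis using True by (simp add: lq_norm_def Lp_norm_def esssup_count_space)
next
  case False
  show ?thesis
    unfolding lq_norm_def Lp_norm_alt[OF q False] nn_integral_count_suminf
    by measurable
qed

lemma lq_norm_ge:
  fixes b :: "'k::countable \<Rightarrow> real"
  assumes q: "0 < q" and b: "\<And>k. 0 \<le> b k" and P: "adm q P"
  shows "ennreal (\<Sum>k\<in>P. b k powr ex q) \<le> ennreal_powr (lq_norm q (\<lambda>k. ennreal (b k))) (ex q)"
proof (cases "lq_norm q (\<lambda>k. ennreal (b k))")
  case (real X)
  then have "(\<Sum>k\<in>P. b k powr ex q) \<le> X powr ex q"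
    using lq_norm_le_iff[where b=b and q=q and X=X, OF q b real(1)] P by simp
  then show ?thesis using real by (simp add: ennreal_powr_ennreal ennreal_leI)
qed (simp add: ennreal_powr_def)

lemma adm_translate: "adm q P \<Longrightarrow> adm q ((\<lambda>k. k + l) ` P)" for l :: "'k::ab_group_add"
  unfolding adm_def by (metis card_image_le finite_imageI le_trans)

text \<open>Bounding the sum by its number of terms times the largest one gives a constant that is
  good for exponents below and above 1 alike.\<close>

lemma sum_powr_le:
  fixes a :: "'l \<Rightarrow> real"
  assumes "finite L" "\<And>l. l \<in> L \<Longrightarrow> 0 \<le> a l" "0 < r"
  shows "(\<Sum>l\<in>L. a l) powr r \<le> real (card L) powr r * (\<Sum>l\<in>L. a l powr r)"
proof (cases "L = {}")
  case False
  define m where "m = Max (a ` L)"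
  have "m \<in> a ` L" unfolding m_def using assms(1) False by (intro Max_in) auto
  then obtain l where l: "l \<in> L" "m = a l" by blast
  have "(\<Sum>l\<in>L. a l) \<le> (\<Sum>l\<in>L. m)" unfolding m_def using assms(1) by (intro sum_mono Max_ge) auto
  then have "(\<Sum>l\<in>L. a l) powr r \<le> (real (card L) * m) powr r"
    using assms by (intro powr_mono2 sum_nonneg) auto
  also have "\<dots> = real (card L) powr r * a l powr r" using l assms(2) by (simp add: powr_mult)
  also have "a l powr r \<le> (\<Sum>l\<in>L. a l powr r)" using l assms(1) by (intro member_le_sum) auto
  finally show ?thesis by (simp add: mult_left_mono)
qed simp

lemma ennreal_powr_powr: "0 < r \<Longrightarrow> 0 < s \<Longrightarrow> ennreal_powr (ennreal_powr x r) s = ennreal_powr x (r * s)"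
  by (cases x) (auto simp: ennreal_powr_def powr_powr)

text \<open>Constructs the slowly varying majorant. For finite \<open>p\<close> its
  \<open>p\<close>-th power is the weighted average of the \<open>p\<close>-th power of the
  \<open>lq\<close> norm: the weight is at most 1, which gives the supremum bound, Fubini gives the
  \<open>Lp\<close> bound, and Peetre's inequality gives slow variation. For infinite
  \<open>p\<close> the constant \<open>\<beta>\<close> does.\<close>

lemma family_average:
  fixes p q :: ennreal
  assumes p: "0 < p" and q: "0 < q"
  obtains N where "2 * DIM('a::euclidean_space) \<le> N"
   "\<And>A. 0 < A \<Longrightarrow> \<exists>C M. 0 < C \<and> (\<forall>(g :: 'k::countable \<Rightarrow> 'a \<Rightarrow> real) B \<beta>. (\<forall>k. g k \<in> borel_measurable borel) \<longrightarrow>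
      (\<forall>k x. 0 \<le> g k x \<and> g k x \<le> B k) \<longrightarrow>
      (\<forall>k x. g k x powr ex q \<le> A * (\<integral>y. g k (x - y) powr ex q * wgt N y \<partial>lborel)) \<longrightarrow> 0 \<le> \<beta> \<longrightarrow>
      Lp_norm lborel p (\<lambda>x. lq_norm q (\<lambda>k. ennreal (g k x))) = ennreal \<beta> \<longrightarrow>
      (\<exists>J. J \<in> borel_measurable borel \<and> (\<forall>x. 0 \<le> J x \<and> J x \<le> \<beta>) \<and>
        (\<forall>x y. J (x + y) \<le> (1 + norm y) ^ M * J x) \<and>
        (\<forall>P x. adm q P \<longrightarrow> (\<integral>y. (\<Sum>k\<in>P. g k (x - y) powr ex q) * wgt N y \<partial>lborel) \<le> C * J x powr ex q) \<and>
        (p \<noteq> \<infinity> \<longrightarrow> (\<integral>\<^sup>+x. ennreal (J x powr ex p) \<partial>lborel) \<le> ennreal (C * \<beta> powr ex p))))"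
proof (cases "p = \<infinity>")
  case True
  define N where "N = 2 * DIM('a)"
  define W where "W = (\<integral>y. wgt N (y::'a) \<partial>lborel)"
  have W: "0 < W" unfolding W_def N_def by (rule integral_wgt_pos) simp
  show thesis
  proof (rule that[of N], goal_cases)
    case 1 show ?case by (simp add: N_def)
  next
    case (2 A)
    show ?case
    proof (intro exI[of _ W] exI[of _ 0] conjI allI impI W)
      fix g :: "'k \<Rightarrow> 'a \<Rightarrow> real" and B \<beta>
      assume g[rule_format, measurable]: "\<forall>k. g k \<in> borel_measurable borel"
        and gB: "\<forall>k x. 0 \<le> g k x \<and> g k x \<le> B k" and \<beta>: "0 \<le> \<beta>"
        and L: "Lp_norm lborel p (\<lambda>x. lq_norm q (\<lambda>k. ennreal (g k x))) = ennreal \<beta>"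
      \<comment> \<open>The essential supremum controls almost every point only, which is enough
        inside an average.\<close>
      have L': "AE x in lborel. lq_norm q (\<lambda>k. ennreal (g k x)) \<le> ennreal \<beta>"
        using esssup_AE[of "\<lambda>x. lq_norm q (\<lambda>k. ennreal (g k x))" "lborel :: 'a measure"] L True
        by (simp add: Lp_norm_def)
      have D: "(\<integral>y. (\<Sum>k\<in>P. g k (x - y) powr ex q) * wgt N y \<partial>lborel) \<le> W * \<beta> powr ex q" if P: "adm q P" for P x
      proof -
        have ae: "AE z in lborel. (\<Sum>k\<in>P. g k z powr ex q) \<le> \<beta> powr ex q"
          using L'
        proof (rule AE_mp, intro AE_I2 impI)
          fix z assume "lq_norm q (\<lambda>k. ennreal (g k z)) \<le> ennreal \<beta>"
          then show "(\<Sum>k\<in>P. g k z powr ex q) \<le> \<beta> powr ex q"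
            using lq_norm_le_iff[OF q _ \<beta>, of "\<lambda>k. g k z"] gB P by simp
        qed
        have sh: "(\<integral>y. (\<Sum>k\<in>P. g k (x - y) powr ex q) * wgt N y \<partial>lborel)
          = (\<integral>z. (\<Sum>k\<in>P. g k z powr ex q) * wgt N (x - z) \<partial>lborel)"
          using integral_lborel_shift(2)[of "\<lambda>z. (\<Sum>k\<in>P. g k z powr ex q) * wgt N (x - z)" x] by simp
        also have "\<dots> \<le> (\<integral>z. \<beta> powr ex q * wgt N (x - z) \<partial>lborel)"
        proof (rule integral_mono_AE')
          show "integrable lborel (\<lambda>z. \<beta> powr ex q * wgt N (x - z))"
            by (intro integrable_mult_right integrable_lborel_shift(2) wgt_integrable) (simp add: N_def)
          show "AE z in lborel. (\<Sum>k\<in>P. g k z powr ex q) * wgt N (x - z) \<le> \<beta> powr ex q * wgt N (x - z)"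
            using ae by (rule AE_mp) (auto intro: mult_right_mono)
        qed (auto intro!: mult_nonneg_nonneg sum_nonneg)
        also have "\<dots> = \<beta> powr ex q * W"
          using integral_lborel_shift(2)[of "wgt N" x] by (simp add: W_def)
        finally show ?thesis by (simp add: mult.commute)
      qed
      show "\<exists>J. J \<in> borel_measurable borel \<and> (\<forall>x. 0 \<le> J x \<and> J x \<le> \<beta>) \<and>
        (\<forall>x y. J (x + y) \<le> (1 + norm y) ^ 0 * J x) \<and>
        (\<forall>P x. adm q P \<longrightarrow> (\<integral>y. (\<Sum>k\<in>P. g k (x - y) powr ex q) * wgt N y \<partial>lborel) \<le> W * J x powr ex q) \<and>
        (p \<noteq> \<infinity> \<longrightarrow> (\<integral>\<^sup>+x. ennreal (J x powr ex p) \<partial>lborel) \<le> ennreal (W * \<beta> powr ex p))"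
        using True \<beta> D by (intro exI[of _ "\<lambda>_. \<beta>"]) auto
    qed
  qed
next
  case False
  define q' where "q' = ex q"
  define p' where "p' = ex p"
  have q': "0 < q'" and p': "0 < p'" using ex_pos p q by (auto simp: q'_def p'_def)
  \<comment> \<open>A sum of \<open>q\<close>-th powers raised to \<open>s\<close> is bounded by the
    \<open>p\<close>-th power of the \<open>lq\<close> norm, which is the quantity whose integral is
    known.\<close>
  define s where "s = p' / q'"
  have s: "0 < s" using p' q' by (simp add: s_def)
  define M0 where "M0 = 2 * DIM('a)"
  obtain N where N: "2 * DIM('a) \<le> N" and AP:
    "\<And>A. 0 < A \<Longrightarrow> \<exists>C>0. \<forall>(d::'a \<Rightarrow> real) B. d \<in> borel_measurable borel \<longrightarrow> (\<forall>x. 0 \<le> d x) \<longrightarrow> (\<forall>x. d x \<le> B) \<longrightarrow>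
      (\<forall>x. d x \<le> A * (\<integral>y. d (x - y) * wgt N y \<partial>lborel)) \<longrightarrow>
      (\<forall>x. (\<integral>y. d (x - y) * wgt N y \<partial>lborel) powr s \<le> C * (\<integral>y. d (x - y) powr s * wgt M0 y \<partial>lborel))"
    using average_powr[OF s, of M0, where 'a='a] unfolding M0_def by blast
  define W where "W = (\<integral>y. wgt M0 (y::'a) \<partial>lborel)"
  have W: "0 < W" unfolding W_def M0_def by (rule integral_wgt_pos) simp
  have Wnn: "(\<integral>\<^sup>+y. ennreal (wgt M0 (y::'a)) \<partial>lborel) = ennreal W"
    unfolding W_def using wgt_integrable[of M0, where 'a='a] by (intro nn_integral_eq_integral) (auto simp: M0_def)
  show thesis
  proof (rule that[OF N])
    fix A :: real assume A: "0 < A"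
    obtain C1 where C1: "0 < C1" and AP1: "\<And>(d::'a \<Rightarrow> real) B x. d \<in> borel_measurable borel \<Longrightarrow> (\<And>x. 0 \<le> d x) \<Longrightarrow> (\<And>x. d x \<le> B) \<Longrightarrow>
      (\<And>x. d x \<le> A * (\<integral>y. d (x - y) * wgt N y \<partial>lborel)) \<Longrightarrow>
      (\<integral>y. d (x - y) * wgt N y \<partial>lborel) powr s \<le> C1 * (\<integral>y. d (x - y) powr s * wgt M0 y \<partial>lborel)"
      using AP[OF A] by blast
    \<comment> \<open>The first term appears on undoing the power \<open>s\<close> in the bound for
      averages; \<open>W\<close> is the mass of the weight and serves the \<open>Lp\<close>
      bound.\<close>
    define C where "C = C1 powr (1 / s) + W"
    have C: "0 < C" using C1 W by (simp add: C_def add_pos_pos)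
    \<comment> \<open>The \<open>p\<close>-th power of \<open>J\<close> varies with exponent
      \<open>M0\<close>, hence \<open>J\<close> itself with exponent \<open>M0 / p'\<close>, rounded
      up.\<close>
    define M where "M = nat \<lceil>real M0 / p'\<rceil>"
    show "\<exists>C M. 0 < C \<and> (\<forall>(g :: 'k::countable \<Rightarrow> 'a \<Rightarrow> real) B \<beta>. (\<forall>k. g k \<in> borel_measurable borel) \<longrightarrow>
      (\<forall>k x. 0 \<le> g k x \<and> g k x \<le> B k) \<longrightarrow>
      (\<forall>k x. g k x powr ex q \<le> A * (\<integral>y. g k (x - y) powr ex q * wgt N y \<partial>lborel)) \<longrightarrow> 0 \<le> \<beta> \<longrightarrow>
      Lp_norm lborel p (\<lambda>x. lq_norm q (\<lambda>k. ennreal (g k x))) = ennreal \<beta> \<longrightarrow>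
      (\<exists>J. J \<in> borel_measurable borel \<and> (\<forall>x. 0 \<le> J x \<and> J x \<le> \<beta>) \<and>
        (\<forall>x y. J (x + y) \<le> (1 + norm y) ^ M * J x) \<and>
        (\<forall>P x. adm q P \<longrightarrow> (\<integral>y. (\<Sum>k\<in>P. g k (x - y) powr ex q) * wgt N y \<partial>lborel) \<le> C * J x powr ex q) \<and>
        (p \<noteq> \<infinity> \<longrightarrow> (\<integral>\<^sup>+x. ennreal (J x powr ex p) \<partial>lborel) \<le> ennreal (C * \<beta> powr ex p))))"
    proof (rule exI[of _ C], rule exI[of _ M], intro conjI allI impI C)
      fix g :: "'k \<Rightarrow> 'a \<Rightarrow> real" and B \<beta>
      assume g[rule_format, measurable]: "\<forall>k. g k \<in> borel_measurable borel"
        and gB: "\<forall>k x. 0 \<le> g k x \<and> g k x \<le> B k" and \<beta>: "0 \<le> \<beta>"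
        and self: "\<forall>k x. g k x powr ex q \<le> A * (\<integral>y. g k (x - y) powr ex q * wgt N y \<partial>lborel)"
        and L: "Lp_norm lborel p (\<lambda>x. lq_norm q (\<lambda>k. ennreal (g k x))) = ennreal \<beta>"
      have g0: "0 \<le> g k x" and gB': "g k x \<le> B k" for k x using gB by auto
      define b where "b x = ennreal_powr (lq_norm q (\<lambda>k. ennreal (g k x))) p'" for x
      have [measurable]: "(\<lambda>x. lq_norm q (\<lambda>k. ennreal (g k x))) \<in> borel_measurable borel"
        by (rule lq_norm_measurable[OF q]) simp
      have bm [measurable]: "b \<in> borel_measurable borel" unfolding b_def by measurable
      have "(\<integral>\<^sup>+x. b x \<partial>lborel) = ennreal_powr (ennreal_powr (\<integral>\<^sup>+x. b x \<partial>lborel) (1 / p')) p'"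
        using p' by (simp add: ennreal_powr_inverse)
      also have "ennreal_powr (\<integral>\<^sup>+x. b x \<partial>lborel) (1 / p') = ennreal \<beta>"
        unfolding L[symmetric] Lp_norm_alt[OF p False] b_def p'_def ..
      finally have bint: "(\<integral>\<^sup>+x. b x \<partial>lborel) = ennreal (\<beta> powr p')" using \<beta> by (simp add: ennreal_powr_ennreal)
      \<comment> \<open>\<open>b\<close> may be infinite on a null set, so the average is formed in
        \<open>ennreal\<close> and becomes real only after its bound is known.\<close>
      define Jp where "Jp x = (\<integral>\<^sup>+y. b (x - y) * ennreal (wgt M0 y) \<partial>lborel)" for x
      have Jpm [measurable]: "Jp \<in> borel_measurable borel" unfolding Jp_def by measurable
      have Jp_le: "Jp x \<le> ennreal (\<beta> powr p')" for x
      proof -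
        have "Jp x \<le> (\<integral>\<^sup>+y. b (x - y) \<partial>lborel)"
          unfolding Jp_def
        proof (rule nn_integral_mono)
          fix y
          show "b (x - y) * ennreal (wgt M0 y) \<le> b (x - y)"
            using mult_left_mono[of "ennreal (wgt M0 y)" 1 "b (x - y)"] wgt_le_1[of M0 y] by simp
        qed
        then show ?thesis using nn_integral_lborel_shift(2)[OF bm, of x] bint by simp
      qed
      define J where "J x = enn2real (Jp x) powr (1 / p')" for x
      have Jpr: "Jp x = ennreal (enn2real (Jp x))" for x
        using Jp_le[of x] by (metis ennreal_enn2real ennreal_less_top le_less_trans)
      have J0: "0 \<le> J x" for x by (simp add: J_def)
      have JJp: "J x powr p' = enn2real (Jp x)" for x using p' by (simp add: J_def powr_powr)
      have J\<beta>: "J x \<le> \<beta>" for x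
      proof -
        have "enn2real (Jp x) \<le> \<beta> powr p'" using Jp_le[of x] by (metis Jpr enn2real_leI powr_ge_zero)
        then show ?thesis using powr_le_iff[OF p' J0 \<beta>] JJp by simp
      qed
      have sh: "Jp (x + y) \<le> ennreal ((1 + norm y) ^ M0) * Jp x" for x y
      proof -
        have "Jp (x + y) = (\<integral>\<^sup>+w. b (x + y - (y + w)) * ennreal (wgt M0 (y + w)) \<partial>lborel)"
          unfolding Jp_def by (rule nn_integral_lborel_shift(1)[symmetric]) measurable
        also have "\<dots> \<le> (\<integral>\<^sup>+w. ennreal ((1 + norm y) ^ M0) * (b (x - w) * ennreal (wgt M0 w)) \<partial>lborel)"
        proof (rule nn_integral_mono)
          fix w
          have "wgt M0 (y + w) \<le> (1 + norm (- y)) ^ M0 * wgt M0 ((y + w) + (- y))" by (rule wgt_shift)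
          then have "ennreal (wgt M0 (y + w)) \<le> ennreal ((1 + norm y) ^ M0) * ennreal (wgt M0 w)"
            by (simp add: ennreal_mult[symmetric] ennreal_leI)
          then have "b (x - w) * ennreal (wgt M0 (y + w)) \<le> b (x - w) * (ennreal ((1 + norm y) ^ M0) * ennreal (wgt M0 w))"
            by (rule mult_left_mono) simp
          then show "b (x + y - (y + w)) * ennreal (wgt M0 (y + w)) \<le> ennreal ((1 + norm y) ^ M0) * (b (x - w) * ennreal (wgt M0 w))"
            by (simp add: mult_ac)
        qed
        also have "\<dots> = ennreal ((1 + norm y) ^ M0) * Jp x" unfolding Jp_def by (rule nn_integral_cmult) measurable
        finally show ?thesis .
      qed
      have J2: "J (x + y) \<le> (1 + norm y) ^ M * J x" for x y
      proof -
        have n1: "1 \<le> 1 + norm y" by simp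
        have "ennreal (enn2real (Jp (x + y))) \<le> ennreal ((1 + norm y) ^ M0 * enn2real (Jp x))"
          using sh[of x y] Jpr by (metis ennreal_mult enn2real_nonneg norm_ge_zero add_nonneg_nonneg zero_le_one zero_le_power)
        then have "enn2real (Jp (x + y)) \<le> (1 + norm y) ^ M0 * enn2real (Jp x)"
          by (subst (asm) ennreal_le_iff) auto
        then have "J (x + y) \<le> ((1 + norm y) ^ M0 * enn2real (Jp x)) powr (1 / p')"
          unfolding J_def using p' by (intro powr_mono2) auto
        also have "\<dots> = ((1 + norm y) ^ M0) powr (1 / p') * J x" by (simp add: J_def powr_mult)
        also have "((1 + norm y) ^ M0) powr (1 / p') = (1 + norm y) powr (real M0 / p')"
          using one_norm_pos[of y] by (simp add: powr_powr flip: powr_realpow)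
        also have "\<dots> \<le> (1 + norm y) powr real M"
          using n1 unfolding M_def by (intro powr_mono real_nat_ceiling_ge)
        also have "\<dots> = (1 + norm y) ^ M" using one_norm_pos[of y] by (simp add: powr_realpow)
        finally show ?thesis using J0[of x] by (simp add: mult_right_mono)
      qed
      have J1: "(\<integral>y. (\<Sum>k\<in>P. g k (x - y) powr ex q) * wgt N y \<partial>lborel) \<le> C * J x powr ex q" if P: "adm q P" for P x
      proof -
        have fin: "finite P" using P by (simp add: adm_def)
        \<comment> \<open>The self-bound is linear in the \<open>q\<close>-th powers, so it passes
          to this sum with the same \<open>A\<close>. The constants obtained for \<open>d\<close>
          therefore do not depend on \<open>P\<close>.\<close>
        define d where "d x = (\<Sum>k\<in>P. g k x powr q')" for x
        have dm [measurable]: "d \<in> borel_measurable borel" unfolding d_def by measurable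
        have d0: "0 \<le> d x" for x unfolding d_def by (intro sum_nonneg) auto
        have dB: "d x \<le> (\<Sum>k\<in>P. B k powr q')" for x
          unfolding d_def using q' g0 gB' by (intro sum_mono powr_mono2) auto
        have gi: "integrable lborel (\<lambda>y. g k (x - y) powr q' * wgt N y)" for k x
          by (rule integrable_wgt_mult[OF powr_bounded_meas(1)[OF g g0 gB' q'] _ powr_bounded_meas(2)[OF g g0 gB' q'] N]) simp
        have dsum: "(\<integral>y. d (x - y) * wgt N y \<partial>lborel) = (\<Sum>k\<in>P. \<integral>y. g k (x - y) powr q' * wgt N y \<partial>lborel)" for x
          unfolding d_def sum_distrib_right by (rule Bochner_Integration.integral_sum) (rule gi)
        have ds: "d x \<le> A * (\<integral>y. d (x - y) * wgt N y \<partial>lborel)" for x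
          unfolding dsum sum_distrib_left using self unfolding d_def q'_def by (intro sum_mono) auto
        have "(\<integral>y. d (x - y) * wgt N y \<partial>lborel) powr s \<le> C1 * (\<integral>y. d (x - y) powr s * wgt M0 y \<partial>lborel)"
          by (rule AP1[OF dm d0 dB ds])
        also have "(\<integral>y. d (x - y) powr s * wgt M0 y \<partial>lborel) \<le> enn2real (Jp x)"
        proof -
          have i: "integrable lborel (\<lambda>y. d (x - y) powr s * wgt M0 y)"
            by (rule integrable_wgt_mult[OF powr_bounded_meas(1)[OF dm d0 dB s] _ powr_bounded_meas(2)[OF dm d0 dB s]]) (auto simp: M0_def)
          have "ennreal (\<integral>y. d (x - y) powr s * wgt M0 y \<partial>lborel) = (\<integral>\<^sup>+y. ennreal (d (x - y) powr s * wgt M0 y) \<partial>lborel)"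
            using i by (intro nn_integral_eq_integral[symmetric]) auto
          also have "\<dots> \<le> Jp x"
            unfolding Jp_def
          proof (rule nn_integral_mono)
            fix y
            have "ennreal (d (x - y)) \<le> ennreal_powr (lq_norm q (\<lambda>k. ennreal (g k (x - y)))) q'"
              unfolding d_def q'_def by (rule lq_norm_ge[OF q g0 P])
            from ennreal_powr_mono[OF this, of s]
            have "ennreal (d (x - y) powr s) \<le> b (x - y)"
              using s q' d0 by (simp add: ennreal_powr_ennreal ennreal_powr_powr b_def) (simp add: s_def)
            then show "ennreal (d (x - y) powr s * wgt M0 y) \<le> b (x - y) * ennreal (wgt M0 y)"
              by (simp add: ennreal_mult mult_right_mono)
          qed
          finally show ?thesis using Jpr[of x] by (metis ennreal_le_iff enn2real_nonneg)
        qed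
        finally have "(\<integral>y. d (x - y) * wgt N y \<partial>lborel) powr s \<le> C1 * J x powr p'"
          using C1 by (simp add: JJp)
        then have "((\<integral>y. d (x - y) * wgt N y \<partial>lborel) powr s) powr (1 / s) \<le> (C1 * J x powr p') powr (1 / s)"
          using s by (intro powr_mono2) auto
        moreover have "0 \<le> (\<integral>y. d (x - y) * wgt N y \<partial>lborel)" using d0 by (intro integral_nonneg_AE) auto
        ultimately have "(\<integral>y. d (x - y) * wgt N y \<partial>lborel) \<le> C1 powr (1 / s) * J x powr q'"
          using s C1 p' by (simp add: powr_powr powr_mult) (simp add: s_def)
        also have "\<dots> \<le> C * J x powr q'" using W by (intro mult_right_mono) (auto simp: C_def)
        finally show ?thesis by (simp add: d_def q'_def)
      qed
      have J4: "(\<integral>\<^sup>+x. ennreal (J x powr ex p) \<partial>lborel) \<le> ennreal (C * \<beta> powr ex p)"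
      proof -
        have "(\<integral>\<^sup>+x. ennreal (J x powr ex p) \<partial>lborel) = (\<integral>\<^sup>+x. Jp x \<partial>lborel)"
          using JJp Jpr unfolding p'_def by simp
        also have "\<dots> = (\<integral>\<^sup>+y. (\<integral>\<^sup>+x. b (x - y) * ennreal (wgt M0 y) \<partial>lborel) \<partial>lborel)"
          unfolding Jp_def by (rule lborel_pair.Fubini') measurable
        also have "\<dots> = (\<integral>\<^sup>+y. ennreal (\<beta> powr p') * ennreal (wgt M0 (y::'a)) \<partial>lborel)"
        proof (rule nn_integral_cong)
          fix y :: 'a
          have "(\<integral>\<^sup>+x. b (x - y) * ennreal (wgt M0 y) \<partial>lborel) = (\<integral>\<^sup>+x. b (x - y) \<partial>lborel) * ennreal (wgt M0 y)"
            by (rule nn_integral_multc) measurable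
          also have "(\<integral>\<^sup>+x. b (x - y) \<partial>lborel) = ennreal (\<beta> powr p')"
            using nn_integral_lborel_shift(1)[OF bm, of "- y"] bint by simp
          finally show "(\<integral>\<^sup>+x. b (x - y) * ennreal (wgt M0 y) \<partial>lborel) = ennreal (\<beta> powr p') * ennreal (wgt M0 y)" .
        qed
        also have "\<dots> = ennreal (\<beta> powr p') * ennreal W" by (subst nn_integral_cmult) (auto simp: Wnn)
        also have "\<dots> = ennreal (W * \<beta> powr p')" using W by (simp add: ennreal_mult[symmetric] mult.commute)
        also have "\<dots> \<le> ennreal (C * \<beta> powr ex p)" unfolding p'_def C_def by (intro ennreal_leI mult_right_mono) auto
        finally show ?thesis .
      qed
      show "\<exists>J. J \<in> borel_measurable borel \<and> (\<forall>x. 0 \<le> J x \<and> J x \<le> \<beta>) \<and>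
        (\<forall>x y. J (x + y) \<le> (1 + norm y) ^ M * J x) \<and>
        (\<forall>P x. adm q P \<longrightarrow> (\<integral>y. (\<Sum>k\<in>P. g k (x - y) powr ex q) * wgt N y \<partial>lborel) \<le> C * J x powr ex q) \<and>
        (p \<noteq> \<infinity> \<longrightarrow> (\<integral>\<^sup>+x. ennreal (J x powr ex p) \<partial>lborel) \<le> ennreal (C * \<beta> powr ex p))"
      proof (rule exI[of _ J], intro conjI allI impI J1 J2 J0 J\<beta> J4)
        show "J \<in> borel_measurable borel" unfolding J_def by measurable
      qed
    qed
  qed
qed

section \<open>Change of window and the main window estimate\<close>

definition win :: "(real ^ 'n \<Rightarrow> complex) \<Rightarrow> ('b::euclidean_space \<Rightarrow> real ^ 'n) \<Rightarrow> ('b \<Rightarrow> complex) \<Rightarrow>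
    int ^ 'n \<Rightarrow> real ^ 'n \<Rightarrow> real" where
  "win \<phi> \<rho> F k x = cmod (synth \<rho> (\<lambda>\<omega>. \<phi> (\<rho> \<omega> - of_lattice k) * F \<omega>) x)"

lemma win_nonneg [simp]: "0 \<le> win \<phi> \<rho> F k x"
  by (simp add: win_def)

lemma win_integrable:
  assumes "test_fun \<phi>" "integrable lborel F" "\<rho> \<in> borel_measurable borel"
  shows "integrable lborel (\<lambda>\<omega>. \<phi> (\<rho> \<omega> - c) * F \<omega>)"
  by (rule test_mult_integrable[where m="\<lambda>\<xi>. \<phi> (\<xi> - c)", OF rd_test_fun[OF test_fun_shift[OF assms(1)]] assms(2,3)])

lemma win_measurable:
  assumes "test_fun \<phi>" "integrable lborel F" "\<rho> \<in> borel_measurable borel"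
  shows "win \<phi> \<rho> F k \<in> borel_measurable borel"
  unfolding win_def[abs_def] by (rule synth_measurable_norm[OF win_integrable[OF assms] assms(3)])

lemma win_bounded:
  assumes "test_fun \<phi>" "integrable lborel F" "\<rho> \<in> borel_measurable borel"
  shows "win \<phi> \<rho> F k x \<le> (\<integral>\<omega>. cmod (\<phi> (\<rho> \<omega> - of_lattice k) * F \<omega>) \<partial>lborel)"
  unfolding win_def by (rule synth_bound[OF win_integrable[OF assms] assms(3)])

text \<open>A cut-off \<open>\<theta>\<close> equal to 1 on the support of \<open>\<kappa>\<close>
  reproduces every window, so the kernel estimate for \<open>\<theta>\<close> bounds a window by an
  average of itself.\<close>

lemma window_self:
  fixes \<kappa> :: "real ^ 'n \<Rightarrow> complex"
  assumes w: "wiener_window \<kappa>" and N: "2 * DIM(real ^ 'n) \<le> N"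
  obtains C where "0 < C" "\<And>(\<rho> :: 'b::euclidean_space \<Rightarrow> real ^ 'n) F k x. integrable lborel F \<Longrightarrow>
    \<rho> \<in> borel_measurable borel \<Longrightarrow> win \<kappa> \<rho> F k x \<le> C * (\<integral>y. win \<kappa> \<rho> F k (x - y) * wgt N y \<partial>lborel)"
proof -
  note \<kappa> = wiener_window_test[OF w]
  obtain R where R: "R > 0" "\<And>x. \<kappa> x \<noteq> 0 \<Longrightarrow> norm x < R" using test_fun_bounded_supp[OF \<kappa>] by blast
  obtain \<theta> :: "real ^ 'n \<Rightarrow> complex" where \<theta>: "test_fun \<theta>" "\<And>\<xi>. norm \<xi> \<le> R \<Longrightarrow> \<theta> \<xi> = 1"
    using cutoff_exists[OF w] by blast
  have \<theta>\<kappa>: "\<theta> \<xi> * \<kappa> \<xi> = \<kappa> \<xi>" for \<xi> using R(2)[of \<xi>] \<theta>(2)[of \<xi>] by (cases "\<kappa> \<xi> = 0") auto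
  obtain C where C: "C > 0" "\<And>(\<rho> :: 'b \<Rightarrow> real ^ 'n) F k x. integrable lborel F \<Longrightarrow> \<rho> \<in> borel_measurable borel \<Longrightarrow>
      cmod (synth \<rho> (\<lambda>\<omega>. \<theta> (\<rho> \<omega> - k) * F \<omega>) x) \<le> C * (\<integral>y. cmod (synth \<rho> F (x - y)) * wgt N y \<partial>lborel)"
    using synth_window_le[OF \<theta>(1) N] by blast
  show thesis
  proof (rule that[OF C(1)])
    fix \<rho> :: "'b \<Rightarrow> real ^ 'n" and F :: "'b \<Rightarrow> complex" and k x
    assume F: "integrable lborel F" and \<rho>: "\<rho> \<in> borel_measurable borel"
    from C(2)[OF win_integrable[OF \<kappa> F \<rho>] \<rho>, of "of_lattice k" "of_lattice k" x]
    show "win \<kappa> \<rho> F k x \<le> C * (\<integral>y. win \<kappa> \<rho> F k (x - y) * wgt N y \<partial>lborel)"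
      by (simp add: win_def mult.assoc[symmetric] \<theta>\<kappa>)
  qed
qed

lemma synth_sum:
  assumes "finite L" "\<And>l. l \<in> L \<Longrightarrow> integrable lborel (F l)" "\<rho> \<in> borel_measurable borel"
  shows "synth \<rho> (\<lambda>\<omega>. \<Sum>l\<in>L. F l \<omega>) x = (\<Sum>l\<in>L. synth \<rho> (F l) x)"
  unfolding synth_def sum_distrib_left
  by (intro Bochner_Integration.integral_sum synth_integrable assms)

text \<open>Decomposes the window \<open>\<phi>\<close> into neighbouring windows
  \<open>\<kappa>\<close>; the kernel of the common factor \<open>m\<close> turns each of them into
  an average.\<close>

lemma window_step:
  fixes \<kappa> \<phi> :: "real ^ 'n \<Rightarrow> complex"
  assumes w: "wiener_window \<kappa>" and \<phi>: "test_fun \<phi>" and N: "2 * DIM(real ^ 'n) \<le> N"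
  obtains C L where "0 < C" "finite L" "\<And>(\<rho> :: 'b::euclidean_space \<Rightarrow> real ^ 'n) F \<mu> x. integrable lborel F \<Longrightarrow>
    \<rho> \<in> borel_measurable borel \<Longrightarrow>
    win \<phi> \<rho> F \<mu> x \<le> C * (\<Sum>l\<in>L. \<integral>y. win \<kappa> \<rho> F (\<mu> + l) (x - y) * wgt N y \<partial>lborel)"
proof -
  note \<kappa> = wiener_window_test[OF w]
  obtain L m where L: "finite L" "test_fun m"
    "\<And>\<mu> \<xi>. \<phi> (\<xi> - of_lattice \<mu>) = (\<Sum>l\<in>L. m (\<xi> - of_lattice \<mu>) * \<kappa> (\<xi> - of_lattice (\<mu> + l)))"
    using window_decomp[OF w \<phi>] by blast
  obtain C where C: "C > 0" "\<And>(\<rho> :: 'b \<Rightarrow> real ^ 'n) F k x. integrable lborel F \<Longrightarrow> \<rho> \<in> borel_measurable borel \<Longrightarrow>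
      cmod (synth \<rho> (\<lambda>\<omega>. m (\<rho> \<omega> - k) * F \<omega>) x) \<le> C * (\<integral>y. cmod (synth \<rho> F (x - y)) * wgt N y \<partial>lborel)"
    using synth_window_le[OF L(2) N] by blast
  show thesis
  proof (rule that[OF C(1) L(1)])
    fix \<rho> :: "'b \<Rightarrow> real ^ 'n" and F :: "'b \<Rightarrow> complex" and \<mu> x
    assume F: "integrable lborel F" and \<rho>: "\<rho> \<in> borel_measurable borel"
    define H where "H l \<omega> = m (\<rho> \<omega> - of_lattice \<mu>) * (\<kappa> (\<rho> \<omega> - of_lattice (\<mu> + l)) * F \<omega>)" for l \<omega>
    have "win \<phi> \<rho> F \<mu> x = cmod (synth \<rho> (\<lambda>\<omega>. \<Sum>l\<in>L. H l \<omega>) x)"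
      unfolding win_def L(3) H_def by (simp add: sum_distrib_right mult.assoc)
    also have "\<dots> = cmod (\<Sum>l\<in>L. synth \<rho> (H l) x)"
      using L \<kappa> F \<rho> unfolding H_def by (subst synth_sum) (auto intro!: win_integrable)
    also have "\<dots> \<le> (\<Sum>l\<in>L. cmod (synth \<rho> (H l) x))" by (rule norm_sum)
    also have "\<dots> \<le> (\<Sum>l\<in>L. C * (\<integral>y. win \<kappa> \<rho> F (\<mu> + l) (x - y) * wgt N y \<partial>lborel))"
      unfolding H_def win_def by (intro sum_mono C(2) win_integrable \<kappa> F \<rho>)
    finally show "win \<phi> \<rho> F \<mu> x \<le> C * (\<Sum>l\<in>L. \<integral>y. win \<kappa> \<rho> F (\<mu> + l) (x - y) * wgt N y \<partial>lborel)"
      by (simp add: sum_distrib_left)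
  qed
qed

text \<open>Adds that the \<open>s\<close>-th power of \<open>d\<close> is again bounded by its own
  average. With \<open>s = ex q\<close> this is the hypothesis that \<open>family_average\<close>
  puts on the windows.\<close>

lemma average_powr':
  assumes s: "0 < s" and M: "2 * DIM('a::euclidean_space) \<le> M"
  obtains N where "2 * DIM('a) \<le> N"
    "\<And>A. 0 < A \<Longrightarrow> \<exists>C>0. \<forall>(d::'a \<Rightarrow> real) B. d \<in> borel_measurable borel \<longrightarrow> (\<forall>x. 0 \<le> d x) \<longrightarrow> (\<forall>x. d x \<le> B) \<longrightarrow>
      (\<forall>x. d x \<le> A * (\<integral>y. d (x - y) * wgt N y \<partial>lborel)) \<longrightarrow>
      (\<forall>x. (\<integral>y. d (x - y) * wgt N y \<partial>lborel) powr s \<le> C * (\<integral>y. d (x - y) powr s * wgt M y \<partial>lborel) \<and>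
        d x powr s \<le> A powr s * C * (\<integral>y. d (x - y) powr s * wgt M y \<partial>lborel))"
proof -
  obtain N where N: "2 * DIM('a) \<le> N" and AP:
    "\<And>A. 0 < A \<Longrightarrow> \<exists>C>0. \<forall>(d::'a \<Rightarrow> real) B. d \<in> borel_measurable borel \<longrightarrow> (\<forall>x. 0 \<le> d x) \<longrightarrow> (\<forall>x. d x \<le> B) \<longrightarrow>
      (\<forall>x. d x \<le> A * (\<integral>y. d (x - y) * wgt N y \<partial>lborel)) \<longrightarrow>
      (\<forall>x. (\<integral>y. d (x - y) * wgt N y \<partial>lborel) powr s \<le> C * (\<integral>y. d (x - y) powr s * wgt M y \<partial>lborel))"
    using average_powr[OF s M] by blast
  show thesis
  proof (rule that[OF N])
    fix A :: real assume A: "0 < A"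
    obtain C where C: "0 < C" and *: "\<And>(d::'a \<Rightarrow> real) B x. d \<in> borel_measurable borel \<Longrightarrow> (\<And>x. 0 \<le> d x) \<Longrightarrow> (\<And>x. d x \<le> B) \<Longrightarrow>
      (\<And>x. d x \<le> A * (\<integral>y. d (x - y) * wgt N y \<partial>lborel)) \<Longrightarrow>
      (\<integral>y. d (x - y) * wgt N y \<partial>lborel) powr s \<le> C * (\<integral>y. d (x - y) powr s * wgt M y \<partial>lborel)"
      using AP[OF A] by blast
    have "d x powr s \<le> A powr s * C * (\<integral>y. d (x - y) powr s * wgt M y \<partial>lborel)"
      if d: "d \<in> borel_measurable borel" "\<And>x. 0 \<le> d x" "\<And>x. d x \<le> B"
        "\<And>x. d x \<le> A * (\<integral>y. d (x - y) * wgt N y \<partial>lborel)" for d :: "'a \<Rightarrow> real" and B x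
    proof -
      have nn: "0 \<le> (\<integral>y. d (x - y) * wgt N y \<partial>lborel)" using d(2) by (intro integral_nonneg_AE) auto
      have "d x powr s \<le> (A * (\<integral>y. d (x - y) * wgt N y \<partial>lborel)) powr s"
        using s d by (intro powr_mono2) auto
      also have "\<dots> = A powr s * (\<integral>y. d (x - y) * wgt N y \<partial>lborel) powr s" using A nn by (simp add: powr_mult)
      also have "\<dots> \<le> A powr s * (C * (\<integral>y. d (x - y) powr s * wgt M y \<partial>lborel))"
        by (intro mult_left_mono *[OF d]) auto
      finally show ?thesis by (simp add: mult.assoc)
    qed
    then show "\<exists>C>0. \<forall>(d::'a \<Rightarrow> real) B. d \<in> borel_measurable borel \<longrightarrow> (\<forall>x. 0 \<le> d x) \<longrightarrow> (\<forall>x. d x \<le> B) \<longrightarrow>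
      (\<forall>x. d x \<le> A * (\<integral>y. d (x - y) * wgt N y \<partial>lborel)) \<longrightarrow>
      (\<forall>x. (\<integral>y. d (x - y) * wgt N y \<partial>lborel) powr s \<le> C * (\<integral>y. d (x - y) powr s * wgt M y \<partial>lborel) \<and>
        d x powr s \<le> A powr s * C * (\<integral>y. d (x - y) powr s * wgt M y \<partial>lborel))"
      using C * by blast
  qed
qed

text \<open>Two averaging rounds whose weights are chosen backwards: \<open>N1\<close> is what
  passing to the \<open>Lp\<close> norm asks for, and \<open>N0\<close> is then chosen so that
  averages of windows with weight \<open>N0\<close>, raised to the power \<open>ex q\<close>, are
  controlled by averages with weight \<open>N1\<close>. The kernel constants are taken only after
  both are fixed.\<close>

theorem window_bound:
  fixes \<kappa> \<phi> :: "real ^ 'n \<Rightarrow> complex"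
  assumes w: "wiener_window \<kappa>" and \<phi>: "test_fun \<phi>" and p: "0 < p" and q: "0 < q"
  obtains C M where "0 < C" "\<And>(\<rho> :: 'b::euclidean_space \<Rightarrow> real ^ 'n) F \<beta>. integrable lborel F \<Longrightarrow>
    \<rho> \<in> borel_measurable borel \<Longrightarrow> 0 \<le> \<beta> \<Longrightarrow> wiener_norm \<kappa> p q (distr_of_fun (synth \<rho> F)) = ennreal \<beta> \<Longrightarrow>
    \<exists>J. J \<in> borel_measurable borel \<and> (\<forall>x. 0 \<le> J x \<and> J x \<le> \<beta>) \<and>
        (\<forall>x y. J (x + y) \<le> (1 + norm y) ^ M * J x) \<and>
        (\<forall>x. lq_norm q (\<lambda>k. ennreal (win \<phi> \<rho> F k x)) \<le> ennreal (C * J x)) \<and>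
        (p \<noteq> \<infinity> \<longrightarrow> (\<integral>\<^sup>+x. ennreal (J x powr ex p) \<partial>lborel) \<le> ennreal (C * \<beta> powr ex p))"
proof -
  note \<kappa> = wiener_window_test[OF w]
  note q' = ex_pos[OF q]
  obtain N1 where N1: "2 * DIM(real ^ 'n) \<le> N1" and FA:
   "\<And>A. 0 < A \<Longrightarrow> \<exists>C M. 0 < C \<and> (\<forall>(g :: int ^ 'n \<Rightarrow> real ^ 'n \<Rightarrow> real) B \<beta>. (\<forall>k. g k \<in> borel_measurable borel) \<longrightarrow>
      (\<forall>k x. 0 \<le> g k x \<and> g k x \<le> B k) \<longrightarrow>
      (\<forall>k x. g k x powr ex q \<le> A * (\<integral>y. g k (x - y) powr ex q * wgt N1 y \<partial>lborel)) \<longrightarrow> 0 \<le> \<beta> \<longrightarrow>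
      Lp_norm lborel p (\<lambda>x. lq_norm q (\<lambda>k. ennreal (g k x))) = ennreal \<beta> \<longrightarrow>
      (\<exists>J. J \<in> borel_measurable borel \<and> (\<forall>x. 0 \<le> J x \<and> J x \<le> \<beta>) \<and>
        (\<forall>x y. J (x + y) \<le> (1 + norm y) ^ M * J x) \<and>
        (\<forall>P x. adm q P \<longrightarrow> (\<integral>y. (\<Sum>k\<in>P. g k (x - y) powr ex q) * wgt N1 y \<partial>lborel) \<le> C * J x powr ex q) \<and>
        (p \<noteq> \<infinity> \<longrightarrow> (\<integral>\<^sup>+x. ennreal (J x powr ex p) \<partial>lborel) \<le> ennreal (C * \<beta> powr ex p))))"
    using family_average[OF p q, where 'a="real ^ 'n" and 'k="int ^ 'n"] by blast
  obtain N0 where N0: "2 * DIM(real ^ 'n) \<le> N0" and AP: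
    "\<And>A. 0 < A \<Longrightarrow> \<exists>C>0. \<forall>(d::real ^ 'n \<Rightarrow> real) B. d \<in> borel_measurable borel \<longrightarrow> (\<forall>x. 0 \<le> d x) \<longrightarrow> (\<forall>x. d x \<le> B) \<longrightarrow>
      (\<forall>x. d x \<le> A * (\<integral>y. d (x - y) * wgt N0 y \<partial>lborel)) \<longrightarrow>
      (\<forall>x. (\<integral>y. d (x - y) * wgt N0 y \<partial>lborel) powr ex q \<le> C * (\<integral>y. d (x - y) powr ex q * wgt N1 y \<partial>lborel) \<and>
        d x powr ex q \<le> A powr ex q * C * (\<integral>y. d (x - y) powr ex q * wgt N1 y \<partial>lborel))"
    using average_powr'[OF q' N1] by blast
  obtain Cs where Cs: "0 < Cs" and self: "\<And>(\<rho> :: 'b \<Rightarrow> real ^ 'n) F k x. integrable lborel F \<Longrightarrow>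
    \<rho> \<in> borel_measurable borel \<Longrightarrow> win \<kappa> \<rho> F k x \<le> Cs * (\<integral>y. win \<kappa> \<rho> F k (x - y) * wgt N0 y \<partial>lborel)"
    using window_self[OF w N0] by blast
  obtain C\<phi> L where C\<phi>: "0 < C\<phi>" and L: "finite L" and step: "\<And>(\<rho> :: 'b \<Rightarrow> real ^ 'n) F \<mu> x. integrable lborel F \<Longrightarrow>
    \<rho> \<in> borel_measurable borel \<Longrightarrow>
    win \<phi> \<rho> F \<mu> x \<le> C\<phi> * (\<Sum>l\<in>L. \<integral>y. win \<kappa> \<rho> F (\<mu> + l) (x - y) * wgt N0 y \<partial>lborel)"
    using window_step[OF w \<phi> N0] by blast
  obtain C0 where C0: "0 < C0" and AP0: "\<And>(d::real ^ 'n \<Rightarrow> real) B x. d \<in> borel_measurable borel \<Longrightarrow> (\<And>x. 0 \<le> d x) \<Longrightarrow> (\<And>x. d x \<le> B) \<Longrightarrow>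
      (\<And>x. d x \<le> Cs * (\<integral>y. d (x - y) * wgt N0 y \<partial>lborel)) \<Longrightarrow>
      (\<integral>y. d (x - y) * wgt N0 y \<partial>lborel) powr ex q \<le> C0 * (\<integral>y. d (x - y) powr ex q * wgt N1 y \<partial>lborel) \<and>
        d x powr ex q \<le> Cs powr ex q * C0 * (\<integral>y. d (x - y) powr ex q * wgt N1 y \<partial>lborel)"
    using AP[OF Cs] by blast
  define A1 where "A1 = Cs powr ex q * C0"
  have A1: "0 < A1" using Cs C0 by (simp add: A1_def)
  obtain C1 M where C1: "0 < C1" and FA1: "\<And>(g :: int ^ 'n \<Rightarrow> real ^ 'n \<Rightarrow> real) B \<beta>. (\<And>k. g k \<in> borel_measurable borel) \<Longrightarrow>
      (\<And>k x. 0 \<le> g k x \<and> g k x \<le> B k) \<Longrightarrow>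
      (\<And>k x. g k x powr ex q \<le> A1 * (\<integral>y. g k (x - y) powr ex q * wgt N1 y \<partial>lborel)) \<Longrightarrow> 0 \<le> \<beta> \<Longrightarrow>
      Lp_norm lborel p (\<lambda>x. lq_norm q (\<lambda>k. ennreal (g k x))) = ennreal \<beta> \<Longrightarrow>
      (\<exists>J. J \<in> borel_measurable borel \<and> (\<forall>x. 0 \<le> J x \<and> J x \<le> \<beta>) \<and>
        (\<forall>x y. J (x + y) \<le> (1 + norm y) ^ M * J x) \<and>
        (\<forall>P x. adm q P \<longrightarrow> (\<integral>y. (\<Sum>k\<in>P. g k (x - y) powr ex q) * wgt N1 y \<partial>lborel) \<le> C1 * J x powr ex q) \<and>
        (p \<noteq> \<infinity> \<longrightarrow> (\<integral>\<^sup>+x. ennreal (J x powr ex p) \<partial>lborel) \<le> ennreal (C1 * \<beta> powr ex p)))"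
    using FA[OF A1] by blast
  \<comment> \<open>In this order: the kernel bound for the change of window, the power of a sum
    over \<open>L\<close>, the number of shifts, and the constants of the two averaging
    rounds.\<close>
  define K where "K = C\<phi> powr ex q * (real (card L) powr ex q * (real (card L) * (C0 * C1)))"
  have K: "0 \<le> K" using C0 C1 by (simp add: K_def)
  define C where "C = K powr (1 / ex q) + C1"
  have C: "0 < C" using C1 by (simp add: C_def add_nonneg_pos)
  show thesis
  proof (rule that[OF C, of M])
    fix \<rho> :: "'b \<Rightarrow> real ^ 'n" and F :: "'b \<Rightarrow> complex" and \<beta>
    assume F: "integrable lborel F" and \<rho>: "\<rho> \<in> borel_measurable borel" and \<beta>: "0 \<le> \<beta>"
      and W: "wiener_norm \<kappa> p q (distr_of_fun (synth \<rho> F)) = ennreal \<beta>"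
    define g where "g = win \<kappa> \<rho> F"
    note gm = win_measurable[OF \<kappa> F \<rho>, folded g_def]
    note gB = win_bounded[OF \<kappa> F \<rho>, folded g_def]
    have g0: "0 \<le> g k x" for k x by (simp add: g_def)
    note gAP = AP0[OF gm g0 gB self[OF F \<rho>, folded g_def]]
    have gL: "Lp_norm lborel p (\<lambda>x. lq_norm q (\<lambda>k. ennreal (g k x))) = ennreal \<beta>"
      unfolding W[symmetric] wiener_norm_synth[OF w F \<rho>] by (simp add: g_def win_def)
    have gA: "g k x powr ex q \<le> A1 * (\<integral>y. g k (x - y) powr ex q * wgt N1 y \<partial>lborel)" for k x
      using gAP unfolding A1_def by blast
    obtain J where Jm: "J \<in> borel_measurable borel" and J0: "\<And>x. 0 \<le> J x" and J\<beta>: "\<And>x. J x \<le> \<beta>"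
      and J2: "\<And>x y. J (x + y) \<le> (1 + norm y) ^ M * J x"
      and J1: "\<And>P x. adm q P \<Longrightarrow> (\<integral>y. (\<Sum>k\<in>P. g k (x - y) powr ex q) * wgt N1 y \<partial>lborel) \<le> C1 * J x powr ex q"
      and J4: "p \<noteq> \<infinity> \<longrightarrow> (\<integral>\<^sup>+x. ennreal (J x powr ex p) \<partial>lborel) \<le> ennreal (C1 * \<beta> powr ex p)"
      using FA1[where g=g and \<beta>=\<beta>, OF gm conjI[OF g0 gB] gA \<beta> gL] by blast
    have gi: "integrable lborel (\<lambda>y. g k (x - y) powr ex q * wgt N1 y)" for k x
      by (rule integrable_wgt_mult[OF powr_bounded_meas(1)[OF gm g0 gB q'] _ powr_bounded_meas(2)[OF gm g0 gB q'] N1]) simp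
    have "lq_norm q (\<lambda>k. ennreal (win \<phi> \<rho> F k x)) \<le> ennreal (C * J x)" for x
    proof (subst lq_norm_le_iff[OF q])
      show "0 \<le> C * J x" using C J0 by simp
      show "\<forall>P. adm q P \<longrightarrow> (\<Sum>k\<in>P. win \<phi> \<rho> F k x powr ex q) \<le> (C * J x) powr ex q"
      proof (intro allI impI)
        fix P :: "(int ^ 'n) set" assume P: "adm q P"
        have fin: "finite P" using P by (simp add: adm_def)
        define I where "I k = (\<integral>y. g k (x - y) * wgt N0 y \<partial>lborel)" for k
        have I0: "0 \<le> I k" for k unfolding I_def using g0 by (intro integral_nonneg_AE) auto
        have "(\<Sum>\<mu>\<in>P. win \<phi> \<rho> F \<mu> x powr ex q) \<le> (\<Sum>\<mu>\<in>P. (C\<phi> * (\<Sum>l\<in>L. I (\<mu> + l))) powr ex q)"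
          using q' step[OF F \<rho>] unfolding I_def g_def by (intro sum_mono powr_mono2) auto
        also have "\<dots> = (\<Sum>\<mu>\<in>P. C\<phi> powr ex q * (\<Sum>l\<in>L. I (\<mu> + l)) powr ex q)"
          using C\<phi> I0 by (intro sum.cong refl) (simp add: powr_mult sum_nonneg)
        also have "\<dots> \<le> (\<Sum>\<mu>\<in>P. C\<phi> powr ex q * (real (card L) powr ex q * (\<Sum>l\<in>L. I (\<mu> + l) powr ex q)))"
          using I0 q' L by (intro sum_mono mult_left_mono sum_powr_le) auto
        also have "\<dots> \<le> (\<Sum>\<mu>\<in>P. C\<phi> powr ex q * (real (card L) powr ex q * (\<Sum>l\<in>L. C0 * (\<integral>y. g (\<mu> + l) (x - y) powr ex q * wgt N1 y \<partial>lborel))))"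
          unfolding I_def by (intro sum_mono mult_left_mono gAP[THEN conjunct1]) auto
        also have "\<dots> = C\<phi> powr ex q * (real (card L) powr ex q * (\<Sum>l\<in>L. C0 * (\<Sum>\<mu>\<in>P. \<integral>y. g (\<mu> + l) (x - y) powr ex q * wgt N1 y \<partial>lborel)))"
          unfolding sum_distrib_left[symmetric] by (subst sum.swap) (simp add: sum_distrib_left)
        also have "\<dots> \<le> C\<phi> powr ex q * (real (card L) powr ex q * (\<Sum>l\<in>L. C0 * (C1 * J x powr ex q)))"
        proof (intro mult_left_mono sum_mono)
          fix l
          \<comment> \<open>Admissible index sets are stable under translation, so every shift
            \<open>l\<close> is bounded by the same \<open>J x\<close>.\<close>
          have "(\<Sum>\<mu>\<in>P. \<integral>y. g (\<mu> + l) (x - y) powr ex q * wgt N1 y \<partial>lborel)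
            = (\<Sum>k\<in>(\<lambda>k. k + l) ` P. \<integral>y. g k (x - y) powr ex q * wgt N1 y \<partial>lborel)"
            by (subst sum.reindex) (auto simp: inj_on_def)
          also have "\<dots> = (\<integral>y. (\<Sum>k\<in>(\<lambda>k. k + l) ` P. g k (x - y) powr ex q) * wgt N1 y \<partial>lborel)"
            unfolding sum_distrib_right by (rule Bochner_Integration.integral_sum[symmetric]) (rule gi)
          also have "\<dots> \<le> C1 * J x powr ex q" by (rule J1[OF adm_translate[OF P]])
          finally show "(\<Sum>\<mu>\<in>P. \<integral>y. g (\<mu> + l) (x - y) powr ex q * wgt N1 y \<partial>lborel) \<le> C1 * J x powr ex q" .
        qed (use C0 in auto)
        also have "\<dots> = K * J x powr ex q" by (simp add: K_def mult_ac)
        also have "\<dots> = (K powr (1 / ex q) * J x) powr ex q" using K J0 q' by (simp add: powr_mult powr_powr)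
        also have "\<dots> \<le> (C * J x) powr ex q" using J0 C1 q' by (intro powr_mono2 mult_right_mono) (auto simp: C_def)
        finally show "(\<Sum>k\<in>P. win \<phi> \<rho> F k x powr ex q) \<le> (C * J x) powr ex q" .
      qed
    qed simp
    moreover have "p \<noteq> \<infinity> \<longrightarrow> (\<integral>\<^sup>+x. ennreal (J x powr ex p) \<partial>lborel) \<le> ennreal (C * \<beta> powr ex p)"
    proof
      assume "p \<noteq> \<infinity>"
      then have "(\<integral>\<^sup>+x. ennreal (J x powr ex p) \<partial>lborel) \<le> ennreal (C1 * \<beta> powr ex p)" using J4 by blast
      also have "\<dots> \<le> ennreal (C * \<beta> powr ex p)" unfolding C_def by (intro ennreal_leI mult_right_mono) auto
      finally show "(\<integral>\<^sup>+x. ennreal (J x powr ex p) \<partial>lborel) \<le> ennreal (C * \<beta> powr ex p)" .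
    qed
    ultimately show "\<exists>J. J \<in> borel_measurable borel \<and> (\<forall>x. 0 \<le> J x \<and> J x \<le> \<beta>) \<and>
        (\<forall>x y. J (x + y) \<le> (1 + norm y) ^ M * J x) \<and>
        (\<forall>x. lq_norm q (\<lambda>k. ennreal (win \<phi> \<rho> F k x)) \<le> ennreal (C * J x)) \<and>
        (p \<noteq> \<infinity> \<longrightarrow> (\<integral>\<^sup>+x. ennreal (J x powr ex p) \<partial>lborel) \<le> ennreal (C * \<beta> powr ex p))"
      using Jm J0 J\<beta> J2 by (intro exI[of _ J]) blast
  qed
qed

section \<open>The upper bound\<close>

lemma ex_ennreal: "0 < p \<Longrightarrow> p \<noteq> \<infinity> \<Longrightarrow> p = ennreal (ex p)"
  by (simp add: ex_def less_top[symmetric])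

lemma one_divide_ex: "0 < p \<Longrightarrow> 1 / p = (if p = \<infinity> then 0 else ennreal (1 / ex p))"
proof (cases "p = \<infinity>")
  case False
  assume p: "0 < p"
  have "1 / p = ennreal 1 / ennreal (ex p)" using ex_ennreal[OF p False] by simp
  also have "\<dots> = ennreal (1 / ex p)" using ex_pos[OF p] by (subst divide_ennreal) auto
  finally show ?thesis using False by simp
qed simp

text \<open>Pointwise substitute for Hoelder's inequality. With \<open>m\<close> the larger of the
  two powers, the product is at most \<open>m\<close> to a power whose exponent, multiplied by
  \<open>ex p\<close>, is at least 1. Since \<open>m \<le> 1\<close>, any surplus in the exponents
  only helps; this is where boundedness replaces equality of the exponents.\<close>

lemma prod_powr_le:
  assumes u: "0 \<le> u" "u \<le> 1" and v: "0 \<le> v" "v \<le> 1" and p: "0 < p" "p \<noteq> \<infinity>" "0 < p\<^sub>1" "0 < p\<^sub>2"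
    and le: "1 / p\<^sub>1 + 1 / p\<^sub>2 \<ge> 1 / p"
  shows "(u * v) powr ex p \<le> (if p\<^sub>1 = \<infinity> then 0 else u powr ex p\<^sub>1) + (if p\<^sub>2 = \<infinity> then 0 else v powr ex p\<^sub>2)"
proof -
  note e = ex_pos[OF p(1)] ex_pos[OF p(3)] ex_pos[OF p(4)]
  \<comment> \<open>Covers the cases with exactly one infinite exponent: the factor belonging to it
    is at most 1 and is dropped.\<close>
  have one: "(s * t) powr ex p \<le> t powr r" if "0 \<le> s" "s \<le> 1" "0 \<le> t" "t \<le> 1" "0 < r" "1 / ex p \<le> 1 / r" for s t r :: real
  proof -
    have "r \<le> ex p" using that e(1) by (simp add: field_simps)
    have "(s * t) powr ex p \<le> t powr ex p"
      using that e(1) by (intro powr_mono2) (auto simp: mult_left_le_one_le)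
    also have "\<dots> \<le> t powr r" using \<open>r \<le> ex p\<close> that by (intro powr_mono') auto
    finally show ?thesis .
  qed
  consider "p\<^sub>1 = \<infinity>" "p\<^sub>2 = \<infinity>" | "p\<^sub>1 = \<infinity>" "p\<^sub>2 \<noteq> \<infinity>" | "p\<^sub>1 \<noteq> \<infinity>" "p\<^sub>2 = \<infinity>" | "p\<^sub>1 \<noteq> \<infinity>" "p\<^sub>2 \<noteq> \<infinity>" by blast
  then show ?thesis
  proof cases
    case 1
    then show ?thesis using le p e(1) by (simp add: one_divide_ex)
  next
    case 2
    then have "1 / ex p \<le> 1 / ex p\<^sub>2" using le p e by (simp add: one_divide_ex ennreal_le_iff)
    from one[OF u v e(3) this] show ?thesis using 2 by simp
  next
    case 3
    then have "1 / ex p \<le> 1 / ex p\<^sub>1" using le p e by (simp add: one_divide_ex ennreal_le_iff)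
    from one[OF v u e(2) this] show ?thesis using 3 by (simp add: mult.commute)
  next
    case 4
    then have ineq: "1 / ex p \<le> 1 / ex p\<^sub>1 + 1 / ex p\<^sub>2"
      using le p e by (simp add: one_divide_ex flip: ennreal_plus)
    define m where "m = max (u powr ex p\<^sub>1) (v powr ex p\<^sub>2)"
    have m: "0 \<le> m" "m \<le> 1" using u v e powr_mono2[of "ex p\<^sub>1" u 1] powr_mono2[of "ex p\<^sub>2" v 1]
      by (auto simp: m_def le_max_iff_disj)
    have "u = (u powr ex p\<^sub>1) powr (1 / ex p\<^sub>1)" using u e by (simp add: powr_powr)
    also have "\<dots> \<le> m powr (1 / ex p\<^sub>1)" using e by (intro powr_mono2) (auto simp: m_def)
    finally have um: "u \<le> m powr (1 / ex p\<^sub>1)" .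
    have "v = (v powr ex p\<^sub>2) powr (1 / ex p\<^sub>2)" using v e by (simp add: powr_powr)
    also have "\<dots> \<le> m powr (1 / ex p\<^sub>2)" using e by (intro powr_mono2) (auto simp: m_def)
    finally have vm: "v \<le> m powr (1 / ex p\<^sub>2)" .
    have "(u * v) powr ex p \<le> (m powr (1 / ex p\<^sub>1) * m powr (1 / ex p\<^sub>2)) powr ex p"
      using um vm u v e by (intro powr_mono2 mult_mono) auto
    also have "\<dots> = m powr ((1 / ex p\<^sub>1 + 1 / ex p\<^sub>2) * ex p)" by (simp only: powr_add[symmetric] powr_powr)
    also have "\<dots> \<le> m powr 1"
    proof (rule powr_mono')
      show "1 \<le> (1 / ex p\<^sub>1 + 1 / ex p\<^sub>2) * ex p"
        using mult_right_mono[OF ineq, of "ex p"] e by simp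
    qed (use m in auto)
    also have "\<dots> \<le> u powr ex p\<^sub>1 + v powr ex p\<^sub>2" using m by (simp add: m_def)
    finally show ?thesis using 4 by simp
  qed
qed

text \<open>Dividing each \<open>J\<close> by its bound brings the pointwise inequality to the unit
  interval, where it can be integrated term by term. The summand 1 keeps the constant at least 1, as
  the case of infinite \<open>p\<close> demands.\<close>

lemma Lp_norm_product:
  fixes J\<^sub>1 J\<^sub>2 :: "'a::euclidean_space \<Rightarrow> real"
  assumes p: "0 < p" "0 < p\<^sub>1" "0 < p\<^sub>2" and le: "1 / p\<^sub>1 + 1 / p\<^sub>2 \<ge> 1 / p"
    and [measurable]: "J\<^sub>1 \<in> borel_measurable borel" "J\<^sub>2 \<in> borel_measurable borel" "f \<in> borel_measurable borel"
    and J1: "\<And>x. 0 \<le> J\<^sub>1 x" "\<And>x. J\<^sub>1 x \<le> \<beta>\<^sub>1" and J2: "\<And>x. 0 \<le> J\<^sub>2 x" "\<And>x. J\<^sub>2 x \<le> \<beta>\<^sub>2"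
    and C: "0 \<le> C\<^sub>1" "0 \<le> C\<^sub>2" and K: "0 \<le> K"
    and i1: "p\<^sub>1 \<noteq> \<infinity> \<longrightarrow> (\<integral>\<^sup>+x. ennreal (J\<^sub>1 x powr ex p\<^sub>1) \<partial>lborel) \<le> ennreal (C\<^sub>1 * \<beta>\<^sub>1 powr ex p\<^sub>1)"
    and i2: "p\<^sub>2 \<noteq> \<infinity> \<longrightarrow> (\<integral>\<^sup>+x. ennreal (J\<^sub>2 x powr ex p\<^sub>2) \<partial>lborel) \<le> ennreal (C\<^sub>2 * \<beta>\<^sub>2 powr ex p\<^sub>2)"
    and f: "\<And>x. f x \<le> ennreal (K * J\<^sub>1 x * J\<^sub>2 x)"
  shows "Lp_norm lborel p f \<le> ennreal (K * (C\<^sub>1 + C\<^sub>2 + 1) powr (1 / ex p) * \<beta>\<^sub>1 * \<beta>\<^sub>2)"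
proof -
  note e = ex_pos[OF p(1)] ex_pos[OF p(2)] ex_pos[OF p(3)]
  have \<beta>: "0 \<le> \<beta>\<^sub>1" "0 \<le> \<beta>\<^sub>2" using J1 J2 order_trans by blast+
  show ?thesis
  proof (cases "p = \<infinity>")
    case True
    have "K * J\<^sub>1 x * J\<^sub>2 x \<le> K * (C\<^sub>1 + C\<^sub>2 + 1) powr (1 / ex p) * \<beta>\<^sub>1 * \<beta>\<^sub>2" for x
    proof -
      have "K * J\<^sub>1 x * J\<^sub>2 x \<le> K * \<beta>\<^sub>1 * \<beta>\<^sub>2" using J1 J2 K \<beta> by (intro mult_mono mult_left_mono) auto
      also have "\<dots> \<le> K * (C\<^sub>1 + C\<^sub>2 + 1) powr (1 / ex p) * \<beta>\<^sub>1 * \<beta>\<^sub>2"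
        using C K \<beta> True by (intro mult_right_mono) (auto simp: ex_def mult_le_cancel_left1)
      finally show ?thesis .
    qed
    then have "f x \<le> ennreal (K * (C\<^sub>1 + C\<^sub>2 + 1) powr (1 / ex p) * \<beta>\<^sub>1 * \<beta>\<^sub>2)" for x
      using f[of x] ennreal_leI order_trans by blast
    then have "esssup lborel f \<le> ennreal (K * (C\<^sub>1 + C\<^sub>2 + 1) powr (1 / ex p) * \<beta>\<^sub>1 * \<beta>\<^sub>2)"
      by (intro esssup_I) auto
    then show ?thesis using True by (simp add: Lp_norm_def)
  next
    case False
    define B where "B = K * (C\<^sub>1 + C\<^sub>2 + 1) powr (1 / ex p) * \<beta>\<^sub>1 * \<beta>\<^sub>2"
    have B0: "0 \<le> B" using K \<beta> by (simp add: B_def)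
    have "(\<integral>\<^sup>+x. ennreal_powr (f x) (ex p) \<partial>lborel) \<le> ennreal (B powr ex p)"
    proof (cases "\<beta>\<^sub>1 = 0 \<or> \<beta>\<^sub>2 = 0")
      case True
      then have "J\<^sub>1 x = 0 \<or> J\<^sub>2 x = 0" for x using J1 J2 by (metis antisym)
      then have "f x = 0" for x using f[of x] by (metis ennreal_0 le_zero_eq mult_zero_left mult_zero_right)
      then show ?thesis by (simp add: ennreal_powr_def)
    next
      case nz: False
      then have \<beta>p: "0 < \<beta>\<^sub>1" "0 < \<beta>\<^sub>2" using \<beta> by auto
      define A\<^sub>1 where "A\<^sub>1 x = (if p\<^sub>1 = \<infinity> then 0 else (J\<^sub>1 x / \<beta>\<^sub>1) powr ex p\<^sub>1)" for x
      define A\<^sub>2 where "A\<^sub>2 x = (if p\<^sub>2 = \<infinity> then 0 else (J\<^sub>2 x / \<beta>\<^sub>2) powr ex p\<^sub>2)" for x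
      have [measurable]: "A\<^sub>1 \<in> borel_measurable borel" "A\<^sub>2 \<in> borel_measurable borel"
        unfolding A\<^sub>1_def A\<^sub>2_def by measurable
      have A0: "0 \<le> A\<^sub>1 x" "0 \<le> A\<^sub>2 x" for x by (auto simp: A\<^sub>1_def A\<^sub>2_def)
      define Z where "Z = (K * \<beta>\<^sub>1 * \<beta>\<^sub>2) powr ex p"
      have gen: "(\<integral>\<^sup>+x. ennreal ((J x / \<beta>) powr r) \<partial>lborel) \<le> ennreal C'"
        if "\<And>x. 0 \<le> J x" "0 < \<beta>" "0 \<le> C'" "(\<integral>\<^sup>+x. ennreal (J x powr r) \<partial>lborel) \<le> ennreal (C' * \<beta> powr r)"
          "J \<in> borel_measurable borel" for J :: "'a \<Rightarrow> real" and \<beta> r C'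
      proof -
        have [measurable]: "J \<in> borel_measurable borel" by fact
        have "(\<integral>\<^sup>+x. ennreal ((J x / \<beta>) powr r) \<partial>lborel) = (\<integral>\<^sup>+x. ennreal (1 / \<beta> powr r) * ennreal (J x powr r) \<partial>lborel)"
          using that by (intro nn_integral_cong) (simp add: powr_divide ennreal_mult[symmetric])
        also have "\<dots> = ennreal (1 / \<beta> powr r) * (\<integral>\<^sup>+x. ennreal (J x powr r) \<partial>lborel)"
          by (rule nn_integral_cmult) measurable
        also have "\<dots> \<le> ennreal (1 / \<beta> powr r) * ennreal (C' * \<beta> powr r)" by (rule mult_left_mono[OF that(4)]) simp
        also have "\<dots> = ennreal C'" using that(2,3) by (simp add: ennreal_mult[symmetric])
        finally show ?thesis .
      qed
      have I1: "(\<integral>\<^sup>+x. ennreal (A\<^sub>1 x) \<partial>lborel) \<le> ennreal C\<^sub>1"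
        unfolding A\<^sub>1_def using gen[OF J1(1) \<beta>p(1) C(1)] i1 by (cases "p\<^sub>1 = \<infinity>") auto
      have I2: "(\<integral>\<^sup>+x. ennreal (A\<^sub>2 x) \<partial>lborel) \<le> ennreal C\<^sub>2"
        unfolding A\<^sub>2_def using gen[OF J2(1) \<beta>p(2) C(2)] i2 by (cases "p\<^sub>2 = \<infinity>") auto
      have "ennreal_powr (f x) (ex p) \<le> ennreal Z * (ennreal (A\<^sub>1 x) + ennreal (A\<^sub>2 x))" for x
      proof -
        have "ennreal_powr (f x) (ex p) \<le> ennreal ((K * J\<^sub>1 x * J\<^sub>2 x) powr ex p)"
          using ennreal_powr_mono[OF f[of x], of "ex p"] e J1(1)[of x] J2(1)[of x] K by (simp add: ennreal_powr_ennreal)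
        also have "K * J\<^sub>1 x * J\<^sub>2 x = (K * \<beta>\<^sub>1 * \<beta>\<^sub>2) * ((J\<^sub>1 x / \<beta>\<^sub>1) * (J\<^sub>2 x / \<beta>\<^sub>2))" using \<beta>p by simp
        also have "(\<dots>) powr ex p = Z * ((J\<^sub>1 x / \<beta>\<^sub>1) * (J\<^sub>2 x / \<beta>\<^sub>2)) powr ex p"
          unfolding Z_def by (rule powr_mult)
        also have "\<dots> \<le> Z * (A\<^sub>1 x + A\<^sub>2 x)"
          unfolding A\<^sub>1_def A\<^sub>2_def using \<beta>p J1[of x] J2[of x] p False le
          by (intro mult_left_mono prod_powr_le) (auto simp: Z_def)
        finally show ?thesis using A0[of x] by (simp add: ennreal_mult Z_def ennreal_leI)
      qed
      then have "(\<integral>\<^sup>+x. ennreal_powr (f x) (ex p) \<partial>lborel) \<le> (\<integral>\<^sup>+x. ennreal Z * (ennreal (A\<^sub>1 x) + ennreal (A\<^sub>2 x)) \<partial>lborel)"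
        by (rule nn_integral_mono)
      also have "\<dots> = ennreal Z * ((\<integral>\<^sup>+x. ennreal (A\<^sub>1 x) \<partial>lborel) + (\<integral>\<^sup>+x. ennreal (A\<^sub>2 x) \<partial>lborel))"
        by (simp add: nn_integral_cmult nn_integral_add)
      also have "\<dots> \<le> ennreal Z * (ennreal C\<^sub>1 + ennreal C\<^sub>2)" by (intro mult_left_mono add_mono I1 I2) auto
      also have "\<dots> = ennreal (Z * (C\<^sub>1 + C\<^sub>2))" using C by (simp add: ennreal_mult Z_def)
      also have "\<dots> \<le> ennreal (B powr ex p)"
      proof (rule ennreal_leI)
        have "B = (K * \<beta>\<^sub>1 * \<beta>\<^sub>2) * (C\<^sub>1 + C\<^sub>2 + 1) powr (1 / ex p)" by (simp add: B_def)
        then have "B powr ex p = Z * (C\<^sub>1 + C\<^sub>2 + 1)" using K \<beta> C e by (simp add: Z_def powr_mult powr_powr)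
        then show "Z * (C\<^sub>1 + C\<^sub>2) \<le> B powr ex p" by (simp add: Z_def mult_left_mono)
      qed
      finally show ?thesis .
    qed
    then show ?thesis
      unfolding Lp_norm_alt[OF p(1) False] B_def[symmetric] using ennreal_powr_le_iff[OF e(1) B0] by blast
  qed
qed

lemma lq_norm_eq_0D:
  fixes b :: "'k::countable \<Rightarrow> real"
  assumes "0 < q" "\<And>k. 0 \<le> b k" "lq_norm q (\<lambda>k. ennreal (b k)) = 0"
  shows "b k = 0"
proof -
  have "adm q {k}" by (simp add: adm_def)
  then have "b k powr ex q \<le> 0" using lq_norm_le_iff[where q=q and b=b and X=0, OF assms(1,2)] assms(3) by fastforce
  then have "b k powr ex q = 0" using powr_ge_zero[of "b k" "ex q"] by linarith
  then show ?thesis by simp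
qed

lemma seq_op_finite:
  assumes B: "finite B" "\<And>k. k \<notin> B \<Longrightarrow> b\<^sub>1 k = 0" "\<And>k. k \<notin> B \<Longrightarrow> b\<^sub>2 k = 0"
  shows "seq_op a b\<^sub>1 b\<^sub>2 m = (\<Sum>\<mu>\<in>{\<mu>\<in>B \<times> B. fst \<mu> + snd \<mu> = m}. a \<mu> * b\<^sub>1 (fst \<mu>) * b\<^sub>2 (snd \<mu>))"
proof -
  have "seq_op a b\<^sub>1 b\<^sub>2 m = (\<Sum>\<^sub>\<infinity>\<mu>\<in>{\<mu>\<in>B \<times> B. fst \<mu> + snd \<mu> = m}. a \<mu> * b\<^sub>1 (fst \<mu>) * b\<^sub>2 (snd \<mu>))"
  proof -
    have "b\<^sub>1 k \<noteq> 0 \<Longrightarrow> k \<in> B" "b\<^sub>2 k \<noteq> 0 \<Longrightarrow> k \<in> B" for k using B by blast+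
    then show ?thesis unfolding seq_op_def by (intro infsum_cong_neutral) auto
  qed
  then show ?thesis using B(1) by simp
qed

lemma ennreal_eq_divide_times: "y \<noteq> 0 \<Longrightarrow> y \<noteq> top \<Longrightarrow> (x::ennreal) = x / y * y"
  by (simp add: ennreal_divide_times ennreal_divide_self less_top)

text \<open>The quotients defining the norm exclude zero sequences, but window pieces of a function
  may vanish; that case is added here.\<close>

lemma seq_op_bound:
  fixes a :: "('k::{countable, ab_group_add}) \<times> 'k \<Rightarrow> complex"
  assumes q: "0 < q\<^sub>1" "0 < q\<^sub>2" "0 < q" and S: "0 \<le> S" "seq_op_norm q\<^sub>1 q\<^sub>2 q a \<le> ennreal S"
    and b: "b\<^sub>1 \<in> finsupp" "b\<^sub>2 \<in> finsupp" and X: "0 \<le> X\<^sub>1" "0 \<le> X\<^sub>2"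
    and l1: "lq_norm q\<^sub>1 (\<lambda>\<mu>. ennreal (cmod (b\<^sub>1 \<mu>))) \<le> ennreal X\<^sub>1"
    and l2: "lq_norm q\<^sub>2 (\<lambda>\<mu>. ennreal (cmod (b\<^sub>2 \<mu>))) \<le> ennreal X\<^sub>2"
  shows "lq_norm q (\<lambda>\<mu>. ennreal (cmod (seq_op a b\<^sub>1 b\<^sub>2 \<mu>))) \<le> ennreal (S * X\<^sub>1 * X\<^sub>2)"
proof (cases "b\<^sub>1 = (\<lambda>_. 0) \<or> b\<^sub>2 = (\<lambda>_. 0)")
  case True
  then have "seq_op a b\<^sub>1 b\<^sub>2 \<mu> = 0" for \<mu> unfolding seq_op_def by (intro infsum_0) auto
  then show ?thesis using S X lq_norm_le_iff[OF q(3), of "\<lambda>_. 0" "S * X\<^sub>1 * X\<^sub>2"] by simp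
next
  case False
  let ?n1 = "lq_norm q\<^sub>1 (\<lambda>\<mu>. ennreal (cmod (b\<^sub>1 \<mu>)))" and ?n2 = "lq_norm q\<^sub>2 (\<lambda>\<mu>. ennreal (cmod (b\<^sub>2 \<mu>)))"
  let ?n = "lq_norm q (\<lambda>\<mu>. ennreal (cmod (seq_op a b\<^sub>1 b\<^sub>2 \<mu>)))"
  have n1: "?n1 \<noteq> 0"
  proof
    assume z: "?n1 = 0"
    have "cmod (b\<^sub>1 \<mu>) = 0" for \<mu>
      by (rule lq_norm_eq_0D[where b="\<lambda>\<mu>. cmod (b\<^sub>1 \<mu>)", OF q(1) norm_ge_zero z])
    then have "b\<^sub>1 = (\<lambda>_. 0)" by (simp add: fun_eq_iff)
    with False show False by blast
  qed
  have n2: "?n2 \<noteq> 0"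
  proof
    assume z: "?n2 = 0"
    have "cmod (b\<^sub>2 \<mu>) = 0" for \<mu>
      by (rule lq_norm_eq_0D[where b="\<lambda>\<mu>. cmod (b\<^sub>2 \<mu>)", OF q(2) norm_ge_zero z])
    then have "b\<^sub>2 = (\<lambda>_. 0)" by (simp add: fun_eq_iff)
    with False show False by blast
  qed
  have top: "?n1 \<noteq> top" "?n2 \<noteq> top" using l1 l2 by (auto simp: top_unique)
  have "?n / (?n1 * ?n2) \<le> seq_op_norm q\<^sub>1 q\<^sub>2 q a"
    unfolding seq_op_norm_def using b False by (intro Sup_upper) blast
  then have le: "?n / (?n1 * ?n2) \<le> ennreal S" using S(2) by (rule order_trans)
  have "?n = ?n / (?n1 * ?n2) * (?n1 * ?n2)"
    using n1 n2 top by (intro ennreal_eq_divide_times) (auto simp: ennreal_mult_eq_top_iff)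
  also have "\<dots> \<le> ennreal S * (ennreal X\<^sub>1 * ennreal X\<^sub>2)" by (intro mult_mono le l1 l2) auto
  also have "\<dots> = ennreal (S * X\<^sub>1 * X\<^sub>2)" using S X by (simp add: ennreal_mult mult.assoc)
  finally show ?thesis .
qed

lemma norm_fst_snd_le: "norm (fst z) \<le> norm z" "norm (snd z) \<le> norm z"
  by (metis norm_fst_le prod.collapse) (metis norm_snd_le prod.collapse)

section \<open>Truncated symbols and their bilinear forms\<close>

text \<open>The symbol restricted to a finite square of lattice points, so that the sequences it
  produces are finitely supported.\<close>

definition lsum :: "((int ^ 'n) \<times> (int ^ 'n) \<Rightarrow> complex) \<Rightarrow> ((real ^ 'n) \<times> (real ^ 'n) \<Rightarrow> complex) \<Rightarrow>
    (int ^ 'n) set \<Rightarrow> (real ^ 'n) \<times> (real ^ 'n) \<Rightarrow> complex" where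
  "lsum a \<Phi> B \<xi> = (\<Sum>\<mu>\<in>B \<times> B. a \<mu> * \<Phi> (fst \<xi> - of_lattice (fst \<mu>), snd \<xi> - of_lattice (snd \<mu>)))"

lemma lattice_symbol_eq_lsum:
  assumes R: "\<And>\<eta>. \<Phi> \<eta> \<noteq> 0 \<Longrightarrow> norm \<eta> < R" and r: "norm \<xi> + R \<le> r"
  shows "lattice_symbol a \<Phi> \<xi> = lsum a \<Phi> {k. norm (of_lattice k) \<le> r} \<xi>"
proof -
  let ?B = "{k. norm (of_lattice k) \<le> r}"
  obtain \<xi>\<^sub>1 \<xi>\<^sub>2 where \<xi>: "\<xi> = (\<xi>\<^sub>1, \<xi>\<^sub>2)" by (cases \<xi>)
  have z: "\<Phi> (\<xi>\<^sub>1 - of_lattice \<mu>\<^sub>1, \<xi>\<^sub>2 - of_lattice \<mu>\<^sub>2) = 0" if "\<not> (\<mu>\<^sub>1 \<in> ?B \<and> \<mu>\<^sub>2 \<in> ?B)" for \<mu>\<^sub>1 \<mu>\<^sub>2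
  proof (rule ccontr)
    assume "\<Phi> (\<xi>\<^sub>1 - of_lattice \<mu>\<^sub>1, \<xi>\<^sub>2 - of_lattice \<mu>\<^sub>2) \<noteq> 0"
    then have n: "norm (\<xi>\<^sub>1 - of_lattice \<mu>\<^sub>1, \<xi>\<^sub>2 - of_lattice \<mu>\<^sub>2) < R" by (rule R)
    have "norm (\<xi>\<^sub>1 - of_lattice \<mu>\<^sub>1) < R" "norm (\<xi>\<^sub>2 - of_lattice \<mu>\<^sub>2) < R"
      using n norm_fst_snd_le[of "(\<xi>\<^sub>1 - of_lattice \<mu>\<^sub>1, \<xi>\<^sub>2 - of_lattice \<mu>\<^sub>2)"]
      by auto
    moreover have "norm \<xi>\<^sub>1 \<le> norm \<xi>" "norm \<xi>\<^sub>2 \<le> norm \<xi>" using norm_fst_snd_le[of \<xi>] \<xi> by auto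
    moreover have "norm (of_lattice \<mu>\<^sub>1) \<le> norm (\<xi>\<^sub>1 - of_lattice \<mu>\<^sub>1) + norm \<xi>\<^sub>1"
      "norm (of_lattice \<mu>\<^sub>2) \<le> norm (\<xi>\<^sub>2 - of_lattice \<mu>\<^sub>2) + norm \<xi>\<^sub>2"
      by (metis norm_minus_commute norm_triangle_sub add.commute)+
    ultimately have "\<mu>\<^sub>1 \<in> ?B" "\<mu>\<^sub>2 \<in> ?B" using r by auto
    then show False using that by blast
  qed
  have z': "\<mu>\<^sub>1 \<in> ?B" "\<mu>\<^sub>2 \<in> ?B" if "\<Phi> (\<xi>\<^sub>1 - of_lattice \<mu>\<^sub>1, \<xi>\<^sub>2 - of_lattice \<mu>\<^sub>2) \<noteq> 0" for \<mu>\<^sub>1 \<mu>\<^sub>2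
    using z that by blast+
  have "lattice_symbol a \<Phi> \<xi> = (\<Sum>\<^sub>\<infinity>\<mu>\<in>?B \<times> ?B. a \<mu> * \<Phi> (\<xi>\<^sub>1 - of_lattice (fst \<mu>), \<xi>\<^sub>2 - of_lattice (snd \<mu>)))"
    unfolding lattice_symbol_def \<xi> split_conv using z' by (intro infsum_cong_neutral) auto
  also have "\<dots> = lsum a \<Phi> ?B \<xi>"
    unfolding lsum_def \<xi> fst_conv snd_conv by (intro infsum_finite finite_cartesian_product finite_lattice)
  finally show ?thesis .
qed

text \<open>Subtracting the integer part of \<open>x\<close> moves the ball near the origin, which
  makes the count uniform in \<open>x\<close>.\<close>

lemma card_lattice_ball:
  fixes x :: "real ^ 'n"
  shows "finite {k. norm (x - of_lattice k) \<le> R}"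
    "card {k. norm (x - of_lattice k) \<le> R} \<le> card {k::int ^ 'n. norm (of_lattice k) \<le> R + real CARD('n)}"
proof -
  define f :: "int ^ 'n" where "f = (\<chi> i. \<lfloor>x $ i\<rfloor>)"
  have "norm (x - of_lattice f) \<le> (\<Sum>i\<in>UNIV. \<bar>(x - of_lattice f) $ i\<bar>)" by (rule norm_le_l1_cart)
  also have "\<dots> \<le> (\<Sum>i\<in>(UNIV :: 'n set). 1)"
  proof (rule sum_mono)
    fix i show "\<bar>(x - of_lattice f) $ i\<bar> \<le> 1" by (simp add: f_def of_lattice_def) linarith
  qed
  finally have n: "norm (x - of_lattice f) \<le> real CARD('n)" by simp
  have sub: "(\<lambda>k. k - f) ` {k. norm (x - of_lattice k) \<le> R} \<subseteq> {k. norm (of_lattice k) \<le> R + real CARD('n)}"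
  proof safe
    fix k assume k: "norm (x - of_lattice k) \<le> R"
    have "of_lattice (k - f) = (x - of_lattice f) - (x - of_lattice k)" by (simp add: of_lattice_diff)
    then show "norm (of_lattice (k - f)) \<le> R + real CARD('n)"
      using norm_triangle_ineq4[of "x - of_lattice f" "x - of_lattice k"] k n by simp
  qed
  have inj: "inj_on (\<lambda>k. k - f) A" for A by (auto simp: inj_on_def)
  show "finite {k. norm (x - of_lattice k) \<le> R}"
    using finite_subset[OF sub finite_lattice] inj by (rule finite_imageD)
  show "card {k. norm (x - of_lattice k) \<le> R} \<le> card {k::int ^ 'n. norm (of_lattice k) \<le> R + real CARD('n)}"
    using card_mono[OF finite_lattice sub] by (simp add: card_image[OF inj])
qed

text \<open>At every point only boundedly many translates of \<open>\<Phi>\<close> are nonzero, so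
  \<open>K\<close> does not depend on \<open>B\<close>. This gives a common majorant when the
  truncation is removed.\<close>

lemma lsum_bound:
  fixes \<Phi> :: "(real ^ 'n) \<times> (real ^ 'n) \<Rightarrow> complex"
  assumes "test_fun \<Phi>"
  obtains K where "0 \<le> K" "\<And>a A B \<xi>. (\<And>\<mu>. cmod (a \<mu>) \<le> A) \<Longrightarrow> finite B \<Longrightarrow> cmod (lsum a \<Phi> B \<xi>) \<le> A * K"
proof -
  obtain R where R: "R > 0" "\<And>x. \<Phi> x \<noteq> 0 \<Longrightarrow> norm x < R" using test_fun_bounded_supp[OF assms] by blast
  obtain b where b: "b > 0" "\<And>x. cmod (\<Phi> x) \<le> b" using rd_bounded[OF rd_test_fun[OF assms]] by blast
  define c where "c = card {k::int ^ 'n. norm (of_lattice k) \<le> R + real CARD('n)}"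
  show thesis
  proof (rule that[of "real (c * c) * b"])
    fix a :: "(int ^ 'n) \<times> (int ^ 'n) \<Rightarrow> complex" and A and B :: "(int ^ 'n) set" and \<xi> :: "(real ^ 'n) \<times> (real ^ 'n)"
    assume a: "\<And>\<mu>. cmod (a \<mu>) \<le> A" and B: "finite B"
    have A: "0 \<le> A" using a[of 0] norm_ge_zero order_trans by blast
    define E where "E = {k. norm (fst \<xi> - of_lattice k) \<le> R} \<times> {k. norm (snd \<xi> - of_lattice k) \<le> R}"
    have E: "finite E" unfolding E_def by (intro finite_cartesian_product card_lattice_ball)
    have cE: "card E \<le> c * c" unfolding E_def card_cartesian_product c_def
      using card_lattice_ball(2)[of "fst \<xi>" R] card_lattice_ball(2)[of "snd \<xi>" R] by (intro mult_mono) auto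
    have "lsum a \<Phi> B \<xi> = (\<Sum>\<mu>\<in>(B \<times> B) \<inter> E. a \<mu> * \<Phi> (fst \<xi> - of_lattice (fst \<mu>), snd \<xi> - of_lattice (snd \<mu>)))"
      unfolding lsum_def
    proof (rule sum.mono_neutral_right)
      show "\<forall>\<mu>\<in>B \<times> B - B \<times> B \<inter> E. a \<mu> * \<Phi> (fst \<xi> - of_lattice (fst \<mu>), snd \<xi> - of_lattice (snd \<mu>)) = 0"
      proof
        fix \<mu> assume \<mu>: "\<mu> \<in> B \<times> B - B \<times> B \<inter> E"
        have "\<Phi> (fst \<xi> - of_lattice (fst \<mu>), snd \<xi> - of_lattice (snd \<mu>)) = 0"
        proof (rule ccontr)
          let ?z = "(fst \<xi> - of_lattice (fst \<mu>), snd \<xi> - of_lattice (snd \<mu>))"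
          assume "\<Phi> ?z \<noteq> 0"
          then have "norm ?z < R" by (rule R)
          then have "\<mu> \<in> E" unfolding E_def using norm_fst_snd_le[of ?z] by (cases \<mu>) auto
          then show False using \<mu> by blast
        qed
        then show "a \<mu> * \<Phi> (fst \<xi> - of_lattice (fst \<mu>), snd \<xi> - of_lattice (snd \<mu>)) = 0" by simp
      qed
    qed (use B in auto)
    also have "cmod \<dots> \<le> real (card ((B \<times> B) \<inter> E)) * (A * b)"
      using a b A by (intro sum_norm_bound) (auto simp: norm_mult intro!: mult_mono)
    also have "\<dots> \<le> real (c * c) * (A * b)"
      using A b(1) of_nat_mono[OF order_trans[OF card_mono[OF E, of "(B \<times> B) \<inter> E"] cE]]
      by (intro mult_right_mono) auto
    finally show "cmod (lsum a \<Phi> B \<xi>) \<le> A * (real (c * c) * b)" by (simp add: mult_ac)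
  qed (use b in auto)
qed

lemma lborel_pair_mult:
  fixes F :: "'a::euclidean_space \<Rightarrow> complex" and G :: "'b::euclidean_space \<Rightarrow> complex"
  assumes F: "integrable lborel F" and G: "integrable lborel G"
  shows "integrable lborel (\<lambda>\<eta>. F (fst \<eta>) * G (snd \<eta>))"
    and "(\<integral>\<eta>. F (fst \<eta>) * G (snd \<eta>) \<partial>lborel) = (\<integral>x. F x \<partial>lborel) * (\<integral>y. G y \<partial>lborel)"
proof -
  have [measurable]: "F \<in> borel_measurable borel" "G \<in> borel_measurable borel"
    using borel_measurable_integrable[OF F] borel_measurable_integrable[OF G] by auto
  have i: "integrable (lborel \<Otimes>\<^sub>M lborel) (\<lambda>(x, y). F x * G y)"
  proof (rule lborel_pair.Fubini_integrable)
    show "(\<lambda>(x, y). F x * G y) \<in> borel_measurable (lborel \<Otimes>\<^sub>M lborel)" by measurable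
    show "integrable lborel (\<lambda>x. \<integral>y. norm (case (x, y) of (x, y) \<Rightarrow> F x * G y) \<partial>lborel)"
      using F G by (simp add: norm_mult)
    show "AE x in lborel. integrable lborel (\<lambda>y. case (x, y) of (x, y) \<Rightarrow> F x * G y)"
      using G by simp
  qed
  then show "integrable lborel (\<lambda>\<eta>. F (fst \<eta>) * G (snd \<eta>))"
    unfolding lborel_prod split_beta' .
  have "(\<integral>x. (\<integral>y. F x * G y \<partial>lborel) \<partial>lborel) = (\<integral>\<eta>. (case \<eta> of (x, y) \<Rightarrow> F x * G y) \<partial>(lborel \<Otimes>\<^sub>M lborel))"
    by (rule lborel_pair.integral_fst[OF i])
  then show "(\<integral>\<eta>. F (fst \<eta>) * G (snd \<eta>) \<partial>lborel) = (\<integral>x. F x \<partial>lborel) * (\<integral>y. G y \<partial>lborel)"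
    unfolding lborel_prod split_beta' by simp
qed

lemma norm_le_fst_snd: "norm z \<le> norm (fst z) + norm (snd z)"
  using sqrt_sum_squares_le_sum[of "norm (fst z)" "norm (snd z)"] by (cases z) (simp add: norm_Pair)

lemma test_fun_tensor:
  fixes \<theta> :: "'a::euclidean_space \<Rightarrow> complex"
  assumes "test_fun \<theta>" shows "test_fun (\<lambda>\<eta>::'a \<times> 'a. \<theta> (fst \<eta>) * \<theta> (snd \<eta>))"
proof -
  obtain r where r: "r > 0" "\<And>x. \<theta> x \<noteq> 0 \<Longrightarrow> norm x < r" using test_fun_bounded_supp[OF assms] by blast
  have s: "smooth (\<lambda>\<eta>::'a \<times> 'a. \<theta> (fst \<eta>))" "smooth (\<lambda>\<eta>::'a \<times> 'a. \<theta> (snd \<eta>))"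
    using smooth_affine[OF bounded_linear_fst test_fun_smooth[OF assms], of 0]
      smooth_affine[OF bounded_linear_snd test_fun_smooth[OF assms], of 0] by auto
  show ?thesis
  proof (rule test_funI[where R="2 * r"])
    show "smooth (\<lambda>\<eta>::'a \<times> 'a. \<theta> (fst \<eta>) * \<theta> (snd \<eta>))" by (rule smooth_mult[OF s])
    fix \<eta> :: "'a \<times> 'a" assume "\<theta> (fst \<eta>) * \<theta> (snd \<eta>) \<noteq> 0"
    then have "norm (fst \<eta>) < r" "norm (snd \<eta>) < r" using r by auto
    then show "norm \<eta> \<le> 2 * r" using norm_le_fst_snd[of \<eta>] by simp
  qed
qed

lemma bounded_linear_fst_plus_snd: "bounded_linear (\<lambda>\<xi>::'a::euclidean_space \<times> 'a. fst \<xi> + snd \<xi>)"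
  by (intro bounded_linear_add bounded_linear_fst bounded_linear_snd)

lemma fst_plus_snd_measurable [measurable]:
  "(\<lambda>\<xi>::'a::euclidean_space \<times> 'a. fst \<xi> + snd \<xi>) \<in> borel_measurable borel"
  by (intro borel_measurable_continuous_onI continuous_intros)

lemma synth_ident_0: "synth (\<lambda>\<eta>. \<eta>) F 0 = (\<integral>\<eta>. F \<eta> \<partial>lborel)"
  by (simp add: synth_def)

text \<open>The terms of the bilinear form with \<open>\<mu>\<^sub>1 + \<mu>\<^sub>2 = m\<close> are moved back to the origin, so that the
  inverse Fourier transform in \<open>\<eta>\<close> is \<open>seq_op\<close> applied to window pieces of the two functions.\<close>

definition part :: "((int ^ 'n) \<times> (int ^ 'n) \<Rightarrow> complex) \<Rightarrow> (int ^ 'n) set \<Rightarrow> (real ^ 'n \<Rightarrow> complex) \<Rightarrow>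
    (real ^ 'n \<Rightarrow> complex) \<Rightarrow> (real ^ 'n \<Rightarrow> complex) \<Rightarrow> real ^ 'n \<Rightarrow> int ^ 'n \<Rightarrow> (real ^ 'n) \<times> (real ^ 'n) \<Rightarrow> complex" where
  "part a B \<psi> F\<^sub>1 F\<^sub>2 x m \<eta> = (\<Sum>\<mu>\<in>{\<mu>\<in>B \<times> B. fst \<mu> + snd \<mu> = m}. a \<mu> *
     ((cis (2 * pi * (x \<bullet> (fst \<eta> + of_lattice (fst \<mu>)))) * (\<psi> (fst \<eta>) * F\<^sub>1 (fst \<eta> + of_lattice (fst \<mu>)))) *
      (cis (2 * pi * (x \<bullet> (snd \<eta> + of_lattice (snd \<mu>)))) * (\<psi> (snd \<eta>) * F\<^sub>2 (snd \<eta> + of_lattice (snd \<mu>))))))"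

text \<open>The window of the function with transform \<open>F\<close> at the point
  \<open>x + y\<close>. The unimodular factor records the translation of the spectrum back to the
  origin; it changes no sequence norm, so the norm of the sequence operator can be used at every
  \<open>y\<close>.\<close>

definition piece :: "(int ^ 'n) set \<Rightarrow> (real ^ 'n \<Rightarrow> complex) \<Rightarrow> (real ^ 'n \<Rightarrow> complex) \<Rightarrow> real ^ 'n \<Rightarrow> real ^ 'n \<Rightarrow>
    int ^ 'n \<Rightarrow> complex" where
  "piece B \<psi> F x y \<mu> = (if \<mu> \<in> B then cis (- 2 * pi * (y \<bullet> of_lattice \<mu>)) *
     synth (\<lambda>\<xi>. \<xi>) (\<lambda>\<xi>. \<psi> (\<xi> - of_lattice \<mu>) * F \<xi>) (x + y) else 0)"

lemma part_factor_integrable: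
  assumes "test_fun \<psi>" "integrable lborel F"
  shows "integrable lborel (\<lambda>\<eta>. cis (2 * pi * (x \<bullet> (\<eta> + c))) * (\<psi> \<eta> * F (\<eta> + c)))"
proof (rule integrable_cis_mult)
  have "integrable lborel (\<lambda>\<eta>. F (c + \<eta>))" by (rule integrable_lborel_shift(1)[OF assms(2)])
  then have i: "integrable lborel (\<lambda>\<eta>. F (\<eta> + c))" by (simp add: add.commute)
  show "integrable lborel (\<lambda>\<eta>. \<psi> \<eta> * F (\<eta> + c))"
    by (rule test_mult_integrable[where \<rho>="\<lambda>\<eta>. \<eta>", OF rd_test_fun[OF assms(1)] i]) simp
qed measurable

lemma part_integrable:
  assumes "test_fun \<psi>" "integrable lborel F\<^sub>1" "integrable lborel F\<^sub>2"
  shows "integrable lborel (part a B \<psi> F\<^sub>1 F\<^sub>2 x m)"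
  unfolding part_def[abs_def]
  by (intro Bochner_Integration.integrable_sum integrable_mult_right lborel_pair_mult(1) part_factor_integrable assms)

lemma part_factor_integral:
  assumes \<psi>: "test_fun \<psi>" and F: "integrable lborel F"
  shows "(\<integral>\<eta>. cis (2 * pi * (y \<bullet> \<eta>)) * (cis (2 * pi * (x \<bullet> (\<eta> + c))) * (\<psi> \<eta> * F (\<eta> + c))) \<partial>lborel)
    = cis (- 2 * pi * (y \<bullet> c)) * synth (\<lambda>\<xi>. \<xi>) (\<lambda>\<xi>. \<psi> (\<xi> - c) * F \<xi>) (x + y)"
proof -
  have [measurable]: "F \<in> borel_measurable borel" "\<psi> \<in> borel_measurable borel"
    using borel_measurable_integrable[OF F] rd_measurable[OF rd_test_fun[OF \<psi>]] by auto
  have "(\<integral>\<eta>. cis (2 * pi * (y \<bullet> \<eta>)) * (cis (2 * pi * (x \<bullet> (\<eta> + c))) * (\<psi> \<eta> * F (\<eta> + c))) \<partial>lborel)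
    = (\<integral>\<eta>. cis (2 * pi * (y \<bullet> ((c + \<eta>) - c))) * (cis (2 * pi * (x \<bullet> (c + \<eta>))) * (\<psi> ((c + \<eta>) - c) * F (c + \<eta>))) \<partial>lborel)"
    by (simp add: add.commute)
  also have "\<dots> = (\<integral>\<xi>. cis (2 * pi * (y \<bullet> (\<xi> - c))) * (cis (2 * pi * (x \<bullet> \<xi>)) * (\<psi> (\<xi> - c) * F \<xi>)) \<partial>lborel)"
    by (rule integral_lborel_shift(1)) measurable
  also have "\<dots> = (\<integral>\<xi>. cis (- 2 * pi * (y \<bullet> c)) * (cis (2 * pi * ((x + y) \<bullet> \<xi>)) * (\<psi> (\<xi> - c) * F \<xi>)) \<partial>lborel)"
  proof (intro Bochner_Integration.integral_cong refl)
    fix \<xi>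
    have "2 * pi * (y \<bullet> (\<xi> - c)) + 2 * pi * (x \<bullet> \<xi>) = - 2 * pi * (y \<bullet> c) + 2 * pi * ((x + y) \<bullet> \<xi>)"
      by (simp add: inner_diff_right inner_add_left algebra_simps)
    then show "cis (2 * pi * (y \<bullet> (\<xi> - c))) * (cis (2 * pi * (x \<bullet> \<xi>)) * (\<psi> (\<xi> - c) * F \<xi>))
      = cis (- 2 * pi * (y \<bullet> c)) * (cis (2 * pi * ((x + y) \<bullet> \<xi>)) * (\<psi> (\<xi> - c) * F \<xi>))"
      by (simp only: mult.assoc[symmetric] cis_mult)
  qed
  finally show ?thesis by (simp add: synth_def)
qed

lemma synth_part:
  assumes B: "finite B" and \<psi>: "test_fun \<psi>" and F: "integrable lborel F\<^sub>1" "integrable lborel F\<^sub>2"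
  shows "synth (\<lambda>\<eta>. \<eta>) (part a B \<psi> F\<^sub>1 F\<^sub>2 x m) y = seq_op a (piece B \<psi> F\<^sub>1 x (fst y)) (piece B \<psi> F\<^sub>2 x (snd y)) m"
proof -
  define H where "H F c \<eta> = cis (2 * pi * (x \<bullet> (\<eta> + c))) * (\<psi> \<eta> * F (\<eta> + c))" for F :: "real ^ 'a \<Rightarrow> complex" and c \<eta>
  have Hi: "integrable lborel (H F\<^sub>1 c)" "integrable lborel (H F\<^sub>2 c)" for c
    unfolding H_def using part_factor_integrable[OF \<psi>] F by auto
  let ?S = "{\<mu>\<in>B \<times> B. fst \<mu> + snd \<mu> = m}"
  define U where "U \<mu> \<eta> = (cis (2 * pi * (fst y \<bullet> fst \<eta>)) * H F\<^sub>1 (of_lattice (fst \<mu>)) (fst \<eta>)) *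
     (cis (2 * pi * (snd y \<bullet> snd \<eta>)) * H F\<^sub>2 (of_lattice (snd \<mu>)) (snd \<eta>))" for \<mu> \<eta>
  have ci: "integrable lborel (\<lambda>\<eta>. cis (2 * pi * (z \<bullet> \<eta>)) * G \<eta>)" if "integrable lborel G" for z and G :: "real ^ 'a \<Rightarrow> complex"
    using that by (rule integrable_cis_mult) measurable
  have Ui: "integrable lborel (U \<mu>)" for \<mu>
    unfolding U_def by (rule lborel_pair_mult(1)[OF ci[OF Hi(1)] ci[OF Hi(2)]])
  have "synth (\<lambda>\<eta>. \<eta>) (part a B \<psi> F\<^sub>1 F\<^sub>2 x m) y = (\<integral>\<eta>. (\<Sum>\<mu>\<in>?S. a \<mu> * U \<mu> \<eta>) \<partial>lborel)"
    unfolding synth_def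
  proof (intro Bochner_Integration.integral_cong refl)
    fix \<eta>
    have "y \<bullet> \<eta> = fst y \<bullet> fst \<eta> + snd y \<bullet> snd \<eta>" by (simp add: inner_prod_def)
    then have "cis (2 * pi * (y \<bullet> \<eta>)) = cis (2 * pi * (fst y \<bullet> fst \<eta>)) * cis (2 * pi * (snd y \<bullet> snd \<eta>))"
      by (simp add: cis_mult distrib_left)
    then show "cis (2 * pi * (y \<bullet> \<eta>)) * part a B \<psi> F\<^sub>1 F\<^sub>2 x m \<eta> = (\<Sum>\<mu>\<in>?S. a \<mu> * U \<mu> \<eta>)"
      by (simp add: part_def sum_distrib_left U_def H_def mult_ac)
  qed
  also have "\<dots> = (\<Sum>\<mu>\<in>?S. a \<mu> * (\<integral>\<eta>. U \<mu> \<eta> \<partial>lborel))"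
    by (subst Bochner_Integration.integral_sum) (auto intro: integrable_mult_right Ui)
  also have "\<dots> = (\<Sum>\<mu>\<in>?S. a \<mu> * piece B \<psi> F\<^sub>1 x (fst y) (fst \<mu>) * piece B \<psi> F\<^sub>2 x (snd y) (snd \<mu>))"
  proof (rule sum.cong[OF refl])
    fix \<mu> assume \<mu>: "\<mu> \<in> ?S"
    have "(\<integral>\<eta>. U \<mu> \<eta> \<partial>lborel) = (\<integral>\<eta>. cis (2 * pi * (fst y \<bullet> \<eta>)) * H F\<^sub>1 (of_lattice (fst \<mu>)) \<eta> \<partial>lborel) *
      (\<integral>\<eta>. cis (2 * pi * (snd y \<bullet> \<eta>)) * H F\<^sub>2 (of_lattice (snd \<mu>)) \<eta> \<partial>lborel)"
      unfolding U_def by (rule lborel_pair_mult(2)[OF ci[OF Hi(1)] ci[OF Hi(2)]])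
    also have "\<dots> = piece B \<psi> F\<^sub>1 x (fst y) (fst \<mu>) * piece B \<psi> F\<^sub>2 x (snd y) (snd \<mu>)"
      unfolding H_def part_factor_integral[OF \<psi> F(1)] part_factor_integral[OF \<psi> F(2)]
      using \<mu> by (auto simp: piece_def)
    finally show "a \<mu> * (\<integral>\<eta>. U \<mu> \<eta> \<partial>lborel) = a \<mu> * piece B \<psi> F\<^sub>1 x (fst y) (fst \<mu>) * piece B \<psi> F\<^sub>2 x (snd y) (snd \<mu>)"
      by simp
  qed
  also have "\<dots> = seq_op a (piece B \<psi> F\<^sub>1 x (fst y)) (piece B \<psi> F\<^sub>2 x (snd y)) m"
    by (rule seq_op_finite[symmetric, OF B]) (simp_all add: piece_def)
  finally show ?thesis .
qed

text \<open>The substitution \<open>\<xi> = \<eta> + \<mu>\<close> turns the output window into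
  \<open>\<kappa>\<close> shifted by \<open>l = \<mu>\<^sub>1 + \<mu>\<^sub>2 - k\<close>. Grouping
  the terms by \<open>l\<close> leaves one multiplier per \<open>l\<close>, common to all
  \<open>\<mu>\<close>, and \<open>L\<close> contains every \<open>l\<close> for which it is
  nonzero. The cut-off \<open>\<psi>\<close> may be inserted because it is 1 where
  \<open>\<Phi>\<close> lives.\<close>

lemma synth_lsum:
  fixes \<kappa> \<psi> :: "real ^ 'n \<Rightarrow> complex"
  assumes \<kappa>: "test_fun \<kappa>" and \<Phi>: "test_fun \<Phi>" and \<psi>: "test_fun \<psi>"
    and \<Phi>\<psi>: "\<And>\<eta>. \<Phi> \<eta> \<noteq> 0 \<Longrightarrow> \<psi> (fst \<eta>) = 1 \<and> \<psi> (snd \<eta>) = 1"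
    and F: "integrable lborel F\<^sub>1" "integrable lborel F\<^sub>2" and B: "finite B"
    and L: "finite L" "\<And>l \<eta>. l \<notin> L \<Longrightarrow> \<kappa> (fst \<eta> + snd \<eta> + of_lattice l) * \<Phi> \<eta> = 0"
  shows "synth (\<lambda>\<xi>. fst \<xi> + snd \<xi>) (\<lambda>\<xi>. \<kappa> (fst \<xi> + snd \<xi> - of_lattice k) * (lsum a \<Phi> B \<xi> * F\<^sub>1 (fst \<xi>) * F\<^sub>2 (snd \<xi>))) x
    = (\<Sum>l\<in>L. synth (\<lambda>\<eta>. \<eta>) (\<lambda>\<eta>. (\<kappa> (fst \<eta> + snd \<eta> + of_lattice l) * \<Phi> \<eta>) * part a B \<psi> F\<^sub>1 F\<^sub>2 x (k + l) \<eta>) 0)"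
proof -
  define H where "H F c \<eta> = cis (2 * pi * (x \<bullet> (\<eta> + c))) * (\<psi> \<eta> * F (\<eta> + c))" for F :: "real ^ 'n \<Rightarrow> complex" and c \<eta>
  have Hi: "integrable lborel (H F\<^sub>1 c)" "integrable lborel (H F\<^sub>2 c)" for c
    unfolding H_def using part_factor_integrable[OF \<psi>] F by auto
  have [measurable]: "F\<^sub>1 \<in> borel_measurable borel" "F\<^sub>2 \<in> borel_measurable borel"
    "\<kappa> \<in> borel_measurable borel" "\<Phi> \<in> borel_measurable borel"
    using borel_measurable_integrable[OF F(1)] borel_measurable_integrable[OF F(2)]
      rd_measurable[OF rd_test_fun[OF \<kappa>]] rd_measurable[OF rd_test_fun[OF \<Phi>]] by auto
  define m where "m l \<eta> = \<kappa> (fst \<eta> + snd \<eta> + of_lattice l) * \<Phi> \<eta>" for l \<eta>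
  have mt: "test_fun (m l)" for l
    unfolding m_def by (intro test_fun_mult2 \<Phi> smooth_affine[OF bounded_linear_fst_plus_snd] test_fun_smooth \<kappa>)
  define V where "V l \<mu> \<eta> = m l \<eta> * (H F\<^sub>1 (of_lattice (fst \<mu>)) (fst \<eta>) * H F\<^sub>2 (of_lattice (snd \<mu>)) (snd \<eta>))" for l \<mu> \<eta>
  have Vi: "integrable lborel (V l \<mu>)" for l \<mu>
    unfolding V_def
    by (rule test_mult_integrable[where \<rho>="\<lambda>\<eta>. \<eta>", OF rd_test_fun[OF mt] lborel_pair_mult(1)[OF Hi]]) simp
  define T where "T \<mu> \<xi> = cis (2 * pi * (x \<bullet> (fst \<xi> + snd \<xi>))) * (\<kappa> (fst \<xi> + snd \<xi> - of_lattice k) *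
     (\<Phi> (fst \<xi> - of_lattice (fst \<mu>), snd \<xi> - of_lattice (snd \<mu>)) * F\<^sub>1 (fst \<xi>) * F\<^sub>2 (snd \<xi>)))" for \<mu> \<xi>
  have Tm [measurable]: "T \<mu> \<in> borel_measurable borel" for \<mu>
    unfolding T_def borel_prod[symmetric] by measurable
  have shift: "T \<mu> ((of_lattice (fst \<mu>), of_lattice (snd \<mu>)) + \<eta>) = V (fst \<mu> + snd \<mu> - k) \<mu> \<eta>" for \<mu> \<eta>
  proof (cases "\<Phi> \<eta> = 0")
    case False
    obtain \<eta>\<^sub>1 \<eta>\<^sub>2 where \<eta>: "\<eta> = (\<eta>\<^sub>1, \<eta>\<^sub>2)" by (cases \<eta>)
    have 1: "\<psi> \<eta>\<^sub>1 = 1" "\<psi> \<eta>\<^sub>2 = 1" using \<Phi>\<psi>[OF False] \<eta> by auto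
    define e\<^sub>1 where "e\<^sub>1 = of_lattice (fst \<mu>)"
    define e\<^sub>2 where "e\<^sub>2 = of_lattice (snd \<mu>)"
    have c: "cis (2 * pi * (x \<bullet> (e\<^sub>1 + \<eta>\<^sub>1 + (e\<^sub>2 + \<eta>\<^sub>2)))) =
      cis (2 * pi * (x \<bullet> (\<eta>\<^sub>1 + e\<^sub>1))) * cis (2 * pi * (x \<bullet> (\<eta>\<^sub>2 + e\<^sub>2)))"
      by (simp add: cis_mult inner_add_right algebra_simps)
    have k: "e\<^sub>1 + \<eta>\<^sub>1 + (e\<^sub>2 + \<eta>\<^sub>2) - of_lattice k = \<eta>\<^sub>1 + \<eta>\<^sub>2 + of_lattice (fst \<mu> + snd \<mu> - k)"
      by (simp add: of_lattice_add of_lattice_diff algebra_simps e\<^sub>1_def e\<^sub>2_def)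
    have "T \<mu> ((e\<^sub>1, e\<^sub>2) + \<eta>) = cis (2 * pi * (x \<bullet> (e\<^sub>1 + \<eta>\<^sub>1 + (e\<^sub>2 + \<eta>\<^sub>2)))) *
      (\<kappa> (e\<^sub>1 + \<eta>\<^sub>1 + (e\<^sub>2 + \<eta>\<^sub>2) - of_lattice k) * (\<Phi> \<eta> * F\<^sub>1 (e\<^sub>1 + \<eta>\<^sub>1) * F\<^sub>2 (e\<^sub>2 + \<eta>\<^sub>2)))"
      by (simp add: T_def \<eta> e\<^sub>1_def e\<^sub>2_def)
    also have "\<dots> = (\<kappa> (\<eta>\<^sub>1 + \<eta>\<^sub>2 + of_lattice (fst \<mu> + snd \<mu> - k)) * \<Phi> \<eta>) *
      ((cis (2 * pi * (x \<bullet> (\<eta>\<^sub>1 + e\<^sub>1))) * (1 * F\<^sub>1 (\<eta>\<^sub>1 + e\<^sub>1))) * (cis (2 * pi * (x \<bullet> (\<eta>\<^sub>2 + e\<^sub>2))) * (1 * F\<^sub>2 (\<eta>\<^sub>2 + e\<^sub>2))))"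
      unfolding c k unfolding add.commute[of e\<^sub>1] add.commute[of e\<^sub>2] by (simp only: mult_ac mult_1_left)
    also have "\<dots> = V (fst \<mu> + snd \<mu> - k) \<mu> \<eta>"
      unfolding V_def m_def H_def \<eta> fst_conv snd_conv 1 e\<^sub>1_def e\<^sub>2_def ..
    finally show ?thesis by (simp add: e\<^sub>1_def e\<^sub>2_def)
  next
    case True
    then show ?thesis by (cases \<eta>) (simp add: T_def V_def m_def)
  qed
  have Ti: "integrable lborel (T \<mu>)" and TV: "(\<integral>\<xi>. T \<mu> \<xi> \<partial>lborel) = (\<integral>\<eta>. V (fst \<mu> + snd \<mu> - k) \<mu> \<eta> \<partial>lborel)" for \<mu>
  proof -
    let ?c = "(of_lattice (fst \<mu>), of_lattice (snd \<mu>))"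
    have "integrable lborel (\<lambda>\<xi>. V (fst \<mu> + snd \<mu> - k) \<mu> (- ?c + \<xi>))" by (rule integrable_lborel_shift(1)[OF Vi])
    then show "integrable lborel (T \<mu>)" by (simp only: shift[symmetric] add_minus_cancel)
    show "(\<integral>\<xi>. T \<mu> \<xi> \<partial>lborel) = (\<integral>\<eta>. V (fst \<mu> + snd \<mu> - k) \<mu> \<eta> \<partial>lborel)"
      unfolding shift[symmetric] by (rule integral_lborel_shift(1)[symmetric]) measurable
  qed
  let ?lhs = "synth (\<lambda>\<xi>. fst \<xi> + snd \<xi>) (\<lambda>\<xi>. \<kappa> (fst \<xi> + snd \<xi> - of_lattice k) * (lsum a \<Phi> B \<xi> * F\<^sub>1 (fst \<xi>) * F\<^sub>2 (snd \<xi>))) x"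
  have "?lhs = (\<integral>\<xi>. (\<Sum>\<mu>\<in>B \<times> B. a \<mu> * T \<mu> \<xi>) \<partial>lborel)"
    unfolding synth_def lsum_def T_def
    by (intro Bochner_Integration.integral_cong refl) (simp add: sum_distrib_left sum_distrib_right mult_ac)
  also have "\<dots> = (\<Sum>\<mu>\<in>B \<times> B. a \<mu> * (\<integral>\<xi>. T \<mu> \<xi> \<partial>lborel))"
    by (subst Bochner_Integration.integral_sum) (auto intro: integrable_mult_right Ti)
  also have "\<dots> = (\<Sum>\<mu>\<in>B \<times> B. a \<mu> * (\<integral>\<eta>. V (fst \<mu> + snd \<mu> - k) \<mu> \<eta> \<partial>lborel))" unfolding TV ..
  also have "\<dots> = (\<Sum>\<mu>\<in>{\<mu>\<in>B \<times> B. fst \<mu> + snd \<mu> - k \<in> L}. a \<mu> * (\<integral>\<eta>. V (fst \<mu> + snd \<mu> - k) \<mu> \<eta> \<partial>lborel))"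
  proof (rule sum.mono_neutral_right)
    show "\<forall>\<mu>\<in>B \<times> B - {\<mu>\<in>B \<times> B. fst \<mu> + snd \<mu> - k \<in> L}. a \<mu> * (\<integral>\<eta>. V (fst \<mu> + snd \<mu> - k) \<mu> \<eta> \<partial>lborel) = 0"
    proof
      fix \<mu> assume "\<mu> \<in> B \<times> B - {\<mu>\<in>B \<times> B. fst \<mu> + snd \<mu> - k \<in> L}"
      then have "fst \<mu> + snd \<mu> - k \<notin> L" by auto
      from L(2)[OF this] have "V (fst \<mu> + snd \<mu> - k) \<mu> = (\<lambda>\<eta>. 0)"
        unfolding V_def m_def by (simp only: mult_zero_left)
      then show "a \<mu> * (\<integral>\<eta>. V (fst \<mu> + snd \<mu> - k) \<mu> \<eta> \<partial>lborel) = 0" by simp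
    qed
  qed (use B in auto)
  also have "\<dots> = (\<Sum>l\<in>L. \<Sum>\<mu>\<in>{\<mu>\<in>{\<mu>\<in>B \<times> B. fst \<mu> + snd \<mu> - k \<in> L}. fst \<mu> + snd \<mu> - k = l}. a \<mu> * (\<integral>\<eta>. V (fst \<mu> + snd \<mu> - k) \<mu> \<eta> \<partial>lborel))"
    by (rule sum.group[symmetric]) (use B L in auto)
  also have "\<dots> = (\<Sum>l\<in>L. synth (\<lambda>\<eta>. \<eta>) (\<lambda>\<eta>. m l \<eta> * part a B \<psi> F\<^sub>1 F\<^sub>2 x (k + l) \<eta>) 0)"
  proof (rule sum.cong[OF refl])
    fix l assume l: "l \<in> L"
    have S: "{\<mu>\<in>{\<mu>\<in>B \<times> B. fst \<mu> + snd \<mu> - k \<in> L}. fst \<mu> + snd \<mu> - k = l} = {\<mu>\<in>B \<times> B. fst \<mu> + snd \<mu> = k + l}"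
      using l by (auto simp: algebra_simps)
    have "(\<Sum>\<mu>\<in>{\<mu>\<in>B \<times> B. fst \<mu> + snd \<mu> = k + l}. a \<mu> * (\<integral>\<eta>. V (fst \<mu> + snd \<mu> - k) \<mu> \<eta> \<partial>lborel))
      = (\<Sum>\<mu>\<in>{\<mu>\<in>B \<times> B. fst \<mu> + snd \<mu> = k + l}. (\<integral>\<eta>. a \<mu> * V l \<mu> \<eta> \<partial>lborel))"
      by (intro sum.cong refl) auto
    also have "\<dots> = (\<integral>\<eta>. (\<Sum>\<mu>\<in>{\<mu>\<in>B \<times> B. fst \<mu> + snd \<mu> = k + l}. a \<mu> * V l \<mu> \<eta>) \<partial>lborel)"
      by (rule Bochner_Integration.integral_sum[symmetric]) (intro integrable_mult_right Vi)
    also have "\<dots> = (\<integral>\<eta>. m l \<eta> * part a B \<psi> F\<^sub>1 F\<^sub>2 x (k + l) \<eta> \<partial>lborel)"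
      unfolding part_def V_def H_def sum_distrib_left by (simp add: mult_ac)
    finally show "(\<Sum>\<mu>\<in>{\<mu>\<in>{\<mu>\<in>B \<times> B. fst \<mu> + snd \<mu> - k \<in> L}. fst \<mu> + snd \<mu> - k = l}. a \<mu> * (\<integral>\<eta>. V (fst \<mu> + snd \<mu> - k) \<mu> \<eta> \<partial>lborel))
      = synth (\<lambda>\<eta>. \<eta>) (\<lambda>\<eta>. m l \<eta> * part a B \<psi> F\<^sub>1 F\<^sub>2 x (k + l) \<eta>) 0"
      unfolding S synth_ident_0 .
  qed
  finally show ?thesis by (simp add: m_def)
qed

lemma lq_norm_leD:
  fixes b :: "'k::countable \<Rightarrow> real"
  assumes "lq_norm q (\<lambda>k. ennreal (b k)) \<le> ennreal X" "0 < q" "\<And>k. 0 \<le> b k" "0 \<le> X" "adm q P"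
  shows "(\<Sum>k\<in>P. b k powr ex q) \<le> X powr ex q"
  using lq_norm_le_iff[where b=b, OF assms(2-4)] assms(1,5) by blast

lemma lq_norm_le_mono:
  fixes b b' :: "'k::countable \<Rightarrow> real"
  assumes q: "0 < q" and b: "\<And>k. 0 \<le> b k" "\<And>k. b k \<le> b' k" and X: "0 \<le> X" "lq_norm q (\<lambda>k. ennreal (b' k)) \<le> ennreal X"
  shows "lq_norm q (\<lambda>k. ennreal (b k)) \<le> ennreal X"
proof (subst lq_norm_le_iff[OF q b(1) X(1)], intro allI impI)
  fix P :: "'k set" assume P: "adm q P"
  have b': "0 \<le> b' k" for k using b order_trans by blast
  have "(\<Sum>k\<in>P. b k powr ex q) \<le> (\<Sum>k\<in>P. b' k powr ex q)"
    using b ex_pos[OF q] by (intro sum_mono powr_mono2) auto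
  also have "\<dots> \<le> X powr ex q" by (rule lq_norm_leD[OF X(2) q b' X(1) P])
  finally show "(\<Sum>k\<in>P. b k powr ex q) \<le> X powr ex q" .
qed

lemma lq_norm_le_limit:
  fixes b :: "nat \<Rightarrow> 'k::countable \<Rightarrow> real"
  assumes q: "0 < q" and b: "\<And>j k. 0 \<le> b j k" and lim: "\<And>k. (\<lambda>j. b j k) \<longlonglongrightarrow> b' k"
    and X: "0 \<le> X" "\<And>j. lq_norm q (\<lambda>k. ennreal (b j k)) \<le> ennreal X"
  shows "lq_norm q (\<lambda>k. ennreal (b' k)) \<le> ennreal X"
proof -
  have b': "0 \<le> b' k" for k using lim[of k] b by (intro LIMSEQ_le_const) auto
  show ?thesis
  proof (subst lq_norm_le_iff[OF q b' X(1)], intro allI impI)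
    fix P :: "'k set" assume P: "adm q P"
    have "(\<lambda>j. \<Sum>k\<in>P. b j k powr ex q) \<longlonglongrightarrow> (\<Sum>k\<in>P. b' k powr ex q)"
      using b ex_pos[OF q] by (intro tendsto_sum tendsto_powr2[OF lim tendsto_const]) (auto intro: always_eventually)
    then show "(\<Sum>k\<in>P. b' k powr ex q) \<le> X powr ex q"
    proof (rule LIMSEQ_le_const2)
      show "\<exists>n. \<forall>j\<ge>n. (\<Sum>k\<in>P. b j k powr ex q) \<le> X powr ex q"
        using lq_norm_leD[OF X(2) q b X(1) P] by blast
    qed
  qed
qed

text \<open>For fixed \<open>x\<close> the values of \<open>S\<^sub>a\<close> on pieces are
  band-limited functions of \<open>y\<close> on the doubled space, so they are bounded by their own
  averages and Peetre's trick reaches every \<open>q\<close>. The sequence norm is taken inside the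
  average over \<open>y\<close>, where the hypothesis applies at each point.\<close>

lemma truncated_pointwise:
  fixes \<kappa> \<psi> :: "real ^ 'n \<Rightarrow> complex"
  assumes w: "wiener_window \<kappa>" and \<Phi>: "test_fun \<Phi>" and \<psi>: "test_fun \<psi>"
    and \<Phi>\<psi>: "\<And>\<eta>. \<Phi> \<eta> \<noteq> 0 \<Longrightarrow> \<psi> (fst \<eta>) = 1 \<and> \<psi> (snd \<eta>) = 1" and q: "0 < q"
  obtains C where "0 < C" "\<And>a B F\<^sub>1 F\<^sub>2 x Y. integrable lborel F\<^sub>1 \<Longrightarrow> integrable lborel F\<^sub>2 \<Longrightarrow> finite B \<Longrightarrow> 0 \<le> Y \<Longrightarrow>
    (\<And>y. lq_norm q (\<lambda>m. ennreal (cmod (seq_op a (piece B \<psi> F\<^sub>1 x (fst y)) (piece B \<psi> F\<^sub>2 x (snd y)) m)))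
        \<le> ennreal (Y * (1 + norm y) ^ M)) \<Longrightarrow>
    lq_norm q (\<lambda>k. ennreal (win \<kappa> (\<lambda>\<xi>. fst \<xi> + snd \<xi>) (\<lambda>\<xi>. lsum a \<Phi> B \<xi> * F\<^sub>1 (fst \<xi>) * F\<^sub>2 (snd \<xi>)) k x)) \<le> ennreal (C * Y)"
proof -
  note \<kappa> = wiener_window_test[OF w]
  note q' = ex_pos[OF q]
  let ?D = "DIM((real ^ 'n) \<times> (real ^ 'n))"
  \<comment> \<open>The surplus absorbs the growth of the hypothesis in \<open>y\<close>, raised to
    the power \<open>ex q\<close>; an integrable weight remains.\<close>
  define M' where "M' = 2 * ?D + nat \<lceil>real M * ex q\<rceil>"
  have M': "2 * ?D \<le> M'" by (simp add: M'_def)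
  obtain N where N: "2 * ?D \<le> N" and AP:
    "\<And>A. 0 < A \<Longrightarrow> \<exists>C>0. \<forall>(d::(real ^ 'n) \<times> (real ^ 'n) \<Rightarrow> real) B. d \<in> borel_measurable borel \<longrightarrow> (\<forall>x. 0 \<le> d x) \<longrightarrow> (\<forall>x. d x \<le> B) \<longrightarrow>
      (\<forall>x. d x \<le> A * (\<integral>y. d (x - y) * wgt N y \<partial>lborel)) \<longrightarrow>
      (\<forall>x. (\<integral>y. d (x - y) * wgt N y \<partial>lborel) powr ex q \<le> C * (\<integral>y. d (x - y) powr ex q * wgt M' y \<partial>lborel) \<and>
        d x powr ex q \<le> A powr ex q * C * (\<integral>y. d (x - y) powr ex q * wgt M' y \<partial>lborel))"
    using average_powr'[OF q' M'] by blast
  obtain R\<^sub>1 where R1: "R\<^sub>1 > 0" "\<And>x. \<kappa> x \<noteq> 0 \<Longrightarrow> norm x < R\<^sub>1" using test_fun_bounded_supp[OF \<kappa>] by blast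
  obtain R\<^sub>2 where R2: "R\<^sub>2 > 0" "\<And>x. \<Phi> x \<noteq> 0 \<Longrightarrow> norm x < R\<^sub>2" using test_fun_bounded_supp[OF \<Phi>] by blast
  obtain R\<^sub>3 where R3: "R\<^sub>3 > 0" "\<And>x. \<psi> x \<noteq> 0 \<Longrightarrow> norm x < R\<^sub>3" using test_fun_bounded_supp[OF \<psi>] by blast
  define L where "L = {l::int ^ 'n. norm (of_lattice l) \<le> R\<^sub>1 + 2 * R\<^sub>2}"
  have L: "finite L" unfolding L_def by (rule finite_lattice)
  define m where "m l \<eta> = \<kappa> (fst \<eta> + snd \<eta> + of_lattice l) * \<Phi> \<eta>" for l \<eta>
  have mt: "test_fun (m l)" for l
    unfolding m_def by (intro test_fun_mult2 \<Phi> smooth_affine[OF bounded_linear_fst_plus_snd] test_fun_smooth \<kappa>)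
  have mL: "m l \<eta> = 0" if l: "l \<notin> L" for l \<eta>
  proof (rule ccontr)
    assume "m l \<eta> \<noteq> 0"
    then have 1: "norm (fst \<eta> + snd \<eta> + of_lattice l) < R\<^sub>1" and 2: "norm \<eta> < R\<^sub>2"
      using R1(2) R2(2) by (auto simp: m_def)
    have "of_lattice l = (fst \<eta> + snd \<eta> + of_lattice l) - (fst \<eta> + snd \<eta>)" by simp
    then have "norm (of_lattice l) \<le> norm (fst \<eta> + snd \<eta> + of_lattice l) + norm (fst \<eta> + snd \<eta>)"
      by (metis norm_triangle_ineq4)
    moreover have "norm (fst \<eta> + snd \<eta>) \<le> norm (fst \<eta>) + norm (snd \<eta>)" by (rule norm_triangle_ineq)
    ultimately have "norm (of_lattice l) \<le> R\<^sub>1 + 2 * R\<^sub>2" using 1 2 norm_fst_snd_le[of \<eta>] by linarith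
    then show False using l by (simp add: L_def)
  qed
  have "\<forall>l. \<exists>C>0. \<forall>F k x. integrable lborel F \<longrightarrow>
      cmod (synth (\<lambda>\<eta>. \<eta>) (\<lambda>\<eta>. m l (\<eta> - k) * F \<eta>) x) \<le> C * (\<integral>y. cmod (synth (\<lambda>\<eta>. \<eta>) F (x - y)) * wgt N y \<partial>lborel)"
  proof
    fix l
    obtain C where "C > 0" "\<And>(\<rho> :: (real ^ 'n) \<times> (real ^ 'n) \<Rightarrow> (real ^ 'n) \<times> (real ^ 'n)) F k x. integrable lborel F \<Longrightarrow> \<rho> \<in> borel_measurable borel \<Longrightarrow>
      cmod (synth \<rho> (\<lambda>\<omega>. m l (\<rho> \<omega> - k) * F \<omega>) x) \<le> C * (\<integral>y. cmod (synth \<rho> F (x - y)) * wgt N y \<partial>lborel)"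
      using synth_window_le[OF mt N] by blast
    from this(1) this(2)[where \<rho>="\<lambda>\<eta>. \<eta>"] show "\<exists>C>0. \<forall>F k x. integrable lborel F \<longrightarrow>
      cmod (synth (\<lambda>\<eta>. \<eta>) (\<lambda>\<eta>. m l (\<eta> - k) * F \<eta>) x) \<le> C * (\<integral>y. cmod (synth (\<lambda>\<eta>. \<eta>) F (x - y)) * wgt N y \<partial>lborel)"
      by (intro exI[of _ C]) simp
  qed
  from choice[OF this] obtain Cl where Cl': "\<forall>l. 0 < Cl l \<and> (\<forall>F k x. integrable lborel F \<longrightarrow>
      cmod (synth (\<lambda>\<eta>. \<eta>) (\<lambda>\<eta>. m l (\<eta> - k) * F \<eta>) x) \<le> Cl l * (\<integral>y. cmod (synth (\<lambda>\<eta>. \<eta>) F (x - y)) * wgt N y \<partial>lborel))"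
    by (rule exE)
  have Cl: "0 < Cl l" for l using Cl' by (rule allE) (rule conjunct1)
  have Cle: "integrable lborel F \<Longrightarrow>
      cmod (synth (\<lambda>\<eta>. \<eta>) (\<lambda>\<eta>. m l (\<eta> - k) * F \<eta>) x) \<le> Cl l * (\<integral>y. cmod (synth (\<lambda>\<eta>. \<eta>) F (x - y)) * wgt N y \<partial>lborel)" for l F k x
    using Cl'[rule_format, of l] by blast
  define C1 where "C1 = (\<Sum>l\<in>L. Cl l)"
  have C1: "0 \<le> C1" unfolding C1_def using Cl by (intro sum_nonneg) (simp add: less_imp_le)
  obtain \<theta> :: "real ^ 'n \<Rightarrow> complex" where \<theta>: "test_fun \<theta>" "\<And>\<xi>. norm \<xi> \<le> R\<^sub>3 \<Longrightarrow> \<theta> \<xi> = 1"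
    using cutoff_exists[OF w] by blast
  have \<theta>\<psi>: "\<theta> \<xi> * \<psi> \<xi> = \<psi> \<xi>" for \<xi> using R3(2)[of \<xi>] \<theta>(2)[of \<xi>] by (cases "\<psi> \<xi> = 0") auto
  \<comment> \<open>Equal to 1 wherever both factors \<open>\<psi>\<close> in \<open>part\<close>
    are nonzero, so it reproduces \<open>part\<close> and yields the self-bound that Peetre's trick
    starts from.\<close>
  define \<Theta> where "\<Theta> \<eta> = \<theta> (fst \<eta>) * \<theta> (snd \<eta>)" for \<eta> :: "(real ^ 'n) \<times> (real ^ 'n)"
  have \<Theta>: "test_fun \<Theta>" unfolding \<Theta>_def by (rule test_fun_tensor[OF \<theta>(1)])
  obtain C2 where C2: "C2 > 0" "\<And>(\<rho> :: (real ^ 'n) \<times> (real ^ 'n) \<Rightarrow> (real ^ 'n) \<times> (real ^ 'n)) F k x. integrable lborel F \<Longrightarrow> \<rho> \<in> borel_measurable borel \<Longrightarrow>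
      cmod (synth \<rho> (\<lambda>\<omega>. \<Theta> (\<rho> \<omega> - k) * F \<omega>) x) \<le> C2 * (\<integral>y. cmod (synth \<rho> F (x - y)) * wgt N y \<partial>lborel)"
    using synth_window_le[OF \<Theta> N] by blast
  obtain C0 where C0: "0 < C0" and AP0: "\<And>(d::(real ^ 'n) \<times> (real ^ 'n) \<Rightarrow> real) B x. d \<in> borel_measurable borel \<Longrightarrow> (\<And>x. 0 \<le> d x) \<Longrightarrow> (\<And>x. d x \<le> B) \<Longrightarrow>
      (\<And>x. d x \<le> C2 * (\<integral>y. d (x - y) * wgt N y \<partial>lborel)) \<Longrightarrow>
      (\<integral>y. d (x - y) * wgt N y \<partial>lborel) powr ex q \<le> C0 * (\<integral>y. d (x - y) powr ex q * wgt M' y \<partial>lborel)"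
    using AP[OF C2(1)] by blast
  define W where "W = (\<integral>y. wgt (2 * ?D) (y :: (real ^ 'n) \<times> (real ^ 'n)) \<partial>lborel)"
  have W: "0 < W" unfolding W_def by (rule integral_wgt_pos) simp
  \<comment> \<open>Built as in \<open>window_bound\<close>: here \<open>C1\<close> dominates the
    kernel constants of all multipliers \<open>m l\<close>, and \<open>W\<close> is the mass of the
    remaining weight.\<close>
  define K where "K = C1 powr ex q * (real (card L) powr ex q * (real (card L) * (C0 * W)))"
  have K: "0 \<le> K" using C0 W by (simp add: K_def)
  show thesis
  \<comment> \<open>\<open>K\<close> can be zero, for instance when \<open>L\<close> is empty; the
    summand 1 makes the constant positive.\<close>
  proof (rule that[of "K powr (1 / ex q) + 1"])
    fix a B F\<^sub>1 F\<^sub>2 x Y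
    assume F: "integrable lborel F\<^sub>1" "integrable lborel F\<^sub>2" and B: "finite B" and Y: "0 \<le> Y"
      and hyp: "\<And>y. lq_norm q (\<lambda>m. ennreal (cmod (seq_op a (piece B \<psi> F\<^sub>1 x (fst y)) (piece B \<psi> F\<^sub>2 x (snd y)) m)))
        \<le> ennreal (Y * (1 + norm y) ^ M)"
    define G where "G k = part a B \<psi> F\<^sub>1 F\<^sub>2 x k" for k
    have Gi: "integrable lborel (G k)" for k unfolding G_def by (rule part_integrable[OF \<psi> F])
    define d where "d k y = cmod (synth (\<lambda>\<eta>. \<eta>) (G k) y)" for k y
    have dm: "d k \<in> borel_measurable borel" for k
      unfolding d_def[abs_def] by (rule synth_measurable_norm[OF Gi]) simp
    have d0: "0 \<le> d k y" for k y by (simp add: d_def)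
    have dB: "d k y \<le> (\<integral>\<omega>. cmod (G k \<omega>) \<partial>lborel)" for k y unfolding d_def by (rule synth_bound[OF Gi]) simp
    have \<Theta>G: "\<Theta> \<eta> * G k \<eta> = G k \<eta>" for k \<eta>
    proof -
      have "\<Theta> \<eta> * (\<psi> (fst \<eta>) * \<psi> (snd \<eta>)) = (\<theta> (fst \<eta>) * \<psi> (fst \<eta>)) * (\<theta> (snd \<eta>) * \<psi> (snd \<eta>))"
        unfolding \<Theta>_def by (simp only: mult_ac)
      then have t: "\<Theta> \<eta> * (\<psi> (fst \<eta>) * \<psi> (snd \<eta>)) = \<psi> (fst \<eta>) * \<psi> (snd \<eta>)" unfolding \<theta>\<psi> .
      have "\<Theta> \<eta> * (c * ((e * (\<psi> (fst \<eta>) * f)) * (e' * (\<psi> (snd \<eta>) * f')))) = c * ((e * (\<psi> (fst \<eta>) * f)) * (e' * (\<psi> (snd \<eta>) * f')))"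
        for c e f e' f'
      proof -
        have "\<Theta> \<eta> * (c * ((e * (\<psi> (fst \<eta>) * f)) * (e' * (\<psi> (snd \<eta>) * f')))) =
          (\<Theta> \<eta> * (\<psi> (fst \<eta>) * \<psi> (snd \<eta>))) * (c * (e * (f * (e' * f'))))" by (simp only: mult_ac)
        also have "\<dots> = c * ((e * (\<psi> (fst \<eta>) * f)) * (e' * (\<psi> (snd \<eta>) * f')))" unfolding t by (simp only: mult_ac)
        finally show ?thesis .
      qed
      then show ?thesis unfolding G_def part_def sum_distrib_left by (intro sum.cong refl)
    qed
    have dself: "d k y \<le> C2 * (\<integral>z. d k (y - z) * wgt N z \<partial>lborel)" for k y
      using C2(2)[where \<rho>="\<lambda>\<eta>. \<eta>" and F="G k" and k=0 and x=y, OF Gi]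
      unfolding d_def diff_0_right \<Theta>G by simp
    note dAP = AP0[OF dm d0 dB dself]
    define I where "I k = (\<integral>y. d k (0 - y) * wgt N y \<partial>lborel)" for k
    have I0: "0 \<le> I k" for k unfolding I_def using d0 by (intro integral_nonneg_AE) auto
    define u where "u k = win \<kappa> (\<lambda>\<xi>. fst \<xi> + snd \<xi>) (\<lambda>\<xi>. lsum a \<Phi> B \<xi> * F\<^sub>1 (fst \<xi>) * F\<^sub>2 (snd \<xi>)) k x" for k
    have u_le: "u k \<le> C1 * (\<Sum>l\<in>L. I (k + l))" for k
    proof -
      have "u k = cmod (\<Sum>l\<in>L. synth (\<lambda>\<eta>. \<eta>) (\<lambda>\<eta>. m l \<eta> * G (k + l) \<eta>) 0)"
        unfolding u_def win_def m_def G_def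
        by (subst synth_lsum[OF \<kappa> \<Phi> \<psi> \<Phi>\<psi> F B L mL[unfolded m_def]]) auto
      also have "\<dots> \<le> (\<Sum>l\<in>L. cmod (synth (\<lambda>\<eta>. \<eta>) (\<lambda>\<eta>. m l \<eta> * G (k + l) \<eta>) 0))" by (rule norm_sum)
      also have "\<dots> \<le> (\<Sum>l\<in>L. C1 * I (k + l))"
      proof (rule sum_mono)
        fix l assume l: "l \<in> L"
        have "cmod (synth (\<lambda>\<eta>. \<eta>) (\<lambda>\<eta>. m l \<eta> * G (k + l) \<eta>) 0) \<le> Cl l * I (k + l)"
          using Cle[where F="G (k + l)" and l=l and k=0 and x=0, OF Gi] by (simp add: I_def d_def)
        also have "\<dots> \<le> C1 * I (k + l)"
          unfolding C1_def using l L Cl I0 by (intro mult_right_mono member_le_sum) (auto simp: less_imp_le)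
        finally show "cmod (synth (\<lambda>\<eta>. \<eta>) (\<lambda>\<eta>. m l \<eta> * G (k + l) \<eta>) 0) \<le> C1 * I (k + l)" .
      qed
      finally show ?thesis by (simp add: sum_distrib_left)
    qed
    have u0: "0 \<le> u k" for k by (simp add: u_def)
    have di: "integrable lborel (\<lambda>y. d k (0 - y) powr ex q * wgt M' y)" for k
      by (rule integrable_wgt_mult[OF powr_bounded_meas(1)[OF dm d0 dB q'] _ powr_bounded_meas(2)[OF dm d0 dB q'] M']) simp
    have key: "(\<Sum>k\<in>P. \<integral>y. d k (0 - y) powr ex q * wgt M' y \<partial>lborel) \<le> Y powr ex q * W" if P: "adm q P" for P
    proof -
      have "(\<Sum>k\<in>P. \<integral>y. d k (0 - y) powr ex q * wgt M' y \<partial>lborel) = (\<integral>y. (\<Sum>k\<in>P. d k (0 - y) powr ex q) * wgt M' y \<partial>lborel)"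
        unfolding sum_distrib_right by (rule Bochner_Integration.integral_sum[symmetric]) (rule di)
      also have "\<dots> \<le> (\<integral>y. Y powr ex q * wgt (2 * ?D) (y :: (real ^ 'n) \<times> (real ^ 'n)) \<partial>lborel)"
      proof (rule integral_mono')
        show "integrable lborel (\<lambda>y :: (real ^ 'n) \<times> (real ^ 'n). Y powr ex q * wgt (2 * ?D) y)"
          by (intro integrable_mult_right wgt_integrable) simp
        fix y :: "(real ^ 'n) \<times> (real ^ 'n)"
        have "d k (0 - y) = cmod (seq_op a (piece B \<psi> F\<^sub>1 x (fst (- y))) (piece B \<psi> F\<^sub>2 x (snd (- y))) k)" for k
          unfolding d_def G_def by (simp add: synth_part[OF B \<psi> F])
        then have "lq_norm q (\<lambda>k. ennreal (d k (0 - y))) \<le> ennreal (Y * (1 + norm y) ^ M)"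
          using hyp[of "- y"] by simp
        then have "(\<Sum>k\<in>P. d k (0 - y) powr ex q) \<le> (Y * (1 + norm y) ^ M) powr ex q"
          using P lq_norm_le_iff[OF q, of "\<lambda>k. d k (0 - y)" "Y * (1 + norm y) ^ M"] d0 Y by simp
        also have "\<dots> = Y powr ex q * (1 + norm y) powr (real M * ex q)"
          using Y one_norm_pos[of y] by (simp add: powr_mult powr_powr flip: powr_realpow)
        also have "\<dots> \<le> Y powr ex q * (1 + norm y) ^ nat \<lceil>real M * ex q\<rceil>"
        proof (rule mult_left_mono)
          have "(1 + norm y) powr (real M * ex q) \<le> (1 + norm y) powr real (nat \<lceil>real M * ex q\<rceil>)"
            by (intro powr_mono real_nat_ceiling_ge) simp
          then show "(1 + norm y) powr (real M * ex q) \<le> (1 + norm y) ^ nat \<lceil>real M * ex q\<rceil>"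
            using one_norm_pos[of y] by (simp add: powr_realpow)
        qed simp
        finally have "(\<Sum>k\<in>P. d k (0 - y) powr ex q) * wgt M' y
          \<le> (Y powr ex q * (1 + norm y) ^ nat \<lceil>real M * ex q\<rceil>) * wgt M' y" by (rule mult_right_mono) simp
        also have "\<dots> = Y powr ex q * wgt (2 * ?D) y * ((1 + norm y) ^ nat \<lceil>real M * ex q\<rceil> * wgt (nat \<lceil>real M * ex q\<rceil>) y)"
          unfolding M'_def wgt_add by (simp only: mult_ac)
        finally show "(\<Sum>k\<in>P. d k (0 - y) powr ex q) * wgt M' y \<le> Y powr ex q * wgt (2 * ?D) y"
          unfolding wgt_mult_power by simp
      qed simp
      also have "\<dots> = Y powr ex q * W" by (simp add: W_def)
      finally show ?thesis .
    qed
    show "lq_norm q (\<lambda>k. ennreal (win \<kappa> (\<lambda>\<xi>. fst \<xi> + snd \<xi>) (\<lambda>\<xi>. lsum a \<Phi> B \<xi> * F\<^sub>1 (fst \<xi>) * F\<^sub>2 (snd \<xi>)) k x))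
      \<le> ennreal ((K powr (1 / ex q) + 1) * Y)"
      unfolding u_def[symmetric]
    proof (subst lq_norm_le_iff[OF q u0], goal_cases)
      case 1 show ?case using Y by simp
    next
      case 2
      show ?case
      proof (intro allI impI)
        fix P :: "(int ^ 'n) set" assume P: "adm q P"
        have "(\<Sum>k\<in>P. u k powr ex q) \<le> (\<Sum>k\<in>P. (C1 * (\<Sum>l\<in>L. I (k + l))) powr ex q)"
          using q' u_le u0 by (intro sum_mono powr_mono2) auto
        also have "\<dots> = (\<Sum>k\<in>P. C1 powr ex q * (\<Sum>l\<in>L. I (k + l)) powr ex q)" by (simp add: powr_mult)
        also have "\<dots> \<le> (\<Sum>k\<in>P. C1 powr ex q * (real (card L) powr ex q * (\<Sum>l\<in>L. I (k + l) powr ex q)))"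
          using I0 q' L by (intro sum_mono mult_left_mono sum_powr_le) auto
        also have "\<dots> \<le> (\<Sum>k\<in>P. C1 powr ex q * (real (card L) powr ex q * (\<Sum>l\<in>L. C0 * (\<integral>y. d (k + l) (0 - y) powr ex q * wgt M' y \<partial>lborel))))"
          unfolding I_def by (intro sum_mono mult_left_mono dAP) auto
        also have "\<dots> = C1 powr ex q * (real (card L) powr ex q * (\<Sum>l\<in>L. C0 * (\<Sum>k\<in>P. \<integral>y. d (k + l) (0 - y) powr ex q * wgt M' y \<partial>lborel)))"
          unfolding sum_distrib_left[symmetric] by (subst sum.swap) (simp add: sum_distrib_left)
        also have "\<dots> \<le> C1 powr ex q * (real (card L) powr ex q * (\<Sum>l\<in>L. C0 * (Y powr ex q * W)))"
        proof (intro mult_left_mono sum_mono)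
          fix l
          have "(\<Sum>k\<in>P. \<integral>y. d (k + l) (0 - y) powr ex q * wgt M' y \<partial>lborel)
            = (\<Sum>k\<in>(\<lambda>k. k + l) ` P. \<integral>y. d k (0 - y) powr ex q * wgt M' y \<partial>lborel)"
            by (subst sum.reindex) (auto simp: inj_on_def)
          also have "\<dots> \<le> Y powr ex q * W" by (rule key[OF adm_translate[OF P]])
          finally show "(\<Sum>k\<in>P. \<integral>y. d (k + l) (0 - y) powr ex q * wgt M' y \<partial>lborel) \<le> Y powr ex q * W" .
        qed (use C0 in auto)
        also have "\<dots> = K * Y powr ex q" by (simp add: K_def mult_ac)
        also have "\<dots> = (K powr (1 / ex q) * Y) powr ex q" using K q' by (simp add: powr_mult powr_powr)
        also have "\<dots> \<le> ((K powr (1 / ex q) + 1) * Y) powr ex q"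
          using Y q' by (intro powr_mono2 mult_right_mono) auto
        finally show "(\<Sum>k\<in>P. u k powr ex q) \<le> ((K powr (1 / ex q) + 1) * Y) powr ex q" .
      qed
    qed
  qed (simp add: add_nonneg_pos)
qed

lemma bilin_symbol_integrable:
  fixes F\<^sub>1 F\<^sub>2 :: "real ^ 'n \<Rightarrow> complex"
  assumes "integrable lborel F\<^sub>1" "integrable lborel F\<^sub>2" and s: "s \<in> borel_measurable borel" "\<And>\<xi>. cmod (s \<xi>) \<le> b"
  shows "integrable lborel (\<lambda>\<xi>. s \<xi> * F\<^sub>1 (fst \<xi>) * F\<^sub>2 (snd \<xi>))"
  using integrable_bounded_mult[OF s lborel_pair_mult(1)[OF assms(1,2)]] by (simp add: mult.assoc)

lemma lsum_measurable:
  fixes \<Phi> :: "(real ^ 'n) \<times> (real ^ 'n) \<Rightarrow> complex"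
  assumes "test_fun \<Phi>" shows "lsum a \<Phi> B \<in> borel_measurable borel"
proof -
  have c: "continuous_on UNIV \<Phi>" using assms by (simp add: test_fun_smooth smooth_continuous)
  have "continuous_on UNIV (lsum a \<Phi> B)"
    unfolding lsum_def[abs_def]
    by (intro continuous_intros continuous_on_compose2[OF c]) auto
  then show ?thesis by (rule borel_measurable_continuous_onI)
qed

lemma lattice_symbol_limit:
  fixes \<Phi> :: "(real ^ 'n) \<times> (real ^ 'n) \<Rightarrow> complex"
  assumes "test_fun \<Phi>"
  shows "(\<lambda>j. lsum a \<Phi> {k. norm (of_lattice k) \<le> real j} \<xi>) \<longlonglongrightarrow> lattice_symbol a \<Phi> \<xi>"
proof (rule tendsto_eventually)
  obtain R where R: "R > 0" "\<And>x. \<Phi> x \<noteq> 0 \<Longrightarrow> norm x < R" using test_fun_bounded_supp[OF assms] by blast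
  show "\<forall>\<^sub>F j in sequentially. lsum a \<Phi> {k. norm (of_lattice k) \<le> real j} \<xi> = lattice_symbol a \<Phi> \<xi>"
    using eventually_ge_at_top[of "nat \<lceil>norm \<xi> + R\<rceil>"]
  proof eventually_elim
    case (elim j)
    then have "norm \<xi> + R \<le> real j" by linarith
    then show ?case using lattice_symbol_eq_lsum[of \<Phi> R \<xi> "real j" a] R(2) by simp
  qed
qed

lemma lattice_symbol_measurable:
  fixes \<Phi> :: "(real ^ 'n) \<times> (real ^ 'n) \<Rightarrow> complex"
  assumes "test_fun \<Phi>" shows "lattice_symbol a \<Phi> \<in> borel_measurable borel"
  by (rule borel_measurable_LIMSEQ_metric[OF lsum_measurable[OF assms] lattice_symbol_limit[OF assms]])

lemma lattice_symbol_bounded: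
  fixes \<Phi> :: "(real ^ 'n) \<times> (real ^ 'n) \<Rightarrow> complex"
  assumes \<Phi>: "test_fun \<Phi>" and a: "bounded (range a)"
  obtains b where "0 \<le> b" "\<And>B \<xi>. finite B \<Longrightarrow> cmod (lsum a \<Phi> B \<xi>) \<le> b" "\<And>\<xi>. cmod (lattice_symbol a \<Phi> \<xi>) \<le> b"
proof -
  obtain A where A: "\<And>\<mu>. cmod (a \<mu>) \<le> A" using a by (auto simp: bounded_iff)
  then have "0 \<le> A" using norm_ge_zero order_trans by blast
  obtain K where K: "0 \<le> K" "\<And>a A B \<xi>. (\<And>\<mu>. cmod (a \<mu>) \<le> A) \<Longrightarrow> finite B \<Longrightarrow> cmod (lsum a \<Phi> B \<xi>) \<le> A * K"
    using lsum_bound[OF \<Phi>] by blast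
  show thesis
  proof (rule that[of "A * K"])
    show "0 \<le> A * K" using K \<open>0 \<le> A\<close> by simp
    show b: "cmod (lsum a \<Phi> B \<xi>) \<le> A * K" if "finite B" for B \<xi> by (rule K(2)[OF A that])
    show "cmod (lattice_symbol a \<Phi> \<xi>) \<le> A * K" for \<xi>
      by (rule LIMSEQ_le_const2[OF tendsto_norm[OF lattice_symbol_limit[OF \<Phi>]]]) (use b finite_lattice in blast)
  qed
qed

theorem upper_bound:
  fixes \<kappa> :: "real ^ 'n \<Rightarrow> complex" and \<Phi> :: "(real ^ 'n) \<times> (real ^ 'n) \<Rightarrow> complex"
  assumes w: "wiener_window \<kappa>" and \<Phi>: "test_fun \<Phi>"
    and p: "0 < p\<^sub>1" "0 < p\<^sub>2" "0 < p" and q: "0 < q\<^sub>1" "0 < q\<^sub>2" "0 < q"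
    and le: "1 / p\<^sub>1 + 1 / p\<^sub>2 \<ge> 1 / p"
  obtains c where "0 < c" "\<And>a S f\<^sub>1 f\<^sub>2 \<beta>\<^sub>1 \<beta>\<^sub>2. bounded (range a) \<Longrightarrow> 0 \<le> S \<Longrightarrow> seq_op_norm q\<^sub>1 q\<^sub>2 q a \<le> ennreal S \<Longrightarrow>
    f\<^sub>1 \<in> schwartz \<Longrightarrow> f\<^sub>2 \<in> schwartz \<Longrightarrow> 0 \<le> \<beta>\<^sub>1 \<Longrightarrow> 0 \<le> \<beta>\<^sub>2 \<Longrightarrow>
    wiener_norm \<kappa> p\<^sub>1 q\<^sub>1 (distr_of_fun f\<^sub>1) = ennreal \<beta>\<^sub>1 \<Longrightarrow> wiener_norm \<kappa> p\<^sub>2 q\<^sub>2 (distr_of_fun f\<^sub>2) = ennreal \<beta>\<^sub>2 \<Longrightarrow>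
    wiener_norm \<kappa> p q (distr_of_fun (bilin_op (lattice_symbol a \<Phi>) f\<^sub>1 f\<^sub>2)) \<le> ennreal (c * S * \<beta>\<^sub>1 * \<beta>\<^sub>2)"
proof -
  note \<kappa> = wiener_window_test[OF w]
  let ?id = "\<lambda>\<xi>::real ^ 'n. \<xi>"
  let ?\<rho> = "\<lambda>\<xi>::(real ^ 'n) \<times> (real ^ 'n). fst \<xi> + snd \<xi>"
  obtain R where R: "R > 0" "\<And>x. \<Phi> x \<noteq> 0 \<Longrightarrow> norm x < R" using test_fun_bounded_supp[OF \<Phi>] by blast
  obtain \<psi> :: "real ^ 'n \<Rightarrow> complex" where \<psi>: "test_fun \<psi>" "\<And>\<xi>. norm \<xi> \<le> R \<Longrightarrow> \<psi> \<xi> = 1"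
    using cutoff_exists[OF w] by blast
  have \<Phi>\<psi>: "\<psi> (fst \<eta>) = 1 \<and> \<psi> (snd \<eta>) = 1" if "\<Phi> \<eta> \<noteq> 0" for \<eta>
    using R(2)[OF that] norm_fst_snd_le[of \<eta>] by (auto intro!: \<psi>(2))
  obtain C\<^sub>1 M\<^sub>1 where C1: "0 < C\<^sub>1" and WB1: "\<And>(\<rho> :: real ^ 'n \<Rightarrow> real ^ 'n) F \<beta>. integrable lborel F \<Longrightarrow>
    \<rho> \<in> borel_measurable borel \<Longrightarrow> 0 \<le> \<beta> \<Longrightarrow> wiener_norm \<kappa> p\<^sub>1 q\<^sub>1 (distr_of_fun (synth \<rho> F)) = ennreal \<beta> \<Longrightarrow>
    \<exists>J. J \<in> borel_measurable borel \<and> (\<forall>x. 0 \<le> J x \<and> J x \<le> \<beta>) \<and>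
        (\<forall>x y. J (x + y) \<le> (1 + norm y) ^ M\<^sub>1 * J x) \<and>
        (\<forall>x. lq_norm q\<^sub>1 (\<lambda>k. ennreal (win \<psi> \<rho> F k x)) \<le> ennreal (C\<^sub>1 * J x)) \<and>
        (p\<^sub>1 \<noteq> \<infinity> \<longrightarrow> (\<integral>\<^sup>+x. ennreal (J x powr ex p\<^sub>1) \<partial>lborel) \<le> ennreal (C\<^sub>1 * \<beta> powr ex p\<^sub>1))"
    using window_bound[OF w \<psi>(1) p(1) q(1)] by blast
  obtain C\<^sub>2 M\<^sub>2 where C2: "0 < C\<^sub>2" and WB2: "\<And>(\<rho> :: real ^ 'n \<Rightarrow> real ^ 'n) F \<beta>. integrable lborel F \<Longrightarrow>
    \<rho> \<in> borel_measurable borel \<Longrightarrow> 0 \<le> \<beta> \<Longrightarrow> wiener_norm \<kappa> p\<^sub>2 q\<^sub>2 (distr_of_fun (synth \<rho> F)) = ennreal \<beta> \<Longrightarrow>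
    \<exists>J. J \<in> borel_measurable borel \<and> (\<forall>x. 0 \<le> J x \<and> J x \<le> \<beta>) \<and>
        (\<forall>x y. J (x + y) \<le> (1 + norm y) ^ M\<^sub>2 * J x) \<and>
        (\<forall>x. lq_norm q\<^sub>2 (\<lambda>k. ennreal (win \<psi> \<rho> F k x)) \<le> ennreal (C\<^sub>2 * J x)) \<and>
        (p\<^sub>2 \<noteq> \<infinity> \<longrightarrow> (\<integral>\<^sup>+x. ennreal (J x powr ex p\<^sub>2) \<partial>lborel) \<le> ennreal (C\<^sub>2 * \<beta> powr ex p\<^sub>2))"
    using window_bound[OF w \<psi>(1) p(2) q(2)] by blast
  obtain C\<^sub>3 where C3: "0 < C\<^sub>3" and TP: "\<And>a B F\<^sub>1 F\<^sub>2 x Y. integrable lborel F\<^sub>1 \<Longrightarrow> integrable lborel F\<^sub>2 \<Longrightarrow> finite B \<Longrightarrow> 0 \<le> Y \<Longrightarrow>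
    (\<And>y. lq_norm q (\<lambda>m. ennreal (cmod (seq_op a (piece B \<psi> F\<^sub>1 x (fst y)) (piece B \<psi> F\<^sub>2 x (snd y)) m)))
        \<le> ennreal (Y * (1 + norm y) ^ (M\<^sub>1 + M\<^sub>2))) \<Longrightarrow>
    lq_norm q (\<lambda>k. ennreal (win \<kappa> ?\<rho> (\<lambda>\<xi>. lsum a \<Phi> B \<xi> * F\<^sub>1 (fst \<xi>) * F\<^sub>2 (snd \<xi>)) k x)) \<le> ennreal (C\<^sub>3 * Y)"
    using truncated_pointwise[OF w \<Phi> \<psi>(1) \<Phi>\<psi> q(3), of "M\<^sub>1 + M\<^sub>2"] by blast
  define c where "c = C\<^sub>3 * C\<^sub>1 * C\<^sub>2 * (C\<^sub>1 + C\<^sub>2 + 1) powr (1 / ex p)"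
  have c: "0 < c" using C1 C2 C3 by (simp add: c_def)
  show thesis
  proof (rule that[OF c])
    fix a :: "(int ^ 'n) \<times> (int ^ 'n) \<Rightarrow> complex" and S f\<^sub>1 f\<^sub>2 \<beta>\<^sub>1 \<beta>\<^sub>2
    assume a: "bounded (range a)" and S: "0 \<le> S" "seq_op_norm q\<^sub>1 q\<^sub>2 q a \<le> ennreal S"
      and f: "f\<^sub>1 \<in> schwartz" "f\<^sub>2 \<in> schwartz" and \<beta>: "0 \<le> \<beta>\<^sub>1" "0 \<le> \<beta>\<^sub>2"
      and W1: "wiener_norm \<kappa> p\<^sub>1 q\<^sub>1 (distr_of_fun f\<^sub>1) = ennreal \<beta>\<^sub>1"
      and W2: "wiener_norm \<kappa> p\<^sub>2 q\<^sub>2 (distr_of_fun f\<^sub>2) = ennreal \<beta>\<^sub>2"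
    define F\<^sub>1 where "F\<^sub>1 = fourier f\<^sub>1"
    define F\<^sub>2 where "F\<^sub>2 = fourier f\<^sub>2"
    have F1: "integrable lborel F\<^sub>1" and F2: "integrable lborel F\<^sub>2"
      unfolding F\<^sub>1_def F\<^sub>2_def using f rd_fourier rd_integrable by blast+
    have f1: "synth ?id F\<^sub>1 = f\<^sub>1" and f2: "synth ?id F\<^sub>2 = f\<^sub>2"
      unfolding F\<^sub>1_def F\<^sub>2_def using f by (simp_all add: schwartz_synth)
    have idm: "?id \<in> borel_measurable borel" by simp
    obtain J\<^sub>1 where J1m: "J\<^sub>1 \<in> borel_measurable borel" and J1: "\<And>x. 0 \<le> J\<^sub>1 x" "\<And>x. J\<^sub>1 x \<le> \<beta>\<^sub>1"
      and J1s: "\<And>x y. J\<^sub>1 (x + y) \<le> (1 + norm y) ^ M\<^sub>1 * J\<^sub>1 x"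
      and J1w: "\<And>x. lq_norm q\<^sub>1 (\<lambda>k. ennreal (win \<psi> ?id F\<^sub>1 k x)) \<le> ennreal (C\<^sub>1 * J\<^sub>1 x)"
      and J1i: "p\<^sub>1 \<noteq> \<infinity> \<longrightarrow> (\<integral>\<^sup>+x. ennreal (J\<^sub>1 x powr ex p\<^sub>1) \<partial>lborel) \<le> ennreal (C\<^sub>1 * \<beta>\<^sub>1 powr ex p\<^sub>1)"
      using WB1[OF F1 idm \<beta>(1)] unfolding f1 using W1 by blast
    obtain J\<^sub>2 where J2m: "J\<^sub>2 \<in> borel_measurable borel" and J2: "\<And>x. 0 \<le> J\<^sub>2 x" "\<And>x. J\<^sub>2 x \<le> \<beta>\<^sub>2"
      and J2s: "\<And>x y. J\<^sub>2 (x + y) \<le> (1 + norm y) ^ M\<^sub>2 * J\<^sub>2 x"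
      and J2w: "\<And>x. lq_norm q\<^sub>2 (\<lambda>k. ennreal (win \<psi> ?id F\<^sub>2 k x)) \<le> ennreal (C\<^sub>2 * J\<^sub>2 x)"
      and J2i: "p\<^sub>2 \<noteq> \<infinity> \<longrightarrow> (\<integral>\<^sup>+x. ennreal (J\<^sub>2 x powr ex p\<^sub>2) \<partial>lborel) \<le> ennreal (C\<^sub>2 * \<beta>\<^sub>2 powr ex p\<^sub>2)"
      using WB2[OF F2 idm \<beta>(2)] unfolding f2 using W2 by blast
    define Y where "Y x = S * (C\<^sub>1 * J\<^sub>1 x) * (C\<^sub>2 * J\<^sub>2 x)" for x
    have Y: "0 \<le> Y x" for x using S C1 C2 J1 J2 by (simp add: Y_def)
    have pfin: "piece B \<psi> F x y \<in> finsupp" if "finite B" for B F x y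
      unfolding finsupp_def piece_def using that by (auto intro: finite_subset[of _ B])
    have pn: "cmod (piece B \<psi> F x y \<mu>) \<le> win \<psi> ?id F \<mu> (x + y)" for B F x y \<mu>
      by (simp add: piece_def win_def norm_mult)
    have hyp: "lq_norm q (\<lambda>m. ennreal (cmod (seq_op a (piece B \<psi> F\<^sub>1 x (fst y)) (piece B \<psi> F\<^sub>2 x (snd y)) m)))
        \<le> ennreal (Y x * (1 + norm y) ^ (M\<^sub>1 + M\<^sub>2))" if B: "finite B" for B x y
    proof -
      let ?X1 = "C\<^sub>1 * J\<^sub>1 (x + fst y)" and ?X2 = "C\<^sub>2 * J\<^sub>2 (x + snd y)"
      have X: "0 \<le> ?X1" "0 \<le> ?X2" using C1 C2 J1 J2 by auto
      have l1: "lq_norm q\<^sub>1 (\<lambda>\<mu>. ennreal (cmod (piece B \<psi> F\<^sub>1 x (fst y) \<mu>))) \<le> ennreal ?X1"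
        by (rule lq_norm_le_mono[OF q(1) norm_ge_zero pn X(1) J1w])
      have l2: "lq_norm q\<^sub>2 (\<lambda>\<mu>. ennreal (cmod (piece B \<psi> F\<^sub>2 x (snd y) \<mu>))) \<le> ennreal ?X2"
        by (rule lq_norm_le_mono[OF q(2) norm_ge_zero pn X(2) J2w])
      have "lq_norm q (\<lambda>m. ennreal (cmod (seq_op a (piece B \<psi> F\<^sub>1 x (fst y)) (piece B \<psi> F\<^sub>2 x (snd y)) m))) \<le> ennreal (S * ?X1 * ?X2)"
        by (rule seq_op_bound[OF q S pfin[OF B] pfin[OF B] X l1 l2])
      also have "S * ?X1 * ?X2 \<le> Y x * (1 + norm y) ^ (M\<^sub>1 + M\<^sub>2)"
      proof -
        have "J\<^sub>1 (x + fst y) \<le> (1 + norm y) ^ M\<^sub>1 * J\<^sub>1 x"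
          by (rule order_trans[OF J1s]) (intro mult_right_mono power_mono add_left_mono norm_fst_snd_le J1, simp)
        moreover have "J\<^sub>2 (x + snd y) \<le> (1 + norm y) ^ M\<^sub>2 * J\<^sub>2 x"
          by (rule order_trans[OF J2s]) (intro mult_right_mono power_mono add_left_mono norm_fst_snd_le J2, simp)
        ultimately have "S * ?X1 * ?X2 \<le> S * (C\<^sub>1 * ((1 + norm y) ^ M\<^sub>1 * J\<^sub>1 x)) * (C\<^sub>2 * ((1 + norm y) ^ M\<^sub>2 * J\<^sub>2 x))"
          using S C1 C2 J1 J2 by (intro mult_mono mult_left_mono mult_nonneg_nonneg) auto
        also have "\<dots> = Y x * (1 + norm y) ^ (M\<^sub>1 + M\<^sub>2)" unfolding Y_def power_add by (simp only: mult_ac)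
        finally show ?thesis .
      qed
      finally show ?thesis by (simp add: ennreal_leI)
    qed
    obtain b where b: "0 \<le> b" "\<And>B \<xi>. finite B \<Longrightarrow> cmod (lsum a \<Phi> B \<xi>) \<le> b" "\<And>\<xi>. cmod (lattice_symbol a \<Phi> \<xi>) \<le> b"
      using lattice_symbol_bounded[OF \<Phi> a] by blast
    define B where "B j = {k::int ^ 'n. norm (of_lattice k) \<le> real j}" for j
    have B: "finite (B j)" for j unfolding B_def by (rule finite_lattice)
    define G where "G \<xi> = lattice_symbol a \<Phi> \<xi> * F\<^sub>1 (fst \<xi>) * F\<^sub>2 (snd \<xi>)" for \<xi>
    define Gj where "Gj j \<xi> = lsum a \<Phi> (B j) \<xi> * F\<^sub>1 (fst \<xi>) * F\<^sub>2 (snd \<xi>)" for j \<xi>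
    have Gi: "integrable lborel G" unfolding G_def
      by (rule bilin_symbol_integrable[OF F1 F2 lattice_symbol_measurable[OF \<Phi>] b(3)])
    have Gji: "integrable lborel (Gj j)" for j unfolding Gj_def
      by (rule bilin_symbol_integrable[OF F1 F2 lsum_measurable[OF \<Phi>] b(2)[OF B]])
    have \<rho>: "?\<rho> \<in> borel_measurable borel" by (rule fst_plus_snd_measurable)
    \<comment> \<open>The truncated symbols are bounded by \<open>b\<close> uniformly in
      \<open>j\<close>, so each window converges. The pointwise estimate has a constant free of
      \<open>j\<close> and passes to the limit through finite sums.\<close>
    have lim: "(\<lambda>j. win \<kappa> ?\<rho> (Gj j) k x) \<longlonglongrightarrow> win \<kappa> ?\<rho> G k x" for k x
      unfolding win_def synth_def
    proof (intro tendsto_norm integral_dominated_convergence[where w="\<lambda>\<xi>. b * cmod (\<kappa> (fst \<xi> + snd \<xi> - of_lattice k) * (F\<^sub>1 (fst \<xi>) * F\<^sub>2 (snd \<xi>)))"])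
      show "(\<lambda>\<omega>. cis (2 * pi * (x \<bullet> ?\<rho> \<omega>)) * (\<kappa> (?\<rho> \<omega> - of_lattice k) * G \<omega>)) \<in> borel_measurable lborel"
        by (rule borel_measurable_integrable[OF synth_integrable[OF win_integrable[OF \<kappa> Gi \<rho>] \<rho>]])
      show "(\<lambda>\<omega>. cis (2 * pi * (x \<bullet> ?\<rho> \<omega>)) * (\<kappa> (?\<rho> \<omega> - of_lattice k) * Gj j \<omega>)) \<in> borel_measurable lborel" for j
        by (rule borel_measurable_integrable[OF synth_integrable[OF win_integrable[OF \<kappa> Gji \<rho>] \<rho>]])
      show "integrable lborel (\<lambda>\<xi>. b * cmod (\<kappa> (fst \<xi> + snd \<xi> - of_lattice k) * (F\<^sub>1 (fst \<xi>) * F\<^sub>2 (snd \<xi>))))"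
        by (intro integrable_mult_right integrable_norm win_integrable[OF \<kappa> lborel_pair_mult(1)[OF F1 F2] \<rho>])
      show "AE \<omega> in lborel. (\<lambda>j. cis (2 * pi * (x \<bullet> ?\<rho> \<omega>)) * (\<kappa> (?\<rho> \<omega> - of_lattice k) * Gj j \<omega>))
         \<longlonglongrightarrow> cis (2 * pi * (x \<bullet> ?\<rho> \<omega>)) * (\<kappa> (?\<rho> \<omega> - of_lattice k) * G \<omega>)"
        unfolding G_def Gj_def B_def by (intro AE_I2 tendsto_intros lattice_symbol_limit[OF \<Phi>])
      show "AE \<omega> in lborel. cmod (cis (2 * pi * (x \<bullet> ?\<rho> \<omega>)) * (\<kappa> (?\<rho> \<omega> - of_lattice k) * Gj j \<omega>))
         \<le> b * cmod (\<kappa> (fst \<omega> + snd \<omega> - of_lattice k) * (F\<^sub>1 (fst \<omega>) * F\<^sub>2 (snd \<omega>)))" for j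
      proof (rule AE_I2)
        fix \<omega>
        have "cmod (lsum a \<Phi> (B j) \<omega>) * cmod (\<kappa> (fst \<omega> + snd \<omega> - of_lattice k) * (F\<^sub>1 (fst \<omega>) * F\<^sub>2 (snd \<omega>)))
          \<le> b * cmod (\<kappa> (fst \<omega> + snd \<omega> - of_lattice k) * (F\<^sub>1 (fst \<omega>) * F\<^sub>2 (snd \<omega>)))"
          by (rule mult_right_mono[OF b(2)[OF B]]) simp
        then show "cmod (cis (2 * pi * (x \<bullet> ?\<rho> \<omega>)) * (\<kappa> (?\<rho> \<omega> - of_lattice k) * Gj j \<omega>))
         \<le> b * cmod (\<kappa> (fst \<omega> + snd \<omega> - of_lattice k) * (F\<^sub>1 (fst \<omega>) * F\<^sub>2 (snd \<omega>)))"
          unfolding Gj_def norm_mult norm_cis by (simp only: mult_ac mult_1_left mult_1_right)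
      qed
    qed
    have point: "lq_norm q (\<lambda>k. ennreal (win \<kappa> ?\<rho> G k x)) \<le> ennreal (C\<^sub>3 * Y x)" for x
    proof (rule lq_norm_le_limit[OF q(3) _ lim])
      show "lq_norm q (\<lambda>k. ennreal (win \<kappa> ?\<rho> (Gj j) k x)) \<le> ennreal (C\<^sub>3 * Y x)" for j
        unfolding Gj_def by (rule TP[OF F1 F2 B Y hyp[OF B]])
    qed (use C3 Y in auto)
    have "wiener_norm \<kappa> p q (distr_of_fun (bilin_op (lattice_symbol a \<Phi>) f\<^sub>1 f\<^sub>2))
      = Lp_norm lborel p (\<lambda>x. lq_norm q (\<lambda>k. ennreal (win \<kappa> ?\<rho> G k x)))"
      unfolding bilin_op_synth win_def F\<^sub>1_def[symmetric] F\<^sub>2_def[symmetric] G_def[symmetric]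
      by (rule wiener_norm_synth[OF w Gi \<rho>])
    also have "\<dots> \<le> ennreal ((C\<^sub>3 * S * C\<^sub>1 * C\<^sub>2) * (C\<^sub>1 + C\<^sub>2 + 1) powr (1 / ex p) * \<beta>\<^sub>1 * \<beta>\<^sub>2)"
    proof (rule Lp_norm_product[OF p(3,1,2) le J1m J2m _ J1 J2 _ _ _ J1i J2i])
      show "(\<lambda>x. lq_norm q (\<lambda>k. ennreal (win \<kappa> ?\<rho> G k x))) \<in> borel_measurable borel"
        by (rule lq_norm_measurable[OF q(3) win_measurable[OF \<kappa> Gi \<rho>]])
      show "lq_norm q (\<lambda>k. ennreal (win \<kappa> ?\<rho> G k x)) \<le> ennreal (C\<^sub>3 * S * C\<^sub>1 * C\<^sub>2 * J\<^sub>1 x * J\<^sub>2 x)" for x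
        using point[of x] unfolding Y_def by (simp add: mult_ac)
    qed (use C1 C2 C3 S in auto)
    also have "(C\<^sub>3 * S * C\<^sub>1 * C\<^sub>2) * (C\<^sub>1 + C\<^sub>2 + 1) powr (1 / ex p) * \<beta>\<^sub>1 * \<beta>\<^sub>2 = c * S * \<beta>\<^sub>1 * \<beta>\<^sub>2"
      by (simp add: c_def mult_ac)
    finally show "wiener_norm \<kappa> p q (distr_of_fun (bilin_op (lattice_symbol a \<Phi>) f\<^sub>1 f\<^sub>2)) \<le> ennreal (c * S * \<beta>\<^sub>1 * \<beta>\<^sub>2)" .
  qed
qed

section \<open>The lower bound\<close>

text \<open>\<open>N\<close> is so large that the \<open>p\<close>-th power of the weight is still
  integrable, however small \<open>p\<close> is. The summand 1 in the constant covers infinite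
  \<open>p\<close>.\<close>

lemma Lp_norm_le_wgt:
  assumes p: "0 < p" and N: "2 * real DIM('a::euclidean_space) \<le> real N * ex p" and K: "0 \<le> K"
    and f[measurable]: "f \<in> borel_measurable borel" and le: "\<And>x::'a. f x \<le> ennreal (K * wgt N x)"
  shows "Lp_norm lborel p f \<le> ennreal (K * ((\<integral>y. wgt (2 * DIM('a)) (y::'a) \<partial>lborel) powr (1 / ex p) + 1))"
proof -
  define W where "W = (\<integral>y. wgt (2 * DIM('a)) (y::'a) \<partial>lborel)"
  have W: "0 < W" unfolding W_def by (rule integral_wgt_pos) simp
  show ?thesis
  proof (cases "p = \<infinity>")
    case True
    have "f x \<le> ennreal (K * (W powr (1 / ex p) + 1))" for x
    proof -
      have "K * wgt N x \<le> K * (W powr (1 / ex p) + 1)"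
        using K wgt_le_1[of N x] by (intro mult_left_mono) (auto intro: order_trans)
      then show ?thesis using le[of x] ennreal_leI order_trans by blast
    qed
    then have "esssup lborel f \<le> ennreal (K * (W powr (1 / ex p) + 1))" by (intro esssup_I) auto
    then show ?thesis using True by (simp add: Lp_norm_def W_def)
  next
    case False
    note e = ex_pos[OF p]
    have "(\<integral>\<^sup>+x. ennreal_powr (f x) (ex p) \<partial>lborel) \<le> (\<integral>\<^sup>+x. ennreal (K powr ex p) * ennreal (wgt (2 * DIM('a)) (x::'a)) \<partial>lborel)"
    proof (rule nn_integral_mono)
      fix x :: 'a
      have "ennreal_powr (f x) (ex p) \<le> ennreal ((K * wgt N x) powr ex p)"
        using ennreal_powr_mono[OF le[of x], of "ex p"] K e by (simp add: ennreal_powr_ennreal)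
      also have "(K * wgt N x) powr ex p = K powr ex p * wgt N x powr ex p" by (rule powr_mult)
      also have "wgt N x = (1 + norm x) powr (- real N)"
        using one_norm_pos[of x] by (simp add: wgt_def powr_minus powr_realpow inverse_eq_divide)
      also have "((1 + norm x) powr (- real N)) powr ex p = (1 + norm x) powr (- (real N * ex p))" by (simp add: powr_powr)
      also have "\<dots> \<le> (1 + norm x) powr (- real (2 * DIM('a)))" using N by (intro powr_mono) auto
      also have "\<dots> = wgt (2 * DIM('a)) x"
        using one_norm_pos[of x] by (simp add: wgt_def powr_minus inverse_eq_divide flip: powr_realpow)
      finally show "ennreal_powr (f x) (ex p) \<le> ennreal (K powr ex p) * ennreal (wgt (2 * DIM('a)) x)"
        by (simp add: ennreal_mult[symmetric] mult_left_mono ennreal_leI)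
    qed
    also have "\<dots> = ennreal (K powr ex p) * (\<integral>\<^sup>+x. ennreal (wgt (2 * DIM('a)) (x::'a)) \<partial>lborel)"
      by (rule nn_integral_cmult) measurable
    also have "(\<integral>\<^sup>+x. ennreal (wgt (2 * DIM('a)) (x::'a)) \<partial>lborel) = ennreal W"
      unfolding W_def by (intro nn_integral_eq_integral wgt_integrable) auto
    also have "ennreal (K powr ex p) * ennreal W = ennreal (K powr ex p * W)" using W by (simp add: ennreal_mult)
    also have "K powr ex p * W = (K * W powr (1 / ex p)) powr ex p" using W K e by (simp add: powr_mult powr_powr)
    also have "\<dots> \<le> (K * (W powr (1 / ex p) + 1)) powr ex p" using K e by (intro powr_mono2 mult_left_mono) auto
    finally have "(\<integral>\<^sup>+x. ennreal_powr (f x) (ex p) \<partial>lborel) \<le> ennreal ((K * (W powr (1 / ex p) + 1)) powr ex p)"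
      by (simp add: ennreal_leI)
    then show ?thesis
      unfolding Lp_norm_alt[OF p False] W_def[symmetric] using K ennreal_powr_le_iff[OF e] by simp
  qed
qed

lemma finite_overlap:
  fixes \<kappa> \<psi> :: "real ^ 'n \<Rightarrow> complex"
  assumes "test_fun \<kappa>" "test_fun \<psi>"
  obtains L where "finite L" "\<And>l \<eta>. l \<notin> L \<Longrightarrow> \<kappa> (\<eta> - of_lattice l) * \<psi> \<eta> = 0"
proof -
  obtain R where R: "R > 0" "\<And>x. \<kappa> x \<noteq> 0 \<Longrightarrow> norm x < R" using test_fun_bounded_supp[OF assms(1)] by blast
  obtain R' where R': "R' > 0" "\<And>x. \<psi> x \<noteq> 0 \<Longrightarrow> norm x < R'" using test_fun_bounded_supp[OF assms(2)] by blast
  show thesis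
  proof (rule that[of "{k::int ^ 'n. norm (of_lattice k) \<le> R + R'}"], rule finite_lattice, rule ccontr)
    fix l :: "int ^ 'n" and \<eta> assume l: "l \<notin> {k. norm (of_lattice k) \<le> R + R'}" and nz: "\<kappa> (\<eta> - of_lattice l) * \<psi> \<eta> \<noteq> 0"
    then have "norm (\<eta> - of_lattice l) < R" "norm \<eta> < R'" using R R' by auto
    moreover have "norm (of_lattice l) \<le> norm (\<eta> - of_lattice l) + norm \<eta>"
      by (metis norm_minus_commute norm_triangle_sub add.commute)
    ultimately show False using l by simp
  qed
qed

text \<open>An atom at \<open>\<mu>\<close> meets the window at \<open>k\<close> only if
  \<open>k - \<mu>\<close> lies in \<open>L\<close>, and the outcome is a modulation of one of
  finitely many rapidly decreasing kernels. The windows at \<open>x\<close> are thus bounded by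
  \<open>wgt N x\<close> times a convolution of the moduli of \<open>b\<close> with the indicator of
  \<open>L\<close>, which is bounded on every sequence space.\<close>

lemma wiener_norm_atoms:
  fixes \<kappa> \<psi> :: "real ^ 'n \<Rightarrow> complex"
  assumes w: "wiener_window \<kappa>" and \<psi>: "test_fun \<psi>" and p: "0 < p" and q: "0 < q"
  obtains D where "0 < D" "\<And>b B X. finite B \<Longrightarrow> (\<And>\<mu>. \<mu> \<notin> B \<Longrightarrow> b \<mu> = 0) \<Longrightarrow> 0 \<le> X \<Longrightarrow>
     lq_norm q (\<lambda>\<mu>. ennreal (cmod (b \<mu>))) \<le> ennreal X \<Longrightarrow>
     wiener_norm \<kappa> p q (distr_of_fun (inv_fourier (\<lambda>\<xi>. \<Sum>\<mu>\<in>B. b \<mu> * \<psi> (\<xi> - of_lattice \<mu>)))) \<le> ennreal (D * X)"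
proof -
  note \<kappa> = wiener_window_test[OF w]
  note q' = ex_pos[OF q]
  note p' = ex_pos[OF p]
  let ?id = "\<lambda>\<xi>::real ^ 'n. \<xi>"
  let ?D = "DIM(real ^ 'n)"
  obtain L where L: "finite L" "\<And>l \<eta>. l \<notin> L \<Longrightarrow> \<kappa> (\<eta> - of_lattice l) * \<psi> \<eta> = 0"
    using finite_overlap[OF \<kappa> \<psi>] by blast
  define N where "N = nat \<lceil>2 * real ?D / ex p\<rceil>"
  have N: "2 * real ?D \<le> real N * ex p"
  proof -
    have "2 * real ?D / ex p \<le> real N" unfolding N_def by (rule real_nat_ceiling_ge)
    then show ?thesis using p' by (simp add: pos_divide_le_eq)
  qed
  define m where "m l \<eta> = \<kappa> (\<eta> - of_lattice l) * \<psi> \<eta>" for l \<eta>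
  have mt: "test_fun (m l)" for l
    unfolding m_def by (intro test_fun_mult test_fun_shift \<kappa> test_fun_smooth \<psi>)
  have "\<exists>C>0. \<forall>x. cmod (inv_fourier (m l) x) \<le> C * wgt N x" for l
    using rdE[OF rd_inv_fourier[OF test_fun_schwartz[OF mt[of l]]], where N=N] by blast
  then obtain Cl where Cl: "\<And>l. 0 < Cl l" "\<And>l x. cmod (inv_fourier (m l) x) \<le> Cl l * wgt N x" by metis
  define C where "C = (\<Sum>l\<in>L. Cl l)"
  have C: "0 \<le> C" unfolding C_def using Cl(1) by (intro sum_nonneg) (simp add: less_imp_le)
  have Cle: "cmod (inv_fourier (m l) x) \<le> C * wgt N x" if "l \<in> L" for l x
  proof -
    have "Cl l \<le> C" unfolding C_def using that L(1) Cl(1) by (intro member_le_sum) (auto simp: less_imp_le)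
    then show ?thesis using Cl(2)[of l x] by (meson mult_right_mono order_trans wgt_nonneg)
  qed
  define K where "K = C powr ex q * (real (card L) powr ex q * real (card L))"
  define D where "D = K powr (1 / ex q) * ((\<integral>y. wgt (2 * ?D) (y::real ^ 'n) \<partial>lborel) powr (1 / ex p) + 1) + 1"
  show thesis
  proof (rule that[of D])
    show "0 < D" unfolding D_def by (intro add_nonneg_pos mult_nonneg_nonneg add_nonneg_nonneg) auto
    fix b :: "int ^ 'n \<Rightarrow> complex" and B X
    assume B: "finite B" "\<And>\<mu>. \<mu> \<notin> B \<Longrightarrow> b \<mu> = 0" and X: "0 \<le> X" "lq_norm q (\<lambda>\<mu>. ennreal (cmod (b \<mu>))) \<le> ennreal X"
    define F where "F \<xi> = (\<Sum>\<mu>\<in>B. b \<mu> * \<psi> (\<xi> - of_lattice \<mu>))" for \<xi>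
    have \<psi>i: "integrable lborel (\<lambda>\<xi>. \<psi> (\<xi> - c))" for c by (rule rd_integrable[OF rd_test_fun[OF test_fun_shift[OF \<psi>]]])
    have F: "integrable lborel F" unfolding F_def by (intro Bochner_Integration.integrable_sum integrable_mult_right \<psi>i)
    have idm: "?id \<in> borel_measurable borel" by simp
    have win_le: "win \<kappa> ?id F k x \<le> (C * wgt N x) * (\<Sum>l\<in>L. cmod (b (k - l)))" for k x
    proof -
      define T where "T \<mu> \<xi> = cis (2 * pi * (x \<bullet> \<xi>)) * (\<kappa> (\<xi> - of_lattice k) * \<psi> (\<xi> - of_lattice \<mu>))" for \<mu> \<xi>
      have Ti: "integrable lborel (T \<mu>)" for \<mu>
        unfolding T_def by (intro integrable_cis_mult win_integrable[OF \<kappa> \<psi>i idm]) measurable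
      have Tv: "(\<integral>\<xi>. T \<mu> \<xi> \<partial>lborel) = cis (2 * pi * (x \<bullet> of_lattice \<mu>)) * inv_fourier (m (k - \<mu>)) x" for \<mu>
      proof -
        have "(\<integral>\<xi>. T \<mu> \<xi> \<partial>lborel) = (\<integral>\<eta>. T \<mu> (of_lattice \<mu> + \<eta>) \<partial>lborel)"
          using borel_measurable_integrable[OF Ti] by (intro integral_lborel_shift(1)[symmetric]) simp
        also have "\<dots> = (\<integral>\<eta>. cis (2 * pi * (x \<bullet> of_lattice \<mu>)) * (cis (2 * pi * (x \<bullet> \<eta>)) * m (k - \<mu>) \<eta>) \<partial>lborel)"
        proof (intro Bochner_Integration.integral_cong refl)
          fix \<eta>
          have "of_lattice \<mu> + \<eta> - of_lattice k = \<eta> - of_lattice (k - \<mu>)" by (simp add: of_lattice_diff)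
          then show "T \<mu> (of_lattice \<mu> + \<eta>) = cis (2 * pi * (x \<bullet> of_lattice \<mu>)) * (cis (2 * pi * (x \<bullet> \<eta>)) * m (k - \<mu>) \<eta>)"
            by (simp only: T_def m_def add_diff_cancel_left' inner_add_right distrib_left cis_mult[symmetric] mult.assoc)
        qed
        finally show ?thesis by (simp add: inv_fourier_def)
      qed
      have "win \<kappa> ?id F k x = cmod (\<integral>\<xi>. (\<Sum>\<mu>\<in>B. b \<mu> * T \<mu> \<xi>) \<partial>lborel)"
        unfolding win_def synth_def F_def T_def by (simp add: sum_distrib_left mult_ac)
      also have "(\<integral>\<xi>. (\<Sum>\<mu>\<in>B. b \<mu> * T \<mu> \<xi>) \<partial>lborel) = (\<Sum>\<mu>\<in>B. b \<mu> * (\<integral>\<xi>. T \<mu> \<xi> \<partial>lborel))"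
        by (subst Bochner_Integration.integral_sum) (auto intro: integrable_mult_right Ti)
      also have "cmod \<dots> \<le> (\<Sum>\<mu>\<in>B. cmod (b \<mu>) * cmod (inv_fourier (m (k - \<mu>)) x))"
        unfolding Tv by (rule order_trans[OF norm_sum]) (simp add: norm_mult)
      also have "\<dots> = (\<Sum>\<mu>\<in>{\<mu>\<in>B. k - \<mu> \<in> L}. cmod (b \<mu>) * cmod (inv_fourier (m (k - \<mu>)) x))"
      proof (rule sum.mono_neutral_right)
        show "\<forall>\<mu>\<in>B - {\<mu>\<in>B. k - \<mu> \<in> L}. cmod (b \<mu>) * cmod (inv_fourier (m (k - \<mu>)) x) = 0"
        proof
          fix \<mu> assume "\<mu> \<in> B - {\<mu>\<in>B. k - \<mu> \<in> L}"
          then have "k - \<mu> \<notin> L" by auto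
          then have "m (k - \<mu>) = (\<lambda>_. 0)" unfolding m_def using L(2) by (simp add: fun_eq_iff del: mult_eq_0_iff)
          then show "cmod (b \<mu>) * cmod (inv_fourier (m (k - \<mu>)) x) = 0" by (simp add: inv_fourier_def)
        qed
      qed (use B in auto)
      also have "\<dots> \<le> (\<Sum>\<mu>\<in>{\<mu>\<in>B. k - \<mu> \<in> L}. cmod (b \<mu>) * (C * wgt N x))"
        by (intro sum_mono mult_left_mono Cle) auto
      also have "\<dots> = (C * wgt N x) * (\<Sum>\<mu>\<in>{\<mu>\<in>B. k - \<mu> \<in> L}. cmod (b \<mu>))" by (simp add: sum_distrib_left mult.commute)
      also have "(\<Sum>\<mu>\<in>{\<mu>\<in>B. k - \<mu> \<in> L}. cmod (b \<mu>)) \<le> (\<Sum>l\<in>L. cmod (b (k - l)))"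
      proof -
        have "(\<Sum>\<mu>\<in>{\<mu>\<in>B. k - \<mu> \<in> L}. cmod (b \<mu>)) \<le> (\<Sum>\<mu>\<in>(\<lambda>l. k - l) ` L. cmod (b \<mu>))"
          using L(1) by (intro sum_mono2) (auto simp: image_iff intro!: bexI[of _ "k - _"])
        also have "\<dots> = (\<Sum>l\<in>L. cmod (b (k - l)))" by (subst sum.reindex) (auto simp: inj_on_def)
        finally show ?thesis .
      qed
      finally show ?thesis using C by (simp add: mult_left_mono)
    qed
    have lq: "lq_norm q (\<lambda>k. ennreal (win \<kappa> ?id F k x)) \<le> ennreal ((K powr (1 / ex q) * X) * wgt N x)" for x
    proof (subst lq_norm_le_iff[OF q win_nonneg], goal_cases)
      case 1 show ?case using X by simp
    next
      case 2
      show ?case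
      proof (intro allI impI)
        fix P :: "(int ^ 'n) set" assume P: "adm q P"
        have "(\<Sum>k\<in>P. win \<kappa> ?id F k x powr ex q) \<le> (\<Sum>k\<in>P. ((C * wgt N x) * (\<Sum>l\<in>L. cmod (b (k - l)))) powr ex q)"
          using q' win_le by (intro sum_mono powr_mono2) auto
        also have "\<dots> = (\<Sum>k\<in>P. (C * wgt N x) powr ex q * (\<Sum>l\<in>L. cmod (b (k - l))) powr ex q)" by (simp add: powr_mult)
        also have "\<dots> \<le> (\<Sum>k\<in>P. (C * wgt N x) powr ex q * (real (card L) powr ex q * (\<Sum>l\<in>L. cmod (b (k - l)) powr ex q)))"
          using q' L(1) by (intro sum_mono mult_left_mono sum_powr_le) auto
        also have "\<dots> = (C * wgt N x) powr ex q * (real (card L) powr ex q * (\<Sum>l\<in>L. \<Sum>k\<in>P. cmod (b (k - l)) powr ex q))"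
          unfolding sum_distrib_left[symmetric] by (subst sum.swap) simp
        also have "\<dots> \<le> (C * wgt N x) powr ex q * (real (card L) powr ex q * (\<Sum>l\<in>L. X powr ex q))"
        proof (intro mult_left_mono sum_mono)
          fix l
          have "(\<Sum>k\<in>P. cmod (b (k - l)) powr ex q) = (\<Sum>k\<in>(\<lambda>k. k + (- l)) ` P. cmod (b k) powr ex q)"
            by (subst sum.reindex) (auto simp: inj_on_def)
          also have "\<dots> \<le> X powr ex q" by (rule lq_norm_leD[OF X(2) q norm_ge_zero X(1) adm_translate[OF P]])
          finally show "(\<Sum>k\<in>P. cmod (b (k - l)) powr ex q) \<le> X powr ex q" .
        qed auto
        also have "\<dots> = ((K powr (1 / ex q) * X) * wgt N x) powr ex q"
          using q' C by (simp add: powr_mult powr_powr K_def mult_ac)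
        finally show "(\<Sum>k\<in>P. win \<kappa> ?id F k x powr ex q) \<le> ((K powr (1 / ex q) * X) * wgt N x) powr ex q" .
      qed
    qed
    have "wiener_norm \<kappa> p q (distr_of_fun (inv_fourier F)) = Lp_norm lborel p (\<lambda>x. lq_norm q (\<lambda>k. ennreal (win \<kappa> ?id F k x)))"
      unfolding inv_fourier_synth win_def by (rule wiener_norm_synth[OF w F idm])
    also have "\<dots> \<le> ennreal ((K powr (1 / ex q) * X) * ((\<integral>y. wgt (2 * ?D) (y::real ^ 'n) \<partial>lborel) powr (1 / ex p) + 1))"
      by (rule Lp_norm_le_wgt[OF p N _ lq_norm_measurable[OF q win_measurable[OF \<kappa> F idm]] lq]) (use X in simp)
    also have "\<dots> \<le> ennreal (D * X)"
      using X by (intro ennreal_leI) (simp add: D_def algebra_simps)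
    finally show "wiener_norm \<kappa> p q (distr_of_fun (inv_fourier (\<lambda>\<xi>. \<Sum>\<mu>\<in>B. b \<mu> * \<psi> (\<xi> - of_lattice \<mu>)))) \<le> ennreal (D * X)"
      unfolding F_def[symmetric] .
  qed
qed

lemma norm_of_lattice_ge_1: "k \<noteq> 0 \<Longrightarrow> 1 \<le> norm (of_lattice k)"
proof -
  assume "k \<noteq> 0"
  then obtain i where "k $ i \<noteq> 0" by (auto simp: vec_eq_iff)
  then have "1 \<le> \<bar>of_lattice k $ i\<bar>" by (simp add: of_lattice_def)
  then show ?thesis using component_le_norm_cart[of "of_lattice k" i] by linarith
qed

text \<open>Near \<open>\<xi>\<^sub>0\<close> only finitely many translates of the compactly
  supported \<open>\<Phi>\<close> can interfere, and each misses a neighbourhood of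
  \<open>\<xi>\<^sub>0\<close> because supports are closed; so the condition spreads from the point
  to a ball. Positivity of the normalised real part excludes cancellation in later
  integrals.\<close>

lemma condition_B_ball:
  fixes \<Phi> :: "(real ^ 'n) \<times> (real ^ 'n) \<Rightarrow> complex"
  assumes \<Phi>: "test_fun \<Phi>" and B: "condition_B \<Phi>"
  obtains e \<xi>\<^sub>0 where "0 < e" "\<Phi> \<xi>\<^sub>0 \<noteq> 0" "\<And>\<eta>. \<eta> \<in> ball \<xi>\<^sub>0 e \<Longrightarrow> 0 < Re (\<Phi> \<eta> / \<Phi> \<xi>\<^sub>0)"
    "\<And>\<mu> \<eta>. \<eta> \<in> ball \<xi>\<^sub>0 e \<Longrightarrow> \<mu> \<noteq> 0 \<Longrightarrow> \<Phi> (\<eta> - map_prod of_lattice of_lattice \<mu>) = 0"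
proof -
  let ?l = "map_prod of_lattice of_lattice :: (int ^ 'n) \<times> (int ^ 'n) \<Rightarrow> _"
  obtain \<xi>\<^sub>0 where \<xi>0: "\<Phi> \<xi>\<^sub>0 \<noteq> 0" "\<xi>\<^sub>0 \<notin> (\<Union>\<mu> \<in> UNIV - {0}. supp (\<lambda>\<xi>. \<Phi> (\<xi> - ?l \<mu>)))"
    using B unfolding condition_B_def by blast
  obtain R where R: "R > 0" "\<And>x. \<Phi> x \<noteq> 0 \<Longrightarrow> norm x < R" using test_fun_bounded_supp[OF \<Phi>] by blast
  \<comment> \<open>For \<open>\<eta>\<close> within distance 1 of \<open>\<xi>\<^sub>0\<close>, a
    translate by a lattice point of norm above \<open>r\<close> vanishes at
    \<open>\<eta>\<close>.\<close>
  define r where "r = R + norm \<xi>\<^sub>0 + 1"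
  define E where "E = {\<mu> :: (int ^ 'n) \<times> (int ^ 'n). norm (?l \<mu>) \<le> r} - {0}"
  have "finite {\<mu> :: (int ^ 'n) \<times> (int ^ 'n). norm (?l \<mu>) \<le> r}"
  proof (rule finite_subset)
    show "{\<mu> :: (int ^ 'n) \<times> (int ^ 'n). norm (?l \<mu>) \<le> r} \<subseteq> {k. norm (of_lattice k) \<le> r} \<times> {k. norm (of_lattice k) \<le> r}"
    proof
      fix \<mu> :: "(int ^ 'n) \<times> (int ^ 'n)" assume "\<mu> \<in> {\<mu>. norm (?l \<mu>) \<le> r}"
      then show "\<mu> \<in> {k. norm (of_lattice k) \<le> r} \<times> {k. norm (of_lattice k) \<le> r}"
        using norm_fst_snd_le[of "?l \<mu>"] by (cases \<mu>) auto
    qed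
  qed (intro finite_cartesian_product finite_lattice)
  then have E: "finite E" by (simp add: E_def)
  define U where "U = ball \<xi>\<^sub>0 1 \<inter> (\<Inter>\<mu>\<in>E. - supp (\<lambda>\<xi>. \<Phi> (\<xi> - ?l \<mu>))) \<inter> {\<eta>. 0 < Re (\<Phi> \<eta> / \<Phi> \<xi>\<^sub>0)}"
  have c: "continuous_on UNIV \<Phi>" using \<Phi> by (simp add: test_fun_smooth smooth_continuous)
  have "open U" unfolding U_def
  proof (intro open_Int open_ball)
    show "open (\<Inter>\<mu>\<in>E. - supp (\<lambda>\<xi>. \<Phi> (\<xi> - ?l \<mu>)))" using E by (intro open_INT) (auto simp: supp_def)
    show "open {\<eta>. 0 < Re (\<Phi> \<eta> / \<Phi> \<xi>\<^sub>0)}" using \<xi>0(1) by (intro open_Collect_less continuous_intros c) auto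
  qed
  moreover have "\<xi>\<^sub>0 \<in> U" using \<xi>0 by (auto simp: U_def E_def)
  ultimately obtain e where e: "0 < e" "ball \<xi>\<^sub>0 e \<subseteq> U" using open_contains_ball by blast
  show thesis
  proof (rule that[OF e(1) \<xi>0(1)])
    fix \<eta> assume "\<eta> \<in> ball \<xi>\<^sub>0 e"
    then show "0 < Re (\<Phi> \<eta> / \<Phi> \<xi>\<^sub>0)" using e(2) by (auto simp: U_def)
  next
    fix \<mu> :: "(int ^ 'n) \<times> (int ^ 'n)" and \<eta> assume \<eta>: "\<eta> \<in> ball \<xi>\<^sub>0 e" and \<mu>: "\<mu> \<noteq> 0"
    show "\<Phi> (\<eta> - ?l \<mu>) = 0"
    proof (rule ccontr)
      assume nz: "\<Phi> (\<eta> - ?l \<mu>) \<noteq> 0"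
      have "norm (?l \<mu>) \<le> norm (\<eta> - ?l \<mu>) + norm \<eta>" by (metis norm_minus_commute norm_triangle_sub add.commute)
      moreover have "norm (\<eta> - ?l \<mu>) < R" using nz by (rule R)
      moreover have "norm \<eta> \<le> norm \<xi>\<^sub>0 + norm (\<xi>\<^sub>0 - \<eta>)" by (metis norm_minus_commute norm_triangle_sub)
      moreover have "norm (\<xi>\<^sub>0 - \<eta>) < 1" using \<eta> e(2) by (auto simp: U_def dist_norm)
      ultimately have "norm (?l \<mu>) \<le> r" by (simp add: r_def)
      then have "\<mu> \<in> E" using \<mu> by (simp add: E_def)
      then have "\<eta> \<notin> supp (\<lambda>\<xi>. \<Phi> (\<xi> - ?l \<mu>))" using \<eta> e(2) by (auto simp: U_def)
      moreover have "\<eta> \<in> supp (\<lambda>\<xi>. \<Phi> (\<xi> - ?l \<mu>))"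
        unfolding supp_def by (rule subsetD[OF closure_subset]) (use nz in simp)
      ultimately show False by blast
    qed
  qed
qed

lemma lq_norm_cmult_le:
  fixes b :: "'k::countable \<Rightarrow> real"
  assumes q: "0 < q" and b: "\<And>k. 0 \<le> b k" and t: "0 < t" and X: "0 \<le> X"
    and le: "lq_norm q (\<lambda>k. ennreal (t * b k)) \<le> ennreal X"
  shows "lq_norm q (\<lambda>k. ennreal (b k)) \<le> ennreal (X / t)"
proof (subst lq_norm_le_iff[OF q b], goal_cases)
  case 1 show ?case using X t by simp
next
  case 2
  show ?case
  proof (intro allI impI)
    fix P :: "'k set" assume P: "adm q P"
    have "t powr ex q * (\<Sum>k\<in>P. b k powr ex q) = (\<Sum>k\<in>P. (t * b k) powr ex q)"
      by (simp add: sum_distrib_left powr_mult)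
    also have "\<dots> \<le> X powr ex q" by (rule lq_norm_leD[OF le q _ X P]) (use t b in simp)
    finally show "(\<Sum>k\<in>P. b k powr ex q) \<le> (X / t) powr ex q"
      using t X by (simp add: powr_divide pos_le_divide_eq mult.commute)
  qed
qed

lemma lq_norm_finsupp:
  fixes b :: "'k::countable \<Rightarrow> complex"
  assumes q: "0 < q" and b: "b \<in> finsupp" "b \<noteq> (\<lambda>_. 0)"
  obtains X where "0 < X" "lq_norm q (\<lambda>k. ennreal (cmod (b k))) = ennreal X"
proof -
  let ?B = "{k. b k \<noteq> 0}"
  have B: "finite ?B" using b by (simp add: finsupp_def)
  define Y where "Y = (\<Sum>k\<in>?B. cmod (b k) powr ex q) powr (1 / ex q)"
  have "lq_norm q (\<lambda>k. ennreal (cmod (b k))) \<le> ennreal Y"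
  proof (subst lq_norm_le_iff[OF q norm_ge_zero], goal_cases)
    case 1 show ?case by (simp add: Y_def)
  next
    case 2
    show ?case
    proof (intro allI impI)
      fix P :: "'k set" assume "adm q P"
      then have P: "finite P" by (simp add: adm_def)
      have "(\<Sum>k\<in>P. cmod (b k) powr ex q) = (\<Sum>k\<in>P \<inter> ?B. cmod (b k) powr ex q)"
        using P by (intro sum.mono_neutral_right) auto
      also have "\<dots> \<le> (\<Sum>k\<in>?B. cmod (b k) powr ex q)" using B by (intro sum_mono2) auto
      also have "\<dots> = Y powr ex q" using ex_pos[OF q] by (simp add: Y_def powr_powr sum_nonneg)
      finally show "(\<Sum>k\<in>P. cmod (b k) powr ex q) \<le> Y powr ex q" .
    qed
  qed
  then obtain X where X: "0 \<le> X" "lq_norm q (\<lambda>k. ennreal (cmod (b k))) = ennreal X"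
    by (cases "lq_norm q (\<lambda>k. ennreal (cmod (b k)))") (auto simp: top_unique)
  have "X \<noteq> 0"
  proof
    assume "X = 0"
    then have z: "lq_norm q (\<lambda>k. ennreal (cmod (b k))) = 0" using X by simp
    have "cmod (b k) = 0" for k by (rule lq_norm_eq_0D[where b="\<lambda>k. cmod (b k)", OF q norm_ge_zero z])
    then show False using b(2) by (simp add: fun_eq_iff)
  qed
  then show thesis using X that by simp
qed

lemma lattice_symbol_single:
  fixes \<Phi> :: "(real ^ 'n) \<times> (real ^ 'n) \<Rightarrow> complex"
  assumes "\<And>\<nu>. \<nu> \<noteq> \<mu> \<Longrightarrow> \<Phi> (\<xi> - map_prod of_lattice of_lattice \<nu>) = 0"
  shows "lattice_symbol a \<Phi> \<xi> = a \<mu> * \<Phi> (\<xi> - map_prod of_lattice of_lattice \<mu>)"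
proof -
  obtain \<xi>\<^sub>1 \<xi>\<^sub>2 where \<xi>: "\<xi> = (\<xi>\<^sub>1, \<xi>\<^sub>2)" by (cases \<xi>)
  have "lattice_symbol a \<Phi> \<xi> = (\<Sum>\<^sub>\<infinity>\<nu>\<in>UNIV. a \<nu> * \<Phi> (\<xi> - map_prod of_lattice of_lattice \<nu>))"
    unfolding lattice_symbol_def \<xi> split_conv by (intro infsum_cong) auto
  also have "\<dots> = (\<Sum>\<^sub>\<infinity>\<nu>\<in>{\<mu>}. a \<nu> * \<Phi> (\<xi> - map_prod of_lattice of_lattice \<nu>))"
    by (rule infsum_cong_neutral) (use assms in auto)
  finally show ?thesis by simp
qed

text \<open>The output is tested with a window \<open>\<phi>\<close> centred at the sum of the two
  components of \<open>\<xi>\<^sub>0\<close>, where \<open>\<kappa>\<close> itself might vanish;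
  \<open>window_bound\<close> compares the two. Since the majorant \<open>J\<close> is bounded by
  the full norm, evaluation at a single point suffices for every \<open>p\<close>.\<close>

theorem lower_bound:
  fixes \<kappa> :: "real ^ 'n \<Rightarrow> complex" and \<Phi> :: "(real ^ 'n) \<times> (real ^ 'n) \<Rightarrow> complex"
  assumes w: "wiener_window \<kappa>" and \<Phi>: "test_fun \<Phi>" and cB: "condition_B \<Phi>"
    and p: "0 < p\<^sub>1" "0 < p\<^sub>2" "0 < p" and q: "0 < q\<^sub>1" "0 < q\<^sub>2" "0 < q"
  obtains c where "0 < c" "\<And>a C. bounded (range a) \<Longrightarrow> 0 \<le> C \<Longrightarrow>
    (\<And>f\<^sub>1 f\<^sub>2. f\<^sub>1 \<in> schwartz \<Longrightarrow> f\<^sub>2 \<in> schwartz \<Longrightarrow> distr_of_fun f\<^sub>1 \<in> wiener_space \<kappa> p\<^sub>1 q\<^sub>1 \<Longrightarrow>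
       distr_of_fun f\<^sub>2 \<in> wiener_space \<kappa> p\<^sub>2 q\<^sub>2 \<Longrightarrow>
       wiener_norm \<kappa> p q (distr_of_fun (bilin_op (lattice_symbol a \<Phi>) f\<^sub>1 f\<^sub>2)) \<le>
         ennreal C * wiener_norm \<kappa> p\<^sub>1 q\<^sub>1 (distr_of_fun f\<^sub>1) * wiener_norm \<kappa> p\<^sub>2 q\<^sub>2 (distr_of_fun f\<^sub>2)) \<Longrightarrow>
    seq_op_norm q\<^sub>1 q\<^sub>2 q a \<le> ennreal (c * C)"
proof -
  note \<kappa> = wiener_window_test[OF w]
  let ?\<rho> = "\<lambda>\<xi>::(real ^ 'n) \<times> (real ^ 'n). fst \<xi> + snd \<xi>"
  let ?l = "map_prod of_lattice of_lattice :: (int ^ 'n) \<times> (int ^ 'n) \<Rightarrow> (real ^ 'n) \<times> (real ^ 'n)"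
  obtain e \<xi>\<^sub>0 where e: "0 < e" "\<Phi> \<xi>\<^sub>0 \<noteq> 0" "\<And>\<eta>. \<eta> \<in> ball \<xi>\<^sub>0 e \<Longrightarrow> 0 < Re (\<Phi> \<eta> / \<Phi> \<xi>\<^sub>0)"
    "\<And>\<mu> \<eta>. \<eta> \<in> ball \<xi>\<^sub>0 e \<Longrightarrow> \<mu> \<noteq> 0 \<Longrightarrow> \<Phi> (\<eta> - ?l \<mu>) = 0"
  proof (rule condition_B_ball[OF \<Phi> cB], goal_cases)
    case (1 e \<xi>\<^sub>0)
    show ?case by (rule that[OF 1(2-5)])
  qed
  obtain z where z: "\<kappa> z \<noteq> 0" using wiener_window_point[OF w] by blast
  \<comment> \<open>\<open>e / 2\<close> keeps the product of two bumps in the ball where a single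
    term of the symbol survives. \<open>1 / 8\<close> keeps the output frequency within 1/4 of its
    centre; together with radius 1/2 for \<open>\<phi>\<close> this stays below 1, the least norm of
    a nonzero lattice point, so no other output window responds.\<close>
  define \<delta> where "\<delta> = min (e / 2) (1 / 8)"
  have \<delta>: "0 < \<delta>" "2 * \<delta> \<le> e" "2 * \<delta> \<le> 1 / 4" using e(1) by (auto simp: \<delta>_def)
  obtain \<psi>\<^sub>1 :: "real ^ 'n \<Rightarrow> real" where \<psi>1: "test_fun (\<lambda>x. complex_of_real (\<psi>\<^sub>1 x))" "\<And>x. 0 \<le> \<psi>\<^sub>1 x"
      "0 < \<psi>\<^sub>1 (fst \<xi>\<^sub>0)" "\<And>x. \<psi>\<^sub>1 x \<noteq> 0 \<Longrightarrow> dist x (fst \<xi>\<^sub>0) < \<delta>"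
  proof (rule test_fun_bump[OF \<kappa> z \<delta>(1), of "fst \<xi>\<^sub>0"], goal_cases)
    case (1 \<beta>)
    show ?case by (rule that[OF 1(2-5)])
  qed
  obtain \<psi>\<^sub>2 :: "real ^ 'n \<Rightarrow> real" where \<psi>2: "test_fun (\<lambda>x. complex_of_real (\<psi>\<^sub>2 x))" "\<And>x. 0 \<le> \<psi>\<^sub>2 x"
      "0 < \<psi>\<^sub>2 (snd \<xi>\<^sub>0)" "\<And>x. \<psi>\<^sub>2 x \<noteq> 0 \<Longrightarrow> dist x (snd \<xi>\<^sub>0) < \<delta>"
  proof (rule test_fun_bump[OF \<kappa> z \<delta>(1), of "snd \<xi>\<^sub>0"], goal_cases)
    case (1 \<beta>)
    show ?case by (rule that[OF 1(2-5)])
  qed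
  obtain \<phi> :: "real ^ 'n \<Rightarrow> real" where \<phi>: "test_fun (\<lambda>x. complex_of_real (\<phi> x))" "\<And>x. 0 \<le> \<phi> x"
      "0 < \<phi> (?\<rho> \<xi>\<^sub>0)" "\<And>x. \<phi> x \<noteq> 0 \<Longrightarrow> dist x (?\<rho> \<xi>\<^sub>0) < 1 / 2"
  proof (rule test_fun_bump[OF \<kappa> z, of "1 / 2" "?\<rho> \<xi>\<^sub>0"], simp, goal_cases)
    case (1 \<beta>)
    show ?case by (rule that[OF 1(2-5)])
  qed
  define \<Psi> where "\<Psi> \<eta> = complex_of_real (\<psi>\<^sub>1 (fst \<eta>)) * complex_of_real (\<psi>\<^sub>2 (snd \<eta>))" for \<eta>
  have supp: "norm (fst \<eta> - fst \<xi>\<^sub>0) < \<delta>" "norm (snd \<eta> - snd \<xi>\<^sub>0) < \<delta>" "\<eta> \<in> ball \<xi>\<^sub>0 e" if "\<Psi> \<eta> \<noteq> 0" for \<eta>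
  proof -
    show 1: "norm (fst \<eta> - fst \<xi>\<^sub>0) < \<delta>" and 2: "norm (snd \<eta> - snd \<xi>\<^sub>0) < \<delta>"
      using that \<psi>1(4)[of "fst \<eta>"] \<psi>2(4)[of "snd \<eta>"] by (auto simp: \<Psi>_def dist_norm)
    have "norm (\<eta> - \<xi>\<^sub>0) < 2 * \<delta>" using norm_le_fst_snd[of "\<eta> - \<xi>\<^sub>0"] 1 2 by simp
    then show "\<eta> \<in> ball \<xi>\<^sub>0 e" using \<delta>(2) by (simp add: dist_norm norm_minus_commute)
  qed
  have i1: "integrable lborel (\<lambda>x. complex_of_real (\<psi>\<^sub>1 (x - c)))" and i2: "integrable lborel (\<lambda>x. complex_of_real (\<psi>\<^sub>2 (x - c)))" for c
    using rd_integrable[OF rd_test_fun[OF test_fun_shift[OF \<psi>1(1)]]] rd_integrable[OF rd_test_fun[OF test_fun_shift[OF \<psi>2(1)]]] by auto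
  have \<Psi>i: "integrable lborel (\<lambda>\<xi>. \<Psi> (\<xi> - c))" for c
    using lborel_pair_mult(1)[OF i1 i2, of "fst c" "snd c"] by (simp add: \<Psi>_def)
  define h where "h \<eta> = complex_of_real (\<phi> (?\<rho> \<eta>)) * (\<Phi> \<eta> * \<Psi> \<eta>)" for \<eta>
  have \<rho>: "?\<rho> \<in> borel_measurable borel" by (rule fst_plus_snd_measurable)
  have \<Phi>\<Psi>i: "integrable lborel (\<lambda>\<eta>. \<Phi> \<eta> * \<Psi> \<eta>)"
    using test_mult_integrable[where m=\<Phi> and \<rho>="\<lambda>\<eta>. \<eta>", OF rd_test_fun[OF \<Phi>] \<Psi>i[of 0]] by simp
  have hi: "integrable lborel h"
    unfolding h_def by (rule test_mult_integrable[OF rd_test_fun[OF \<phi>(1)] \<Phi>\<Psi>i \<rho>])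
  \<comment> \<open>The fixed multiple in the lower bound. It is nonzero because, after division by
    \<open>\<Phi> \<xi>\<^sub>0\<close>, the integrand has continuous nonnegative real part that is
    positive at \<open>\<xi>\<^sub>0\<close>.\<close>
  define A where "A = (\<integral>\<eta>. h \<eta> \<partial>lborel)"
  have A: "A \<noteq> 0"
  proof
    assume A0: "A = 0"
    have hi': "integrable lborel (\<lambda>\<eta>. h \<eta> / \<Phi> \<xi>\<^sub>0)" using hi by simp
    have "(\<integral>\<eta>. Re (h \<eta> / \<Phi> \<xi>\<^sub>0) \<partial>lborel) = Re (\<integral>\<eta>. h \<eta> / \<Phi> \<xi>\<^sub>0 \<partial>lborel)" by (rule integral_Re[OF hi'])
    also have "\<dots> = 0" using A0 by (simp add: A_def)
    finally have z: "(\<integral>\<eta>. Re (h \<eta> / \<Phi> \<xi>\<^sub>0) \<partial>lborel) = 0" .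
    have heq: "Re (h \<eta> / \<Phi> \<xi>\<^sub>0) = \<phi> (?\<rho> \<eta>) * (\<psi>\<^sub>1 (fst \<eta>) * \<psi>\<^sub>2 (snd \<eta>)) * Re (\<Phi> \<eta> / \<Phi> \<xi>\<^sub>0)" for \<eta>
    proof -
      have "h \<eta> / \<Phi> \<xi>\<^sub>0 = complex_of_real (\<phi> (?\<rho> \<eta>) * (\<psi>\<^sub>1 (fst \<eta>) * \<psi>\<^sub>2 (snd \<eta>))) * (\<Phi> \<eta> / \<Phi> \<xi>\<^sub>0)"
        by (simp add: h_def \<Psi>_def)
      then show ?thesis by (simp only: Re_complex_of_real Im_complex_of_real times_complex.sel mult_zero_left diff_zero)
    qed
    have c: "continuous_on UNIV \<Phi>" "continuous_on UNIV (\<lambda>x. complex_of_real (\<phi> x))"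
      "continuous_on UNIV (\<lambda>x. complex_of_real (\<psi>\<^sub>1 x))" "continuous_on UNIV (\<lambda>x. complex_of_real (\<psi>\<^sub>2 x))"
      by (intro smooth_continuous test_fun_smooth \<Phi> \<phi>(1) \<psi>1(1) \<psi>2(1))+
    have "continuous_on UNIV h" unfolding h_def \<Psi>_def
      by (intro continuous_on_mult continuous_on_compose2[OF c(2)] continuous_on_compose2[OF c(3)]
          continuous_on_compose2[OF c(4)] c(1) continuous_intros) auto
    then have "continuous_on UNIV (\<lambda>\<eta>. Re (h \<eta> / \<Phi> \<xi>\<^sub>0))" using e(2) by (intro continuous_intros) auto
    moreover have "0 \<le> Re (h \<eta> / \<Phi> \<xi>\<^sub>0)" for \<eta>
    proof (cases "\<Psi> \<eta> = 0")
      case False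
      then have "0 < Re (\<Phi> \<eta> / \<Phi> \<xi>\<^sub>0)" using e(3) supp(3) by blast
      then show ?thesis unfolding heq using \<phi>(2) \<psi>1(2) \<psi>2(2) by (intro mult_nonneg_nonneg) auto
    qed (simp add: h_def)
    ultimately have "Re (h \<xi>\<^sub>0 / \<Phi> \<xi>\<^sub>0) = 0"
      using continuous_integral_zero[of "\<lambda>\<eta>. Re (h \<eta> / \<Phi> \<xi>\<^sub>0)", OF _ integrable_Re[OF hi'] _ z] by blast
    then show False unfolding heq using \<phi>(3) \<psi>1(3) \<psi>2(3) e(2) by simp
  qed
  obtain C\<^sub>0 M where C0: "0 < C\<^sub>0" and WB: "\<And>(\<rho> :: (real ^ 'n) \<times> (real ^ 'n) \<Rightarrow> real ^ 'n) F \<beta>. integrable lborel F \<Longrightarrow>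
    \<rho> \<in> borel_measurable borel \<Longrightarrow> 0 \<le> \<beta> \<Longrightarrow> wiener_norm \<kappa> p q (distr_of_fun (synth \<rho> F)) = ennreal \<beta> \<Longrightarrow>
    \<exists>J. J \<in> borel_measurable borel \<and> (\<forall>x. 0 \<le> J x \<and> J x \<le> \<beta>) \<and>
        (\<forall>x y. J (x + y) \<le> (1 + norm y) ^ M * J x) \<and>
        (\<forall>x. lq_norm q (\<lambda>k. ennreal (win (\<lambda>x. complex_of_real (\<phi> x)) \<rho> F k x)) \<le> ennreal (C\<^sub>0 * J x)) \<and>
        (p \<noteq> \<infinity> \<longrightarrow> (\<integral>\<^sup>+x. ennreal (J x powr ex p) \<partial>lborel) \<le> ennreal (C\<^sub>0 * \<beta> powr ex p))"
    using window_bound[OF w \<phi>(1) p(3) q(3)] by blast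
  obtain D\<^sub>1 where D1: "0 < D\<^sub>1" and at1: "\<And>b B X. finite B \<Longrightarrow> (\<And>\<mu>. \<mu> \<notin> B \<Longrightarrow> b \<mu> = 0) \<Longrightarrow> 0 \<le> X \<Longrightarrow>
     lq_norm q\<^sub>1 (\<lambda>\<mu>. ennreal (cmod (b \<mu>))) \<le> ennreal X \<Longrightarrow>
     wiener_norm \<kappa> p\<^sub>1 q\<^sub>1 (distr_of_fun (inv_fourier (\<lambda>\<xi>. \<Sum>\<mu>\<in>B. b \<mu> * complex_of_real (\<psi>\<^sub>1 (\<xi> - of_lattice \<mu>))))) \<le> ennreal (D\<^sub>1 * X)"
    using wiener_norm_atoms[OF w \<psi>1(1) p(1) q(1)] by blast
  obtain D\<^sub>2 where D2: "0 < D\<^sub>2" and at2: "\<And>b B X. finite B \<Longrightarrow> (\<And>\<mu>. \<mu> \<notin> B \<Longrightarrow> b \<mu> = 0) \<Longrightarrow> 0 \<le> X \<Longrightarrow>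
     lq_norm q\<^sub>2 (\<lambda>\<mu>. ennreal (cmod (b \<mu>))) \<le> ennreal X \<Longrightarrow>
     wiener_norm \<kappa> p\<^sub>2 q\<^sub>2 (distr_of_fun (inv_fourier (\<lambda>\<xi>. \<Sum>\<mu>\<in>B. b \<mu> * complex_of_real (\<psi>\<^sub>2 (\<xi> - of_lattice \<mu>))))) \<le> ennreal (D\<^sub>2 * X)"
    using wiener_norm_atoms[OF w \<psi>2(1) p(2) q(2)] by blast
  \<comment> \<open>Change of output window, norms of the two sums of atoms, and division by the
    modulus of the multiple \<open>A\<close>.\<close>
  define c where "c = C\<^sub>0 * D\<^sub>1 * D\<^sub>2 / cmod A"
  have c: "0 < c" using C0 D1 D2 A by (simp add: c_def)
  show thesis
  proof (rule that[OF c])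
    fix a :: "(int ^ 'n) \<times> (int ^ 'n) \<Rightarrow> complex" and C :: real
    assume a: "bounded (range a)" and C: "0 \<le> C"
      and op: "\<And>f\<^sub>1 f\<^sub>2. f\<^sub>1 \<in> schwartz \<Longrightarrow> f\<^sub>2 \<in> schwartz \<Longrightarrow> distr_of_fun f\<^sub>1 \<in> wiener_space \<kappa> p\<^sub>1 q\<^sub>1 \<Longrightarrow>
       distr_of_fun f\<^sub>2 \<in> wiener_space \<kappa> p\<^sub>2 q\<^sub>2 \<Longrightarrow>
       wiener_norm \<kappa> p q (distr_of_fun (bilin_op (lattice_symbol a \<Phi>) f\<^sub>1 f\<^sub>2)) \<le>
         ennreal C * wiener_norm \<kappa> p\<^sub>1 q\<^sub>1 (distr_of_fun f\<^sub>1) * wiener_norm \<kappa> p\<^sub>2 q\<^sub>2 (distr_of_fun f\<^sub>2)"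
    have space: "distr_of_fun f \<in> wiener_space \<kappa> p' q'" if "wiener_norm \<kappa> p' q' (distr_of_fun f) \<le> ennreal X" for f p' q' X
    proof -
      have fin: "wiener_norm \<kappa> p' q' (distr_of_fun f) < \<infinity>" using that ennreal_less_top le_less_trans by fastforce
      moreover have "tempered (distr_of_fun f)"
        by (rule ccontr) (use fin in \<open>simp add: wiener_norm_def\<close>)
      ultimately show ?thesis by (simp add: wiener_space_def)
    qed
    show "seq_op_norm q\<^sub>1 q\<^sub>2 q a \<le> ennreal (c * C)"
      unfolding seq_op_norm_def
    proof (rule Sup_least, elim CollectE exE conjE, goal_cases)
      case (1 y b\<^sub>1 b\<^sub>2)
      have b1: "b\<^sub>1 \<in> finsupp" "b\<^sub>1 \<noteq> (\<lambda>_. 0)" and b2: "b\<^sub>2 \<in> finsupp" "b\<^sub>2 \<noteq> (\<lambda>_. 0)" using 1 by auto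
      obtain X\<^sub>1 where X1: "0 < X\<^sub>1" "lq_norm q\<^sub>1 (\<lambda>k. ennreal (cmod (b\<^sub>1 k))) = ennreal X\<^sub>1"
        using lq_norm_finsupp[OF q(1) b1] by blast
      obtain X\<^sub>2 where X2: "0 < X\<^sub>2" "lq_norm q\<^sub>2 (\<lambda>k. ennreal (cmod (b\<^sub>2 k))) = ennreal X\<^sub>2"
        using lq_norm_finsupp[OF q(2) b2] by blast
      define B where "B = {\<mu>. b\<^sub>1 \<mu> \<noteq> 0} \<union> {\<mu>. b\<^sub>2 \<mu> \<noteq> 0}"
      have B: "finite B" "\<And>\<mu>. \<mu> \<notin> B \<Longrightarrow> b\<^sub>1 \<mu> = 0" "\<And>\<mu>. \<mu> \<notin> B \<Longrightarrow> b\<^sub>2 \<mu> = 0"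
        using b1(1) b2(1) by (auto simp: B_def finsupp_def)
      define F\<^sub>1 where "F\<^sub>1 \<xi> = (\<Sum>\<mu>\<in>B. b\<^sub>1 \<mu> * complex_of_real (\<psi>\<^sub>1 (\<xi> - of_lattice \<mu>)))" for \<xi>
      define F\<^sub>2 where "F\<^sub>2 \<xi> = (\<Sum>\<mu>\<in>B. b\<^sub>2 \<mu> * complex_of_real (\<psi>\<^sub>2 (\<xi> - of_lattice \<mu>)))" for \<xi>
      have F1: "test_fun F\<^sub>1" unfolding F\<^sub>1_def
        by (intro test_fun_sum B test_fun_mult2 smooth_const test_fun_shift[OF \<psi>1(1)])
      have F2: "test_fun F\<^sub>2" unfolding F\<^sub>2_def
        by (intro test_fun_sum B test_fun_mult2 smooth_const test_fun_shift[OF \<psi>2(1)])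
      define f\<^sub>1 where "f\<^sub>1 = inv_fourier F\<^sub>1"
      define f\<^sub>2 where "f\<^sub>2 = inv_fourier F\<^sub>2"
      have fs: "f\<^sub>1 \<in> schwartz" "f\<^sub>2 \<in> schwartz"
        unfolding f\<^sub>1_def f\<^sub>2_def using F1 F2 inv_fourier_test_schwartz by blast+
      have ff: "fourier f\<^sub>1 = F\<^sub>1" "fourier f\<^sub>2 = F\<^sub>2"
        unfolding f\<^sub>1_def f\<^sub>2_def using F1 F2 by (simp_all add: fourier_inv_fourier_schwartz test_fun_schwartz)
      have n1: "wiener_norm \<kappa> p\<^sub>1 q\<^sub>1 (distr_of_fun f\<^sub>1) \<le> ennreal (D\<^sub>1 * X\<^sub>1)"
        unfolding f\<^sub>1_def F\<^sub>1_def[abs_def] using X1 by (intro at1 B) auto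
      have n2: "wiener_norm \<kappa> p\<^sub>2 q\<^sub>2 (distr_of_fun f\<^sub>2) \<le> ennreal (D\<^sub>2 * X\<^sub>2)"
        unfolding f\<^sub>2_def F\<^sub>2_def[abs_def] using X2 by (intro at2 B) auto
      define Z where "Z = C * (D\<^sub>1 * X\<^sub>1) * (D\<^sub>2 * X\<^sub>2)"
      have Z: "0 \<le> Z" using C D1 D2 X1 X2 by (simp add: Z_def)
      have "wiener_norm \<kappa> p q (distr_of_fun (bilin_op (lattice_symbol a \<Phi>) f\<^sub>1 f\<^sub>2)) \<le>
         ennreal C * wiener_norm \<kappa> p\<^sub>1 q\<^sub>1 (distr_of_fun f\<^sub>1) * wiener_norm \<kappa> p\<^sub>2 q\<^sub>2 (distr_of_fun f\<^sub>2)"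
        by (rule op[OF fs space[OF n1] space[OF n2]])
      also have "\<dots> \<le> ennreal C * ennreal (D\<^sub>1 * X\<^sub>1) * ennreal (D\<^sub>2 * X\<^sub>2)" by (intro mult_mono n1 n2) auto
      also have "\<dots> = ennreal Z" using C D1 D2 X1 X2 by (simp add: Z_def ennreal_mult)
      finally have TZ: "wiener_norm \<kappa> p q (distr_of_fun (bilin_op (lattice_symbol a \<Phi>) f\<^sub>1 f\<^sub>2)) \<le> ennreal Z" .
      then obtain \<beta> where \<beta>: "0 \<le> \<beta>" "\<beta> \<le> Z" "wiener_norm \<kappa> p q (distr_of_fun (bilin_op (lattice_symbol a \<Phi>) f\<^sub>1 f\<^sub>2)) = ennreal \<beta>"
        by (cases "wiener_norm \<kappa> p q (distr_of_fun (bilin_op (lattice_symbol a \<Phi>) f\<^sub>1 f\<^sub>2))") (use Z in \<open>auto simp: top_unique\<close>)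
      define G where "G \<xi> = lattice_symbol a \<Phi> \<xi> * F\<^sub>1 (fst \<xi>) * F\<^sub>2 (snd \<xi>)" for \<xi>
      have Tsynth: "bilin_op (lattice_symbol a \<Phi>) f\<^sub>1 f\<^sub>2 = synth ?\<rho> G"
        unfolding bilin_op_synth ff G_def ..
      have Gi: "integrable lborel G"
      proof (rule lattice_symbol_bounded[OF \<Phi> a], goal_cases)
        case (1 b)
        show ?case unfolding G_def
          by (rule bilin_symbol_integrable[OF rd_integrable[OF rd_test_fun[OF F1]] rd_integrable[OF rd_test_fun[OF F2]]
              lattice_symbol_measurable[OF \<Phi>] 1(3)])
      qed
      have Gsum: "G \<xi> = (\<Sum>\<mu>\<in>B \<times> B. (a \<mu> * b\<^sub>1 (fst \<mu>) * b\<^sub>2 (snd \<mu>)) * (\<Phi> (\<xi> - ?l \<mu>) * \<Psi> (\<xi> - ?l \<mu>)))" for \<xi>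
      proof -
        \<comment> \<open>Where the bump at \<open>\<mu>\<close> lives, the ball around
          \<open>\<xi>\<^sub>0\<close> translated by \<open>\<mu>\<close>, every term of the symbol
          other than the \<open>\<mu>\<close>-th vanishes.\<close>
        have single: "lattice_symbol a \<Phi> \<xi> * \<Psi> (\<xi> - ?l \<mu>) = a \<mu> * (\<Phi> (\<xi> - ?l \<mu>) * \<Psi> (\<xi> - ?l \<mu>))" for \<mu>
        proof (cases "\<Psi> (\<xi> - ?l \<mu>) = 0")
          case False
          have "lattice_symbol a \<Phi> \<xi> = a \<mu> * \<Phi> (\<xi> - ?l \<mu>)"
          proof (rule lattice_symbol_single)
            fix \<nu> :: "(int ^ 'n) \<times> (int ^ 'n)" assume "\<nu> \<noteq> \<mu>"
            then have "\<Phi> ((\<xi> - ?l \<mu>) - ?l (\<nu> - \<mu>)) = 0" using e(4)[OF supp(3)[OF False], of "\<nu> - \<mu>"] by simp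
            moreover have "(\<xi> - ?l \<mu>) - ?l (\<nu> - \<mu>) = \<xi> - ?l \<nu>"
              by (cases \<mu>; cases \<nu>; cases \<xi>) (simp add: of_lattice_diff)
            ultimately show "\<Phi> (\<xi> - ?l \<nu>) = 0" by simp
          qed
          then show ?thesis by simp
        qed simp
        have "G \<xi> = lattice_symbol a \<Phi> \<xi> * (\<Sum>\<mu>\<in>B \<times> B. (b\<^sub>1 (fst \<mu>) * b\<^sub>2 (snd \<mu>)) * \<Psi> (\<xi> - ?l \<mu>))"
          unfolding G_def F\<^sub>1_def F\<^sub>2_def \<Psi>_def mult.assoc
          by (simp add: sum_product sum.cartesian_product split_beta mult_ac)
        also have "\<dots> = (\<Sum>\<mu>\<in>B \<times> B. (b\<^sub>1 (fst \<mu>) * b\<^sub>2 (snd \<mu>)) * (lattice_symbol a \<Phi> \<xi> * \<Psi> (\<xi> - ?l \<mu>)))"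
          by (simp add: sum_distrib_left mult_ac)
        also have "\<dots> = (\<Sum>\<mu>\<in>B \<times> B. (a \<mu> * b\<^sub>1 (fst \<mu>) * b\<^sub>2 (snd \<mu>)) * (\<Phi> (\<xi> - ?l \<mu>) * \<Psi> (\<xi> - ?l \<mu>)))"
          unfolding single by (simp only: mult_ac)
        finally show ?thesis .
      qed
      \<comment> \<open>At \<open>x = 0\<close> all characters equal 1, so terms with the same
        \<open>\<mu>\<^sub>1 + \<mu>\<^sub>2\<close> add up without phases and the sequence operator
        appears exactly.\<close>
      have win: "win (\<lambda>x. complex_of_real (\<phi> x)) ?\<rho> G k 0 = cmod A * cmod (seq_op a b\<^sub>1 b\<^sub>2 k)" for k
      proof -
        define T where "T \<mu> \<xi> = complex_of_real (\<phi> (?\<rho> \<xi> - of_lattice k)) * (\<Phi> (\<xi> - ?l \<mu>) * \<Psi> (\<xi> - ?l \<mu>))" for \<mu> \<xi>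
        have \<Phi>\<Psi>s: "integrable lborel (\<lambda>\<xi>. \<Phi> (\<xi> - ?l \<mu>) * \<Psi> (\<xi> - ?l \<mu>))" for \<mu>
          using integrable_lborel_shift(1)[OF \<Phi>\<Psi>i, of "- ?l \<mu>"] by simp
        have Ti: "integrable lborel (T \<mu>)" for \<mu>
          unfolding T_def by (rule win_integrable[OF \<phi>(1) \<Phi>\<Psi>s \<rho>])
        have Tv: "(\<integral>\<xi>. T \<mu> \<xi> \<partial>lborel) = (if fst \<mu> + snd \<mu> = k then A else 0)" for \<mu>
        proof -
          have "(\<integral>\<xi>. T \<mu> \<xi> \<partial>lborel) = (\<integral>\<eta>. T \<mu> (?l \<mu> + \<eta>) \<partial>lborel)"
            using borel_measurable_integrable[OF Ti] by (intro integral_lborel_shift(1)[symmetric]) simp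
          also have "\<dots> = (\<integral>\<eta>. (if fst \<mu> + snd \<mu> = k then h \<eta> else 0) \<partial>lborel)"
          proof (intro Bochner_Integration.integral_cong refl)
            fix \<eta>
            have r: "?\<rho> (?l \<mu> + \<eta>) - of_lattice k = ?\<rho> \<eta> + of_lattice (fst \<mu> + snd \<mu> - k)"
              by (cases \<mu>) (simp add: of_lattice_add of_lattice_diff)
            have t: "T \<mu> (?l \<mu> + \<eta>) = complex_of_real (\<phi> (?\<rho> \<eta> + of_lattice (fst \<mu> + snd \<mu> - k))) * (\<Phi> \<eta> * \<Psi> \<eta>)"
              unfolding T_def r by simp
            show "T \<mu> (?l \<mu> + \<eta>) = (if fst \<mu> + snd \<mu> = k then h \<eta> else 0)"
            proof (cases "fst \<mu> + snd \<mu> = k")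
              case True
              then show ?thesis unfolding t h_def by simp
            next
              case False
              have "\<phi> (?\<rho> \<eta> + of_lattice (fst \<mu> + snd \<mu> - k)) = 0" if nz: "\<Psi> \<eta> \<noteq> 0"
              proof (rule ccontr)
                let ?v = "of_lattice (fst \<mu> + snd \<mu> - k) :: real ^ 'n"
                assume "\<phi> (?\<rho> \<eta> + ?v) \<noteq> 0"
                then have 1: "norm (?\<rho> \<eta> + ?v - ?\<rho> \<xi>\<^sub>0) < 1 / 2" using \<phi>(4) by (simp add: dist_norm)
                have v: "(?\<rho> \<eta> + ?v - ?\<rho> \<xi>\<^sub>0) - ((fst \<eta> - fst \<xi>\<^sub>0) + (snd \<eta> - snd \<xi>\<^sub>0)) = ?v" by (simp add: algebra_simps)
                have "norm ?v \<le> norm (?\<rho> \<eta> + ?v - ?\<rho> \<xi>\<^sub>0) + norm ((fst \<eta> - fst \<xi>\<^sub>0) + (snd \<eta> - snd \<xi>\<^sub>0))"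
                  using norm_triangle_ineq4[of "?\<rho> \<eta> + ?v - ?\<rho> \<xi>\<^sub>0" "(fst \<eta> - fst \<xi>\<^sub>0) + (snd \<eta> - snd \<xi>\<^sub>0)"] unfolding v .
                also have "\<dots> \<le> norm (?\<rho> \<eta> + ?v - ?\<rho> \<xi>\<^sub>0) + (norm (fst \<eta> - fst \<xi>\<^sub>0) + norm (snd \<eta> - snd \<xi>\<^sub>0))"
                  by (intro add_left_mono norm_triangle_ineq)
                also have "\<dots> < 1 / 2 + (\<delta> + \<delta>)" using 1 supp(1,2)[OF nz] by linarith
                also have "\<dots> < 1" using \<delta>(3) by simp
                finally show False using norm_of_lattice_ge_1[of "fst \<mu> + snd \<mu> - k"] False by simp
              qed
              then have "T \<mu> (?l \<mu> + \<eta>) = 0" unfolding t by (cases "\<Psi> \<eta> = 0") simp_all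
              then show ?thesis using False by simp
            qed
          qed
          also have "\<dots> = (if fst \<mu> + snd \<mu> = k then A else 0)" by (simp add: A_def)
          finally show ?thesis .
        qed
        have "win (\<lambda>x. complex_of_real (\<phi> x)) ?\<rho> G k 0 = cmod (\<integral>\<xi>. (\<Sum>\<mu>\<in>B \<times> B. (a \<mu> * b\<^sub>1 (fst \<mu>) * b\<^sub>2 (snd \<mu>)) * T \<mu> \<xi>) \<partial>lborel)"
          unfolding win_def synth_def Gsum T_def by (simp add: sum_distrib_left mult_ac)
        also have "(\<integral>\<xi>. (\<Sum>\<mu>\<in>B \<times> B. (a \<mu> * b\<^sub>1 (fst \<mu>) * b\<^sub>2 (snd \<mu>)) * T \<mu> \<xi>) \<partial>lborel)
          = (\<Sum>\<mu>\<in>B \<times> B. (a \<mu> * b\<^sub>1 (fst \<mu>) * b\<^sub>2 (snd \<mu>)) * (\<integral>\<xi>. T \<mu> \<xi> \<partial>lborel))"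
          by (subst Bochner_Integration.integral_sum) (auto intro: integrable_mult_right Ti)
        also have "\<dots> = (\<Sum>\<mu>\<in>{\<mu>\<in>B \<times> B. fst \<mu> + snd \<mu> = k}. (a \<mu> * b\<^sub>1 (fst \<mu>) * b\<^sub>2 (snd \<mu>)) * A)"
          unfolding Tv using B(1) by (intro sum.mono_neutral_cong_right) auto
        also have "\<dots> = seq_op a b\<^sub>1 b\<^sub>2 k * A" 
          by (subst seq_op_finite[where B=B]) (use B in \<open>simp_all only: sum_distrib_right\<close>)
        finally show ?thesis by (simp add: norm_mult mult.commute)
      qed
      obtain J where J: "\<And>x. J x \<le> \<beta>" "\<And>x. lq_norm q (\<lambda>k. ennreal (win (\<lambda>x. complex_of_real (\<phi> x)) ?\<rho> G k x)) \<le> ennreal (C\<^sub>0 * J x)"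
        using WB[OF Gi \<rho> \<beta>(1) \<beta>(3)[unfolded Tsynth]] by blast
      have "lq_norm q (\<lambda>k. ennreal (cmod A * cmod (seq_op a b\<^sub>1 b\<^sub>2 k))) \<le> ennreal (C\<^sub>0 * J 0)"
        using J(2)[of 0] unfolding win .
      also have "\<dots> \<le> ennreal (C\<^sub>0 * Z)" using J(1)[of 0] \<beta>(2) C0 by (intro ennreal_leI mult_left_mono) auto
      finally have "lq_norm q (\<lambda>k. ennreal (cmod (seq_op a b\<^sub>1 b\<^sub>2 k))) \<le> ennreal (C\<^sub>0 * Z / cmod A)"
        using A C0 Z by (intro lq_norm_cmult_le[OF q(3)]) auto
      also have "C\<^sub>0 * Z / cmod A = c * C * (X\<^sub>1 * X\<^sub>2)" by (simp add: Z_def c_def)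
      finally have n: "lq_norm q (\<lambda>k. ennreal (cmod (seq_op a b\<^sub>1 b\<^sub>2 k))) \<le> ennreal (c * C) * ennreal (X\<^sub>1 * X\<^sub>2)"
        using c C X1 X2 by (simp add: ennreal_mult)
      have "y = lq_norm q (\<lambda>k. ennreal (cmod (seq_op a b\<^sub>1 b\<^sub>2 k))) / ennreal (X\<^sub>1 * X\<^sub>2)"
        using 1 X1 X2 by (simp add: ennreal_mult)
      also have "\<dots> \<le> ennreal (c * C) * ennreal (X\<^sub>1 * X\<^sub>2) / ennreal (X\<^sub>1 * X\<^sub>2)" by (rule divide_right_mono_ennreal[OF n])
      also have "\<dots> = ennreal (c * C)" using X1(1) X2(1) by (intro ennreal_mult_divide_eq) auto
      finally show ?case .
    qed
  qed
qed

theorem theorem3: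
  fixes \<kappa> :: "real ^ 'n \<Rightarrow> complex"
    and \<Phi> :: "(real ^ 'n) \<times> (real ^ 'n) \<Rightarrow> complex"
    and p\<^sub>1 p\<^sub>2 p q\<^sub>1 q\<^sub>2 q :: ennreal
  assumes "wiener_window \<kappa>"
    and "test_fun \<Phi>" and "condition_B \<Phi>"
    and "0 < p\<^sub>1" "0 < p\<^sub>2" "0 < p" "0 < q\<^sub>1" "0 < q\<^sub>2" "0 < q"
    and "1 / p\<^sub>1 + 1 / p\<^sub>2 \<ge> 1 / p"
  shows "\<exists>c::real. 0 < c \<and>
    (\<forall>a :: (int ^ 'n) \<times> (int ^ 'n) \<Rightarrow> complex. bounded (range a) \<longrightarrow>
       ennreal (1 / c) * seq_op_norm q\<^sub>1 q\<^sub>2 q a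
         \<le> bilin_wiener_norm \<kappa> p\<^sub>1 q\<^sub>1 p\<^sub>2 q\<^sub>2 p q (lattice_symbol a \<Phi>) \<and>
       bilin_wiener_norm \<kappa> p\<^sub>1 q\<^sub>1 p\<^sub>2 q\<^sub>2 p q (lattice_symbol a \<Phi>)
         \<le> ennreal c * seq_op_norm q\<^sub>1 q\<^sub>2 q a)"
proof -
  obtain c\<^sub>1 where c1: "0 < c\<^sub>1" and up: "\<And>a S f\<^sub>1 f\<^sub>2 \<beta>\<^sub>1 \<beta>\<^sub>2. bounded (range a) \<Longrightarrow> 0 \<le> S \<Longrightarrow> seq_op_norm q\<^sub>1 q\<^sub>2 q a \<le> ennreal S \<Longrightarrow>
    f\<^sub>1 \<in> schwartz \<Longrightarrow> f\<^sub>2 \<in> schwartz \<Longrightarrow> 0 \<le> \<beta>\<^sub>1 \<Longrightarrow> 0 \<le> \<beta>\<^sub>2 \<Longrightarrow>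
    wiener_norm \<kappa> p\<^sub>1 q\<^sub>1 (distr_of_fun f\<^sub>1) = ennreal \<beta>\<^sub>1 \<Longrightarrow> wiener_norm \<kappa> p\<^sub>2 q\<^sub>2 (distr_of_fun f\<^sub>2) = ennreal \<beta>\<^sub>2 \<Longrightarrow>
    wiener_norm \<kappa> p q (distr_of_fun (bilin_op (lattice_symbol a \<Phi>) f\<^sub>1 f\<^sub>2)) \<le> ennreal (c\<^sub>1 * S * \<beta>\<^sub>1 * \<beta>\<^sub>2)"
    using upper_bound[OF assms(1,2,4,5,6,7,8,9,10)] by blast
  obtain c\<^sub>2 where c2: "0 < c\<^sub>2" and low: "\<And>a C. bounded (range a) \<Longrightarrow> 0 \<le> C \<Longrightarrow>
    (\<And>f\<^sub>1 f\<^sub>2. f\<^sub>1 \<in> schwartz \<Longrightarrow> f\<^sub>2 \<in> schwartz \<Longrightarrow> distr_of_fun f\<^sub>1 \<in> wiener_space \<kappa> p\<^sub>1 q\<^sub>1 \<Longrightarrow>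
       distr_of_fun f\<^sub>2 \<in> wiener_space \<kappa> p\<^sub>2 q\<^sub>2 \<Longrightarrow>
       wiener_norm \<kappa> p q (distr_of_fun (bilin_op (lattice_symbol a \<Phi>) f\<^sub>1 f\<^sub>2)) \<le>
         ennreal C * wiener_norm \<kappa> p\<^sub>1 q\<^sub>1 (distr_of_fun f\<^sub>1) * wiener_norm \<kappa> p\<^sub>2 q\<^sub>2 (distr_of_fun f\<^sub>2)) \<Longrightarrow>
    seq_op_norm q\<^sub>1 q\<^sub>2 q a \<le> ennreal (c\<^sub>2 * C)"
    using lower_bound[OF assms(1-9)] by blast
  define c where "c = max c\<^sub>1 c\<^sub>2"
  have c: "0 < c" using c1 by (simp add: c_def)
  show ?thesis
  proof (intro exI[of _ c] conjI c allI impI)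
    fix a :: "(int ^ 'n) \<times> (int ^ 'n) \<Rightarrow> complex" assume a: "bounded (range a)"
    let ?s = "seq_op_norm q\<^sub>1 q\<^sub>2 q a"
    show "ennreal (1 / c) * ?s \<le> bilin_wiener_norm \<kappa> p\<^sub>1 q\<^sub>1 p\<^sub>2 q\<^sub>2 p q (lattice_symbol a \<Phi>)"
      unfolding bilin_wiener_norm_def
    proof (rule Inf_greatest, elim CollectE exE conjE, goal_cases)
      case (1 y C)
      have "?s \<le> ennreal (c\<^sub>2 * C)" using 1 by (intro low[OF a]) auto
      also have "\<dots> \<le> ennreal (c * C)" using 1 by (intro ennreal_leI mult_right_mono) (auto simp: c_def)
      finally have "ennreal (1 / c) * ?s \<le> ennreal (1 / c) * ennreal (c * C)" by (rule mult_left_mono) simp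
      also have "\<dots> = y" using 1 c by (simp add: ennreal_mult[symmetric])
      finally show ?case .
    qed
    show "bilin_wiener_norm \<kappa> p\<^sub>1 q\<^sub>1 p\<^sub>2 q\<^sub>2 p q (lattice_symbol a \<Phi>) \<le> ennreal c * ?s"
    proof (cases ?s)
      case (real S)
      have "wiener_norm \<kappa> p q (distr_of_fun (bilin_op (lattice_symbol a \<Phi>) f\<^sub>1 f\<^sub>2)) \<le>
            ennreal (c * S) * wiener_norm \<kappa> p\<^sub>1 q\<^sub>1 (distr_of_fun f\<^sub>1) * wiener_norm \<kappa> p\<^sub>2 q\<^sub>2 (distr_of_fun f\<^sub>2)"
        if f: "f\<^sub>1 \<in> schwartz" "f\<^sub>2 \<in> schwartz" and W: "distr_of_fun f\<^sub>1 \<in> wiener_space \<kappa> p\<^sub>1 q\<^sub>1" "distr_of_fun f\<^sub>2 \<in> wiener_space \<kappa> p\<^sub>2 q\<^sub>2"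
        for f\<^sub>1 f\<^sub>2
      proof -
        obtain \<beta>\<^sub>1 where b1: "0 \<le> \<beta>\<^sub>1" "wiener_norm \<kappa> p\<^sub>1 q\<^sub>1 (distr_of_fun f\<^sub>1) = ennreal \<beta>\<^sub>1"
          using W(1) by (cases "wiener_norm \<kappa> p\<^sub>1 q\<^sub>1 (distr_of_fun f\<^sub>1)") (auto simp: wiener_space_def)
        obtain \<beta>\<^sub>2 where b2: "0 \<le> \<beta>\<^sub>2" "wiener_norm \<kappa> p\<^sub>2 q\<^sub>2 (distr_of_fun f\<^sub>2) = ennreal \<beta>\<^sub>2"
          using W(2) by (cases "wiener_norm \<kappa> p\<^sub>2 q\<^sub>2 (distr_of_fun f\<^sub>2)") (auto simp: wiener_space_def)
        have "wiener_norm \<kappa> p q (distr_of_fun (bilin_op (lattice_symbol a \<Phi>) f\<^sub>1 f\<^sub>2)) \<le> ennreal (c\<^sub>1 * S * \<beta>\<^sub>1 * \<beta>\<^sub>2)"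
          using real by (intro up[OF a _ _ f b1(1) b2(1) b1(2) b2(2)]) auto
        also have "\<dots> \<le> ennreal (c * S * \<beta>\<^sub>1 * \<beta>\<^sub>2)"
          using real b1 b2 by (intro ennreal_leI mult_right_mono) (auto simp: c_def)
        also have "\<dots> = ennreal (c * S) * ennreal \<beta>\<^sub>1 * ennreal \<beta>\<^sub>2" using c real b1 b2 by (simp add: ennreal_mult)
        finally show ?thesis unfolding b1 b2 .
      qed
      then have "bilin_wiener_norm \<kappa> p\<^sub>1 q\<^sub>1 p\<^sub>2 q\<^sub>2 p q (lattice_symbol a \<Phi>) \<le> ennreal (c * S)"
        unfolding bilin_wiener_norm_def using c real by (intro Inf_lower) auto
      then show ?thesis using c real by (simp add: ennreal_mult)
    next
      case top
      then show ?thesis using c by (simp add: ennreal_mult_top)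
    qed
  qed
qed

end
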